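(* Let $d>1$, let $\Gamma\subset GL(d,\mathbb{R})$ be a sub-semigroup which is strongly irreducible and contains a proximal element, let $c>1$, and let $\mu$ be a probability measure on $\Gamma$ whose support generates $\Gamma$. Then the Markov operator $P_\mu$ on $\mathbb{P}_c^{d-1}$ has a unique stationary probability measure $\rho$; the support $S_\rho$ of $\rho$ is the unique closed $\Gamma$-invariant minimal subset of $\mathbb{P}_c^{d-1}$; and for any $v\in\mathbb{P}_c^{d-1}$ the sequence of measures $P_\mu^n(v,\cdot)$ converges (weakly) to $\rho$ as $n\to\infty$. Moreover, for every $v\in\mathbb{P}_c^{d-1}$, the trajectories of $P_\mu$ starting from $v$ converge a.e. to $S_\rho$; that is, if $g_1,g_2,\dots$ are i.i.d. with law $\mu$, then almost surely the distance from $g_n\cdots g_1.v$ to $S_\rho$ tends to $0$.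
   Context: $V=\mathbb{R}^d$. For $c>1$, $\mathbb{P}_c^{d-1}$ is the (compact) quotient of $V\setminus\{0\}$ by the group of homotheties with ratios $\pm c^k$, $k\in\mathbb{Z}$; the action of $g\in GL(d,\mathbb{R})$ on $v\in\mathbb{P}_c^{d-1}$ is denoted $g.v$. The Markov operator $P_\mu$ is given by the kernel $P_\mu(v,\cdot)=\int\delta_{g.v}\,d\mu(g)$, and $P_\mu^n$ are its iterates. A probability measure $\rho$ on $\mathbb{P}_c^{d-1}$ is stationary if $\int g.\rho\,d\mu(g)=\rho$. A matrix $\gamma\in GL(d,\mathbb{R})$ is proximal if it has an eigenvalue $\lambda_\gamma$ with $|\lambda_\gamma|>|\lambda|$ for all other (complex) eigenvalues $\lambda$ of $\gamma$, counted with algebraic multiplicity (so $\lambda_\gamma$ is real and simple). $\Gamma$ is strongly irreducible if there is no finite union $W_1\cup\dots\cup W_n$ ($n\ge 1$) of non-zero proper subspaces of $V$ which is $\Gamma$-invariant. A set $M$ is $\Gamma$-invariant if $\gamma M\subset M$ for all $\gamma\in\Gamma$; a closed $\Gamma$-invariant set is minimal if it is non-empty and contains no non-empty closed $\Gamma$-invariant proper subset. *)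

theory Defs
  imports
    "HOL-Analysis.Analysis"
    "HOL-Probability.Probability"
    "HOL-Computational_Algebra.Fundamental_Theorem_Algebra"
begin

section \<open>Linear algebra\<close>

definition complex_charpoly :: "real ^ 'n ^ 'n \<Rightarrow> complex poly" where
  "complex_charpoly A = det (\<chi> i j. (if i = j then [:0, 1:] else 0) - [:complex_of_real (A $ i $ j):])"

definition proximal :: "real ^ 'n ^ 'n \<Rightarrow> bool" where
  "proximal A \<longleftrightarrow> invertible A \<and>
     (\<exists>l \<in># proots (complex_charpoly A).
        \<forall>z \<in># proots (complex_charpoly A) - {#l#}. cmod z < cmod l)"

definition subsemigroup_GL :: "(real ^ 'n ^ 'n) set \<Rightarrow> bool" where
  "subsemigroup_GL \<Gamma> \<longleftrightarrow> \<Gamma> \<noteq> {} \<and> (\<forall>g\<in>\<Gamma>. invertible g) \<and> (\<forall>g\<in>\<Gamma>. \<forall>h\<in>\<Gamma>. g ** h \<in> \<Gamma>)"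

definition strongly_irreducible :: "(real ^ 'n ^ 'n) set \<Rightarrow> bool" where
  "strongly_irreducible \<Gamma> \<longleftrightarrow>
     \<not> (\<exists>\<W> :: (real ^ 'n) set set. finite \<W> \<and> \<W> \<noteq> {} \<and>
          (\<forall>W\<in>\<W>. subspace W \<and> W \<noteq> {0} \<and> W \<noteq> UNIV) \<and>
          (\<forall>\<gamma>\<in>\<Gamma>. (*v) \<gamma> ` \<Union>\<W> \<subseteq> \<Union>\<W>))"

inductive_set semigroup_generated :: "(real ^ 'n ^ 'n) set \<Rightarrow> (real ^ 'n ^ 'n) set"
  for S :: "(real ^ 'n ^ 'n) set" where
  gen: "g \<in> S \<Longrightarrow> g \<in> semigroup_generated S"
| mult: "g \<in> semigroup_generated S \<Longrightarrow> h \<in> semigroup_generated S \<Longrightarrow> g ** h \<in> semigroup_generated S"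


section \<open>Measures on topological spaces\<close>

definition borel_sigma :: "'a topology \<Rightarrow> 'a measure" where
  "borel_sigma X = sigma (topspace X) {U. openin X U}"

definition measure_support :: "'a topology \<Rightarrow> 'a measure \<Rightarrow> 'a set" where
  "measure_support X M = {x \<in> topspace X. \<forall>U. openin X U \<and> x \<in> U \<longrightarrow> 0 < emeasure M U}"

definition weakly_converges :: "'a topology \<Rightarrow> (nat \<Rightarrow> 'a measure) \<Rightarrow> 'a measure \<Rightarrow> bool" where
  "weakly_converges X Ms M \<longleftrightarrow>
     (\<forall>f :: 'a \<Rightarrow> real. continuous_map X euclideanreal f \<and> bounded (f ` topspace X) \<longrightarrow>
        (\<lambda>n. \<integral>x. f x \<partial>Ms n) \<longlonglongrightarrow> (\<integral>x. f x \<partial>M))"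

text \<open>
  The measure lives on \<open>\<Gamma>\<close> itself: \<open>space \<mu> = \<Gamma>\<close>, with the Borel sets of the topology induced by
  \<open>GL(d,\<real>)\<close>; its support is likewise relative to \<open>\<Gamma>\<close>. No closedness or measurability of
  \<open>\<Gamma>\<close> in \<open>GL(d,\<real>)\<close> is needed.
\<close>

definition probability_on :: "(real ^ 'n ^ 'n) set \<Rightarrow> (real ^ 'n ^ 'n) measure \<Rightarrow> bool" where
  "probability_on \<Gamma> \<mu> \<longleftrightarrow> prob_space \<mu> \<and> space \<mu> = \<Gamma> \<and> sets \<mu> = sets (restrict_space borel \<Gamma>)"

text \<open>
  Generation is meant topologically: \<open>\<Gamma>\<close> is the closure, relative to \<open>\<Gamma>\<close>, of the
  semigroup generated by the support. This contains the purely algebraic notion, where \<open>\<Gamma>\<close> equals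
  that semigroup, as well as the case where \<open>\<Gamma>\<close> is the closed semigroup generated by the support.
\<close>

definition support_generates :: "(real ^ 'n ^ 'n) set \<Rightarrow> (real ^ 'n ^ 'n) measure \<Rightarrow> bool" where
  "support_generates \<Gamma> \<mu> \<longleftrightarrow>
     top_of_set \<Gamma> closure_of semigroup_generated (measure_support (top_of_set \<Gamma>) \<mu>) = \<Gamma>"


section \<open>The space \<open>\<P>\<^sub>c\<^sup>d\<^sup>-\<^sup>1\<close>\<close>

definition homothety_rel :: "real \<Rightarrow> ((real ^ 'n) \<times> (real ^ 'n)) set" where
  "homothety_rel c = {(v, w). v \<noteq> 0 \<and> w \<noteq> 0 \<and>
     (\<exists>k::int. w = (c powi k) *\<^sub>R v \<or> w = (- (c powi k)) *\<^sub>R v)}"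

definition Pc :: "real \<Rightarrow> (real ^ 'n) set set" where
  "Pc c = (UNIV - {0}) // homothety_rel c"

definition Pc_proj :: "real \<Rightarrow> real ^ 'n \<Rightarrow> (real ^ 'n) set" where
  "Pc_proj c v = homothety_rel c `` {v}"

definition Pc_top :: "real \<Rightarrow> (real ^ 'n) set topology" where
  "Pc_top c = topology (\<lambda>U. U \<subseteq> Pc c \<and> open {v. v \<noteq> 0 \<and> Pc_proj c v \<in> U})"

text \<open>An invertible matrix maps equivalence classes to equivalence classes, so the image of a
  class is the class of the image of any representative.\<close>

definition act :: "real ^ 'n ^ 'n \<Rightarrow> (real ^ 'n) set \<Rightarrow> (real ^ 'n) set" where
  "act g x = (*v) g ` x"

lemma equiv_homothety_rel:
  assumes "c > 1"
  shows "equiv (UNIV - {0}) (homothety_rel c)"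
proof (rule equivI)
  show "homothety_rel c \<subseteq> (UNIV - {0}) \<times> (UNIV - {0})"
    by (auto simp: homothety_rel_def)
  show "refl_on (UNIV - {0}) (homothety_rel c)"
    by (auto simp: homothety_rel_def refl_on_def intro!: exI[of _ 0])
  show "sym (homothety_rel c)"
  proof (rule symI)
    fix v w :: "real ^ 'n" assume "(v, w) \<in> homothety_rel c"
    then obtain k :: int where k: "v \<noteq> 0" "w \<noteq> 0"
        "w = (c powi k) *\<^sub>R v \<or> w = (- (c powi k)) *\<^sub>R v"
      by (auto simp: homothety_rel_def)
    have "v = (c powi (-k)) *\<^sub>R w \<or> v = (- (c powi (-k))) *\<^sub>R w"
      using k(3) assms by (auto simp: power_int_minus)
    then show "(w, v) \<in> homothety_rel c"
      using k unfolding homothety_rel_def by blast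
  qed
  show "trans (homothety_rel c)"
  proof (rule transI)
    fix u v w :: "real ^ 'n" assume "(u, v) \<in> homothety_rel c" "(v, w) \<in> homothety_rel c"
    then obtain k l :: int where k: "u \<noteq> 0" "w \<noteq> 0"
        "v = (c powi k) *\<^sub>R u \<or> v = (- (c powi k)) *\<^sub>R u"
        "w = (c powi l) *\<^sub>R v \<or> w = (- (c powi l)) *\<^sub>R v"
      by (auto simp: homothety_rel_def)
    have "w = (c powi (l + k)) *\<^sub>R u \<or> w = (- (c powi (l + k))) *\<^sub>R u"
      using k assms by (auto simp: power_int_add)
    then show "(u, w) \<in> homothety_rel c"
      using k unfolding homothety_rel_def by blast
  qed
qed

lemma Pc_eq: "Pc c = Pc_proj c ` (UNIV - {0})"
  by (auto simp: Pc_def Pc_proj_def quotient_def)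

lemma Pc_proj_eq_iff:
  assumes "c > 1" "v \<noteq> 0" "w \<noteq> 0"
  shows "Pc_proj c v = Pc_proj c w \<longleftrightarrow> (v, w) \<in> homothety_rel c"
  unfolding Pc_proj_def using eq_equiv_class_iff[OF equiv_homothety_rel[OF assms(1)]] assms by auto

lemma openin_Pc_top:
  fixes U :: "(real ^ 'n) set set"
  shows "openin (Pc_top c) U \<longleftrightarrow> U \<subseteq> Pc c \<and> open {v. v \<noteq> 0 \<and> Pc_proj c v \<in> U}"
proof -
  have "istopology (\<lambda>U. U \<subseteq> Pc c \<and> open {v :: real ^ 'n. v \<noteq> 0 \<and> Pc_proj c v \<in> U})"
    unfolding istopology_def
  proof (intro conjI allI impI)
    fix S T :: "(real ^ 'n) set set"
    assume "S \<subseteq> Pc c \<and> open {v. v \<noteq> 0 \<and> Pc_proj c v \<in> S}"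
      and "T \<subseteq> Pc c \<and> open {v. v \<noteq> 0 \<and> Pc_proj c v \<in> T}"
    moreover have "{v. v \<noteq> 0 \<and> Pc_proj c v \<in> S \<inter> T} =
        {v. v \<noteq> 0 \<and> Pc_proj c v \<in> S} \<inter> {v. v \<noteq> 0 \<and> Pc_proj c v \<in> T}" by auto
    ultimately show "open {v. v \<noteq> 0 \<and> Pc_proj c v \<in> S \<inter> T}" by auto
  next
    fix K :: "(real ^ 'n) set set set"
    assume *: "\<forall>U\<in>K. U \<subseteq> Pc c \<and> open {v. v \<noteq> 0 \<and> Pc_proj c v \<in> U}"
    have "{v. v \<noteq> 0 \<and> Pc_proj c v \<in> \<Union>K} = (\<Union>U\<in>K. {v. v \<noteq> 0 \<and> Pc_proj c v \<in> U})" by auto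
    with * show "open {v. v \<noteq> 0 \<and> Pc_proj c v \<in> \<Union>K}" by auto
  qed auto
  then show ?thesis by (simp add: Pc_top_def)
qed

lemma topspace_Pc_top: "topspace (Pc_top c) = (Pc c :: (real ^ 'n) set set)"
proof -
  have "{v :: real ^ 'n. v \<noteq> 0 \<and> Pc_proj c v \<in> Pc c} = - {0}" by (auto simp: Pc_eq)
  then have "openin (Pc_top c) (Pc c :: (real ^ 'n) set set)"
    by (simp add: openin_Pc_top open_Compl)
  then show ?thesis
    by (metis openin_Pc_top openin_subset openin_topspace subset_antisym)
qed

lemma quotient_map_Pc_proj:
  "quotient_map (top_of_set (UNIV - {0 :: real ^ 'n})) (Pc_top c) (Pc_proj c)"
proof -
  have "openin (top_of_set (UNIV - {0})) A \<longleftrightarrow> open A" if "A \<subseteq> UNIV - {0}" for A :: "(real ^ 'n) set"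
    using that by (simp add: openin_open_eq open_delete)
  then show ?thesis
    unfolding quotient_map_def topspace_Pc_top openin_Pc_top
    by (simp add: Pc_eq subset_iff)
qed

lemma compact_space_Pc_top:
  assumes "c > 1"
  shows "compact_space (Pc_top c :: (real ^ 'n) set topology)"
proof -
  let ?K = "cball 0 c - ball 0 1 :: (real ^ 'n) set"
  have "compactin (top_of_set (UNIV - {0})) ?K"
    by (auto simp: compactin_subtopology compact_diff)
  then have "compactin (Pc_top c) (Pc_proj c ` ?K)"
    using image_compactin quotient_imp_continuous_map quotient_map_Pc_proj by blast
  moreover have "Pc_proj c ` ?K = Pc c"
  proof
    show "Pc_proj c ` ?K \<subseteq> Pc c" by (auto simp: Pc_eq)
    show "Pc c \<subseteq> Pc_proj c ` ?K"
    proof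
      fix x assume "x \<in> (Pc c :: (real ^ 'n) set set)"
      then obtain v where v: "v \<noteq> 0" "x = Pc_proj c v" by (auto simp: Pc_eq)
      define k where "k = \<lfloor>log c (norm v)\<rfloor>"
      define w where "w = (c powi (-k)) *\<^sub>R v"
      have "c powr k \<le> norm v \<and> norm v < c powr (k + 1)"
        using floor_log_eq_powr_iff[of "norm v" c k] v(1) assms by (simp add: k_def)
      then have *: "c powi k \<le> norm v" "norm v \<le> c powi k * c"
        using assms by (auto simp: powr_real_of_int' power_int_add powr_add)
      have "norm w = norm v / c powi k"
        using assms by (simp add: w_def power_int_minus divide_inverse mult.commute)
      then have "1 \<le> norm w" "norm w \<le> c"
        using * assms by (simp_all add: pos_le_divide_eq pos_divide_le_eq mult.commute)
      moreover have "Pc_proj c v = Pc_proj c w"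
      proof (subst Pc_proj_eq_iff[OF assms])
        show "v \<noteq> 0" "w \<noteq> 0" using v(1) assms by (auto simp: w_def)
        then show "(v, w) \<in> homothety_rel c" unfolding homothety_rel_def w_def by blast
      qed
      ultimately show "x \<in> Pc_proj c ` ?K" using v by auto
    qed
  qed
  ultimately show ?thesis by (simp add: compact_space_def topspace_Pc_top)
qed

lemma metrizable_space_Pc_top:
  assumes "c > 1"
  shows "metrizable_space (Pc_top c :: (real ^ 'n) set topology)"
proof -
  define h :: "real ^ 'n \<Rightarrow> (real ^ 'n ^ 'n) \<times> complex" where
    "h v = ((\<chi> i j. sgn v $ i * sgn v $ j), cis (2 * pi * (ln (norm v) / ln c)))" for v
  have lnc: "ln c > 0" using assms by simp
  have cont: "continuous_map (top_of_set (UNIV - {0})) euclidean h"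
    unfolding h_def sgn_div_norm
    using lnc by (auto intro!: continuous_intros simp: cis_conv_exp)
  have ln_powi: "ln (c powi k) = of_int k * ln c" for k
    using assms ln_powr[of c "of_int k"] by (simp add: powr_real_of_int')
  have resp: "h v = h w" if "v \<noteq> 0" "w \<noteq> 0" "Pc_proj c v = Pc_proj c w" for v w
  proof -
    have "(v, w) \<in> homothety_rel c"
      using that Pc_proj_eq_iff[OF assms] by blast
    then obtain k :: int where k: "w = (c powi k) *\<^sub>R v \<or> w = (- (c powi k)) *\<^sub>R v"
      by (auto simp: homothety_rel_def)
    have pos: "c powi k > 0" using assms by simp
    have "sgn w = sgn v \<or> sgn w = - sgn v"
      using k pos assms by (auto simp: sgn_div_norm)
    moreover have "norm w = c powi k * norm v" using k pos by auto
    then have "ln (norm w) / ln c = of_int k + ln (norm v) / ln c"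
      using that pos lnc assms by (simp add: ln_mult ln_powi field_simps)
    then have "cis (2 * pi * (ln (norm w) / ln c)) =
        cis (2 * pi * of_int k) * cis (2 * pi * (ln (norm v) / ln c))"
      by (simp only: cis_mult ring_distribs mult.assoc)
    then have "cis (2 * pi * (ln (norm w) / ln c)) = cis (2 * pi * (ln (norm v) / ln c))"
      by (simp add: complex_eq_iff)
    ultimately show ?thesis unfolding h_def by auto
  qed
  have sep: "Pc_proj c v = Pc_proj c w" if "v \<noteq> 0" "w \<noteq> 0" "h v = h w" for v w
  proof -
    have "cis (2 * pi * (ln (norm w) / ln c)) = cis (2 * pi * (ln (norm v) / ln c))"
      using that by (simp add: h_def)
    then obtain k :: int where
      "2 * pi * (ln (norm w) / ln c) = 2 * pi * (ln (norm v) / ln c) + 2 * pi * k"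
      using sin_cos_eq_iff by (metis cis.sel)
    then have "2 * pi * (ln (norm w) / ln c) = 2 * pi * (ln (norm v) / ln c + k)"
      by (simp add: ring_distribs)
    then have "ln (norm w) / ln c = ln (norm v) / ln c + k" by (metis mult_cancel_left mult_eq_0_iff pi_neq_zero zero_neq_numeral)
    then have "ln (norm w) = ln (norm v) + k * ln c" using lnc by (simp add: field_simps)
    also have "\<dots> = ln (c powi k * norm v)" using that assms by (simp add: ln_mult ln_powi)
    finally have nw: "norm w = c powi k * norm v"
      using that assms by (subst (asm) ln_inj_iff) auto
    have mat: "sgn v $ i * sgn v $ j = sgn w $ i * sgn w $ j" for i j
      using that by (simp add: h_def vec_eq_iff)
    have "(sgn v \<bullet> sgn v) *\<^sub>R sgn v = (sgn w \<bullet> sgn v) *\<^sub>R sgn w"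
    proof (simp add: vec_eq_iff inner_vec_def sum_distrib_right, intro allI sum.cong refl)
      fix i j show "sgn v $ j * sgn v $ j * sgn v $ i = sgn w $ j * sgn v $ j * sgn w $ i"
        using mat[of j i] mat[of i j] by (metis mult.assoc mult.commute)
    qed
    then have eq: "sgn v = (sgn w \<bullet> sgn v) *\<^sub>R sgn w"
      using that by (simp add: dot_square_norm norm_sgn)
    obtain t where t: "sgn v = t *\<^sub>R sgn w" using eq by blast
    then have "norm (sgn v) = \<bar>t\<bar> * norm (sgn w)" by simp
    then have "\<bar>t\<bar> = 1" using \<open>v \<noteq> 0\<close> \<open>w \<noteq> 0\<close> by (simp add: norm_sgn)
    then have "t = 1 \<or> t = -1" by linarith
    then have "sgn w = sgn v \<or> sgn w = - sgn v" using t by auto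
    then have "w = (c powi k) *\<^sub>R v \<or> w = (- (c powi k)) *\<^sub>R v"
    proof (rule disj_forward)
      have w: "w = (c powi k) *\<^sub>R (norm v *\<^sub>R sgn w)"
      proof -
        have "w = norm w *\<^sub>R sgn w" using \<open>w \<noteq> 0\<close> by (simp add: sgn_div_norm)
        also have "\<dots> = (c powi k) *\<^sub>R (norm v *\<^sub>R sgn w)" by (simp only: nw scaleR_scaleR)
        finally show ?thesis .
      qed
      have v: "norm v *\<^sub>R sgn v = v" using \<open>v \<noteq> 0\<close> by (simp add: sgn_div_norm)
      show "w = (c powi k) *\<^sub>R v" if "sgn w = sgn v"
        by (rule trans[OF w]) (simp only: that v)
      show "w = (- (c powi k)) *\<^sub>R v" if "sgn w = - sgn v"
        by (rule trans[OF w]) (simp only: that v scaleR_minus_right scaleR_minus_left)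
    qed
    then have "(v, w) \<in> homothety_rel c" using that unfolding homothety_rel_def by blast
    then show ?thesis using that Pc_proj_eq_iff[OF assms] by blast
  qed
  obtain H where H: "continuous_map (Pc_top c) euclidean H"
      "\<And>v. v \<in> UNIV - {0} \<Longrightarrow> H (Pc_proj c v) = h v"
  proof (rule quotient_map_lift_exists[OF quotient_map_Pc_proj cont])
    show "h v = h w" if "v \<in> topspace (top_of_set (UNIV - {0}))"
      "w \<in> topspace (top_of_set (UNIV - {0}))" "Pc_proj c v = Pc_proj c w" for v w
      using that by (intro resp) auto
  qed auto
  have "inj_on H (Pc c)"
  proof (rule inj_onI)
    fix x y assume xy: "x \<in> Pc c" "y \<in> Pc c" "H x = H y"
    then obtain v w where vw: "v \<noteq> 0" "w \<noteq> 0" "x = Pc_proj c v" "y = Pc_proj c w"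
      unfolding Pc_eq by blast
    then have "h v = h w" using xy(3) H(2)[of v] H(2)[of w] by simp
    then show "x = y" unfolding vw(3,4) by (rule sep[OF vw(1,2)])
  qed
  then have "embedding_map (Pc_top c) euclidean H"
    by (intro continuous_imp_embedding_map[OF H(1) compact_space_Pc_top[OF assms]])
      (simp_all add: topspace_Pc_top Hausdorff_space_euclidean)
  then show ?thesis
    using homeomorphic_metrizable_space[OF embedding_map_imp_homeomorphic_space]
      metrizable_space_subtopology[OF metrizable_space_euclidean] by blast
qed

lemma act_Pc_proj:
  assumes "c > 1" "invertible g" "v \<noteq> 0"
  shows "act g (Pc_proj c v) = Pc_proj c (g *v v)"
proof -
  obtain g' where g': "g' ** g = mat 1" "g ** g' = mat 1" using assms(2) by (auto simp: invertible_def)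
  have nz: "g *v w = 0 \<longleftrightarrow> w = 0" for w
    by (metis g'(1) matrix_vector_mul_assoc matrix_vector_mul_lid matrix_vector_mult_0_right)
  have "(v, w) \<in> homothety_rel c \<longleftrightarrow> (g *v v, g *v w) \<in> homothety_rel c" for w
  proof -
    have inj: "g *v x = g *v y \<longleftrightarrow> x = y" for x y
      by (metis g'(1) matrix_vector_mul_assoc matrix_vector_mul_lid)
    show ?thesis
      unfolding homothety_rel_def using nz
      by (simp add: inj flip: matrix_vector_mult_scaleR scaleR_minus_left)
  qed
  moreover have "\<exists>w. x = g *v w" for x
    by (metis g'(2) matrix_vector_mul_assoc matrix_vector_mul_lid)
  ultimately show ?thesis
    unfolding act_def Pc_proj_def by (auto simp: image_iff) (metis Image_singleton_iff)
qed


section \<open>The Markov operator\<close>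

definition Pc_borel :: "real \<Rightarrow> (real ^ 'n) set measure" where
  "Pc_borel c = borel_sigma (Pc_top c)"

definition markov_kernel ::
    "real \<Rightarrow> (real ^ 'n ^ 'n) measure \<Rightarrow> (real ^ 'n) set \<Rightarrow> (real ^ 'n) set measure" where
  "markov_kernel c \<mu> v = \<mu> \<bind> (\<lambda>g. return (Pc_borel c) (act g v))"

primrec markov_iter ::
    "real \<Rightarrow> (real ^ 'n ^ 'n) measure \<Rightarrow> nat \<Rightarrow> (real ^ 'n) set \<Rightarrow> (real ^ 'n) set measure" where
  "markov_iter c \<mu> 0 v = return (Pc_borel c) v"
| "markov_iter c \<mu> (Suc n) v = markov_kernel c \<mu> v \<bind> markov_iter c \<mu> n"

definition stationary_probability ::
    "real \<Rightarrow> (real ^ 'n ^ 'n) measure \<Rightarrow> (real ^ 'n) set measure \<Rightarrow> bool" where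
  "stationary_probability c \<mu> \<rho> \<longleftrightarrow> prob_space \<rho> \<and> sets \<rho> = sets (Pc_borel c) \<and>
     \<mu> \<bind> (\<lambda>g. distr \<rho> (Pc_borel c) (act g)) = \<rho>"

definition closed_invariant ::
    "real \<Rightarrow> (real ^ 'n ^ 'n) set \<Rightarrow> (real ^ 'n) set set \<Rightarrow> bool" where
  "closed_invariant c \<Gamma> M \<longleftrightarrow> closedin (Pc_top c) M \<and> (\<forall>\<gamma>\<in>\<Gamma>. act \<gamma> ` M \<subseteq> M)"

definition minimal_invariant ::
    "real \<Rightarrow> (real ^ 'n ^ 'n) set \<Rightarrow> (real ^ 'n) set set \<Rightarrow> bool" where
  "minimal_invariant c \<Gamma> M \<longleftrightarrow> closed_invariant c \<Gamma> M \<and> M \<noteq> {} \<and>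
     \<not> (\<exists>N. closed_invariant c \<Gamma> N \<and> N \<noteq> {} \<and> N \<subset> M)"

text \<open>\<open>left_product g n\<close> is \<open>g\<^sub>n \<cdots> g\<^sub>1\<close>, where the sequence \<open>g\<^sub>1, g\<^sub>2, \<dots>\<close> is indexed from \<open>0\<close>.\<close>

primrec left_product :: "(nat \<Rightarrow> real ^ 'n ^ 'n) \<Rightarrow> nat \<Rightarrow> real ^ 'n ^ 'n" where
  "left_product g 0 = mat 1"
| "left_product g (Suc n) = g n ** left_product g n"

definition iid_with_law ::
    "'w measure \<Rightarrow> (real ^ 'n ^ 'n) measure \<Rightarrow> (nat \<Rightarrow> 'w \<Rightarrow> real ^ 'n ^ 'n) \<Rightarrow> bool" where
  "iid_with_law \<Omega> \<mu> g \<longleftrightarrow> prob_space \<Omega> \<and>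
     prob_space.indep_vars \<Omega> (\<lambda>_. \<mu>) g UNIV \<and> (\<forall>n. distr \<Omega> \<mu> (g n) = \<mu>)"

text \<open>
  The space is compact and metrizable (\<open>metrizable_space_Pc_top\<close>), so all metrics inducing
  its topology are uniformly equivalent and none is preferred; statements about distances are made for
  every such metric.
\<close>

definition compatible_metric :: "real \<Rightarrow> ((real ^ 'n) set \<Rightarrow> (real ^ 'n) set \<Rightarrow> real) \<Rightarrow> bool" where
  "compatible_metric c D \<longleftrightarrow> Metric_space (Pc c) D \<and> Metric_space.mtopology (Pc c) D = Pc_top c"

end

theory Submission imports Defs begin

text \<open>
  Continuous functions \<open>f\<close> on the quotient are treated as functions \<open>F\<close> on the vector space that are invariant under the
  homotheties; the iterates of the Markov operator become the averages of \<open>F (g\<^sub>n \<cdots> g\<^sub>1 v)\<close> over the random walk. The heart of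
  the proof is that these averages converge to a constant independent of \<open>v\<close> (\<open>average_converges\<close>). It has two sources.

  The first is equicontinuity in \<open>v\<close>, uniformly in \<open>n\<close> (\<open>average_equicontinuous\<close>). A product \<open>A\<close> can separate close directions only
  near vectors that it shortens much more than its norm suggests, and with high probability the random product does not shorten a
  given vector \<open>v\<close> in this way, uniformly in \<open>n\<close> and \<open>v\<close> (\<open>no_cancellation\<close>). The reason is a counting argument: strong irreducibility
  supplies many words that move a vector into general position (\<open>general_position\<close>). If shortening had a probability
  bounded below, one and the same product would have to shorten many of these vectors at once, while a \<open>d\<close>-by-\<open>d\<close> matrix nearly
  annihilates fewer than \<open>d\<close> vectors in general position.

  The second is a non-arithmeticity property: any two vectors can be brought close to each other, up to sign, by words
  of the same length (\<open>synchronous_approach\<close>). Powers of the proximal element converge projectively to a matrix of rank one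
  (\<open>proximal_limit\<close>), so that images of vectors under suitable words are nearly collinear and it remains to adjust
  their norms. The quotients of norms which can be realised by words of equal length form a multiplicative group, and this group
  is dense; otherwise certain linear functionals would be proportional against strong irreducibility (\<open>ratio_accumulates_at_1\<close>).

  Together they give convergence: the supremum and the infimum of the averages are monotone in \<open>n\<close>, points where they are almost
  attained can be brought together by words of equal length, and equicontinuity then forces both limits to agree. The limiting
  constant depends on \<open>f\<close> as the integral against a probability measure, obtained by weak compactness (\<open>limit_measure_exists\<close>).
  Weak convergence, stationarity and uniqueness of this measure follow at once (\<open>stationary_iff\<close>). A closed invariant set carries
  the trajectories that start in it, so it contains the support, which is itself invariant (\<open>support_unique_minimal\<close>). Finally a maximal inequality
  strengthens \<open>no_cancellation\<close> to all times simultaneously (\<open>no_cancellation_ever\<close>): a trajectory that has come close to the support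
  stays near a trajectory inside the support for ever, with high probability (\<open>trajectories_approach_cone\<close>).
\<close>

section \<open>Matrix norms and orbits of strongly irreducible semigroups\<close>

text \<open>
  The norm of the type \<^typ>\<open>real^'n^'m\<close> is the Frobenius norm. It is submultiplicative and exceeds the
  operator norm by at most a factor that depends on the dimension, so it can replace the operator norm
  wherever only the order of magnitude matters.
\<close>

lemma norm_matrix_eq: "(norm (A :: real^'n^'m))\<^sup>2 = (\<Sum>i\<in>UNIV. \<Sum>j\<in>UNIV. (A $ i $ j)\<^sup>2)"
  by (simp add: norm_vec_def L2_set_def sum_nonneg)

lemma norm_matrix_vector_mult_le: "norm (A *v x) \<le> norm (A :: real^'n^'m) * norm x"
proof -
  have "norm (A *v x) = L2_set (\<lambda>i. \<bar>A $ i \<bullet> x\<bar>) UNIV"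
    by (simp add: norm_vec_def matrix_vector_mul_component)
  also have "\<dots> \<le> L2_set (\<lambda>i. norm (A $ i) * norm x) UNIV"
    by (intro L2_set_mono Cauchy_Schwarz_ineq2) auto
  also have "\<dots> = norm A * norm x"
    by (simp add: norm_vec_def[of A] L2_set_left_distrib)
  finally show ?thesis .
qed

lemma norm_matrix_columns: "(norm (A :: real^'n^'m))\<^sup>2 = (\<Sum>j\<in>UNIV. (norm (A *v axis j 1))\<^sup>2)"
proof -
  have "(norm (A *v axis j 1))\<^sup>2 = (\<Sum>i\<in>UNIV. (A $ i $ j)\<^sup>2)" for j
    by (simp add: norm_vec_def L2_set_def sum_nonneg matrix_vector_mult_basis column_def)
  then show ?thesis unfolding norm_matrix_eq by (subst sum.swap) simp
qed

lemma norm_matrix_mult_le: "norm (A ** B) \<le> norm (A :: real^'m^'k) * norm (B :: real^'n^'m)"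
proof -
  have "(norm (A ** B))\<^sup>2 = (\<Sum>j\<in>UNIV. (norm (A *v (B *v axis j 1)))\<^sup>2)"
    by (simp add: norm_matrix_columns matrix_vector_mul_assoc)
  also have "\<dots> \<le> (\<Sum>j\<in>UNIV. (norm A * norm (B *v axis j 1))\<^sup>2)"
    by (intro sum_mono power_mono norm_matrix_vector_mult_le) auto
  also have "\<dots> = (norm A * norm B)\<^sup>2"
    by (simp add: norm_matrix_columns[of B] power_mult_distrib sum_distrib_left)
  finally show ?thesis by (rule power2_le_imp_le) simp
qed

text \<open>
  The squared norm is the sum of the squared norms of the columns, so some unit coordinate vector is
  stretched by a fixed share of the norm. The bound with the full dimension instead of its square root
  is enough, because constants are irrelevant in the sequel.
\<close>

lemma norm_matrix_attained_up_to_card: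
  "\<exists>e. norm e = 1 \<and> norm (A :: real^'n^'m) \<le> CARD('n) * norm (A *v e)"
proof (rule ccontr)
  assume *: "\<not> ?thesis"
  have **: "CARD('n) * norm (A *v axis j 1) < norm A" for j
    using * by (auto simp: not_le)
  have "(CARD('n) * norm A)\<^sup>2 = (\<Sum>j\<in>UNIV. (CARD('n) * norm (A *v axis j 1))\<^sup>2)"
    by (simp add: norm_matrix_columns[of A] power_mult_distrib sum_distrib_left)
  also have "\<dots> < (\<Sum>j\<in>(UNIV::'n set). (norm A)\<^sup>2)"
    by (intro sum_strict_mono power_strict_mono **) auto
  also have "\<dots> \<le> (CARD('n) * norm A)\<^sup>2"
  proof -
    have "real CARD('n) \<ge> 1" by (simp add: Suc_le_eq)
    then have "real CARD('n) * 1 \<le> (real CARD('n))\<^sup>2" unfolding power2_eq_square by (intro mult_left_mono) auto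
    then show ?thesis by (simp add: power_mult_distrib mult_right_mono)
  qed
  finally show False by simp
qed

lemma invertible_mult_eq_0_iff [simp]: "invertible (A :: real^'n^'n) \<Longrightarrow> A *v x = 0 \<longleftrightarrow> x = 0"
  by (metis invertible_def matrix_vector_mul_assoc matrix_vector_mul_lid matrix_vector_mult_0_right)

lemma invertible_inj: "invertible (A :: real^'n^'n) \<Longrightarrow> inj ((*v) A)"
  by (simp add: inj_matrix_vector_mult)

lemma dot_matrix_vector: "(x :: real^'n) \<bullet> (A *v y) = (transpose A *v x) \<bullet> y"
  by (simp only: dot_lmul_matrix transpose_matrix_vector)

lemma continuous_on_matrix_mult [continuous_intros]:
  fixes f :: "'a::topological_space \<Rightarrow> real^'n^'m" and g :: "'a \<Rightarrow> real^'k^'n"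
  assumes "continuous_on S f" "continuous_on S g"
  shows "continuous_on S (\<lambda>x. f x ** g x)"
  unfolding matrix_matrix_mult_def
  by (intro continuous_intros assms)

lemma continuous_on_matrix_vector_mult [continuous_intros]:
  fixes f :: "'a::topological_space \<Rightarrow> real^'n^'m" and g :: "'a \<Rightarrow> real^'n"
  assumes "continuous_on S f" "continuous_on S g"
  shows "continuous_on S (\<lambda>x. f x *v g x)"
  unfolding matrix_vector_mult_def
  by (intro continuous_intros assms)

lemma tendsto_matrix_mult [tendsto_intros]:
  fixes f :: "'a \<Rightarrow> real^'n^'m" and g :: "'a \<Rightarrow> real^'k^'n"
  assumes "(f \<longlongrightarrow> a) F" "(g \<longlongrightarrow> b) F"
  shows "((\<lambda>x. f x ** g x) \<longlongrightarrow> a ** b) F"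
  unfolding matrix_matrix_mult_def
  by (intro tendsto_intros assms)

lemma tendsto_matrix_vector_mult [tendsto_intros]:
  fixes f :: "'a \<Rightarrow> real^'n^'m" and g :: "'a \<Rightarrow> real^'n"
  assumes "(f \<longlongrightarrow> a) F" "(g \<longlongrightarrow> b) F"
  shows "((\<lambda>x. f x *v g x) \<longlongrightarrow> a *v b) F"
  unfolding matrix_vector_mult_def
  by (intro tendsto_intros assms)

text \<open>
  Among all finite coverings of the orbit by proper subspaces, take one for which the
  largest dimension \<open>r\<close> is minimal and then the number of members of dimension \<open>r\<close> is minimal. Intersecting
  the members with preimages of members under \<open>g\<close> gives another covering, since \<open>g\<close> maps the orbit to
  itself. By minimality it has at least as many members of dimension \<open>r\<close>, and each of these is a member of
  the old covering that \<open>g\<close> carries onto a member of dimension \<open>r\<close>. Hence \<open>g\<close> permutes these members.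
\<close>

lemma orbit_in_finite_union:
  fixes G :: "(real^'n^'n) set"
  assumes G: "G \<noteq> {}" "\<And>g h. g \<in> G \<Longrightarrow> h \<in> G \<Longrightarrow> g ** h \<in> G" "\<And>g. g \<in> G \<Longrightarrow> invertible g"
    and x: "x \<noteq> 0"
    and W: "finite \<W>" "\<And>W. W \<in> \<W> \<Longrightarrow> subspace W \<and> W \<noteq> UNIV" "\<And>g. g \<in> G \<Longrightarrow> g *v x \<in> \<Union>\<W>"
  shows "\<exists>\<F>. finite \<F> \<and> \<F> \<noteq> {} \<and> (\<forall>W\<in>\<F>. subspace W \<and> W \<noteq> {0} \<and> W \<noteq> UNIV) \<and>
           (\<forall>g\<in>G. \<forall>W\<in>\<F>. (*v) g ` W \<in> \<F>)"
proof -
  define cover where "cover \<W> \<longleftrightarrow> finite \<W> \<and> (\<forall>W\<in>\<W>. subspace W \<and> W \<noteq> UNIV) \<and> (\<forall>g\<in>G. g *v x \<in> \<Union>\<W>)"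
    for \<W> :: "(real^'n) set set"
  \<comment> \<open>The covering is minimised lexicographically: first \<open>r\<close>, then the number \<open>k\<close> of members of dimension \<open>r\<close>.\<close>
  define P where "P r \<longleftrightarrow> (\<exists>\<W>. cover \<W> \<and> (\<forall>W\<in>\<W>. dim W \<le> r))" for r
  define r where "r = (LEAST r. P r)"
  have "P (DIM(real^'n))" unfolding P_def cover_def using W dim_subset_UNIV by blast
  then have Pr: "P r" unfolding r_def by (rule LeastI)
  define K where "K k \<longleftrightarrow> (\<exists>\<W>. cover \<W> \<and> (\<forall>W\<in>\<W>. dim W \<le> r) \<and> card {W\<in>\<W>. dim W = r} = k)" for k
  define k where "k = (LEAST k. K k)"
  have "\<exists>k. K k" using Pr unfolding P_def K_def by blast
  then have "K k" unfolding k_def by (rule LeastI_ex)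
  then obtain \<W> where \<W>: "cover \<W>" "\<And>W. W \<in> \<W> \<Longrightarrow> dim W \<le> r" "card {W\<in>\<W>. dim W = r} = k"
    unfolding K_def by blast
  define \<F> where "\<F> = {W\<in>\<W>. dim W = r}"
  have fin: "finite \<W>" and sub: "\<And>W. W \<in> \<W> \<Longrightarrow> subspace W" "\<And>W. W \<in> \<W> \<Longrightarrow> W \<noteq> UNIV"
    and cov: "\<And>g. g \<in> G \<Longrightarrow> g *v x \<in> \<Union>\<W>"
    using \<W>(1) unfolding cover_def by auto
  have r0: "r \<noteq> 0"
  proof
    assume "r = 0"
    obtain g where g: "g \<in> G" using G(1) by auto
    obtain W where "W \<in> \<W>" "g *v x \<in> W" using cov[OF g] by auto
    moreover have "W \<subseteq> {0}" using \<W>(2)[OF \<open>W \<in> \<W>\<close>] \<open>r = 0\<close> by (simp add: dim_eq_0)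
    ultimately show False using G(3)[OF g] x by auto
  qed
  have "\<F> \<noteq> {}"
  proof
    assume "\<F> = {}"
    then have "\<forall>W\<in>\<W>. dim W \<le> r - 1"
      using \<W>(2) unfolding \<F>_def by (metis (mono_tags, lifting) One_nat_def Suc_pred empty_Collect_eq le_neq_implies_less less_Suc_eq_le neq0_conv r0)
    then have "P (r - 1)" using \<W>(1) unfolding P_def by blast
    then have "r \<le> r - 1" unfolding r_def by (rule Least_le)
    with r0 show False by simp
  qed
  have perm: "(*v) g ` W \<in> \<F>" if g: "g \<in> G" and WF: "W \<in> \<F>" for g W
  proof -
    define \<V> where "\<V> = (\<lambda>(W, W'). W \<inter> (*v) g -` W') ` (\<W> \<times> \<W>)"
    have covV: "cover \<V>"
      unfolding cover_def
    proof (intro conjI ballI)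
      show "finite \<V>" unfolding \<V>_def using fin by simp
      fix V assume "V \<in> \<V>"
      then obtain W W' where V: "V = W \<inter> (*v) g -` W'" "W \<in> \<W>" "W' \<in> \<W>" unfolding \<V>_def by auto
      show "subspace V" unfolding V
        using sub V by (intro subspace_inter linear_subspace_vimage matrix_vector_mul_linear) auto
      show "V \<noteq> UNIV" using sub(2)[OF V(2)] unfolding V by auto
    next
      fix h assume h: "h \<in> G"
      obtain W where "W \<in> \<W>" "h *v x \<in> W" using cov[OF h] by auto
      moreover obtain W' where "W' \<in> \<W>" "g *v (h *v x) \<in> W'"
        using cov[OF G(2)[OF g h]] by (auto simp: matrix_vector_mul_assoc)
      ultimately show "h *v x \<in> \<Union>\<V>" unfolding \<V>_def by blast
    qed
    have dimV: "\<forall>V\<in>\<V>. dim V \<le> r"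
      unfolding \<V>_def using \<W>(2) by (auto intro: order_trans[OF dim_subset])
    have top: "{V\<in>\<V>. dim V = r} \<subseteq> {W\<in>\<F>. (*v) g ` W \<in> \<F>}"
    proof safe
      fix V assume V: "V \<in> \<V>" and r: "r = dim V"
      then obtain W W' where V': "V = W \<inter> (*v) g -` W'" "W \<in> \<W>" "W' \<in> \<W>" unfolding \<V>_def by auto
      have "subspace V" using covV V unfolding cover_def by blast
      then have VW: "V = W"
        using V'(1) sub(1)[OF V'(2)] \<W>(2)[OF V'(2)] r by (intro subspace_dim_equal) auto
      then show "V \<in> \<F>" using V'(2) r unfolding \<F>_def by simp
      have "dim ((*v) g ` W) = dim W"
        using invertible_inj[OF G(3)[OF g]] by (intro dim_image_eq) (auto intro: inj_on_subset)
      then have "(*v) g ` W = W'"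
        using V' VW sub(1)[OF V'(2)] sub(1)[OF V'(3)] \<W>(2)[OF V'(3)] r
        by (intro subspace_dim_equal) (auto intro: linear_subspace_image)
      then show "(*v) g ` V \<in> \<F>"
        using V'(3) VW r \<open>dim ((*v) g ` W) = dim W\<close> unfolding \<F>_def by auto
    qed
    have "K (card {V\<in>\<V>. dim V = r})" using covV dimV unfolding K_def by blast
    then have "card \<F> \<le> card {V\<in>\<V>. dim V = r}"
      unfolding \<F>_def \<W>(3) k_def by (rule Least_le)
    also have "\<dots> \<le> card {W\<in>\<F>. (*v) g ` W \<in> \<F>}"
      using top fin by (intro card_mono) (auto simp: \<F>_def)
    finally have "{W\<in>\<F>. (*v) g ` W \<in> \<F>} = \<F>"
      using fin by (intro card_seteq) (auto simp: \<F>_def)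
    then show ?thesis using WF by blast
  qed
  have proper: "\<forall>W\<in>\<F>. subspace W \<and> W \<noteq> {0} \<and> W \<noteq> UNIV"
  proof
    fix W assume "W \<in> \<F>"
    then have "W \<in> \<W>" "dim W = r" by (simp_all add: \<F>_def)
    then show "subspace W \<and> W \<noteq> {0} \<and> W \<noteq> UNIV" using r0 sub[of W] by auto
  qed
  have "finite \<F>" using fin by (simp add: \<F>_def)
  with proper \<open>\<F> \<noteq> {}\<close> perm show ?thesis by meson
qed

locale irreducible_semigroup =
  fixes G :: "(real^'n^'n) set"
  assumes nonempty: "G \<noteq> {}"
    and mult_closed: "g \<in> G \<Longrightarrow> h \<in> G \<Longrightarrow> g ** h \<in> G"
    and invertible: "g \<in> G \<Longrightarrow> invertible g"
    and irreducible: "strongly_irreducible G"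
begin

text \<open>
  Strong irreducibility says that no finite union of proper subspaces is invariant; it is always used in
  this stronger form, where only a single orbit is concerned.
\<close>

lemma orbit_escapes:
  assumes "x \<noteq> 0" "finite \<W>" "\<And>W. W \<in> \<W> \<Longrightarrow> subspace W \<and> W \<noteq> UNIV"
  shows "\<exists>g\<in>G. g *v x \<notin> \<Union>\<W>"
proof (rule ccontr)
  assume "\<not> (\<exists>g\<in>G. g *v x \<notin> \<Union>\<W>)"
  then have in_union: "\<And>g. g \<in> G \<Longrightarrow> g *v x \<in> \<Union>\<W>" by metis
  have "\<exists>\<F>. finite \<F> \<and> \<F> \<noteq> {} \<and> (\<forall>W\<in>\<F>. subspace W \<and> W \<noteq> {0} \<and> W \<noteq> UNIV) \<and>
           (\<forall>g\<in>G. \<forall>W\<in>\<F>. (*v) g ` W \<in> \<F>)"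
  proof (rule orbit_in_finite_union[of G x \<W>])
    show "\<And>g. g \<in> G \<Longrightarrow> g *v x \<in> \<Union>\<W>" by (rule in_union)
  qed (use nonempty mult_closed invertible assms in simp_all)
  then obtain \<F> where F: "finite \<F>" "\<F> \<noteq> {}" "\<forall>W\<in>\<F>. subspace W \<and> W \<noteq> {0} \<and> W \<noteq> UNIV"
    "\<And>g W. g \<in> G \<Longrightarrow> W \<in> \<F> \<Longrightarrow> (*v) g ` W \<in> \<F>" by metis
  have "\<forall>g\<in>G. (*v) g ` \<Union>\<F> \<subseteq> \<Union>\<F>"
  proof safe
    fix g z W assume "g \<in> G" "z \<in> W" "W \<in> \<F>"
    then show "g *v z \<in> \<Union>\<F>" using F(4)[of g W] by blast
  qed
  then show False using irreducible F(1-3) unfolding strongly_irreducible_def by metis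
qed

text \<open>
  If one of the two values vanished for every \<open>t\<close>, the orbit of \<open>\<phi>\<close> under the transposed semigroup would lie
  in the union of the hyperplanes orthogonal to \<open>x\<close> and \<open>y\<close>. The transposed semigroup would then permute a
  finite family of subspaces, and \<open>G\<close> would leave the union of their orthogonal complements invariant.
\<close>

lemma simultaneous_nonvanishing:
  assumes nz: "\<phi> \<noteq> 0" "x \<noteq> 0" "y \<noteq> 0"
  shows "\<exists>t\<in>G. \<phi> \<bullet> (t *v x) \<noteq> 0 \<and> \<phi> \<bullet> (t *v y) \<noteq> 0"
proof (rule ccontr)
  assume *: "\<not> ?thesis"
  let ?\<W> = "{{z. x \<bullet> z = 0}, {z. y \<bullet> z = 0}}"
  have "\<exists>\<F>. finite \<F> \<and> \<F> \<noteq> {} \<and> (\<forall>W\<in>\<F>. subspace W \<and> W \<noteq> {0} \<and> W \<noteq> UNIV) \<and>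
           (\<forall>g\<in>transpose ` G. \<forall>W\<in>\<F>. (*v) g ` W \<in> \<F>)"
  proof (rule orbit_in_finite_union[of _ \<phi> ?\<W>])
    show "transpose ` G \<noteq> {}" using nonempty by simp
    show "g ** h \<in> transpose ` G" if "g \<in> transpose ` G" "h \<in> transpose ` G" for g h
      using that mult_closed by (auto simp flip: matrix_transpose_mul)
    show "invertible g" if "g \<in> transpose ` G" for g
      using that invertible by (auto intro: transpose_invertible)
    show "subspace W \<and> W \<noteq> UNIV" if "W \<in> ?\<W>" for W
    proof -
      have "x \<notin> {z. x \<bullet> z = 0}" "y \<notin> {z. y \<bullet> z = 0}" using nz by auto
      then have "{z. x \<bullet> z = 0} \<noteq> UNIV" "{z. y \<bullet> z = 0} \<noteq> UNIV" by blast+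
      then show ?thesis using that by (auto simp: subspace_hyperplane)
    qed
    show "g *v \<phi> \<in> \<Union>?\<W>" if "g \<in> transpose ` G" for g
    proof -
      obtain t where t: "t \<in> G" "g = transpose t" using \<open>g \<in> transpose ` G\<close> by blast
      then have "\<phi> \<bullet> (t *v x) = 0 \<or> \<phi> \<bullet> (t *v y) = 0" using * by blast
      then have "x \<bullet> (g *v \<phi>) = 0 \<or> y \<bullet> (g *v \<phi>) = 0"
        unfolding t(2) dot_matrix_vector[of \<phi> t] inner_commute[of "transpose t *v \<phi>"] .
      then show ?thesis by blast
    qed
  qed (use nz in auto)
  then obtain \<F> where F: "finite \<F>" "\<F> \<noteq> {}" "\<And>W. W\<in>\<F> \<Longrightarrow> subspace W" "\<And>W. W\<in>\<F> \<Longrightarrow> W \<noteq> {0}"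
     "\<And>W. W\<in>\<F> \<Longrightarrow> W \<noteq> UNIV"
    and perm: "\<And>g W. g \<in> G \<Longrightarrow> W\<in>\<F> \<Longrightarrow> (*v) (transpose g) ` W \<in> \<F>"
    by (metis image_eqI)
  let ?\<V> = "orthogonal_comp ` \<F>"
  have "subspace V \<and> V \<noteq> {0} \<and> V \<noteq> UNIV" if V: "V \<in> ?\<V>" for V
  proof -
    obtain W where W: "W \<in> \<F>" "V = orthogonal_comp W" using V by blast
    have WW: "orthogonal_comp (orthogonal_comp W) = W"
      using F(3)[OF W(1)] by (simp add: orthogonal_comp_self)
    show ?thesis using WW F(4,5)[OF W(1)] W(2) by (metis subspace_orthogonal_comp orthogonal_comp_null orthogonal_comp_UNIV)
  qed
  moreover have "(*v) g ` \<Union>?\<V> \<subseteq> \<Union>?\<V>" if g: "g \<in> G" for g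
  proof
    fix z assume "z \<in> (*v) g ` \<Union>?\<V>"
    then obtain W u where W: "W \<in> \<F>" "u \<in> orthogonal_comp W" "z = g *v u" by auto
    have "inj_on ((`) ((*v) (transpose g))) \<F>"
      using invertible_inj[OF transpose_invertible[OF invertible[OF g]]] by (auto simp: inj_on_def inj_image_eq_iff)
    then have "(`) ((*v) (transpose g)) ` \<F> = \<F>"
      using perm[OF g] F(1) by (intro endo_inj_surj) auto
    then obtain W' where W': "W' \<in> \<F>" "W = (*v) (transpose g) ` W'" using W(1) by blast
    have "z \<in> orthogonal_comp W'"
      unfolding orthogonal_comp_def orthogonal_def
    proof safe
      fix w assume "w \<in> W'"
      then have "transpose g *v w \<in> W" using W'(2) by blast
      then have "(transpose g *v w) \<bullet> u = 0"
        using W(2) unfolding orthogonal_comp_def orthogonal_def by blast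
      then show "w \<bullet> z = 0" unfolding W(3) dot_matrix_vector[of w g] .
    qed
    then show "z \<in> \<Union>?\<V>" using W'(1) by auto
  qed
  ultimately show False
    using irreducible F(1,2) unfolding strongly_irreducible_def by (metis finite_imageI image_is_empty)
qed

text \<open>
  The points are chosen one after the other, each outside all proper subspaces spanned by earlier ones.
  A proper subspace \<open>U\<close> that already contains \<open>dim U\<close> of the earlier points is spanned by them, so it does
  not receive the new point.
\<close>

lemma general_position:
  assumes "v \<noteq> 0"
  shows "\<exists>g. (\<forall>l<N::nat. g l \<in> G) \<and> (\<forall>U. subspace U \<and> U \<noteq> UNIV \<longrightarrow> card {l. l < N \<and> g l *v v \<in> U} \<le> dim U)"
proof (induction N)
  case (Suc N)
  then obtain g where g: "\<And>l. l < N \<Longrightarrow> g l \<in> G"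
    and gp: "\<And>U. subspace U \<Longrightarrow> U \<noteq> UNIV \<Longrightarrow> card {l. l < N \<and> g l *v v \<in> U} \<le> dim U" by blast
  define \<W> where "\<W> = {W \<in> (\<lambda>J. span ((\<lambda>l. g l *v v) ` J)) ` Pow {..<N}. W \<noteq> UNIV}"
  have "\<exists>h\<in>G. h *v v \<notin> \<Union>\<W>"
    using assms by (intro orbit_escapes) (auto simp: \<W>_def)
  then obtain h where h: "h \<in> G" "h *v v \<notin> \<Union>\<W>" by blast
  show ?case
  proof (intro exI[of _ "g(N := h)"] conjI allI impI; (elim conjE)?)
    fix l assume "l < Suc N" then show "(g(N := h)) l \<in> G" using g h by (auto simp: less_Suc_eq)
  next
    fix U :: "(real^'n) set" assume U: "subspace U" "U \<noteq> UNIV"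
    define J where "J = {l. l < N \<and> g l *v v \<in> U}"
    have J: "card J \<le> dim U" "finite J" "J \<subseteq> {..<N}" using gp[OF U] by (auto simp: J_def)
    have *: "{l. l < Suc N \<and> (g(N := h)) l *v v \<in> U} = (if h *v v \<in> U then insert N J else J)"
    proof (rule set_eqI)
      fix l show "l \<in> {l. l < Suc N \<and> (g(N := h)) l *v v \<in> U} \<longleftrightarrow> l \<in> (if h *v v \<in> U then insert N J else J)"
        by (cases "l = N") (simp_all add: J_def less_Suc_eq)
    qed
    show "card {l. l < Suc N \<and> (g(N := h)) l *v v \<in> U} \<le> dim U"
    proof (cases "h *v v \<in> U")
      case True
      have "card J \<noteq> dim U"
      proof
        assume eq: "card J = dim U"
        define U' where "U' = span ((\<lambda>l. g l *v v) ` J)"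
        have sub: "U' \<subseteq> U" unfolding U'_def using U by (intro span_minimal) (auto simp: J_def)
        then have "U' \<noteq> UNIV" using U by auto
        then have "card {l. l < N \<and> g l *v v \<in> U'} \<le> dim U'" by (intro gp) (simp_all add: U'_def)
        moreover have "J \<subseteq> {l. l < N \<and> g l *v v \<in> U'}"
        proof
          fix l assume l: "l \<in> J"
          then have "g l *v v \<in> U'" unfolding U'_def by (intro span_base imageI)
          then show "l \<in> {l. l < N \<and> g l *v v \<in> U'}" using l by (simp add: J_def)
        qed
        then have "card J \<le> card {l. l < N \<and> g l *v v \<in> U'}" by (intro card_mono) auto
        ultimately have "dim U \<le> dim U'" using eq by simp
        then have "U' = U" using sub U by (intro subspace_dim_equal) (simp_all add: U'_def)
        moreover have "U' \<in> \<W>" using \<open>U' \<noteq> UNIV\<close> J(3) unfolding \<W>_def U'_def by blast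
        ultimately show False using h(2) True by blast
      qed
      then have "card J < dim U" using J(1) by simp
      then show ?thesis unfolding * using True J(2) by (simp add: card_insert_if)
    next
      case False
      then show ?thesis unfolding * using J(1) by simp
    qed
  qed
qed auto

text \<open>
  Otherwise the orbit would be covered by the hyperplane and one further proper subspace.
\<close>

lemma orbit_off_hyperplane_spans:
  assumes "v \<noteq> 0" "\<phi> \<noteq> 0"
  shows "span {s *v v | s. s \<in> G \<and> \<phi> \<bullet> (s *v v) \<noteq> 0} = UNIV"
proof (rule ccontr)
  assume *: "span {s *v v | s. s \<in> G \<and> \<phi> \<bullet> (s *v v) \<noteq> 0} \<noteq> UNIV" (is "span ?S \<noteq> _")
  have "\<phi> \<notin> {z. \<phi> \<bullet> z = 0}" using assms by auto
  then have "{z. \<phi> \<bullet> z = 0} \<noteq> UNIV" by blast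
  then have "\<exists>g\<in>G. g *v v \<notin> \<Union>{span ?S, {z. \<phi> \<bullet> z = 0}}"
    using assms * by (intro orbit_escapes) (auto simp: subspace_hyperplane)
  then show False by (auto intro: span_base)
qed

end

text \<open>
  The kernel of a non-zero matrix is a proper subspace, so it cannot contain as many points in general
  position as the dimension. By compactness of the unit sphere of matrices this holds with a uniform
  margin: one matrix can nearly annihilate fewer than \<open>CARD('n)\<close> of the points.
\<close>

lemma general_position_quantitative:
  fixes v :: "nat \<Rightarrow> real^'n"
  assumes gp: "\<And>U. subspace U \<Longrightarrow> U \<noteq> UNIV \<Longrightarrow> card {l. l < N \<and> v l \<in> U} \<le> dim U"
  shows "\<exists>\<eta>>0. \<forall>A :: real^'n^'n. A \<noteq> 0 \<longrightarrow> card {l. l < N \<and> norm (A *v v l) \<le> \<eta> * norm A} < CARD('n)"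
proof -
  have "\<exists>\<eta>>0. \<forall>A :: real^'n^'n. A \<noteq> 0 \<longrightarrow> (\<exists>l\<in>J. norm (A *v v l) > \<eta> * norm A)"
    if J: "J \<subseteq> {..<N}" "card J \<ge> CARD('n)" for J
  proof -
    define f where "f A = (\<Sum>l\<in>J. norm (A *v v l))" for A :: "real^'n^'n"
    have "J \<noteq> {}" "finite J" using J finite_subset by (auto simp: zero_less_card_finite)
    have pos: "f A > 0" if "A \<noteq> 0" for A
    proof (rule ccontr)
      assume "\<not> f A > 0"
      then have "f A = 0" using sum_nonneg[of J "\<lambda>l. norm (A *v v l)"] by (simp add: f_def)
      then have "\<And>l. l \<in> J \<Longrightarrow> A *v v l = 0"
        using \<open>finite J\<close> by (simp add: f_def sum_nonneg_eq_0_iff)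
      then have sub: "J \<subseteq> {l. l < N \<and> v l \<in> {z. A *v z = 0}}" using J(1) by auto
      have U: "subspace {z. A *v z = 0}" using linear_subspace_vimage[OF matrix_vector_mul_linear subspace_single_0]
        by (simp add: vimage_def)
      have "{z. A *v z = 0} \<noteq> UNIV"
        using \<open>A \<noteq> 0\<close> by (metis (mono_tags, lifting) UNIV_I matrix_eq matrix_vector_mult_0 mem_Collect_eq)
      then have "card J \<le> dim {z. A *v z = 0}"
        using gp[OF U] card_mono[OF _ sub] by simp
      moreover have "dim {z. A *v z = 0} < dim (UNIV :: (real^'n) set)"
        using U \<open>{z. A *v z = 0} \<noteq> UNIV\<close>
        by (intro dim_psubset) (simp add: span_eq_iff[THEN iffD2] psubset_eq)
      moreover have "dim (UNIV :: (real^'n) set) = CARD('n)" by simp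
      ultimately show False using J(2) by simp
    qed
    obtain A0 :: "real^'n^'n" where A0: "norm A0 = 1" "\<And>A. norm A = 1 \<Longrightarrow> f A0 \<le> f A"
    proof -
      have "\<exists>A0\<in>sphere 0 1. \<forall>A\<in>sphere 0 1. f A0 \<le> f A"
        unfolding f_def by (intro continuous_attains_inf continuous_intros) auto
      then show ?thesis using that by (auto simp: dist_norm)
    qed
    have lower: "f A \<ge> f A0 * norm A" if "A \<noteq> 0" for A
    proof -
      have "f A0 \<le> f ((1 / norm A) *\<^sub>R A)" using that by (intro A0) simp
      also have "\<dots> = f A / norm A"
        by (simp add: f_def scaleR_matrix_vector_assoc[symmetric] sum_divide_distrib)
      finally show ?thesis using that by (simp add: field_simps)
    qed
    have f0: "f A0 > 0" using A0 by (intro pos) auto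
    show ?thesis
    proof (intro exI[of _ "f A0 / (2 * card J)"] conjI allI impI)
      show "f A0 / (2 * card J) > 0" using f0 \<open>J \<noteq> {}\<close> \<open>finite J\<close> by (simp add: card_gt_0_iff)
      fix A :: "real^'n^'n" assume A: "A \<noteq> 0"
      show "\<exists>l\<in>J. norm (A *v v l) > f A0 / (2 * card J) * norm A"
      proof (rule ccontr)
        assume "\<not> ?thesis"
        then have "f A \<le> (\<Sum>l\<in>J. f A0 / (2 * card J) * norm A)"
          unfolding f_def by (intro sum_mono) (auto simp: not_less)
        also have "\<dots> = f A0 * norm A / 2" using \<open>J \<noteq> {}\<close> \<open>finite J\<close> by (simp add: field_simps)
        also have "\<dots> < f A0 * norm A" using f0 A by simp
        finally show False using lower[OF A] by simp
      qed
    qed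
  qed
  then obtain \<eta> where \<eta>: "\<And>J. J \<subseteq> {..<N} \<Longrightarrow> card J \<ge> CARD('n) \<Longrightarrow> \<eta> J > 0"
    "\<And>J A. J \<subseteq> {..<N} \<Longrightarrow> card J \<ge> CARD('n) \<Longrightarrow> (A :: real^'n^'n) \<noteq> 0 \<Longrightarrow> \<exists>l\<in>J. norm (A *v v l) > \<eta> J * norm A"
    by metis
  \<comment> \<open>There are finitely many index sets \<open>J\<close>; the extra element 1 keeps the minimum defined if there are none.\<close>
  define E where "E = Min (insert 1 (\<eta> ` {J. J \<subseteq> {..<N} \<and> card J \<ge> CARD('n)}))"
  have E: "E > 0" "\<And>J. J \<subseteq> {..<N} \<Longrightarrow> card J \<ge> CARD('n) \<Longrightarrow> E \<le> \<eta> J"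
    unfolding E_def using \<eta>(1) by (subst Min_gr_iff) (auto intro!: Min_le)
  show ?thesis
  proof (intro exI[of _ E] conjI allI impI E(1))
    fix A :: "real^'n^'n" assume A: "A \<noteq> 0"
    show "card {l. l < N \<and> norm (A *v v l) \<le> E * norm A} < CARD('n)" (is "card ?J < _")
    proof (rule ccontr)
      assume "\<not> ?thesis"
      then have J: "?J \<subseteq> {..<N}" "card ?J \<ge> CARD('n)" by auto
      from \<eta>(2)[OF J A] obtain l where "l \<in> ?J" "norm (A *v v l) > \<eta> ?J * norm A" by blast
      moreover have "E * norm A \<le> \<eta> ?J * norm A" using E(2)[OF J] by (intro mult_right_mono) auto
      ultimately show False by simp
    qed
  qed
qed

section \<open>Powers of a proximal matrix\<close>

text \<open>
  The aim of this section is that the powers of a proximal matrix, divided by suitable scalars, converge to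
  a matrix of rank one. The entries of the powers obey the linear recurrence given by the characteristic
  polynomial, by the Cayley-Hamilton theorem. The strictly largest root therefore dominates them, and the
  columns of the limit are eigenvectors for a simple eigenvalue, hence proportional.
\<close>

definition charmatrix :: "'a::comm_ring_1^'n^'n \<Rightarrow> 'a poly^'n^'n" where
  "charmatrix B = (\<chi> i j. (if i = j then [:0, 1:] else 0) - [:B $ i $ j:])"

text \<open>
  This is a cofactor of \<open>M\<close>. Replacing a row by a coordinate vector, instead of deleting a row and a column,
  keeps the index type unchanged.
\<close>

definition replaced_row_det :: "'a::comm_ring_1^'n^'n \<Rightarrow> 'n \<Rightarrow> 'n \<Rightarrow> 'a" where
  "replaced_row_det M i j = det (\<chi> k. if k = i then axis j 1 else M $ k)"

text \<open>
  Laplace expansion along row \<open>i\<close>. Expanding a different row \<open>k\<close> with these cofactors gives the determinant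
  of a matrix in which row \<open>k\<close> occurs twice.
\<close>

lemma replaced_row_expansion:
  fixes M :: "'a::comm_ring_1^'n^'n"
  shows "(\<Sum>j\<in>UNIV. M $ k $ j * replaced_row_det M i j) = (if k = i then det M else 0)"
proof -
  have "(\<Sum>j\<in>UNIV. M $ k $ j * replaced_row_det M i j) =
      (\<Sum>j\<in>UNIV. det (\<chi> l. if l = i then (M $ k $ j) *s axis j 1 else M $ l))"
    by (simp add: replaced_row_det_def det_row_mul[of i "M $ k $ _" "\<lambda>_. axis _ 1" "\<lambda>l. M $ l"])
  also have "\<dots> = det (\<chi> l. if l = i then (\<Sum>j\<in>UNIV. (M $ k $ j) *s axis j 1) else M $ l)"
    by (rule det_linear_row_sum[symmetric]) simp
  also have "(\<Sum>j\<in>UNIV. (M $ k $ j) *s axis j 1) = M $ k"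
    by (simp add: vec_eq_iff axis_def if_distrib cong: if_cong)
  also have "det (\<chi> l. if l = i then M $ k else M $ l) = (if k = i then det M else 0)"
  proof (cases "k = i")
    case True
    have "(\<chi> l. if l = i then M $ k else M $ l) = M" using True by (simp add: vec_eq_iff)
    then show ?thesis using True by simp
  next
    case False
    then have "det (\<chi> l. if l = i then M $ k else M $ l) = 0"
      by (intro det_identical_rows[OF False]) (auto simp: row_def)
    then show ?thesis using False by simp
  qed
  finally show ?thesis .
qed

text \<open>
  The sequence \<open>p(S) x\<close>, where \<open>S\<close> is the shift \<open>(S x) n = x (n + 1)\<close>. The recurrence with characteristic
  polynomial \<open>p\<close> is \<open>p(S) x = 0\<close>.
\<close>

definition shift_poly :: "'a::comm_ring_1 poly \<Rightarrow> (nat \<Rightarrow> 'a) \<Rightarrow> nat \<Rightarrow> 'a" where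
  "shift_poly p x n = (\<Sum>m\<le>degree p. coeff p m * x (n + m))"

lemma shift_poly_bound: "degree p \<le> N \<Longrightarrow> shift_poly p x n = (\<Sum>m\<le>N. coeff p m * x (n + m))"
  unfolding shift_poly_def by (intro sum.mono_neutral_left) (auto simp: coeff_eq_0)

lemma shift_poly_add: "shift_poly (p + q) x n = shift_poly p x n + shift_poly q x n"
proof -
  define N where "N = max (degree p) (degree q)"
  have "degree (p + q) \<le> N" "degree p \<le> N" "degree q \<le> N"
    by (auto simp: N_def degree_add_le_max)
  then show ?thesis by (simp add: shift_poly_bound[of _ N] sum.distrib distrib_right)
qed

lemma shift_poly_0 [simp]: "shift_poly 0 x n = 0"
  by (simp add: shift_poly_def)

lemma shift_poly_sum: "shift_poly (\<Sum>i\<in>A. p i) x n = (\<Sum>i\<in>A. shift_poly (p i) x n)"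
  by (induction A rule: infinite_finite_induct) (auto simp: shift_poly_add)

lemma shift_poly_smult: "shift_poly (smult a p) x n = a * shift_poly p x n"
proof -
  have "degree (smult a p) \<le> degree p" by (rule degree_smult_le)
  then show ?thesis by (simp add: shift_poly_bound[of _ "degree p"] sum_distrib_left mult.assoc)
qed

lemma shift_poly_pCons: "shift_poly (pCons a p) x n = a * x n + shift_poly p x (Suc n)"
proof -
  have "degree (pCons a p) \<le> Suc (degree p)" by (simp add: degree_pCons_le)
  then have "shift_poly (pCons a p) x n = (\<Sum>m\<le>Suc (degree p). coeff (pCons a p) m * x (n + m))"
    by (rule shift_poly_bound)
  also have "\<dots> = a * x n + (\<Sum>m\<le>degree p. coeff p m * x (Suc n + m))"
    by (subst sum.atMost_Suc_shift) simp
  finally show ?thesis by (simp add: shift_poly_def)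
qed

text \<open>
  Sequences form a module over the polynomials, so a recurrence can be reduced one linear factor of its
  characteristic polynomial at a time.
\<close>

lemma shift_poly_mult: "shift_poly (p * q) x n = shift_poly p (shift_poly q x) n"
  by (induction p arbitrary: n)
     (simp_all add: mult_pCons_left shift_poly_add shift_poly_smult shift_poly_pCons)

lemma shift_poly_linear_fun: "shift_poly p (\<lambda>n. \<Sum>i\<in>A. c i * x i n) n = (\<Sum>i\<in>A. c i * shift_poly p (x i) n)"
  unfolding shift_poly_def
  by (simp add: sum_distrib_left, subst sum.swap, simp add: mult.left_commute)

primrec matrix_pow :: "'a::comm_ring_1^'n^'n \<Rightarrow> nat \<Rightarrow> 'a^'n^'n" where
  "matrix_pow A 0 = mat 1"
| "matrix_pow A (Suc n) = A ** matrix_pow A n"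

lemma matrix_pow_commute: "matrix_pow A n ** A = A ** matrix_pow A n"
  by (induction n) (simp_all flip: matrix_mul_assoc)

text \<open>
  The sequences formed by the entries of row \<open>r\<close> of the powers satisfy a linear system whose matrix is the
  transposed characteristic matrix with the shift in place of the variable. Multiplying this system by
  the cofactors diagonalises it, and the determinant remains on the diagonal.
\<close>

lemma cayley_hamilton_recurrence:
  fixes B :: "'a::comm_ring_1^'n^'n"
  shows "shift_poly (det (charmatrix B)) (\<lambda>n. matrix_pow B n $ r $ i) m = 0"
proof -
  define x where "x j n = matrix_pow B n $ r $ j" for j n
  define C where "C j = replaced_row_det (charmatrix B) i j" for j
  have step: "x j (Suc n) = (\<Sum>k\<in>UNIV. B $ k $ j * x k n)" for j n
  proof -
    have "x j (Suc n) = (matrix_pow B n ** B) $ r $ j" by (simp add: x_def matrix_pow_commute)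
    then show ?thesis by (simp add: matrix_matrix_mult_def x_def mult.commute)
  qed
  have zero: "(\<Sum>k\<in>UNIV. shift_poly (charmatrix B $ k $ j) (x k) n) = 0" for j n
  proof -
    have "shift_poly (charmatrix B $ k $ j) (x k) n = (if k = j then x j (Suc n) else 0) - B $ k $ j * x k n" for k
      by (auto simp: charmatrix_def shift_poly_pCons)
    then show ?thesis by (simp add: sum_subtractf step)
  qed
  have "shift_poly (det (charmatrix B)) (x i) m =
     (\<Sum>k\<in>UNIV. shift_poly (if k = i then det (charmatrix B) else 0) (x k) m)"
    by (simp add: if_distrib[of "\<lambda>p. shift_poly p _ m"] if_distribR cong: if_cong)
  also have "\<dots> = (\<Sum>k\<in>UNIV. \<Sum>j\<in>UNIV. shift_poly (charmatrix B $ k $ j * C j) (x k) m)"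
    by (simp add: replaced_row_expansion[symmetric] shift_poly_sum C_def)
  also have "\<dots> = (\<Sum>j\<in>UNIV. \<Sum>k\<in>UNIV. shift_poly (C j) (shift_poly (charmatrix B $ k $ j) (x k)) m)"
    by (subst sum.swap) (simp add: mult.commute[of "charmatrix B $ _ $ _"] shift_poly_mult)
  also have "\<dots> = (\<Sum>j\<in>UNIV. shift_poly (C j) (\<lambda>n. \<Sum>k\<in>UNIV. 1 * shift_poly (charmatrix B $ k $ j) (x k) n) m)"
    by (subst shift_poly_linear_fun) simp
  also have "\<dots> = 0" using zero by (simp add: shift_poly_def)
  finally show ?thesis by (simp add: x_def[abs_def])
qed

text \<open>
  Splitting off one root \<open>z\<close> leaves \<open>y (n + 1) = z * y n + w n\<close>, where \<open>w\<close> obeys the shorter recurrence; since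
  \<open>cmod z < r\<close>, the growth rate \<open>r\<close> of \<open>w\<close> passes to \<open>y\<close>.
\<close>

lemma recurrence_growth:
  fixes y :: "nat \<Rightarrow> complex"
  assumes "\<And>n. shift_poly (\<Prod>z\<in>#Z. [:-z, 1:]) y n = 0" "\<And>z. z \<in># Z \<Longrightarrow> cmod z < r" "r > 0"
  shows "\<exists>K. \<forall>n. cmod (y n) \<le> K * r ^ n"
  using assms(1,2)
proof (induction Z arbitrary: y)
  case empty
  then have "y n = 0" for n by (simp add: one_pCons shift_poly_pCons)
  then show ?case by (intro exI[of _ 0]) simp
next
  case (add z Z)
  define w where "w = shift_poly [:-z, 1:] y"
  have "shift_poly (\<Prod>z\<in>#Z. [:-z, 1:]) w n = 0" for n
    using add.prems(1)[of n] unfolding w_def by (simp add: shift_poly_mult[symmetric] mult.commute)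
  then obtain K where K: "\<And>n. cmod (w n) \<le> K * r ^ n" using add.IH[of w] add.prems(2) by auto
  define K' where "K' = max (cmod (y 0)) (K / (r - cmod z))"
  have z: "cmod z < r" using add.prems(2) by simp
  have K': "cmod (y 0) \<le> K'" "K \<le> K' * (r - cmod z)"
    using z by (auto simp: K'_def pos_divide_le_eq[symmetric])
  have "cmod (y n) \<le> K' * r ^ n" for n
  proof (induction n)
    case (Suc n)
    have "y (Suc n) = w n + z * y n" by (simp add: w_def shift_poly_pCons)
    then have "cmod (y (Suc n)) \<le> K * r ^ n + cmod z * (K' * r ^ n)"
      using K[of n] mult_left_mono[OF Suc, of "cmod z"] norm_triangle_ineq[of "w n" "z * y n"]
      by (simp add: norm_mult)
    also have "\<dots> \<le> (K' * (r - cmod z)) * r ^ n + cmod z * (K' * r ^ n)"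
      using K'(2) \<open>r > 0\<close> by (intro add_right_mono mult_right_mono) auto
    also have "\<dots> = K' * r ^ Suc n" by (simp add: algebra_simps)
    finally show ?case .
  qed (use K' in simp)
  then show ?case by blast
qed

text \<open>
  The differences of consecutive terms of \<open>x n / l ^ n\<close> are, up to a constant factor, a sequence without the
  root \<open>l\<close> divided by \<open>l ^ n\<close>. They decay geometrically, so the series of differences converges.
\<close>

lemma dominant_root_limit:
  fixes x :: "nat \<Rightarrow> complex"
  assumes rec: "\<And>n. shift_poly ([:-l, 1:] * (\<Prod>z\<in>#Z. [:-z, 1:])) x n = 0"
    and dom: "\<And>z. z \<in># Z \<Longrightarrow> cmod z < cmod l" and l: "l \<noteq> 0"
  shows "\<exists>L. (\<lambda>n. x n / l ^ n) \<longlonglongrightarrow> L"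
proof -
  define y where "y = shift_poly [:-l, 1:] x"
  have y: "y n = x (Suc n) - l * x n" for n by (simp add: y_def shift_poly_pCons)
  \<comment> \<open>Any \<open>r\<close> strictly between the moduli of the other roots and that of \<open>l\<close> serves as a growth rate.\<close>
  define m where "m = Max (insert 0 (cmod ` set_mset Z))"
  define r where "r = (m + cmod l) / 2"
  have m: "m < cmod l" "0 \<le> m" "\<And>z. z \<in># Z \<Longrightarrow> cmod z \<le> m" using dom l by (auto simp: m_def)
  then have r: "r > 0" "r < cmod l" "\<And>z. z \<in># Z \<Longrightarrow> cmod z < r" by (force simp: r_def)+
  have "shift_poly (\<Prod>z\<in>#Z. [:-z, 1:]) y n = 0" for n
    using rec[of n] unfolding y_def by (simp add: shift_poly_mult[symmetric] mult.commute)
  then obtain K where K: "\<And>n. cmod (y n) \<le> K * r ^ n" using recurrence_growth[of Z y r] r by auto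
  define t where "t n = x n / l ^ n" for n
  have diff: "t (Suc n) - t n = y n / l ^ Suc n" for n
    using l by (simp add: t_def y field_simps)
  have "summable (\<lambda>n. (K / cmod l) * (r / cmod l) ^ n)"
    using r l by (intro summable_mult summable_geometric) (simp add: divide_less_eq)
  then have "summable (\<lambda>n. t (Suc n) - t n)"
  proof (rule summable_comparison_test')
    fix n :: nat
    have "norm (t (Suc n) - t n) = cmod (y n) / cmod l ^ Suc n" by (simp add: diff norm_divide norm_power norm_mult)
    also have "\<dots> \<le> K * r ^ n / cmod l ^ Suc n" using K l by (intro divide_right_mono) auto
    finally show "norm (t (Suc n) - t n) \<le> (K / cmod l) * (r / cmod l) ^ n"
      by (simp add: power_divide)
  qed
  then have "(\<lambda>n. \<Sum>i<n. t (Suc i) - t i) \<longlonglongrightarrow> (\<Sum>n. t (Suc n) - t n)" by (rule summable_LIMSEQ)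
  then have "(\<lambda>n. (t n - t 0) + t 0) \<longlonglongrightarrow> (\<Sum>n. t (Suc n) - t n) + t 0"
    unfolding sum_lessThan_telescope by (intro tendsto_intros)
  then show ?thesis by (auto simp: t_def)
qed

lemma poly_det: "poly (det M) a = det (\<chi> i j. poly (M $ i $ j) (a :: 'a::comm_ring_1))"
  by (simp add: det_def poly_sum poly_prod)

lemma eigenvector_exists:
  fixes B :: "'a::field^'n^'n"
  assumes "poly (det (charmatrix B)) l = 0"
  shows "\<exists>v. v \<noteq> 0 \<and> B *v v = l *s v"
proof -
  let ?E = "(\<chi> i j. poly (charmatrix B $ i $ j) l)"
  have "det ?E = 0" using assms by (simp add: poly_det)
  then have "\<not> invertible ?E" by (simp add: invertible_det_nz)
  then obtain v where v: "v \<noteq> 0" "?E *v v = 0"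
    by (auto simp: invertible_left_inverse matrix_left_invertible_ker)
  have "(?E *v v) $ i = l * v $ i - (B *v v) $ i" for i
  proof -
    have "(?E *v v) $ i = (\<Sum>j\<in>UNIV. (if i = j then l * v $ j else 0) - B $ i $ j * v $ j)"
      by (auto simp: matrix_vector_mult_def charmatrix_def left_diff_distrib intro!: sum.cong)
    then show ?thesis by (simp add: sum_subtractf matrix_vector_mult_def)
  qed
  then show ?thesis using v by (auto simp: vec_eq_iff)
qed

text \<open>
  Two independent eigenvectors make \<open>l\<close> a multiple root: after completion to an invertible constant matrix
  \<open>P\<close>, the two corresponding rows of the product with the transposed characteristic matrix are divisible by
  \<open>[:- l, 1:]\<close>. The normal form of the eigenvectors at the coordinates \<open>i\<close> and \<open>j\<close> makes the completion
  explicit: the other rows of \<open>P\<close> are coordinate vectors.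
\<close>

lemma simple_root_eigenspace:
  fixes B :: "'a::field^'n^'n"
  assumes simple: "order l (det (charmatrix B)) \<le> 1" and nz: "det (charmatrix B) \<noteq> 0"
    and u: "B *v u = l *s u" "B *v w = l *s w" and "i \<noteq> j"
    and coord: "u $ i = 1" "u $ j = 0" "w $ i = 0" "w $ j = 1"
  shows False
proof -
  define R where "R k = (if k = i then u else if k = j then w else axis k 1)" for k
  define lift where "lift v = (\<chi> m. [:v $ m:])" for v :: "'a^'n"
  define P where "P = (\<chi> k. lift (R k))"
  have prod_row: "(P ** transpose (charmatrix B)) $ k = (\<chi> m. [:0, 1:] * [:R k $ m:] - [:(B *v R k) $ m:])" for k
  proof (rule vec_eq_iff[THEN iffD2], intro allI)
    fix m
    have "(P ** transpose (charmatrix B)) $ k $ m =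
      (\<Sum>t\<in>UNIV. (if m = t then [:0, 1:] * [:R k $ t:] else 0) - [:B $ m $ t * R k $ t:])"
      unfolding matrix_matrix_mult_def
      by (auto simp: P_def lift_def transpose_def charmatrix_def left_diff_distrib algebra_simps intro!: sum.cong)
    also have "\<dots> = [:0, 1:] * [:R k $ m:] - (\<Sum>t\<in>UNIV. [:B $ m $ t * R k $ t:])"
      by (simp add: sum_subtractf)
    also have "(\<Sum>t\<in>UNIV. [:B $ m $ t * R k $ t:]) = [:\<Sum>t\<in>UNIV. B $ m $ t * R k $ t:]"
      by (induction rule: infinite_finite_induct[of _ UNIV]) simp_all
    finally show "(P ** transpose (charmatrix B)) $ k $ m = (\<chi> m. [:0, 1:] * [:R k $ m:] - [:(B *v R k) $ m:]) $ m"
      by (simp add: matrix_vector_mult_def)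
  qed
  define rest where "rest k = (P ** transpose (charmatrix B)) $ k" for k
  have row_eig: "rest k = [:-l, 1:] *s lift (R k)" if "k = i \<or> k = j" for k
    using that u \<open>i \<noteq> j\<close> by (auto simp: rest_def prod_row R_def lift_def vec_eq_iff)
  have "det P * det (charmatrix B) = det (P ** transpose (charmatrix B))" by (simp add: det_mul)
  also have "P ** transpose (charmatrix B) =
      (\<chi> k. if k = i then [:-l, 1:] *s lift u else (if k = j then [:-l, 1:] *s lift w else rest k))"
    using row_eig[of i] row_eig[of j] \<open>i \<noteq> j\<close> by (auto simp: vec_eq_iff rest_def R_def)
  also have "det \<dots> = [:-l, 1:] * det (\<chi> k. if k = j then [:-l, 1:] *s lift w else (if k = i then lift u else rest k))"
    by (subst det_row_mul) (intro arg_cong2[where f="(*)"] arg_cong[where f=det] refl, use \<open>i \<noteq> j\<close> in \<open>auto simp: vec_eq_iff\<close>)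
  also have "\<dots> = [:-l, 1:] ^ 2 * det (\<chi> k. if k = j then lift w else (if k = i then lift u else rest k))"
    by (subst det_row_mul) (simp only: power2_eq_square mult.assoc)
  finally have dvd: "[:-l, 1:] ^ 2 dvd det P * det (charmatrix B)" by (rule dvdI)
  have "det (\<chi> k. R k) \<noteq> 0"
  proof -
    have "x = 0" if x: "(\<chi> k. R k) *v x = 0" for x
    proof -
      have row: "(\<Sum>m\<in>UNIV. R k $ m * x $ m) = 0" for k
        using arg_cong[OF x, of "\<lambda>z. z $ k"] by (simp add: matrix_vector_mult_def)
      have other: "x $ k = 0" if "k \<noteq> i" "k \<noteq> j" for k
        using row[of k] that by (simp add: R_def axis_def if_distrib[of "\<lambda>c. c * _"] cong: if_cong)
      have "R i $ m * x $ m = (if m = i then x $ m else 0)" for m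
        using other[of m] coord by (cases "m = i"; cases "m = j") (auto simp: R_def)
      then have "x $ i = 0" using row[of i] by simp
      have "R j $ m * x $ m = (if m = j then x $ m else 0)" for m
        using other[of m] coord \<open>i \<noteq> j\<close> by (cases "m = i"; cases "m = j") (auto simp: R_def)
      then have "x $ j = 0" using row[of j] by simp
      with \<open>x $ i = 0\<close> other show "x = 0" by (metis vec_eq_iff zero_index)
    qed
    then show ?thesis
      by (simp add: invertible_det_nz[symmetric] invertible_left_inverse matrix_left_invertible_ker)
  qed
  moreover have "poly (det P) l = det (\<chi> k. R k)"
    unfolding poly_det by (rule arg_cong[where f=det]) (simp add: vec_eq_iff P_def lift_def)
  ultimately have P: "poly (det P) l \<noteq> 0" by simp
  then have "det P * det (charmatrix B) \<noteq> 0" using nz by auto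
  then have "2 \<le> order l (det P) + order l (det (charmatrix B))"
    using dvd by (simp add: order_divides order_mult)
  then show False using simple order_0I[OF P] by simp
qed

text \<open>
  The dominant eigenvalue \<open>l\<close> is the limit of quotients of consecutive values of a real sequence, hence
  real. The limit \<open>pr\<close> of the powers divided by \<open>l ^ n\<close> fixes an eigenvector, so it is not zero, and all its
  columns are eigenvectors. Since the eigenspace is a line, the limit has rank one.
\<close>

lemma proximal_limit:
  fixes A :: "real^'n^'n"
  assumes "proximal A"
  shows "\<exists>a v \<phi>. (\<forall>n. a n \<noteq> 0) \<and> v \<noteq> 0 \<and> \<phi> \<noteq> 0 \<and>
     (\<lambda>n. (1 / a n) *\<^sub>R matrix_pow A n) \<longlonglongrightarrow> (\<chi> i j. v $ i * \<phi> $ j)"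
proof -
  define B where "B = (\<chi> i j. complex_of_real (A $ i $ j))"
  define p where "p = det (charmatrix B)"
  have p: "complex_charpoly A = p"
    by (simp add: complex_charpoly_def p_def charmatrix_def B_def)
  obtain l where inv: "invertible A" and l: "l \<in># proots p" and dom: "\<And>z. z \<in># proots p - {#l#} \<Longrightarrow> cmod z < cmod l"
    using assms unfolding proximal_def p by blast
  have p0: "p \<noteq> 0" using l by auto
  have root: "poly p l = 0" using l p0 by simp
  have "l \<notin># proots p - {#l#}" using dom[of l] by auto
  then have "order l p \<le> 1" using p0 by (auto simp: not_in_iff)
  note simple = simple_root_eigenspace[of l B, folded p_def, OF this p0]
  obtain V where V: "V \<noteq> 0" "B *v V = l *s V" using eigenvector_exists[of B l] root by (auto simp: p_def)
  have powB: "matrix_pow B n $ i $ j = of_real (matrix_pow A n $ i $ j)" for n i j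
    by (induction n arbitrary: i j) (auto simp: B_def mat_def matrix_matrix_mult_def)
  have powV: "matrix_pow B n *v V = l ^ n *s V" for n
    by (induction n) (simp_all add: V vector_scalar_commute flip: matrix_vector_mul_assoc)
  have l0: "l \<noteq> 0"
  proof
    assume "l = 0"
    then have BV: "B *v V = 0" using V by simp
    have "A *v (\<chi> i. Re (V $ i)) = 0" "A *v (\<chi> i. Im (V $ i)) = 0"
      using arg_cong[OF BV, of "\<lambda>z. Re (z $ _)"] arg_cong[OF BV, of "\<lambda>z. Im (z $ _)"]
      by (auto simp: vec_eq_iff matrix_vector_mult_def B_def)
    then have "(\<chi> i. Re (V $ i)) = 0" "(\<chi> i. Im (V $ i)) = 0" using inv by simp_all
    then show False using V(1) by (simp add: vec_eq_iff complex_eq_iff)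
  qed
  define Z where "Z = proots p - {#l#}"
  have "smult (lead_coeff p) (\<Prod>z\<in>#proots p. [:-z, 1:]) = p" by (rule complex_poly_decompose_multiset)
  then have decomp: "p = smult (lead_coeff p) ([:-l, 1:] * (\<Prod>z\<in>#Z. [:-z, 1:]))"
    using l unfolding Z_def by (metis (no_types, lifting) image_mset_add_mset insert_DiffM prod_mset.add_mset)
  have "\<exists>L. (\<lambda>n. matrix_pow B n $ r $ i / l ^ n) \<longlonglongrightarrow> L" for r i
  proof (rule dominant_root_limit[of l Z])
    fix n
    have "shift_poly p (\<lambda>n. matrix_pow B n $ r $ i) n = 0"
      unfolding p_def by (rule cayley_hamilton_recurrence)
    then show "shift_poly ([:-l, 1:] * (\<Prod>z\<in>#Z. [:-z, 1:])) (\<lambda>n. matrix_pow B n $ r $ i) n = 0"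
      using p0 by (subst (asm) decomp) (simp only: shift_poly_smult mult_eq_0_iff leading_coeff_0_iff, simp)
  qed (use dom l0 in \<open>auto simp: Z_def\<close>)
  then obtain Lim where Lim: "\<And>r i. (\<lambda>n. matrix_pow B n $ r $ i / l ^ n) \<longlonglongrightarrow> Lim r i" by metis
  have Lim_V: "(\<Sum>i\<in>UNIV. Lim r i * V $ i) = V $ r" for r
  proof (rule LIMSEQ_unique)
    show "(\<lambda>n. \<Sum>i\<in>UNIV. matrix_pow B n $ r $ i / l ^ n * V $ i) \<longlonglongrightarrow> (\<Sum>i\<in>UNIV. Lim r i * V $ i)"
      by (intro tendsto_intros Lim)
    have "(\<Sum>i\<in>UNIV. matrix_pow B n $ r $ i / l ^ n * V $ i) = V $ r" for n
    proof -
      have "(\<Sum>i\<in>UNIV. matrix_pow B n $ r $ i / l ^ n * V $ i) = (matrix_pow B n *v V) $ r / l ^ n"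
        by (simp add: matrix_vector_mult_def sum_divide_distrib)
      then show ?thesis using l0 by (simp add: powV)
    qed
    then show "(\<lambda>n. \<Sum>i\<in>UNIV. matrix_pow B n $ r $ i / l ^ n * V $ i) \<longlonglongrightarrow> V $ r" by simp
  qed
  obtain r0 where "V $ r0 \<noteq> 0" using V(1) by (auto simp: vec_eq_iff)
  have "\<exists>i. Lim r0 i \<noteq> 0"
  proof (rule ccontr)
    assume "\<not> ?thesis"
    then show False using Lim_V[of r0] \<open>V $ r0 \<noteq> 0\<close> by simp
  qed
  then obtain i0 where nz: "Lim r0 i0 \<noteq> 0" by blast
  have "(\<lambda>n. (matrix_pow B (Suc n) $ r0 $ i0 / l ^ Suc n) / (matrix_pow B n $ r0 $ i0 / l ^ n) * l) \<longlonglongrightarrow> Lim r0 i0 / Lim r0 i0 * l"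
    by (intro tendsto_intros Lim LIMSEQ_Suc[OF Lim] nz)
  moreover have "(matrix_pow B (Suc n) $ r0 $ i0 / l ^ Suc n) / (matrix_pow B n $ r0 $ i0 / l ^ n) * l
      = of_real (matrix_pow A (Suc n) $ r0 $ i0 / matrix_pow A n $ r0 $ i0)" for n
    using l0 unfolding powB by (simp add: field_simps)
  ultimately have "(\<lambda>n. complex_of_real (matrix_pow A (Suc n) $ r0 $ i0 / matrix_pow A n $ r0 $ i0)) \<longlonglongrightarrow> l"
    using nz by simp
  then have "l \<in> \<real>"
    by (rule Lim_in_closed_set[OF closed_complex_Reals _ sequentially_bot, rotated]) auto
  then obtain \<kappa> where \<kappa>: "l = of_real \<kappa>" by (auto elim: Reals_cases)
  have \<kappa>0: "\<kappa> \<noteq> 0" using l0 \<kappa> by simp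
  define pr where "pr = (\<chi> r i. Re (Lim r i))"
  have lim: "(\<lambda>n. (1 / \<kappa> ^ n) *\<^sub>R matrix_pow A n) \<longlonglongrightarrow> pr"
  proof (intro vec_tendstoI)
    fix r i
    have "(\<lambda>n. Re (matrix_pow B n $ r $ i / l ^ n)) \<longlonglongrightarrow> Re (Lim r i)" by (intro tendsto_intros Lim)
    then show "(\<lambda>n. ((1 / \<kappa> ^ n) *\<^sub>R matrix_pow A n) $ r $ i) \<longlonglongrightarrow> pr $ r $ i"
      by (simp add: powB \<kappa> pr_def flip: of_real_power of_real_divide)
  qed
  have Lim_pr: "Lim r i = of_real (pr $ r $ i)" for r i
  proof (rule LIMSEQ_unique[OF Lim])
    have "(\<lambda>n. of_real (((1 / \<kappa> ^ n) *\<^sub>R matrix_pow A n) $ r $ i)) \<longlonglongrightarrow> complex_of_real (pr $ r $ i)"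
      by (intro tendsto_intros lim)
    then show "(\<lambda>n. matrix_pow B n $ r $ i / l ^ n) \<longlonglongrightarrow> of_real (pr $ r $ i)"
      by (simp add: powB \<kappa>)
  qed
  have A_pr: "A ** pr = \<kappa> *\<^sub>R pr"
  proof (rule LIMSEQ_unique)
    show "(\<lambda>n. A ** ((1 / \<kappa> ^ n) *\<^sub>R matrix_pow A n)) \<longlonglongrightarrow> A ** pr" by (intro tendsto_intros lim)
    have "A ** ((1 / \<kappa> ^ n) *\<^sub>R matrix_pow A n) = \<kappa> *\<^sub>R ((1 / \<kappa> ^ Suc n) *\<^sub>R matrix_pow A (Suc n))" for n
      using \<kappa>0 by (simp add: matrix_eq matrix_vector_mult_scaleR scaleR_matrix_vector_assoc[symmetric] flip: matrix_vector_mul_assoc)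
    then show "(\<lambda>n. A ** ((1 / \<kappa> ^ n) *\<^sub>R matrix_pow A n)) \<longlonglongrightarrow> \<kappa> *\<^sub>R pr"
      by (simp only:) (intro tendsto_intros LIMSEQ_Suc[OF lim])
  qed
  define eig where "eig x \<longleftrightarrow> A *v x = \<kappa> *\<^sub>R x" for x
  have eig_col: "eig (column i pr)" for i
    unfolding eig_def using A_pr by (metis matrix_vector_mul_assoc matrix_vector_mult_basis scaleR_matrix_vector_assoc)
  have eig_lin: "eig (a *\<^sub>R x + b *\<^sub>R y)" if "eig x" "eig y" for a b x y
    using that by (simp add: eig_def matrix_vector_right_distrib matrix_vector_mult_scaleR algebra_simps)
  define v where "v = column i0 pr"
  have v: "eig v" "v \<noteq> 0" using eig_col nz Lim_pr by (auto simp: v_def column_def vec_eq_iff)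
  then obtain i where i: "v $ i \<noteq> 0" by (auto simp: vec_eq_iff)
  have multiple: "w = (w $ i / v $ i) *\<^sub>R v" if w: "eig w" for w
  proof (rule ccontr)
    assume ne: "w \<noteq> (w $ i / v $ i) *\<^sub>R v"
    define w1 where "w1 = 1 *\<^sub>R w + (- (w $ i / v $ i)) *\<^sub>R v"
    have w1: "eig w1" "w1 $ i = 0" "w1 \<noteq> 0"
      unfolding w1_def by (rule eig_lin[OF w v(1)]) (use i ne in simp_all)
    then obtain j where j: "w1 $ j \<noteq> 0" by (auto simp: vec_eq_iff)
    define w2 where "w2 = (1 / w1 $ j) *\<^sub>R w1 + 0 *\<^sub>R w1"
    have w2: "eig w2" "w2 $ i = 0" "w2 $ j = 1"
      unfolding w2_def by (rule eig_lin[OF w1(1) w1(1)]) (use w1 j in simp_all)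
    define u where "u = (1 / v $ i) *\<^sub>R v + (- (v $ j / v $ i)) *\<^sub>R w2"
    have u: "eig u" "u $ i = 1" "u $ j = 0"
      unfolding u_def by (rule eig_lin[OF v(1) w2(1)]) (use w2 i in simp_all)
    have cx: "B *v (\<chi> i. of_real (x $ i)) = l *s (\<chi> i. of_real (x $ i))" if "eig x" for x
      using that by (auto simp: eig_def vec_eq_iff matrix_vector_mult_def B_def \<kappa> simp flip: of_real_mult of_real_sum)
    show False
      by (rule simple[OF cx[OF u(1)] cx[OF w2(1)], of i j]) (use u w2 in auto)
  qed
  define \<phi> where "\<phi> = (\<chi> k. column k pr $ i / v $ i)"
  have "pr $ r $ k = v $ r * \<phi> $ k" for r k
    using arg_cong[OF multiple[OF eig_col[of k]], of "\<lambda>z. z $ r"] by (simp add: \<phi>_def column_def)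
  then have pr: "pr = (\<chi> r k. v $ r * \<phi> $ k)" by (simp add: vec_eq_iff)
  have "\<phi> \<noteq> 0" using nz Lim_pr[of r0 i0] by (auto simp: pr)
  show ?thesis
    by (rule exI[of _ "\<lambda>n. \<kappa> ^ n"]) (use lim \<kappa>0 v(2) \<open>\<phi> \<noteq> 0\<close> in \<open>auto simp: pr\<close>)
qed

section \<open>Synchronous words with prescribed ratios\<close>

primrec set_power :: "(real^'n^'n) set \<Rightarrow> nat \<Rightarrow> (real^'n^'n) set" where
  "set_power T 0 = {mat 1}"
| "set_power T (Suc k) = {h ** t | h t. h \<in> set_power T k \<and> t \<in> T}"

lemma set_power_mult: "g \<in> set_power T i \<Longrightarrow> h \<in> set_power T j \<Longrightarrow> g ** h \<in> set_power T (i + j)"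
proof (induction j arbitrary: h)
  case (Suc j)
  then obtain h' t where "h = h' ** t" "h' \<in> set_power T j" "t \<in> T" by auto
  moreover have "g ** h' \<in> set_power T (i + j)" using Suc calculation by blast
  ultimately show ?case by (auto simp: matrix_mul_assoc)
qed simp

lemma semigroup_generated_set_power:
  "g \<in> semigroup_generated T \<Longrightarrow> \<exists>k. g \<in> set_power T k"
proof (induction rule: semigroup_generated.induct)
  case (gen g)
  then have "g \<in> set_power T (Suc 0)" by (force intro!: exI[of _ "mat 1"])
  then show ?case by blast
qed (blast intro: set_power_mult)

definition outer :: "real^'n \<Rightarrow> real^'n \<Rightarrow> real^'n^'n" where
  "outer v \<phi> = (\<chi> i j. v $ i * \<phi> $ j)"

lemma outer_mult_vector: "outer v \<phi> *v x = (\<phi> \<bullet> x) *\<^sub>R v"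
  by (simp add: outer_def vec_eq_iff matrix_vector_mult_def inner_vec_def sum_distrib_left mult_ac)

lemma outer_sandwich:
  "(\<alpha> *\<^sub>R outer v \<phi>) ** s ** (\<beta> *\<^sub>R outer v \<phi>) = (\<alpha> * \<beta> * (\<phi> \<bullet> (s *v v))) *\<^sub>R outer v \<phi>"
  by (simp add: matrix_eq outer_mult_vector scaleR_matrix_vector_assoc[symmetric] matrix_vector_mult_scaleR
      flip: matrix_vector_mul_assoc)

text \<open>
  Every element of \<open>G\<close> is a word in \<open>T\<close>, and \<open>outer v \<phi>\<close> is a limit of rescaled elements of \<open>G\<close>. The limit
  replaces a proximal element of \<open>G\<close>: in the application the proximal matrix may lie only in the closure of \<open>G\<close>.
\<close>

locale contracting_semigroup = irreducible_semigroup G for G :: "(real^'n^'n) set" +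
  fixes T :: "(real^'n^'n) set" and h :: "nat \<Rightarrow> real^'n^'n" and a :: "nat \<Rightarrow> real" and v \<phi> :: "real^'n"
  assumes word: "g \<in> G \<Longrightarrow> \<exists>k. g \<in> set_power T k"
    and h_in: "h n \<in> G" and a_nz: "a n \<noteq> 0"
    and h_lim: "(\<lambda>n. (1 / a n) *\<^sub>R h n) \<longlonglongrightarrow> outer v \<phi>"
    and v_nz: "v \<noteq> 0" and \<phi>_nz: "\<phi> \<noteq> 0"
    and card: "CARD('n) > 1"
begin

abbreviation pairing :: "real^'n^'n \<Rightarrow> real" where "pairing s \<equiv> \<phi> \<bullet> (s *v v)"

text \<open>
  Two sequences of words of equal length, rescaled by the same scalars, converge to multiples of the same
  matrix of rank one, and \<open>r\<close> is the quotient of the multipliers. The equal lengths are essential: they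
  allow the two words to be followed by the random walk during the same time. The set of ratios is a
  multiplicative group, and the aim is that it is dense; this is the non-arithmeticity behind the theorem.
\<close>

definition ratio :: "real \<Rightarrow> bool" where
  "ratio r \<longleftrightarrow> (\<exists>(k :: nat \<Rightarrow> nat) g g' (b :: nat \<Rightarrow> real) \<alpha> \<beta>.
     (\<forall>n. g n \<in> set_power T (k n) \<and> g' n \<in> set_power T (k n) \<and> b n \<noteq> 0) \<and>
     (\<lambda>n. (1 / b n) *\<^sub>R g n) \<longlonglongrightarrow> \<alpha> *\<^sub>R outer v \<phi> \<and>
     (\<lambda>n. (1 / b n) *\<^sub>R g' n) \<longlonglongrightarrow> \<beta> *\<^sub>R outer v \<phi> \<and>
     \<alpha> \<noteq> 0 \<and> \<beta> \<noteq> 0 \<and> r = \<bar>\<alpha> / \<beta>\<bar>)"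

lemma ratio_inverse: "ratio r \<Longrightarrow> ratio (1 / r)"
proof -
  assume "ratio r"
  then obtain k g g' b \<alpha> \<beta> where 1: "\<And>n. g n \<in> set_power T (k n)" "\<And>n. g' n \<in> set_power T (k n)" "\<And>n::nat. b n \<noteq> (0::real)"
     "(\<lambda>n. (1 / b n) *\<^sub>R g n) \<longlonglongrightarrow> \<alpha> *\<^sub>R outer v \<phi>"
     "(\<lambda>n. (1 / b n) *\<^sub>R g' n) \<longlonglongrightarrow> \<beta> *\<^sub>R outer v \<phi>"
     "\<alpha> \<noteq> 0" "\<beta> \<noteq> 0" "r = \<bar>\<alpha> / \<beta>\<bar>" unfolding ratio_def by blast
  then show "ratio (1 / r)"
    unfolding ratio_def
    by (intro exI[of _ k] exI[of _ g'] exI[of _ g] exI[of _ b] exI[of _ \<beta>] exI[of _ \<alpha>]) simp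
qed

text \<open>
  Limits of rank one multiply like scalars, up to the pairing with the connecting word.
\<close>

lemma sandwich_limit:
  assumes "(\<lambda>n. (1 / b n) *\<^sub>R g n) \<longlonglongrightarrow> \<alpha> *\<^sub>R outer v \<phi>" "(\<lambda>n. (1 / b' n) *\<^sub>R g' n) \<longlonglongrightarrow> \<beta> *\<^sub>R outer v \<phi>"
  shows "(\<lambda>n. (1 / (b n * b' n)) *\<^sub>R (g n ** s ** g' n)) \<longlonglongrightarrow> (\<alpha> * \<beta> * pairing s) *\<^sub>R outer v \<phi>"
proof -
  have "(\<lambda>n. ((1 / b n) *\<^sub>R g n) ** s ** ((1 / b' n) *\<^sub>R g' n)) \<longlonglongrightarrow>
      (\<alpha> *\<^sub>R outer v \<phi>) ** s ** (\<beta> *\<^sub>R outer v \<phi>)"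
    by (intro tendsto_intros assms)
  moreover have "((1 / b n) *\<^sub>R g n) ** s ** ((1 / b' n) *\<^sub>R g' n) = (1 / (b n * b' n)) *\<^sub>R (g n ** s ** g' n)" for n
    by (simp add: matrix_eq scaleR_matrix_vector_assoc[symmetric] matrix_vector_mult_scaleR
      flip: matrix_vector_mul_assoc)
  ultimately show ?thesis unfolding outer_sandwich by simp
qed

lemma pairing_nonzero_exists: "\<exists>s\<in>G. pairing s \<noteq> 0"
  using simultaneous_nonvanishing[OF \<phi>_nz v_nz v_nz] by blast

text \<open>
  Concatenating the words through one and the same connecting word \<open>s\<close> keeps their lengths equal and
  multiplies the ratios.
\<close>

lemma ratio_mult:
  assumes "ratio r" "ratio q" shows "ratio (r * q)"
proof -
  obtain s where s: "s \<in> G" "pairing s \<noteq> 0" using pairing_nonzero_exists by blast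
  obtain j where j: "s \<in> set_power T j" using word s by blast
  obtain k g1 g1' b \<alpha> \<beta> where 1: "\<And>n. g1 n \<in> set_power T (k n)" "\<And>n. g1' n \<in> set_power T (k n)" "\<And>n::nat. b n \<noteq> (0::real)"
     "(\<lambda>n. (1 / b n) *\<^sub>R g1 n) \<longlonglongrightarrow> \<alpha> *\<^sub>R outer v \<phi>"
     "(\<lambda>n. (1 / b n) *\<^sub>R g1' n) \<longlonglongrightarrow> \<beta> *\<^sub>R outer v \<phi>"
     "\<alpha> \<noteq> 0" "\<beta> \<noteq> 0" "r = \<bar>\<alpha> / \<beta>\<bar>" using assms(1) unfolding ratio_def by blast
  obtain k2 g2 g2' b2 \<alpha>2 \<beta>2 where 2: "\<And>n. g2 n \<in> set_power T (k2 n)" "\<And>n. g2' n \<in> set_power T (k2 n)" "\<And>n::nat. b2 n \<noteq> (0::real)"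
     "(\<lambda>n. (1 / b2 n) *\<^sub>R g2 n) \<longlonglongrightarrow> \<alpha>2 *\<^sub>R outer v \<phi>"
     "(\<lambda>n. (1 / b2 n) *\<^sub>R g2' n) \<longlonglongrightarrow> \<beta>2 *\<^sub>R outer v \<phi>"
     "\<alpha>2 \<noteq> 0" "\<beta>2 \<noteq> 0" "q = \<bar>\<alpha>2 / \<beta>2\<bar>" using assms(2) unfolding ratio_def by blast
  show ?thesis unfolding ratio_def
  proof (intro exI conjI allI)
    show "g1 n ** s ** g2 n \<in> set_power T (k n + j + k2 n)" for n
      using 1 2 j by (blast intro: set_power_mult)
    show "g1' n ** s ** g2' n \<in> set_power T (k n + j + k2 n)" for n
      using 1 2 j by (blast intro: set_power_mult)
    show "(\<lambda>n. (1 / (b n * b2 n)) *\<^sub>R (g1 n ** s ** g2 n)) \<longlonglongrightarrow> (\<alpha> * \<alpha>2 * pairing s) *\<^sub>R outer v \<phi>"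
      by (rule sandwich_limit[OF 1(4) 2(4)])
    show "(\<lambda>n. (1 / (b n * b2 n)) *\<^sub>R (g1' n ** s ** g2' n)) \<longlonglongrightarrow> (\<beta> * \<beta>2 * pairing s) *\<^sub>R outer v \<phi>"
      by (rule sandwich_limit[OF 1(5) 2(5)])
    show "r * q = \<bar>\<alpha> * \<alpha>2 * pairing s / (\<beta> * \<beta>2 * pairing s)\<bar>"
      using s(2) unfolding 1(8) 2(8) by (simp add: abs_mult)
  qed (use 1 2 s in auto)
qed

lemma ratio_power: "ratio r \<Longrightarrow> ratio (r ^ Suc k)"
  by (induction k) (auto intro: ratio_mult)

lemma h_lim': "(\<lambda>n. (1 / a n) *\<^sub>R h n) \<longlonglongrightarrow> 1 *\<^sub>R outer v \<phi>"
  using h_lim by simp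

text \<open>
  The words \<open>h s1 h s2 h\<close> and \<open>h s1' h s2' h\<close> have equal length as soon as the total lengths of the inserted
  words agree, even if the single lengths differ.
\<close>

lemma ratio_pair:
  assumes len: "s1 \<in> set_power T i" "s2 \<in> set_power T j" "s1' \<in> set_power T i'" "s2' \<in> set_power T j'" "i + j = i' + j'"
    and nz: "pairing s1 \<noteq> 0" "pairing s2 \<noteq> 0" "pairing s1' \<noteq> 0" "pairing s2' \<noteq> 0"
  shows "ratio \<bar>pairing s1 * pairing s2 / (pairing s1' * pairing s2')\<bar>"
proof -
  have "\<exists>m. \<forall>n. h n \<in> set_power T (m n)" using word[OF h_in] by metis
  then obtain m where m: "\<And>n. h n \<in> set_power T (m n)" by blast
  show ?thesis unfolding ratio_def
  proof (intro exI conjI allI)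
    fix n
    have eq: "m n + i + m n + j + m n = m n + i' + m n + j' + m n" using len by simp
    show "h n ** s1 ** h n ** s2 ** h n \<in> set_power T (m n + i + m n + j + m n)"
      using m len by (blast intro: set_power_mult)
    show "h n ** s1' ** h n ** s2' ** h n \<in> set_power T (m n + i + m n + j + m n)"
      unfolding eq using m len by (blast intro: set_power_mult)
  next
    show "(\<lambda>n. (1 / (a n * a n * a n)) *\<^sub>R (h n ** s1 ** h n ** s2 ** h n)) \<longlonglongrightarrow> (1 * 1 * pairing s1 * 1 * pairing s2) *\<^sub>R outer v \<phi>"
      by (intro sandwich_limit h_lim')
    show "(\<lambda>n. (1 / (a n * a n * a n)) *\<^sub>R (h n ** s1' ** h n ** s2' ** h n)) \<longlonglongrightarrow> (1 * 1 * pairing s1' * 1 * pairing s2') *\<^sub>R outer v \<phi>"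
      by (intro sandwich_limit h_lim')
  qed (use nz a_nz in auto)
qed

lemma middle_limit: "(\<lambda>n. (1 / a n) * pairing (t ** h n ** s)) \<longlonglongrightarrow> pairing t * pairing s"
proof -
  have "(\<lambda>n. \<phi> \<bullet> (t *v (((1 / a n) *\<^sub>R h n) *v (s *v v)))) \<longlonglongrightarrow> \<phi> \<bullet> (t *v (outer v \<phi> *v (s *v v)))"
    by (intro tendsto_intros h_lim)
  then show ?thesis
    by (simp add: outer_mult_vector matrix_vector_mult_scaleR scaleR_matrix_vector_assoc[symmetric]
         matrix_vector_mul_assoc[symmetric] mult.commute)
qed

text \<open>
  Otherwise 1 is an isolated ratio. The quotient \<open>q\<close> of \<open>pairing (t ** h n ** s) * pairing s0\<close> by
  \<open>pairing (t ** h n ** s0) * pairing s\<close> compares words of equal total length, so its modulus is a ratio, and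
  it tends to 1; isolation forces it to be equal to 1 for large \<open>n\<close>. As the vectors \<open>s v\<close> with non-zero pairing span
  the space, the functional \<open>\<phi> t h n\<close> is then a multiple of \<open>\<phi>\<close> for every \<open>t\<close> with non-zero pairing.
  Consequently \<open>\<phi> t1\<close> and \<open>\<phi> t2\<close> are proportional for any two such elements, which contradicts strong
  irreducibility in dimension greater than one.
\<close>

lemma ratio_accumulates_at_1:
  assumes "\<epsilon> > 0"
  shows "\<exists>r. ratio r \<and> 1 < r \<and> r < 1 + \<epsilon>"
proof (rule ccontr)
  assume none: "\<not> ?thesis"
  have isolated: "r = 1" if r: "ratio r" "\<bar>r - 1\<bar> < min (1/2) (\<epsilon> / 4)" for r
  proof (rule ccontr)
    assume "r \<noteq> 1"
    then consider "r > 1" | "r < 1" by linarith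
    then show False
    proof cases
      case 1 then show False using none r by auto
    next
      case 2
      have "r > 1/2" using r(2) by linarith
      have "1 < 1 / r" using 2 \<open>r > 1/2\<close> by simp
      have "1 - r < (\<epsilon> / 2) * r"
      proof -
        have "1 - r < \<epsilon> / 4" using r(2) by linarith
        also have "\<epsilon> / 4 < \<epsilon> / 2 * r" using \<open>r > 1/2\<close> assms by simp
        finally show ?thesis .
      qed
      moreover have "\<epsilon> / 2 * r < \<epsilon> * r" using \<open>r > 1/2\<close> assms by simp
      ultimately have "1 < (1 + \<epsilon>) * r" by (simp add: distrib_right)
      then have "1 / r < 1 + \<epsilon>" using \<open>r > 1/2\<close> by (simp add: pos_divide_less_eq)
      then show False using none ratio_inverse[OF r(1)] \<open>1 < 1 / r\<close> by blast
    qed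
  qed
  obtain s0 where s0: "s0 \<in> G" "pairing s0 \<noteq> 0" using pairing_nonzero_exists by blast
  have proportional: "\<forall>\<^sub>F n in sequentially. pairing (t ** h n ** s) * pairing s0 = pairing (t ** h n ** s0) * pairing s"
    if t: "t \<in> G" "pairing t \<noteq> 0" and s: "s \<in> G" "pairing s \<noteq> 0" for t s
  proof -
    define q where "q n = (pairing (t ** h n ** s) * pairing s0) / (pairing (t ** h n ** s0) * pairing s)" for n
    have lim: "(\<lambda>n. ((1 / a n) * pairing (t ** h n ** s) * pairing s0) / ((1 / a n) * pairing (t ** h n ** s0) * pairing s))
        \<longlonglongrightarrow> (pairing t * pairing s * pairing s0) / (pairing t * pairing s0 * pairing s)"
      using t s s0 by (intro tendsto_intros middle_limit) auto
    have "((1 / a n) * pairing (t ** h n ** s) * pairing s0) / ((1 / a n) * pairing (t ** h n ** s0) * pairing s) = q n" for n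
      using a_nz[of n] by (simp add: q_def)
    then have q1: "q \<longlonglongrightarrow> 1" using lim t s s0 by simp
    then have "(\<lambda>n. \<bar>q n\<bar>) \<longlonglongrightarrow> 1" using tendsto_rabs[OF q1] by simp
    then have "\<forall>\<^sub>F n in sequentially. dist \<bar>q n\<bar> 1 < min (1/2) (\<epsilon> / 4)"
      using assms by (intro tendstoD) auto
    moreover have "\<forall>\<^sub>F n in sequentially. q n > 0" using order_tendstoD(1)[OF q1, of 0] by simp
    ultimately show ?thesis
    proof eventually_elim
      case (elim n)
      have nz: "pairing (t ** h n ** s) \<noteq> 0" "pairing (t ** h n ** s0) \<noteq> 0"
        using elim(2) by (auto simp: q_def)
      obtain i j j' m where len: "t \<in> set_power T i" "s \<in> set_power T j" "s0 \<in> set_power T j'" "h n \<in> set_power T m"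
        using word t(1) s(1) s0(1) h_in by metis
      have "ratio \<bar>pairing (t ** h n ** s) * pairing s0 / (pairing (t ** h n ** s0) * pairing s)\<bar>"
        by (rule ratio_pair[of _ "i + m + j" _ j' _ "i + m + j'" _ j])
          (use len nz s s0 in \<open>auto intro: set_power_mult\<close>)
      then have "\<bar>q n\<bar> = 1" using elim(1) by (intro isolated) (auto simp: q_def dist_real_def)
      then have "q n = 1" using elim(2) by simp
      then show ?case using nz s by (simp add: q_def field_simps)
    qed
  qed
  obtain B where B: "B \<subseteq> {s *v v | s. s \<in> G \<and> pairing s \<noteq> 0}" "independent B"
     "{s *v v | s. s \<in> G \<and> pairing s \<noteq> 0} \<subseteq> span B"
    using maximal_independent_subset by blast
  have spanB: "span B = UNIV"
    using span_mono[OF B(3)] orbit_off_hyperplane_spans[OF v_nz \<phi>_nz] by (simp add: span_span top.extremum_unique)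
  have "finite B" using B(2) by (rule independent_imp_finite)
  have parallel: "\<forall>\<^sub>F n in sequentially. pairing (t ** h n ** s0) \<noteq> 0 \<and>
      (\<forall>x. (\<phi> \<bullet> (t *v (h n *v x))) * pairing s0 = pairing (t ** h n ** s0) * (\<phi> \<bullet> x))"
    if t: "t \<in> G" "pairing t \<noteq> 0" for t
  proof -
    have "\<forall>\<^sub>F n in sequentially. (\<phi> \<bullet> (t *v (h n *v b))) * pairing s0 = pairing (t ** h n ** s0) * (\<phi> \<bullet> b)"
      if b: "b \<in> B" for b
    proof -
      obtain s where s: "s \<in> G" "pairing s \<noteq> 0" "b = s *v v" using B(1) b by blast
      show ?thesis using proportional[OF t s(1,2)] unfolding s(3) by (simp add: matrix_vector_mul_assoc matrix_mul_assoc)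
    qed
    then have "\<forall>\<^sub>F n in sequentially. \<forall>b\<in>B. (\<phi> \<bullet> (t *v (h n *v b))) * pairing s0 = pairing (t ** h n ** s0) * (\<phi> \<bullet> b)"
      using \<open>finite B\<close> by (simp add: eventually_ball_finite)
    moreover have "\<forall>\<^sub>F n in sequentially. (1 / a n) * pairing (t ** h n ** s0) \<noteq> 0"
      by (rule tendsto_imp_eventually_ne[OF middle_limit]) (use t s0 in simp)
    ultimately show ?thesis
    proof eventually_elim
      case (elim n)
      have "(\<phi> \<bullet> (t *v (h n *v x))) * pairing s0 = pairing (t ** h n ** s0) * (\<phi> \<bullet> x)" for x
      proof -
        have "x \<in> span B" using spanB by simp
        then show ?thesis
        proof (induction rule: span_induct_alt)
          case (step c b y)
          then show ?case using elim(1)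
            by (simp add: matrix_vector_right_distrib matrix_vector_mult_scaleR inner_add_right distrib_left distrib_right mult.assoc)
        qed simp
      qed
      then show ?case using elim(2) by auto
    qed
  qed
  obtain t1 where t1: "t1 \<in> G" "pairing t1 \<noteq> 0" using pairing_nonzero_exists by blast
  \<comment> \<open>A non-zero vector in the kernel of \<open>\<phi> t1\<close> exists because the dimension is at least two.\<close>
  obtain x where x: "x \<noteq> 0" "orthogonal (transpose t1 *v \<phi>) x"
    using orthogonal_to_vector_exists[of "transpose t1 *v \<phi>"] card by auto
  have x1: "\<phi> \<bullet> (t1 *v x) = 0" using x(2) unfolding orthogonal_def dot_matrix_vector[of \<phi>] .
  obtain t2 where t2: "t2 \<in> G" "\<phi> \<bullet> (t2 *v x) \<noteq> 0" "pairing t2 \<noteq> 0"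
    using simultaneous_nonvanishing[OF \<phi>_nz x(1) v_nz] by blast
  obtain n where n: "pairing (t1 ** h n ** s0) \<noteq> 0"
     "\<And>x. (\<phi> \<bullet> (t1 *v (h n *v x))) * pairing s0 = pairing (t1 ** h n ** s0) * (\<phi> \<bullet> x)"
     "\<And>x. (\<phi> \<bullet> (t2 *v (h n *v x))) * pairing s0 = pairing (t2 ** h n ** s0) * (\<phi> \<bullet> x)"
    using eventually_happens[OF eventually_conj[OF parallel[OF t1] parallel[OF t2(1,3)]]] by auto
  obtain y where y: "h n *v y = x"
    using invertible[OF h_in[of n]] by (metis invertible_def matrix_vector_mul_assoc matrix_vector_mul_lid)
  have "\<phi> \<bullet> y = 0" using n(1) n(2)[of y] x1 unfolding y by simp
  then show False using n(3)[of y] t2 s0 unfolding y by simp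
qed

text \<open>
  A multiplicative group that contains elements greater than 1 and arbitrarily close to 1 is dense in the
  positive reals: for \<open>t < 1\<close>, the first power of such an element that exceeds \<open>1 / t\<close> overshoots by little.
\<close>

lemma ratio_dense:
  assumes "t > 0" "\<epsilon> > 0"
  shows "\<exists>r. ratio r \<and> \<bar>r * t - 1\<bar> < \<epsilon>"
proof -
  have main: "\<exists>r. ratio r \<and> \<bar>r * t - 1\<bar> < \<epsilon>" if t: "0 < t" "t < 1" and \<epsilon>: "\<epsilon> > 0" for t \<epsilon> :: real
  proof -
    obtain r where r: "ratio r" "1 < r" "r < 1 + \<epsilon>" using ratio_accumulates_at_1[OF \<epsilon>] by blast
    define P where "P k \<longleftrightarrow> r ^ Suc k * t > 1 " for k
    have "\<exists>k. 1 / t < r ^ k" using real_arch_pow r(2) by blast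
    then obtain k where "1 / t < r ^ k" by blast
    also have "r ^ k < r ^ Suc k" using r by simp
    finally have "P k" using t by (simp add: P_def field_simps)
    define k0 where "k0 = (LEAST k. P k)"
    have k0: "P k0" unfolding k0_def by (rule LeastI) fact
    have "r ^ k0 * t \<le> 1"
    proof (cases k0)
      case 0 then show ?thesis using t by simp
    next
      case (Suc k') then have "\<not> P k'" unfolding k0_def by (metis lessI not_less_Least)
      then show ?thesis using Suc by (simp add: P_def)
    qed
    then have "r * (r ^ k0 * t) \<le> r * 1" using r by (intro mult_left_mono) auto
    moreover have "r ^ Suc k0 * t = r * (r ^ k0 * t)" by simp
    ultimately have "r ^ Suc k0 * t < 1 + \<epsilon>" using r by linarith
    then show ?thesis using k0 ratio_power[OF r(1), of k0] unfolding P_def by (intro exI[of _ "r ^ Suc k0"]) auto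
  qed
  obtain r where r: "ratio r" "1 < r" using ratio_accumulates_at_1[of 1] by auto
  \<comment> \<open>A large power of r^-1 reduces to the case of small t.\<close>
  obtain k where k: "t < r ^ k" using real_arch_pow r(2) by blast
  have "t < r ^ Suc k" using k r by (smt (verit) power_strict_increasing_iff lessI)
  define q where "q = 1 / r ^ Suc k"
  have q: "ratio q" "q > 0" "q * t < 1"
    using ratio_inverse[OF ratio_power[OF r(1)]] \<open>t < r ^ Suc k\<close> r by (simp_all add: q_def field_simps)
  obtain p where "ratio p" "\<bar>p * (q * t) - 1\<bar> < \<epsilon>" using main[of "q * t" \<epsilon>] q assms by auto
  then show ?thesis using ratio_mult[of p q] q by (auto simp: mult.assoc)
qed

text \<open>
  Any two directions can be driven, by words of the same length, to nearly the same point up to sign. Both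
  words are close to matrices of rank one, so the images are close to multiples of \<open>v\<close>, and the ratio of
  the words is chosen to compensate the different sizes of \<open>\<phi> (s x)\<close> and \<open>\<phi> (s y)\<close>. The norms, and not
  only the directions, have to agree because the quotient by homotheties remembers them modulo powers of
  \<open>c\<close>.
\<close>

lemma synchronous_approach:
  assumes "x \<noteq> 0" "y \<noteq> 0" "\<delta> > 0"
  shows "\<exists>k g g' \<sigma>. g \<in> set_power T k \<and> g' \<in> set_power T k \<and> (\<sigma> = 1 \<or> \<sigma> = -1) \<and>
           norm (g *v x - \<sigma> *\<^sub>R (g' *v y)) < \<delta> * norm (g *v x)"
proof -
  obtain s where s: "s \<in> G" "\<phi> \<bullet> (s *v x) \<noteq> 0" "\<phi> \<bullet> (s *v y) \<noteq> 0"
    using simultaneous_nonvanishing[OF \<phi>_nz assms(1,2)] by blast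
  define px where "px = \<phi> \<bullet> (s *v x)"
  define py where "py = \<phi> \<bullet> (s *v y)"
  obtain j where j: "s \<in> set_power T j" using word s by blast
  define \<epsilon> where "\<epsilon> = min (1/2) (\<delta> / 4)"
  have \<epsilon>: "\<epsilon> > 0" "\<epsilon> \<le> 1/2" "\<epsilon> \<le> \<delta> / 4" using assms by (auto simp: \<epsilon>_def)
  obtain r where r: "ratio r" "\<bar>r * \<bar>px / py\<bar> - 1\<bar> < \<epsilon>"
    using ratio_dense[of "\<bar>px / py\<bar>" \<epsilon>] s \<epsilon> by (auto simp: px_def py_def)
  obtain k g g' b \<alpha> \<beta> where g: "\<And>n. g n \<in> set_power T (k n)" "\<And>n. g' n \<in> set_power T (k n)" "\<And>n::nat. b n \<noteq> (0::real)"
     "(\<lambda>n. (1 / b n) *\<^sub>R g n) \<longlonglongrightarrow> \<alpha> *\<^sub>R outer v \<phi>"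
     "(\<lambda>n. (1 / b n) *\<^sub>R g' n) \<longlonglongrightarrow> \<beta> *\<^sub>R outer v \<phi>"
     "\<alpha> \<noteq> 0" "\<beta> \<noteq> 0" "r = \<bar>\<alpha> / \<beta>\<bar>" using r(1) unfolding ratio_def by blast
  define A where "A = \<alpha> * px"
  define C where "C = \<beta> * py"
  have nz: "A \<noteq> 0" "C \<noteq> 0" using g s by (auto simp: A_def C_def px_def py_def)
  define \<sigma> where "\<sigma> = (if A * C > 0 then 1 else -1 :: real)"
  have \<sigma>: "\<sigma> = 1 \<or> \<sigma> = -1" by (simp add: \<sigma>_def)
  have AC: "\<bar>\<bar>A\<bar> / \<bar>C\<bar> - 1\<bar> < \<epsilon>"
    using r(2) unfolding g(8) A_def C_def by (simp add: abs_mult)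
  have "\<bar>A - \<sigma> * C\<bar> = \<bar>\<bar>A\<bar> - \<bar>C\<bar>\<bar>"
    using nz by (auto simp: \<sigma>_def zero_less_mult_iff abs_if split: if_splits)
  also have "\<bar>A\<bar> - \<bar>C\<bar> = \<bar>C\<bar> * (\<bar>A\<bar> / \<bar>C\<bar> - 1)"
    using nz by (simp add: right_diff_distrib)
  also have "\<bar>\<bar>C\<bar> * (\<bar>A\<bar> / \<bar>C\<bar> - 1)\<bar> = \<bar>C\<bar> * \<bar>\<bar>A\<bar> / \<bar>C\<bar> - 1\<bar>"
    by (simp only: abs_mult abs_abs)
  also have "\<dots> < \<bar>C\<bar> * \<epsilon>" using AC nz by (intro mult_strict_left_mono) auto
  also have "\<bar>C\<bar> * \<epsilon> \<le> (2 * \<bar>A\<bar>) * (\<delta> / 4)"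
  proof (rule mult_mono)
    have "\<bar>A\<bar> / \<bar>C\<bar> > 1 / 2" using AC \<epsilon> by linarith
    then show "\<bar>C\<bar> \<le> 2 * \<bar>A\<bar>" using nz by (simp add: pos_less_divide_eq)
  qed (use \<epsilon> in auto)
  finally have "\<bar>A - \<sigma> * C\<bar> < \<delta> * \<bar>A\<bar> / 2" by (simp add: mult.commute)
  moreover have "\<delta> * \<bar>A\<bar> > 0" using assms nz by simp
  ultimately have close: "\<bar>A - \<sigma> * C\<bar> < \<delta> * \<bar>A\<bar>" by linarith
  have limx: "(\<lambda>n. (1 / b n) *\<^sub>R (g n *v (s *v x))) \<longlonglongrightarrow> A *\<^sub>R v"
    using tendsto_matrix_vector_mult[OF g(4) tendsto_const[of "s *v x"]]
    by (simp add: outer_mult_vector scaleR_matrix_vector_assoc[symmetric] A_def px_def)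
  have limy: "(\<lambda>n. (1 / b n) *\<^sub>R (g' n *v (s *v y))) \<longlonglongrightarrow> C *\<^sub>R v"
    using tendsto_matrix_vector_mult[OF g(5) tendsto_const[of "s *v y"]]
    by (simp add: outer_mult_vector scaleR_matrix_vector_assoc[symmetric] C_def py_def)
  have "(\<lambda>n. norm ((1 / b n) *\<^sub>R (g n *v (s *v x)) - \<sigma> *\<^sub>R ((1 / b n) *\<^sub>R (g' n *v (s *v y)))) -
       \<delta> * norm ((1 / b n) *\<^sub>R (g n *v (s *v x)))) \<longlonglongrightarrow> norm (A *\<^sub>R v - \<sigma> *\<^sub>R (C *\<^sub>R v)) - \<delta> * norm (A *\<^sub>R v)"
    by (intro tendsto_intros limx limy)
  moreover have "norm (A *\<^sub>R v - \<sigma> *\<^sub>R (C *\<^sub>R v)) - \<delta> * norm (A *\<^sub>R v) < 0"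
  proof -
    have "A *\<^sub>R v - \<sigma> *\<^sub>R (C *\<^sub>R v) = (A - \<sigma> * C) *\<^sub>R v" by (simp add: scaleR_left_diff_distrib)
    then have "norm (A *\<^sub>R v - \<sigma> *\<^sub>R (C *\<^sub>R v)) - \<delta> * norm (A *\<^sub>R v) = (\<bar>A - \<sigma> * C\<bar> - \<delta> * \<bar>A\<bar>) * norm v"
      by (simp add: left_diff_distrib)
    then show ?thesis using close v_nz by (simp add: mult_neg_pos)
  qed
  ultimately have "\<forall>\<^sub>F n in sequentially. norm ((1 / b n) *\<^sub>R (g n *v (s *v x)) - \<sigma> *\<^sub>R ((1 / b n) *\<^sub>R (g' n *v (s *v y)))) -
       \<delta> * norm ((1 / b n) *\<^sub>R (g n *v (s *v x))) < 0"
    by (rule order_tendstoD)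
  then obtain n where n: "norm ((1 / b n) *\<^sub>R (g n *v (s *v x)) - \<sigma> *\<^sub>R ((1 / b n) *\<^sub>R (g' n *v (s *v y)))) -
       \<delta> * norm ((1 / b n) *\<^sub>R (g n *v (s *v x))) < 0"
    using eventually_happens by force
  have "(1 / b n) *\<^sub>R (g n *v (s *v x)) - \<sigma> *\<^sub>R ((1 / b n) *\<^sub>R (g' n *v (s *v y))) =
     (1 / b n) *\<^sub>R (g n *v (s *v x) - \<sigma> *\<^sub>R (g' n *v (s *v y)))" by (simp add: algebra_simps)
  then have "\<bar>1 / b n\<bar> * (norm (g n *v (s *v x) - \<sigma> *\<^sub>R (g' n *v (s *v y))) - \<delta> * norm (g n *v (s *v x))) < 0"
    using n by (simp add: right_diff_distrib mult.left_commute)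
  then have "norm (g n *v (s *v x) - \<sigma> *\<^sub>R (g' n *v (s *v y))) < \<delta> * norm (g n *v (s *v x))"
    using g(3)[of n] by (simp add: divide_less_0_iff)
  moreover have "g n ** s \<in> set_power T (k n + j)" "g' n ** s \<in> set_power T (k n + j)"
    using g j by (auto intro: set_power_mult)
  ultimately show ?thesis using \<sigma>
    by (intro exI[of _ "k n + j"] exI[of _ "g n ** s"] exI[of _ "g' n ** s"] exI[of _ \<sigma>])
       (simp add: matrix_vector_mul_assoc)
qed

end

section \<open>Splitting a random walk and bounding cancellation\<close>

locale random_walk =
  fixes \<mu> :: "(real^'n^'n) measure"
  assumes prob_mu: "prob_space \<mu>"
    and sets_mu: "sets \<mu> = sets (restrict_space borel (space \<mu>))"
    and invertible_mu: "g \<in> space \<mu> \<Longrightarrow> invertible g"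
begin

abbreviation "PP \<equiv> Pi\<^sub>M (UNIV :: nat set) (\<lambda>_. \<mu>)"

lemma sequence_space_mu: "sequence_space \<mu>"
  unfolding sequence_space_def product_prob_space_def product_sigma_finite_def product_prob_space_axioms_def
  using prob_mu prob_space_imp_sigma_finite by blast

sublocale P: prob_space PP
  by (rule prob_space_PiM) (rule prob_mu)

lemma measurable_subspace [measurable]: "(\<lambda>x. x) \<in> borel_measurable \<mu>"
proof -
  have "(\<lambda>x. x) \<in> borel_measurable (restrict_space borel (space \<mu>))"
    by (intro measurable_restrict_space1) simp
  then show ?thesis using measurable_cong_sets[OF sets_mu refl] by blast
qed

lemma measurable_step [measurable]: "(\<lambda>\<omega>. \<omega> i) \<in> borel_measurable PP"
  using measurable_compose[where g="\<lambda>x. x", OF measurable_component_singleton[where i=i and I=UNIV and M="\<lambda>_. \<mu>"] measurable_subspace]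
  by simp

lemma measurable_matrix_mult [measurable (raw)]:
  fixes f g :: "'a \<Rightarrow> real^'n^'n"
  assumes "f \<in> borel_measurable M" "g \<in> borel_measurable M"
  shows "(\<lambda>x. f x ** g x) \<in> borel_measurable M"
  using assms by (rule borel_measurable_continuous_Pair) (intro continuous_intros)

lemma measurable_matrix_vector [measurable (raw)]:
  fixes f :: "'a \<Rightarrow> real^'n^'n" and g :: "'a \<Rightarrow> real^'n"
  assumes "f \<in> borel_measurable M" "g \<in> borel_measurable M"
  shows "(\<lambda>x. f x *v g x) \<in> borel_measurable M"
  using assms by (rule borel_measurable_continuous_Pair) (intro continuous_intros)

lemma measurable_left_product [measurable]: "(\<lambda>\<omega>. left_product \<omega> n) \<in> borel_measurable PP"
  by (induction n) simp_all

lemma step_in_space: "\<omega> \<in> space PP \<Longrightarrow> \<omega> i \<in> space \<mu>"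
  by (auto simp: space_PiM)

lemma invertible_left_product: "\<omega> \<in> space PP \<Longrightarrow> invertible (left_product \<omega> n)"
proof (induction n)
  case 0 show ?case by (auto simp: invertible_def intro!: exI[of _ "mat 1"])
next
  case (Suc n) then show ?case by (simp add: invertible_mult invertible_mu step_in_space)
qed

lemma left_product_cong: "(\<And>i. i < n \<Longrightarrow> f i = g i) \<Longrightarrow> left_product f n = left_product g n"
  by (induction n) auto

text \<open>
  New factors are multiplied from the left, so the steps after time \<open>k\<close> form the left factor.
\<close>

lemma left_product_comb: "left_product (comb_seq k \<omega> \<omega>') (n + k) = left_product \<omega>' n ** left_product \<omega> k"
proof (induction n)
  case 0 show ?case by (simp, rule left_product_cong) (simp add: comb_seq_less)
next
  case (Suc n) then show ?case by (simp add: comb_seq_add matrix_mul_assoc)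
qed

lemma measurable_comb:
  assumes "f \<in> borel_measurable PP"
  shows "(\<lambda>(\<omega>, \<omega>'). f (comb_seq k \<omega> \<omega>') :: real) \<in> borel_measurable (PP \<Otimes>\<^sub>M PP)"
proof -
  have "f \<circ> (\<lambda>(\<omega>, \<omega>'). comb_seq k \<omega> \<omega>') \<in> borel_measurable (PP \<Otimes>\<^sub>M PP)"
    by (rule measurable_comp[OF measurable_comb_seq assms])
  then show ?thesis by (simp add: comp_def case_prod_unfold)
qed

lemma measurable_split_integral:
  assumes f: "f \<in> borel_measurable PP"
  shows "(\<lambda>\<omega>. \<integral>\<omega>'. f (comb_seq k \<omega> \<omega>') \<partial>PP :: real) \<in> borel_measurable PP"
  by (rule P.borel_measurable_lebesgue_integral[OF measurable_comb[OF f]])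

text \<open>
  The Markov property at the fixed time \<open>k\<close>: a path followed up to time \<open>k\<close> and continued by an independent
  path has the same law as a path.
\<close>

lemma integral_split:
  fixes f :: "(nat \<Rightarrow> real^'n^'n) \<Rightarrow> real"
  assumes f: "f \<in> borel_measurable PP" and B: "\<And>\<omega>. \<bar>f \<omega>\<bar> \<le> B"
  shows "(\<integral>\<omega>. f \<omega> \<partial>PP) = (\<integral>\<omega>. \<integral>\<omega>'. f (comb_seq k \<omega> \<omega>') \<partial>PP \<partial>PP)"
proof -
  interpret PPP: pair_prob_space PP PP by unfold_locales
  have "(\<integral>\<omega>. f \<omega> \<partial>PP) = (\<integral>\<omega>. f \<omega> \<partial>distr (PP \<Otimes>\<^sub>M PP) PP (\<lambda>(\<omega>, \<omega>'). comb_seq k \<omega> \<omega>'))"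
    using sequence_space.PiM_comb_seq[OF sequence_space_mu] by simp
  also have "\<dots> = (\<integral>z. f (case z of (\<omega>, \<omega>') \<Rightarrow> comb_seq k \<omega> \<omega>') \<partial>(PP \<Otimes>\<^sub>M PP))"
    by (rule integral_distr[OF measurable_comb_seq f])
  also have "\<dots> = (\<integral>(\<omega>, \<omega>'). f (comb_seq k \<omega> \<omega>') \<partial>(PP \<Otimes>\<^sub>M PP))"
    by (simp add: case_prod_unfold)
  also have "\<dots> = (\<integral>\<omega>. \<integral>\<omega>'. f (comb_seq k \<omega> \<omega>') \<partial>PP \<partial>PP)"
    by (rule PPP.integral_fst[symmetric], rule PPP.P.integrable_const_bound[of _ B])
      (use B measurable_comb[OF f] in \<open>auto simp: case_prod_unfold\<close>)
  finally show ?thesis .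
qed

lemma space_comb: "\<omega> \<in> space PP \<Longrightarrow> \<omega>' \<in> space PP \<Longrightarrow> comb_seq k \<omega> \<omega>' \<in> space PP"
  by (simp add: space_PiM PiE_UNIV_domain Pi_iff comb_seq_def)

lemma integral_affine_indicator:
  assumes "E \<in> sets PP"
  shows "integrable PP (\<lambda>\<omega>. x + y * indicator E \<omega> :: real)"
    and "(\<integral>\<omega>. x + y * indicator E \<omega> \<partial>PP) = x + y * P.prob E"
proof -
  have i: "integrable PP (\<lambda>\<omega>. indicator E \<omega> :: real)"
    by (rule P.integrable_const_bound[of _ 1]) (use assms in \<open>simp_all add: indicator_def\<close>)
  then show "integrable PP (\<lambda>\<omega>. x + y * indicator E \<omega> :: real)" by simp
  have "(\<integral>\<omega>. x + y * indicator E \<omega> \<partial>PP) = (\<integral>\<omega>. x \<partial>PP) + (\<integral>\<omega>. y * indicator E \<omega> \<partial>PP)"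
    using i by (intro Bochner_Integration.integral_add) simp_all
  then show "(\<integral>\<omega>. x + y * indicator E \<omega> \<partial>PP) = x + y * P.prob E"
    using assms by (simp add: P.prob_space)
qed

lemma prob_split_inner:
  assumes Z: "Z \<in> sets PP" and \<omega>: "\<omega> \<in> space PP"
  shows "(\<integral>\<omega>'. indicator Z (comb_seq k \<omega> \<omega>') \<partial>PP :: real) = P.prob {\<omega>'\<in>space PP. comb_seq k \<omega> \<omega>' \<in> Z}"
    and "{\<omega>'\<in>space PP. comb_seq k \<omega> \<omega>' \<in> Z} \<in> sets PP"
proof -
  have "comb_seq k \<omega> -` Z \<inter> space PP \<in> sets PP"
    by (rule measurable_sets[OF measurable_comb_seq' Z]) (use \<omega> in auto)
  then show *: "{\<omega>'\<in>space PP. comb_seq k \<omega> \<omega>' \<in> Z} \<in> sets PP"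
    by (simp add: vimage_def Int_def conj_commute)
  have "(\<integral>\<omega>'. indicator Z (comb_seq k \<omega> \<omega>') \<partial>PP :: real) = (\<integral>\<omega>'. 0 + 1 * indicator {\<omega>'\<in>space PP. comb_seq k \<omega> \<omega>' \<in> Z} \<omega>' \<partial>PP)"
    by (rule Bochner_Integration.integral_cong) (auto simp: indicator_def)
  also have "\<dots> = P.prob {\<omega>'\<in>space PP. comb_seq k \<omega> \<omega>' \<in> Z}"
    using integral_affine_indicator(2)[OF *, of 0 1] by linarith
  finally show "(\<integral>\<omega>'. indicator Z (comb_seq k \<omega> \<omega>') \<partial>PP :: real) = P.prob {\<omega>'\<in>space PP. comb_seq k \<omega> \<omega>' \<in> Z}" .
qed

text \<open>
  The function \<open>u\<close> bounds the conditional probability of \<open>Z\<close> given the first \<open>k\<close> steps.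
\<close>

lemma prob_split_le:
  assumes Z: "Z \<in> sets PP" and u: "u \<in> borel_measurable PP" "\<And>\<omega>. \<omega> \<in> space PP \<Longrightarrow> \<bar>u \<omega>\<bar> \<le> B"
    and le: "\<And>\<omega>. \<omega> \<in> space PP \<Longrightarrow> P.prob {\<omega>'\<in>space PP. comb_seq k \<omega> \<omega>' \<in> Z} \<le> u \<omega>"
  shows "P.prob Z \<le> (\<integral>\<omega>. u \<omega> \<partial>PP)"
proof -
  have ind: "(indicator Z :: _ \<Rightarrow> real) \<in> borel_measurable PP" using Z by simp
  have "P.prob Z = (\<integral>\<omega>. indicator Z \<omega> \<partial>PP)" using Z by simp
  also have "\<dots> = (\<integral>\<omega>. \<integral>\<omega>'. indicator Z (comb_seq k \<omega> \<omega>') \<partial>PP \<partial>PP)"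
    by (rule integral_split[OF ind, of 1]) (simp add: indicator_def)
  also have "\<dots> \<le> (\<integral>\<omega>. u \<omega> \<partial>PP)"
  proof (rule integral_mono)
    show "integrable PP u" by (rule P.integrable_const_bound[of _ B]) (use u in auto)
    have "(\<lambda>\<omega>. \<integral>\<omega>'. indicator Z (comb_seq k \<omega> \<omega>') \<partial>PP :: real) \<in> borel_measurable PP"
      by (rule measurable_split_integral[OF ind])
    moreover have "\<bar>\<integral>\<omega>'. indicator Z (comb_seq k \<omega> \<omega>') \<partial>PP\<bar> \<le> (1::real)" if "\<omega> \<in> space PP" for \<omega>
      unfolding prob_split_inner(1)[OF Z that] by simp
    ultimately show "integrable PP (\<lambda>\<omega>. \<integral>\<omega>'. indicator Z (comb_seq k \<omega> \<omega>') \<partial>PP :: real)"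
      by (intro P.integrable_const_bound[of _ 1]) auto
    show "(\<integral>\<omega>'. indicator Z (comb_seq k \<omega> \<omega>') \<partial>PP) \<le> u \<omega>" if "\<omega> \<in> space PP" for \<omega>
      using le[OF that] prob_split_inner(1)[OF Z that] by simp
  qed
  finally show ?thesis .
qed

lemma prob_split_ge:
  assumes Z: "Z \<in> sets PP" and E: "E \<in> sets PP" and "p \<ge> 0"
    and ge: "\<And>\<omega>. \<omega> \<in> E \<Longrightarrow> P.prob {\<omega>'\<in>space PP. comb_seq k \<omega> \<omega>' \<in> Z} \<ge> p"
  shows "P.prob Z \<ge> P.prob E * p"
proof -
  have compl: "P.prob {\<omega>'\<in>space PP. comb_seq k \<omega> \<omega>' \<in> space PP - Z} = 1 - P.prob {\<omega>'\<in>space PP. comb_seq k \<omega> \<omega>' \<in> Z}"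
    if "\<omega> \<in> space PP" for \<omega>
  proof -
    have "{\<omega>'\<in>space PP. comb_seq k \<omega> \<omega>' \<in> space PP - Z} = space PP - {\<omega>'\<in>space PP. comb_seq k \<omega> \<omega>' \<in> Z}"
      using that space_comb by auto
    then show ?thesis using prob_split_inner(2)[OF Z that] by (simp add: P.prob_compl)
  qed
  have "P.prob (space PP - Z) \<le> (\<integral>\<omega>. 1 + - p * indicator E \<omega> \<partial>PP)"
  proof (rule prob_split_le[where k=k and B="1 + p"])
    show "space PP - Z \<in> sets PP" using Z by auto
    show "(\<lambda>\<omega>. 1 + - p * indicator E \<omega>) \<in> borel_measurable PP" using E by measurable
    show "\<bar>1 + - p * indicator E \<omega>\<bar> \<le> 1 + p" for \<omega> using \<open>p \<ge> 0\<close> by (auto simp: indicator_def)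
    fix \<omega> assume \<omega>: "\<omega> \<in> space PP"
    show "P.prob {\<omega>'\<in>space PP. comb_seq k \<omega> \<omega>' \<in> space PP - Z} \<le> 1 + - p * indicator E \<omega>"
      unfolding compl[OF \<omega>] using ge[of \<omega>] by (auto simp: indicator_def)
  qed
  also have "\<dots> = 1 + - p * P.prob E" by (rule integral_affine_indicator(2)[OF E])
  finally show ?thesis using P.prob_compl[OF Z] by (simp add: mult.commute)
qed

text \<open>
  The probability that the product of the first \<open>n\<close> steps makes \<open>v\<close> much shorter than its norm would allow.
  Off this event the product expands relative distances from \<open>v\<close> by at most the factor \<open>1 / \<eta>\<close>, which is the
  source of all equicontinuity below.
\<close>

definition cancel_prob :: "nat \<Rightarrow> real^'n \<Rightarrow> real \<Rightarrow> real" where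
  "cancel_prob n v \<eta> = P.prob {\<omega>\<in>space PP. norm (left_product \<omega> n *v v) \<le> \<eta> * norm (left_product \<omega> n) * norm v}"

text \<open>
  For invertible \<open>A\<close> this bounds both \<open>A\<close> and its inverse by \<open>C\<close>; avoiding the inverse makes the set of tame
  matrices visibly closed.
\<close>

definition tame :: "real \<Rightarrow> real^'n^'n \<Rightarrow> bool" where
  "tame C A \<longleftrightarrow> norm A \<le> C \<and> (\<forall>x. norm x \<le> C * norm (A *v x))"

lemma tame_mono: "tame C A \<Longrightarrow> C \<le> D \<Longrightarrow> tame D A"
  unfolding tame_def by (meson mult_right_mono norm_ge_zero order_trans)

lemma closed_tame: "closed {A. tame C A}"
proof -
  have "{A. tame C A} = {A. norm A \<le> C} \<inter> (\<Inter>x. {A. norm x \<le> C * norm (A *v x)})"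
    by (auto simp: tame_def)
  then show ?thesis
    by (simp only:) (intro closed_Int closed_INT ballI closed_Collect_le continuous_intros)
qed

lemma tame_event [measurable]: "{\<omega>\<in>space PP. tame C (left_product \<omega> k)} \<in> sets PP"
proof -
  have "(\<lambda>\<omega>. left_product \<omega> k) -` {A. tame C A} \<inter> space PP \<in> sets PP"
    by (rule measurable_sets[OF measurable_left_product]) (simp add: closed_tame)
  then show ?thesis by (simp add: vimage_def Int_def conj_commute)
qed

definition wild_prob :: "nat \<Rightarrow> real \<Rightarrow> real" where
  "wild_prob k C = P.prob {\<omega>\<in>space PP. \<not> tame C (left_product \<omega> k)}"

lemma wild_event [measurable]: "{\<omega>\<in>space PP. \<not> tame C (left_product \<omega> k)} \<in> sets PP"
  by measurable

lemma wild_prob_antimono: "C \<le> D \<Longrightarrow> wild_prob k D \<le> wild_prob k C"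
  unfolding wild_prob_def by (intro P.finite_measure_mono) (auto intro: tame_mono)

text \<open>
  Every invertible matrix is tame for some constant, so the wild events decrease to the empty set.
\<close>

lemma tightness_single:
  assumes "\<epsilon> > 0"
  shows "\<exists>C\<ge>1. wild_prob k C \<le> \<epsilon>"
proof -
  define W where "W i = {\<omega>\<in>space PP. \<not> tame (real i) (left_product \<omega> k)}" for i
  have "(\<lambda>i. P.prob (W i)) \<longlonglongrightarrow> P.prob (\<Inter>i. W i)"
    by (rule P.finite_Lim_measure_decseq) (auto simp: W_def decseq_def intro: tame_mono)
  moreover have "(\<Inter>i. W i) = {}"
  proof (rule ccontr)
    assume "(\<Inter>i. W i) \<noteq> {}"
    then obtain \<omega> where \<omega>: "\<And>i. \<omega> \<in> W i" by blast
    define A where "A = left_product \<omega> k"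
    have "invertible A" using invertible_left_product \<omega>[of 0] by (auto simp: A_def W_def)
    then obtain B where B: "B ** A = mat 1" by (auto simp: invertible_def)
    obtain i :: nat where i: "max (norm A) (norm B) \<le> real i" using real_arch_simple by blast
    have "norm x \<le> real i * norm (A *v x)" for x
    proof -
      have "norm x = norm (B *v (A *v x))" using B by (simp add: matrix_vector_mul_assoc)
      also have "\<dots> \<le> norm B * norm (A *v x)" by (rule norm_matrix_vector_mult_le)
      also have "\<dots> \<le> real i * norm (A *v x)" using i by (intro mult_right_mono) auto
      finally show ?thesis .
    qed
    then have "tame (real i) A" using i by (simp add: tame_def)
    then show False using \<omega>[of i] by (simp add: W_def A_def)
  qed
  ultimately have "(\<lambda>i. P.prob (W i)) \<longlonglongrightarrow> 0" by simp
  then have "\<forall>\<^sub>F i in sequentially. P.prob (W i) < \<epsilon>" using assms by (rule order_tendstoD)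
  then obtain m where m: "\<And>i. i \<ge> m \<Longrightarrow> P.prob (W i) < \<epsilon>" unfolding eventually_sequentially by blast
  define i where "i = max 1 m"
  have "i \<ge> 1" "P.prob (W i) < \<epsilon>" by (auto simp: i_def intro: m)
  then show ?thesis by (intro exI[of _ "real i"]) (simp add: W_def wild_prob_def)
qed

lemma tightness:
  assumes "\<epsilon> > 0"
  shows "\<exists>C\<ge>1. \<forall>k\<le>K. wild_prob k C \<le> \<epsilon>"
proof -
  obtain C where C: "\<And>k. C k \<ge> 1" "\<And>k. wild_prob k (C k) \<le> \<epsilon>"
    using tightness_single[OF assms] by metis
  define D where "D = Max (C ` {..K})"
  have D: "C k \<le> D" if "k \<le> K" for k using that by (auto simp: D_def)
  show ?thesis
  proof (intro exI[of _ D] conjI allI impI)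
    show "D \<ge> 1" using D[of 0] C(1)[of 0] by simp
    show "wild_prob k D \<le> \<epsilon>" if "k \<le> K" for k
      using wild_prob_antimono[OF D[OF that], of k] C(2)[of k] by simp
  qed
qed

lemma cancel_event [measurable]:
  "{\<omega>\<in>space PP. norm (left_product \<omega> n *v v) \<le> \<eta> * norm (left_product \<omega> n) * norm v} \<in> sets PP"
  by measurable

lemma cancel_prob_le_1: "cancel_prob n v \<eta> \<le> 1" and cancel_prob_nonneg: "0 \<le> cancel_prob n v \<eta>"
  by (auto simp: cancel_prob_def)

lemma cancel_prob_mono: "\<eta> \<le> \<eta>' \<Longrightarrow> cancel_prob n v \<eta> \<le> cancel_prob n v \<eta>'"
  unfolding cancel_prob_def
  by (intro P.finite_measure_mono) (auto elim!: order_trans intro!: mult_right_mono)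

lemma cancel_prob_scale: "t \<noteq> 0 \<Longrightarrow> cancel_prob n (t *\<^sub>R v) \<eta> = cancel_prob n v \<eta>"
  unfolding cancel_prob_def
  by (intro arg_cong[where f=P.prob])
     (auto simp: matrix_vector_mult_scaleR mult.left_commute[of _ "\<bar>t\<bar>"])

lemma tame_norm_bounds:
  assumes "tame C A"
  shows "norm A \<le> C" "norm x \<le> C * norm (A *v x)"
  using assms by (auto simp: tame_def)

text \<open>
  A tame matrix distorts norms by at most the factor \<open>C\<^sup>2\<close>.
\<close>

lemma cancel_prob_small:
  assumes "C\<^sup>2 * \<eta> < 1" "C \<ge> 1" "v \<noteq> 0" "\<eta> \<ge> 0"
  shows "cancel_prob k v \<eta> \<le> wild_prob k C"
  unfolding cancel_prob_def wild_prob_def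
proof (rule P.finite_measure_mono, safe)
  fix \<omega> assume *: "norm (left_product \<omega> k *v v) \<le> \<eta> * norm (left_product \<omega> k) * norm v" "tame C (left_product \<omega> k)"
  have "norm v \<le> C * norm (left_product \<omega> k *v v)" using * by (simp add: tame_def)
  also have "\<dots> \<le> C * (\<eta> * C * norm v)"
  proof (intro mult_left_mono)
    have "\<eta> * norm (left_product \<omega> k) * norm v \<le> \<eta> * C * norm v"
      using assms * by (intro mult_right_mono mult_left_mono) (auto simp: tame_def)
    then show "norm (left_product \<omega> k *v v) \<le> \<eta> * C * norm v" using * by simp
  qed (use assms in auto)
  also have "\<dots> = (C\<^sup>2 * \<eta>) * norm v" by (simp add: power2_eq_square)
  also have "\<dots> < 1 * norm v" using assms by (intro mult_strict_right_mono) auto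
  finally show False by simp
qed measurable

text \<open>
  Forgetting the last \<open>n\<close> steps costs the factor \<open>C\<^sup>2\<close> in the scale, except on the event that these steps are
  wild.
\<close>

lemma cancel_prob_left:
  assumes "C \<ge> 1" "\<eta> \<ge> 0"
  shows "cancel_prob (n + k) v \<eta> \<le> wild_prob n C + cancel_prob k v (C\<^sup>2 * \<eta>)"
proof -
  let ?Q = "{\<omega>\<in>space PP. norm (left_product \<omega> k *v v) \<le> (C\<^sup>2 * \<eta>) * norm (left_product \<omega> k) * norm v}"
  have "cancel_prob (n + k) v \<eta> \<le> (\<integral>\<omega>. wild_prob n C + indicator ?Q \<omega> \<partial>PP)"
    unfolding cancel_prob_def
  proof (rule prob_split_le[where k=k and B=2])
    have w: "0 \<le> wild_prob n C" "wild_prob n C \<le> 1" by (auto simp: wild_prob_def)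
    then show "\<bar>wild_prob n C + indicator ?Q \<omega>\<bar> \<le> 2" for \<omega> by (auto simp: indicator_def)
    fix \<omega> assume \<omega>: "\<omega> \<in> space PP"
    let ?E = "{\<omega>' \<in> space PP. comb_seq k \<omega> \<omega>' \<in> {\<omega> \<in> space PP. norm (left_product \<omega> (n + k) *v v)
                     \<le> \<eta> * norm (left_product \<omega> (n + k)) * norm v}}"
    show "P.prob ?E \<le> wild_prob n C + indicator ?Q \<omega>"
    proof (cases "\<omega> \<in> ?Q")
      case True
      then have "indicator ?Q \<omega> = (1::real)" by (rule indicator_simps)
      moreover have "P.prob ?E \<le> 1" by (rule P.prob_le_1)
      ultimately show ?thesis using w(1) by linarith
    next
      case False
      have "?E \<subseteq> {\<omega>\<in>space PP. \<not> tame C (left_product \<omega> n)}"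
      proof safe
        fix \<omega>' assume \<omega>': "\<omega>' \<in> space PP" and tame: "tame C (left_product \<omega>' n)"
          and le: "norm (left_product (comb_seq k \<omega> \<omega>') (n + k) *v v) \<le> \<eta> * norm (left_product (comb_seq k \<omega> \<omega>') (n + k)) * norm v"
        let ?A = "left_product \<omega>' n" and ?B = "left_product \<omega> k"
        have "norm (?B *v v) \<le> C * norm (?A *v (?B *v v))" by (rule tame_norm_bounds[OF tame])
        also have "\<dots> \<le> C * (\<eta> * norm (?A ** ?B) * norm v)"
          using le assms by (intro mult_left_mono) (auto simp: left_product_comb matrix_vector_mul_assoc)
        also have "\<dots> \<le> C * (\<eta> * (C * norm ?B) * norm v)"
        proof -
          have "norm (?A ** ?B) \<le> norm ?A * norm ?B" by (rule norm_matrix_mult_le)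
          also have "\<dots> \<le> C * norm ?B" by (intro mult_right_mono tame_norm_bounds[OF tame]) auto
          finally show ?thesis using assms by (intro mult_left_mono mult_right_mono) auto
        qed
        also have "\<dots> = (C\<^sup>2 * \<eta>) * norm ?B * norm v" by (simp add: power2_eq_square)
        finally show False using False \<omega> by simp
      qed
      then have "P.prob ?E \<le> wild_prob n C" unfolding wild_prob_def by (intro P.finite_measure_mono) auto
      then show ?thesis using False by simp
    qed
  qed measurable
  also have "\<dots> = wild_prob n C + cancel_prob k v (C\<^sup>2 * \<eta>)"
    unfolding cancel_prob_def
    using integral_affine_indicator(2)[OF cancel_event, of "wild_prob n C" 1 k v "C\<^sup>2 * \<eta>"] by simp
  finally show ?thesis .
qed

text \<open>
  Forgetting the first \<open>k\<close> steps replaces \<open>v\<close> by its image and costs the same factor, except on the event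
  that these steps are wild. If paths in \<open>E\<close> lead to
  images with the smaller cancellation probability \<open>u\<close>, the bound improves by \<open>P(E) * (U - u)\<close>.
\<close>

lemma cancel_prob_right:
  assumes C: "C \<ge> 1" and \<eta>: "\<eta> \<ge> 0" and "v \<noteq> 0" and "0 \<le> u" "u \<le> U"
    and U: "\<And>w. w \<noteq> 0 \<Longrightarrow> cancel_prob n w (C\<^sup>2 * \<eta>) \<le> U"
    and E: "E \<in> sets PP" and u: "\<And>\<omega>. \<omega> \<in> E \<Longrightarrow> cancel_prob n (left_product \<omega> k *v v) (C\<^sup>2 * \<eta>) \<le> u"
  shows "cancel_prob (n + k) v \<eta> \<le> wild_prob k C + U - P.prob E * (U - u)"
proof -
  let ?W = "{\<omega>\<in>space PP. \<not> tame C (left_product \<omega> k)}"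
  have "cancel_prob (n + k) v \<eta> \<le> (\<integral>\<omega>. indicator ?W \<omega> + (U - (U - u) * indicator E \<omega>) \<partial>PP)"
    unfolding cancel_prob_def
  proof (rule prob_split_le[where k=k and B="1 + U + (U - u)"])
    show "\<bar>indicator ?W \<omega> + (U - (U - u) * indicator E \<omega>)\<bar> \<le> 1 + U + (U - u)" for \<omega>
      using assms by (auto simp: indicator_def)
    show "(\<lambda>\<omega>. indicator ?W \<omega> + (U - (U - u) * indicator E \<omega>)) \<in> borel_measurable PP"
      using E by measurable
    fix \<omega> assume \<omega>: "\<omega> \<in> space PP"
    let ?E = "{\<omega>' \<in> space PP. comb_seq k \<omega> \<omega>' \<in> {\<omega> \<in> space PP. norm (left_product \<omega> (n + k) *v v)
                     \<le> \<eta> * norm (left_product \<omega> (n + k)) * norm v}}"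
    show "P.prob ?E \<le> indicator ?W \<omega> + (U - (U - u) * indicator E \<omega>)"
    proof (cases "\<omega> \<in> ?W")
      case True
      then have "indicator ?W \<omega> = (1::real)" by (rule indicator_simps)
      moreover have "P.prob ?E \<le> 1" by (rule P.prob_le_1)
      moreover have "U - (U - u) * indicator E \<omega> \<ge> 0" using assms(4,5) by (auto simp: indicator_def)
      ultimately show ?thesis by linarith
    next
      case False
      then have tame: "tame C (left_product \<omega> k)" using \<omega> by simp
      let ?B = "left_product \<omega> k"
      have "?E \<subseteq> {\<omega>'\<in>space PP. norm (left_product \<omega>' n *v (?B *v v)) \<le> (C\<^sup>2 * \<eta>) * norm (left_product \<omega>' n) * norm (?B *v v)}"
      proof safe
        fix \<omega>' assume \<omega>': "\<omega>' \<in> space PP"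
          and le: "norm (left_product (comb_seq k \<omega> \<omega>') (n + k) *v v) \<le> \<eta> * norm (left_product (comb_seq k \<omega> \<omega>') (n + k)) * norm v"
        let ?A = "left_product \<omega>' n"
        have "norm (?A *v (?B *v v)) \<le> \<eta> * norm (?A ** ?B) * norm v"
          using le by (simp add: left_product_comb matrix_vector_mul_assoc)
        also have "\<dots> \<le> \<eta> * (norm ?A * C) * (C * norm (?B *v v))"
        proof (intro mult_mono)
          have "norm (?A ** ?B) \<le> norm ?A * norm ?B" by (rule norm_matrix_mult_le)
          also have "\<dots> \<le> norm ?A * C" by (intro mult_left_mono tame_norm_bounds[OF tame]) auto
          finally show "norm (?A ** ?B) \<le> norm ?A * C" .
        qed (use \<eta> C tame_norm_bounds[OF tame] in auto)
        finally show "norm (?A *v (?B *v v)) \<le> (C\<^sup>2 * \<eta>) * norm ?A * norm (?B *v v)"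
          by (simp add: power2_eq_square mult_ac)
      qed
      then have le: "P.prob ?E \<le> cancel_prob n (?B *v v) (C\<^sup>2 * \<eta>)"
        unfolding cancel_prob_def by (intro P.finite_measure_mono) auto
      have "?B *v v \<noteq> 0" using invertible_left_product[OF \<omega>] \<open>v \<noteq> 0\<close> by simp
      then show ?thesis using le U[of "?B *v v"] u[of \<omega>] False by (auto simp: indicator_def)
    qed
  qed measurable
  also have "\<dots> = wild_prob k C + U - P.prob E * (U - u)"
  proof -
    have "(\<integral>\<omega>. indicator ?W \<omega> + (U - (U - u) * indicator E \<omega>) \<partial>PP) =
       (\<integral>\<omega>. (0 + 1 * indicator ?W \<omega>) + (U + - (U - u) * indicator E \<omega>) \<partial>PP)"
      by (rule Bochner_Integration.integral_cong) (simp_all add: algebra_simps)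
    also have "\<dots> = (\<integral>\<omega>. 0 + 1 * indicator ?W \<omega> \<partial>PP) + (\<integral>\<omega>. U + - (U - u) * indicator E \<omega> \<partial>PP)"
      by (rule Bochner_Integration.integral_add[OF integral_affine_indicator(1)[OF wild_event] integral_affine_indicator(1)[OF E]])
    also have "\<dots> = (0 + 1 * P.prob ?W) + (U + - (U - u) * P.prob E)"
      by (simp only: integral_affine_indicator(2)[OF wild_event] integral_affine_indicator(2)[OF E])
    finally show ?thesis by (simp add: wild_prob_def algebra_simps)
  qed
  finally show ?thesis .
qed

end

section \<open>Cancellation is uniformly unlikely\<close>

lemma eventually_reciprocal_less: "(e::real) > 0 \<Longrightarrow> \<forall>\<^sub>F i in sequentially. 1 / real (Suc i) < e"
  by (rule order_tendstoD(2)[OF LIMSEQ_Suc[OF lim_1_over_n]])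

locale irreducible_walk = random_walk \<mu> + contracting_semigroup G T h a v0 \<phi>
  for \<mu> :: "(real^'n^'n) measure" and G T :: "(real^'n^'n) set" and h :: "nat \<Rightarrow> real^'n^'n"
    and a :: "nat \<Rightarrow> real" and v0 \<phi> :: "real^'n" +
  assumes support: "t \<in> T \<Longrightarrow> r > 0 \<Longrightarrow> 0 < measure \<mu> {g\<in>space \<mu>. dist g t < r}"
begin

lemma first_step_prob: "P.prob {\<omega>\<in>space PP. dist (left_product \<omega> 1) t < r} = measure \<mu> {g\<in>space \<mu>. dist g t < r}"
proof -
  interpret sequence_space \<mu> by (rule sequence_space_mu)
  have ev: "{g\<in>space \<mu>. dist g t < r} \<in> sets \<mu>" by measurable
  have "measure \<mu> {g\<in>space \<mu>. dist g t < r} = measure (distr PP \<mu> (\<lambda>\<omega>. \<omega> 0)) {g\<in>space \<mu>. dist g t < r}"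
    using PiM_component[of 0] by simp
  also have "\<dots> = P.prob ((\<lambda>\<omega>. \<omega> 0) -` {g\<in>space \<mu>. dist g t < r} \<inter> space PP)"
    by (rule measure_distr) (use ev in auto)
  also have "(\<lambda>\<omega>. \<omega> 0) -` {g\<in>space \<mu>. dist g t < r} \<inter> space PP = {\<omega>\<in>space PP. dist (left_product \<omega> 1) t < r}"
    using step_in_space by auto
  finally show ?thesis by simp
qed

text \<open>
  The product is continuous and the steps are independent, so the walk follows every word in \<open>T\<close> closely with
  positive probability.
\<close>

lemma words_are_charged:
  "g \<in> set_power T k \<Longrightarrow> r > 0 \<Longrightarrow> 0 < P.prob {\<omega>\<in>space PP. dist (left_product \<omega> k) g < r}"
proof (induction k arbitrary: g r)
  case 0
  then show ?case by (simp add: P.prob_space)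
next
  case (Suc k)
  then obtain h t where g: "g = h ** t" "h \<in> set_power T k" "t \<in> T" by auto
  have "continuous_on UNIV (\<lambda>z :: (real^'n^'n) \<times> (real^'n^'n). fst z ** snd z)" by (intro continuous_intros)
  then have "isCont (\<lambda>z :: (real^'n^'n) \<times> (real^'n^'n). fst z ** snd z) (h, t)"
    by (simp add: continuous_on_eq_continuous_at)
  then obtain d where d: "d > 0" "\<And>z. dist z (h, t) < d \<Longrightarrow> dist (fst z ** snd z) (h ** t) < r"
    unfolding continuous_at_eps_delta using Suc.prems(2) by force
  have close: "dist (A ** B) g < r" if "dist A h < d / 2" "dist B t < d / 2" for A B
  proof -
    have "dist (A, B) (h, t) \<le> dist A h + dist B t"
      by (simp add: dist_Pair_Pair sqrt_sum_squares_le_sum)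
    then show ?thesis using d(2)[of "(A, B)"] that g(1) by simp
  qed
  let ?E = "{\<omega>\<in>space PP. dist (left_product \<omega> 1) t < d / 2}"
  let ?Z = "{\<omega>\<in>space PP. dist (left_product \<omega> (k + 1)) g < r}"
  let ?p = "P.prob {\<omega>\<in>space PP. dist (left_product \<omega> k) h < d / 2}"
  have "0 < P.prob ?E * ?p"
  proof (rule mult_pos_pos)
    show "0 < P.prob ?E" unfolding first_step_prob by (rule support[OF g(3)]) (use d in simp)
    show "0 < ?p" by (rule Suc.IH[OF g(2)]) (use d in simp)
  qed
  also have "P.prob ?E * ?p \<le> P.prob ?Z"
  proof (rule prob_split_ge[where k=1])
    fix \<omega> assume \<omega>: "\<omega> \<in> ?E"
    then have \<omega>s: "\<omega> \<in> space PP" by simp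
    have "{\<omega>\<in>space PP. dist (left_product \<omega> k) h < d / 2} \<subseteq> {\<omega>'\<in>space PP. comb_seq 1 \<omega> \<omega>' \<in> ?Z}"
      using \<omega> space_comb by (auto simp del: One_nat_def simp add: left_product_comb intro!: close)
    moreover have "{\<omega>'\<in>space PP. comb_seq 1 \<omega> \<omega>' \<in> ?Z} \<in> sets PP"
      by (rule prob_split_inner(2)[OF _ \<omega>s]) measurable
    ultimately show "?p \<le> P.prob {\<omega>'\<in>space PP. comb_seq 1 \<omega> \<omega>' \<in> ?Z}" by (rule P.finite_measure_mono)
  qed measurable
  finally show ?case by simp
qed

text \<open>
  Suppose that the supremum \<open>q \<eta>\<close> of the cancellation probabilities over all times and vectors does not tend
  to 0 with \<open>\<eta>\<close>, but decreases to \<open>qs > 0\<close>. Choose almost optimal times and unit vectors for \<open>\<eta> = 1 / (j + 1)\<close>;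
  the vectors accumulate at some \<open>x\<close>. Let \<open>g 0, \<dots>, g (M - 1)\<close> be words for which the vectors \<open>g l x\<close> are in
  general position, where \<open>M * qs / 2\<close> exceeds the dimension.

  The walk starts by following \<open>g l\<close> closely with a probability of at least \<open>p > 0\<close>. No conditional
  cancellation probability exceeds \<open>qs\<close> by much, and the average almost equals \<open>qs\<close>; hence after \<open>g l\<close> it is
  at least \<open>qs / 2\<close>. In other words, each vector \<open>g l x\<close> is nearly annihilated by the same random product with
  probability at least \<open>qs / 2\<close>. The expected number of nearly annihilated vectors then exceeds the dimension,
  whereas a single matrix nearly annihilates fewer vectors in general position than the dimension.
\<close>

theorem no_cancellation:
  assumes "\<epsilon> > 0"
  shows "\<exists>\<eta>>0. \<forall>n v. v \<noteq> 0 \<longrightarrow> cancel_prob n v \<eta> < \<epsilon>"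
proof (rule ccontr)
  assume neg: "\<not> ?thesis"
  let ?V = "(UNIV :: nat set) \<times> {v :: real^'n. v \<noteq> 0}"
  define q where "q \<eta> = (SUP (n, v)\<in>?V. cancel_prob n v \<eta>)" for \<eta>
  have bdd: "bdd_above ((\<lambda>(n, v). cancel_prob n v \<eta>) ` ?V)" for \<eta>
    by (rule bdd_aboveI[of _ 1]) (auto simp: cancel_prob_le_1)
  have ne: "?V \<noteq> {}" using v_nz by auto
  have q_upper: "cancel_prob n v \<eta> \<le> q \<eta>" if "v \<noteq> 0" for n v \<eta>
    unfolding q_def using cSUP_upper[OF _ bdd, of "(n, v)" \<eta>] that by simp
  have q_lower: "q \<eta> \<ge> \<epsilon>" if "\<eta> > 0" for \<eta>
    using neg that q_upper by (meson not_less order_trans)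
  define qs where "qs = (INF \<eta>\<in>{0<..}. q \<eta>)"
  have bddb: "bdd_below (q ` {0<..})" by (rule bdd_belowI[of _ \<epsilon>]) (auto simp: q_lower)
  have qs_pos: "qs \<ge> \<epsilon>" unfolding qs_def by (intro cINF_greatest) (auto simp: q_lower)
  have qs_le: "qs \<le> q \<eta>" if "\<eta> > 0" for \<eta> unfolding qs_def using that by (intro cINF_lower bddb) auto
  have qs0: "qs > 0" using qs_pos assms by simp
  have "\<exists>n w. norm w = 1 \<and> cancel_prob n w (1 / Suc j) > qs - 1 / Suc j" for j
  proof -
    have "qs - 1 / Suc j < q (1 / Suc j)" using qs_le[of "1 / Suc j"] by (simp add: less_le_trans[rotated])
    then obtain n v where v: "v \<noteq> 0" "qs - 1 / Suc j < cancel_prob n v (1 / Suc j)"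
      unfolding q_def using less_cSUP_iff[OF ne bdd] by fastforce
    then have "cancel_prob n ((1 / norm v) *\<^sub>R v) (1 / Suc j) > qs - 1 / Suc j"
      by (subst cancel_prob_scale) auto
    then show ?thesis using v(1) by (intro exI[of _ n] exI[of _ "(1 / norm v) *\<^sub>R v"]) simp
  qed
  then obtain N w where w: "\<And>j. norm (w j) = 1" "\<And>j. cancel_prob (N j) (w j) (1 / Suc j) > qs - 1 / Suc j"
    by metis
  have "compact (sphere (0 :: real^'n) 1)" by simp
  then obtain x r where x: "x \<in> sphere 0 1" "strict_mono (r :: nat \<Rightarrow> nat)" "(w \<circ> r) \<longlonglongrightarrow> x"
    using w(1) unfolding compact_def by (metis mem_sphere_0)
  have "x \<noteq> 0" using x(1) by auto
  obtain M :: nat where M: "real M * (qs / 2) > CARD('n)"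
    using reals_Archimedean3[of "qs / 2"] qs0 by auto
  have M0: "M > 0" using M by (cases M) auto
  obtain g where g: "\<And>l. l < M \<Longrightarrow> g l \<in> G"
     "\<And>U. subspace U \<Longrightarrow> U \<noteq> UNIV \<Longrightarrow> card {l. l < M \<and> g l *v x \<in> U} \<le> dim U"
    using general_position[OF \<open>x \<noteq> 0\<close>, of M] by blast
  obtain \<eta>0 where \<eta>0: "\<eta>0 > 0" "\<And>A :: real^'n^'n. A \<noteq> 0 \<Longrightarrow> card {l. l < M \<and> norm (A *v (g l *v x)) \<le> \<eta>0 * norm A} < CARD('n)"
    using general_position_quantitative[of M "\<lambda>l. g l *v x"] g(2) by blast
  obtain k where k: "\<And>l. l < M \<Longrightarrow> g l \<in> set_power T (k l)" using word[OF g(1)] by metis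
  define K where "K = Max (k ` {..<M})"
  have K: "k l \<le> K" if "l < M" for l using that by (auto simp: K_def)
  define E where "E l = {\<omega>\<in>space PP. dist (left_product \<omega> (k l)) (g l) < \<eta>0 / 4}" for l
  have E_event: "E l \<in> sets PP" for l unfolding E_def by measurable
  define p where "p = Min ((\<lambda>l. P.prob (E l)) ` {..<M})"
  have p_le: "p \<le> P.prob (E l)" if "l < M" for l using that by (auto simp: p_def)
  have p_pos: "p > 0"
  proof -
    have "P.prob (E l) > 0" if "l < M" for l
      unfolding E_def by (rule words_are_charged[OF k[OF that]]) (use \<eta>0(1) in simp)
    then show ?thesis unfolding p_def using M0 by (subst Min_gr_iff) auto
  qed
  have p1: "p \<le> 1" using p_le[OF M0] P.prob_le_1[of "E 0"] by linarith
  \<comment> \<open>The proof by contradiction below accumulates at most four errors of size \<open>\<epsilon>1\<close> against a gain of \<open>p * qs / 2\<close>.\<close>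
  define \<epsilon>1 where "\<epsilon>1 = p * qs / 16"
  have \<epsilon>1: "\<epsilon>1 > 0" "16 * \<epsilon>1 = p * qs" "16 * \<epsilon>1 \<le> qs"
    using p_pos qs0 p1 by (auto simp: \<epsilon>1_def)
  obtain C where C: "C \<ge> 1" "\<And>i. i \<le> K \<Longrightarrow> wild_prob i C \<le> \<epsilon>1" using tightness[OF \<epsilon>1(1), of K] by blast
  have C2: "C\<^sup>2 \<ge> 1" using C(1) by simp
  have "1 * C\<^sup>2 \<le> C\<^sup>2 * C\<^sup>2" using C2 by (intro mult_right_mono) auto
  then have C2: "C\<^sup>2 \<ge> 1" "C\<^sup>2 \<le> C\<^sup>2 * C\<^sup>2" using C2 by simp_all
  have "\<exists>\<eta>2>0. q \<eta>2 < qs + \<epsilon>1"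
    using cINF_less_iff[OF _ bddb, of "qs + \<epsilon>1"] \<epsilon>1(1) by (auto simp: qs_def)
  then obtain \<eta>2 where \<eta>2: "\<eta>2 > 0" "q \<eta>2 < qs + \<epsilon>1" by blast
  define W where "W = Max ((\<lambda>l. norm (g l *v x)) ` {..<M}) + \<eta>0"
  have W: "norm (g l *v x) \<le> W - \<eta>0" if "l < M" for l using that by (auto simp: W_def)
  have W_pos: "W > 0" using W[OF M0] \<eta>0(1) norm_ge_zero[of "g 0 *v x"] by linarith
  define \<eta>3 where "\<eta>3 = min \<eta>2 (\<eta>0 / (2 * W))"
  have \<eta>3: "\<eta>3 > 0" "\<eta>3 \<le> \<eta>2" "\<eta>3 * W \<le> \<eta>0 / 2"
    using \<eta>2 \<eta>0 W_pos by (auto simp: \<eta>3_def min_def field_simps)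
  have U: "cancel_prob n v \<eta> \<le> qs + \<epsilon>1" if "v \<noteq> 0" "\<eta> \<le> \<eta>3" for n v \<eta>
    using q_upper[OF that(1), of n \<eta>2] cancel_prob_mono[of \<eta> \<eta>2 n v] that(2) \<eta>2 \<eta>3 by linarith
  define H where "H = Max ((\<lambda>l. norm (g l)) ` {..<M}) + 1"
  have H1: "norm (g l) \<le> H - 1" if "l < M" for l
  proof -
    have "norm (g l) \<le> Max ((\<lambda>l. norm (g l)) ` {..<M})" by (rule Max_ge) (use that in auto)
    then show ?thesis by (simp add: H_def)
  qed
  then have H: "norm (g l) \<le> H" if "l < M" for l using that by force
  have H_pos: "H > 0" using H1[OF M0] norm_ge_zero[of "g 0"] by linarith
  have "\<forall>\<^sub>F i in sequentially. dist ((w \<circ> r) i) x < \<eta>0 / (4 * H)"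
    by (rule tendstoD[OF x(3)]) (use \<eta>0 H_pos in simp)
  moreover have "\<forall>\<^sub>F i in sequentially. 1 / real (Suc i) < min \<epsilon>1 (min (\<eta>3 / (C\<^sup>2 * C\<^sup>2)) (1 / C\<^sup>2))"
    by (rule eventually_reciprocal_less) (use \<epsilon>1 \<eta>3 C(1) in simp)
  ultimately have "\<forall>\<^sub>F i in sequentially. dist ((w \<circ> r) i) x < \<eta>0 / (4 * H) \<and>
      1 / real (Suc i) < min \<epsilon>1 (min (\<eta>3 / (C\<^sup>2 * C\<^sup>2)) (1 / C\<^sup>2))" by (rule eventually_conj)
  then obtain i where i: "dist (w (r i)) x < \<eta>0 / (4 * H)" "1 / real (Suc i) < \<epsilon>1"
      "1 / real (Suc i) < \<eta>3 / (C\<^sup>2 * C\<^sup>2)" "1 / real (Suc i) < 1 / C\<^sup>2"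
    using eventually_happens by force
  define J where "J = r i"
  define \<eta> where "\<eta> = 1 / real (Suc J)"
  have "i \<le> J" unfolding J_def by (rule seq_suble[OF x(2)])
  then have le: "\<eta> \<le> 1 / real (Suc i)" unfolding \<eta>_def by (intro divide_left_mono) auto
  have "0 < \<eta>" by (simp add: \<eta>_def)
  then have \<eta>: "0 < \<eta>" "\<eta> < \<epsilon>1" "\<eta> < \<eta>3 / (C\<^sup>2 * C\<^sup>2)" "\<eta> < 1 / C\<^sup>2"
    using le_less_trans[OF le] i by blast+
  have \<eta>C: "C\<^sup>2 * \<eta> < 1" "C\<^sup>2 * (C\<^sup>2 * \<eta>) \<le> \<eta>3"
    using \<eta> C2 C by (auto simp: field_simps)
  define y where "y = w J"
  have y: "norm y = 1" "y \<noteq> 0" "dist y x < \<eta>0 / (4 * H)" using w(1)[of J] i(1) by (auto simp: y_def J_def)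
  have big: "cancel_prob (N J) y \<eta> > qs - \<epsilon>1"
    using w(2)[of J] \<eta>(2) by (simp add: y_def \<eta>_def)
  have "N J > K"
  proof (rule ccontr)
    assume "\<not> N J > K"
    then have "cancel_prob (N J) y \<eta> \<le> \<epsilon>1"
      using cancel_prob_small[OF \<eta>C(1) C(1) y(2), of "N J"] \<eta>(1) C(2)[of "N J"] by simp
    then show False using big \<epsilon>1 by linarith
  qed
  \<comment> \<open>The words have different lengths \<open>k l\<close>; dropping \<open>K - k l\<close> steps at the end leaves \<open>n\<close> steps for every \<open>l\<close>.\<close>
  define n where "n = N J - K"
  have "\<exists>\<omega>\<in>E l. cancel_prob n (left_product \<omega> (k l) *v y) \<eta>3 \<ge> qs / 2" if l: "l < M" for l
  proof (rule ccontr)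
    assume "\<not> ?thesis"
    then have u: "cancel_prob n (left_product \<omega> (k l) *v y) (C\<^sup>2 * (C\<^sup>2 * \<eta>)) \<le> qs / 2" if "\<omega> \<in> E l" for \<omega>
      using that cancel_prob_mono[OF \<eta>C(2), of n "left_product \<omega> (k l) *v y"] by force
    have "N J = (K - k l) + (n + k l)" using K[OF l] \<open>N J > K\<close> by (simp add: n_def)
    then have 1: "cancel_prob (N J) y \<eta> \<le> wild_prob (K - k l) C + cancel_prob (n + k l) y (C\<^sup>2 * \<eta>)"
      using cancel_prob_left[OF C(1), of \<eta> "K - k l" "n + k l" y] \<eta>(1) by simp
    have 2: "cancel_prob (n + k l) y (C\<^sup>2 * \<eta>) \<le> wild_prob (k l) C + (qs + \<epsilon>1) - P.prob (E l) * (qs + \<epsilon>1 - qs / 2)"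
      by (rule cancel_prob_right[OF C(1) _ y(2) _ _ _ E_event u]) (use \<eta> qs0 \<epsilon>1 U[OF _ \<eta>C(2)] in auto)
    have 3: "P.prob (E l) * (qs + \<epsilon>1 - qs / 2) \<ge> p * (qs / 2)"
      using p_le[OF l] p_pos qs0 \<epsilon>1 by (intro mult_mono) auto
    have "cancel_prob (N J) y \<eta> \<le> \<epsilon>1 + (\<epsilon>1 + (qs + \<epsilon>1) - p * (qs / 2))"
      using 1 2 3 C(2)[of "K - k l"] C(2)[OF K[OF l]] by simp
    then show False using big \<epsilon>1 by simp
  qed
  then obtain \<Omega> where \<Omega>: "\<And>l. l < M \<Longrightarrow> \<Omega> l \<in> E l"
     "\<And>l. l < M \<Longrightarrow> cancel_prob n (left_product (\<Omega> l) (k l) *v y) \<eta>3 \<ge> qs / 2" by metis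
  define B where "B l = {\<omega>\<in>space PP. norm (left_product \<omega> n *v (g l *v x)) \<le> \<eta>0 * norm (left_product \<omega> n)}" for l
  have B_event: "B l \<in> sets PP" for l unfolding B_def by measurable
  have B_prob: "P.prob (B l) \<ge> qs / 2" if l: "l < M" for l
  proof -
    let ?A = "left_product (\<Omega> l) (k l)"
    let ?z = "?A *v y"
    have "?z - g l *v x = (?A - g l) *v y + g l *v (y - x)"
      by (simp add: matrix_vector_mult_diff_rdistrib matrix_vector_mult_diff_distrib)
    then have "norm (?z - g l *v x) \<le> norm ((?A - g l) *v y) + norm (g l *v (y - x))"
      by (simp add: norm_triangle_ineq)
    also have "\<dots> \<le> norm (?A - g l) * norm y + norm (g l) * norm (y - x)"
      by (intro add_mono norm_matrix_vector_mult_le)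
    also have "\<dots> \<le> \<eta>0 / 4 * 1 + H * (\<eta>0 / (4 * H))"
      using \<Omega>(1)[OF l] y H[OF l] H_pos \<eta>0(1) by (intro add_mono mult_mono) (auto simp: E_def dist_norm)
    also have "\<dots> = \<eta>0 / 2" using H_pos by simp
    finally have close: "norm (?z - g l *v x) \<le> \<eta>0 / 2" .
    have zW: "norm ?z \<le> W"
      using W[OF l] close norm_triangle_sub[of ?z "g l *v x"] \<eta>0(1) by linarith
    have "{\<omega>\<in>space PP. norm (left_product \<omega> n *v ?z) \<le> \<eta>3 * norm (left_product \<omega> n) * norm ?z} \<subseteq> B l"
      unfolding B_def
    proof safe
      fix \<omega> assume le: "norm (left_product \<omega> n *v ?z) \<le> \<eta>3 * norm (left_product \<omega> n) * norm ?z"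
      let ?L = "left_product \<omega> n"
      have "norm (?L *v (g l *v x)) = norm (?L *v ?z - ?L *v (?z - g l *v x))"
        by (simp add: matrix_vector_mult_diff_distrib)
      also have "\<dots> \<le> norm (?L *v ?z) + norm (?L *v (?z - g l *v x))" by (rule norm_triangle_ineq4)
      also have "\<dots> \<le> \<eta>3 * norm ?L * norm ?z + norm ?L * (\<eta>0 / 2)"
      proof -
        have "norm (?L *v (?z - g l *v x)) \<le> norm ?L * norm (?z - g l *v x)" by (rule norm_matrix_vector_mult_le)
        also have "\<dots> \<le> norm ?L * (\<eta>0 / 2)" using close by (rule mult_left_mono) simp
        finally show ?thesis using le by linarith
      qed
      also have "\<eta>3 * norm ?L * norm ?z \<le> \<eta>3 * norm ?L * W" using zW \<eta>3 by (intro mult_left_mono) auto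
      also have "\<eta>3 * norm ?L * W + norm ?L * (\<eta>0 / 2) = norm ?L * (\<eta>3 * W + \<eta>0 / 2)" by (simp add: algebra_simps)
      also have "\<dots> \<le> norm ?L * \<eta>0" using \<eta>3 by (intro mult_left_mono) auto
      finally show "norm (?L *v (g l *v x)) \<le> \<eta>0 * norm ?L" by (simp add: mult.commute)
    qed
    then have "cancel_prob n ?z \<eta>3 \<le> P.prob (B l)"
      unfolding cancel_prob_def by (intro P.finite_measure_mono B_event)
    then show ?thesis using \<Omega>(2)[OF l] by simp
  qed
  \<comment> \<open>Both sides are the expected number of vectors that are nearly annihilated by the product of \<open>n\<close> steps.\<close>
  have "real M * (qs / 2) \<le> (\<Sum>l<M. P.prob (B l))"
    using sum_mono[of "{..<M}" "\<lambda>_. qs / 2" "\<lambda>l. P.prob (B l)"] B_prob by simp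
  also have "\<dots> = (\<integral>\<omega>. (\<Sum>l<M. indicator (B l) \<omega>) \<partial>PP)"
  proof -
    have "(\<integral>\<omega>. (\<Sum>l<M. 0 + 1 * indicator (B l) \<omega>) \<partial>PP) = (\<Sum>l<M. 0 + 1 * P.prob (B l))"
      by (simp only: Bochner_Integration.integral_sum[OF integral_affine_indicator(1)[OF B_event]] integral_affine_indicator(2)[OF B_event])
    then show ?thesis by simp
  qed
  also have "\<dots> \<le> (\<integral>\<omega>. real CARD('n) \<partial>PP)"
  proof (rule integral_mono)
    show "integrable PP (\<lambda>\<omega>. \<Sum>l<M. indicator (B l) \<omega> :: real)"
    proof -
      have "integrable PP (\<lambda>\<omega>. \<Sum>l<M. 0 + 1 * indicator (B l) \<omega> :: real)"
        by (intro Bochner_Integration.integrable_sum integral_affine_indicator(1) B_event)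
      then show ?thesis by simp
    qed
    fix \<omega> assume \<omega>: "\<omega> \<in> space PP"
    have "left_product \<omega> n \<noteq> 0"
      using invertible_left_product[OF \<omega>, of n] \<open>x \<noteq> 0\<close> by (metis invertible_mult_eq_0_iff matrix_vector_mult_0)
    then have "card {l. l < M \<and> norm (left_product \<omega> n *v (g l *v x)) \<le> \<eta>0 * norm (left_product \<omega> n)} < CARD('n)"
      by (rule \<eta>0(2))
    moreover have "(\<Sum>l<M. indicator (B l) \<omega>) = real (card {l\<in>{..<M}. \<omega> \<in> B l})"
      by (simp add: indicator_def sum.If_cases Int_def)
    moreover have "{l\<in>{..<M}. \<omega> \<in> B l} = {l. l < M \<and> norm (left_product \<omega> n *v (g l *v x)) \<le> \<eta>0 * norm (left_product \<omega> n)}"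
      using \<omega> by (auto simp: B_def)
    ultimately show "(\<Sum>l<M. indicator (B l) \<omega>) \<le> real CARD('n)" by simp
  qed auto
  also have "\<dots> = CARD('n)" by (simp add: P.prob_space)
  finally show False using M by linarith
qed

text \<open>
  If \<open>B\<close> nearly annihilates \<open>v\<close>, so do most products \<open>L B\<close>. Indeed \<open>B\<close> stretches some unit vector \<open>e\<close> by a
  fixed share of its norm, and with probability at least one half \<open>L\<close> does not cancel on \<open>B e\<close>. Then the norm
  of \<open>L B\<close> is comparable to the product of the norms of \<open>L\<close> and \<open>B\<close>.
\<close>

lemma cancellation_persists:
  fixes B :: "real^'n^'n" and v :: "real^'n"
  assumes half: "\<And>n w. w \<noteq> 0 \<Longrightarrow> cancel_prob n w \<eta>1 \<le> 1/2" and "\<eta>1 > 0" "\<eta> \<ge> 0"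
    and bad: "norm (B *v v) \<le> \<eta> * norm B * norm v" and B: "invertible B"
  shows "1/2 \<le> P.prob {\<omega>\<in>space PP. norm (left_product \<omega> N *v (B *v v)) \<le> (\<eta> * CARD('n) / \<eta>1) * norm (left_product \<omega> N ** B) * norm v}"
proof -
  obtain e where e: "norm e = 1" "norm B \<le> CARD('n) * norm (B *v e)" using norm_matrix_attained_up_to_card by blast
  have "B *v e \<noteq> 0" using B e(1) by auto
  let ?Q = "{\<omega>\<in>space PP. norm (left_product \<omega> N *v (B *v e)) \<le> \<eta>1 * norm (left_product \<omega> N) * norm (B *v e)}"
  have Q: "?Q \<in> sets PP" by (rule cancel_event)
  have "1/2 \<le> 1 - P.prob ?Q" using half[OF \<open>B *v e \<noteq> 0\<close>, of N] by (simp add: cancel_prob_def)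
  also have "\<dots> = P.prob (space PP - ?Q)" using P.prob_compl[OF Q] by simp
  also have "\<dots> \<le> P.prob {\<omega>\<in>space PP. norm (left_product \<omega> N *v (B *v v)) \<le> (\<eta> * CARD('n) / \<eta>1) * norm (left_product \<omega> N ** B) * norm v}"
  proof (rule P.finite_measure_mono)
    show "space PP - ?Q \<subseteq> {\<omega>\<in>space PP. norm (left_product \<omega> N *v (B *v v)) \<le> (\<eta> * CARD('n) / \<eta>1) * norm (left_product \<omega> N ** B) * norm v}"
    proof safe
      fix \<omega>
      assume "\<not> norm (left_product \<omega> N *v (B *v e)) \<le> \<eta>1 * norm (left_product \<omega> N) * norm (B *v e)"
      then have gt: "norm (left_product \<omega> N) * norm (B *v e) \<le> norm (left_product \<omega> N *v (B *v e)) / \<eta>1"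
        using \<open>\<eta>1 > 0\<close> by (simp add: field_simps)
      let ?L = "left_product \<omega> N"
      have "norm (?L *v (B *v v)) \<le> norm ?L * norm (B *v v)" by (rule norm_matrix_vector_mult_le)
      also have "\<dots> \<le> norm ?L * (\<eta> * (CARD('n) * norm (B *v e)) * norm v)"
      proof (rule mult_left_mono)
        have "\<eta> * norm B * norm v \<le> \<eta> * (CARD('n) * norm (B *v e)) * norm v"
          using e(2) \<open>\<eta> \<ge> 0\<close> by (intro mult_right_mono mult_left_mono) auto
        then show "norm (B *v v) \<le> \<eta> * (CARD('n) * norm (B *v e)) * norm v" using bad by linarith
      qed simp
      also have "\<dots> = (\<eta> * CARD('n) * norm v) * (norm ?L * norm (B *v e))" by (simp add: mult_ac)
      also have "\<dots> \<le> (\<eta> * CARD('n) * norm v) * (norm (?L ** B) / \<eta>1)"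
      proof (rule mult_left_mono)
        have "norm (?L *v (B *v e)) \<le> norm (?L ** B) * norm e"
          unfolding matrix_vector_mul_assoc by (rule norm_matrix_vector_mult_le)
        then have "norm (?L *v (B *v e)) / \<eta>1 \<le> norm (?L ** B) / \<eta>1"
          using e(1) \<open>\<eta>1 > 0\<close> by (simp add: divide_right_mono)
        then show "norm ?L * norm (B *v e) \<le> norm (?L ** B) / \<eta>1" using gt by linarith
      qed (use \<open>\<eta> \<ge> 0\<close> in auto)
      finally show "norm (?L *v (B *v v)) \<le> (\<eta> * CARD('n) / \<eta>1) * norm (?L ** B) * norm v"
        by (simp add: mult_ac)
    qed
  qed measurable
  finally show ?thesis .
qed

text \<open>
  A maximal inequality of Ottaviani type: if cancellation occurs at some time up to \<open>N\<close>, it is still present at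
  time \<open>N\<close>, with a worse constant, with conditional probability at least one half. The induction splits
  off the first step, which is absorbed into \<open>B\<close>, and so replaces the first time of cancellation.
\<close>

lemma cancellation_maximal_inequality:
  fixes B :: "real^'n^'n" and v :: "real^'n"
  assumes half: "\<And>n w. w \<noteq> 0 \<Longrightarrow> cancel_prob n w \<eta>1 \<le> 1/2" and "\<eta>1 > 0" "\<eta> \<ge> 0"
    and "v \<noteq> 0" and "invertible B"
  shows "P.prob {\<omega>\<in>space PP. \<exists>n\<le>N. norm (left_product \<omega> n *v (B *v v)) \<le> \<eta> * norm (left_product \<omega> n ** B) * norm v}
    \<le> 2 * P.prob {\<omega>\<in>space PP. norm (left_product \<omega> N *v (B *v v)) \<le> (\<eta> * CARD('n) / \<eta>1) * norm (left_product \<omega> N ** B) * norm v}"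
  using \<open>invertible B\<close>
proof (induction N arbitrary: B)
    case 0
    show ?case
    proof (cases "norm (B *v v) \<le> \<eta> * norm B * norm v")
      case True
      have "P.prob {\<omega>\<in>space PP. \<exists>n\<le>0. norm (left_product \<omega> n *v (B *v v)) \<le> \<eta> * norm (left_product \<omega> n ** B) * norm v} \<le> 1"
        by simp
      then show ?thesis using cancellation_persists[OF half assms(2,3) True 0, of 0] by linarith
    next
      case False
      then show ?thesis by simp
    qed
  next
    case (Suc N)
    show ?case
    proof (cases "norm (B *v v) \<le> \<eta> * norm B * norm v")
      case True
      have "P.prob {\<omega>\<in>space PP. \<exists>n\<le>Suc N. norm (left_product \<omega> n *v (B *v v)) \<le> \<eta> * norm (left_product \<omega> n ** B) * norm v} \<le> 1"
        by simp
      then show ?thesis using cancellation_persists[OF half assms(2,3) True Suc.prems, of "Suc N"] by linarith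
    next
      case False
      let ?\<eta> = "\<eta> * CARD('n) / \<eta>1"
      let ?X = "\<lambda>N B. {\<omega>\<in>space PP. \<exists>n\<le>N. norm (left_product \<omega> n *v (B *v v)) \<le> \<eta> * norm (left_product \<omega> n ** B) * norm v}"
      let ?Y = "\<lambda>N B. {\<omega>\<in>space PP. norm (left_product \<omega> N *v (B *v v)) \<le> ?\<eta> * norm (left_product \<omega> N ** B) * norm v}"
      have Y: "?Y N B \<in> sets PP" for N B by measurable
      have step: "left_product (comb_seq 1 \<omega> \<omega>') (Suc m) = left_product \<omega>' m ** left_product \<omega> 1" for \<omega> \<omega>' :: "nat \<Rightarrow> real^'n^'n" and m
        unfolding Suc_eq_plus1 by (rule left_product_comb)
      have Y1: "{\<omega>'\<in>space PP. comb_seq 1 \<omega> \<omega>' \<in> ?Y (Suc N) B} = ?Y N (left_product \<omega> 1 ** B)" if \<omega>: "\<omega> \<in> space PP" for \<omega>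
      proof (rule Collect_cong, rule conj_cong[OF refl])
        fix \<omega>' assume "\<omega>' \<in> space PP"
        then show "(comb_seq 1 \<omega> \<omega>' \<in> ?Y (Suc N) B) = (norm (left_product \<omega>' N *v (left_product \<omega> 1 ** B *v v))
          \<le> ?\<eta> * norm (left_product \<omega>' N ** (left_product \<omega> 1 ** B)) * norm v)"
          unfolding mem_Collect_eq step
          by (simp only: space_comb[OF \<omega>] simp_thms matrix_vector_mul_assoc matrix_mul_assoc)
      qed
      have X1: "{\<omega>'\<in>space PP. comb_seq 1 \<omega> \<omega>' \<in> ?X (Suc N) B} \<subseteq> ?X N (left_product \<omega> 1 ** B)" if "\<omega> \<in> space PP" for \<omega>
      proof safe
        fix \<omega>' n assume n: "n \<le> Suc N" and le: "norm (left_product (comb_seq 1 \<omega> \<omega>') n *v (B *v v))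
          \<le> \<eta> * norm (left_product (comb_seq 1 \<omega> \<omega>') n ** B) * norm v"
        then obtain m where m: "n = Suc m" using False by (cases n) auto
        show "\<exists>n\<le>N. norm (left_product \<omega>' n *v (left_product \<omega> 1 ** B *v v))
             \<le> \<eta> * norm (left_product \<omega>' n ** (left_product \<omega> 1 ** B)) * norm v"
        proof (intro exI[of _ m] conjI)
          show "m \<le> N" using n m by simp
          show "norm (left_product \<omega>' m *v (left_product \<omega> 1 ** B *v v))
             \<le> \<eta> * norm (left_product \<omega>' m ** (left_product \<omega> 1 ** B)) * norm v"
            using le unfolding m step by (simp only: matrix_vector_mul_assoc matrix_mul_assoc)
        qed
      qed
      have "P.prob (?X (Suc N) B) \<le> (\<integral>\<omega>. 2 * (\<integral>\<omega>'. indicator (?Y (Suc N) B) (comb_seq 1 \<omega> \<omega>') \<partial>PP) \<partial>PP)"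
      proof (rule prob_split_le[where k=1 and B=2])
        have ind: "(indicator (?Y (Suc N) B) :: _ \<Rightarrow> real) \<in> borel_measurable PP" using Y[of "Suc N" B] by simp
        show "(\<lambda>\<omega>. 2 * (\<integral>\<omega>'. indicator (?Y (Suc N) B) (comb_seq 1 \<omega> \<omega>') \<partial>PP) :: real) \<in> borel_measurable PP"
          using measurable_split_integral[OF ind, of 1] by measurable
        show "\<bar>2 * (\<integral>\<omega>'. indicator (?Y (Suc N) B) (comb_seq 1 \<omega> \<omega>') \<partial>PP)\<bar> \<le> (2::real)" if "\<omega> \<in> space PP" for \<omega>
        proof -
          have "0 \<le> P.prob Z" "P.prob Z \<le> 1" for Z by simp_all
          then have "\<bar>2 * P.prob Z\<bar> \<le> 2" for Z by (simp only: abs_mult) simp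
          then show ?thesis unfolding prob_split_inner(1)[OF Y that] .
        qed
        fix \<omega> assume \<omega>: "\<omega> \<in> space PP"
        have inv: "invertible (left_product \<omega> 1 ** B)"
          using invertible_left_product[OF \<omega>] Suc.prems by (intro invertible_mult)
        have "P.prob {\<omega>'\<in>space PP. comb_seq 1 \<omega> \<omega>' \<in> ?X (Suc N) B} \<le> P.prob (?X N (left_product \<omega> 1 ** B))"
          by (intro P.finite_measure_mono X1[OF \<omega>]) measurable
        also have "\<dots> \<le> 2 * P.prob (?Y N (left_product \<omega> 1 ** B))"
          using Suc.IH[OF inv] by (simp only: matrix_vector_mul_assoc)
        also have "\<dots> = 2 * (\<integral>\<omega>'. indicator (?Y (Suc N) B) (comb_seq 1 \<omega> \<omega>') \<partial>PP)"
          using prob_split_inner(1)[OF Y[of "Suc N" B] \<omega>, of 1] by (simp only: Y1[OF \<omega>])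
        finally show "P.prob {\<omega>'\<in>space PP. comb_seq 1 \<omega> \<omega>' \<in> ?X (Suc N) B} \<le>
            2 * (\<integral>\<omega>'. indicator (?Y (Suc N) B) (comb_seq 1 \<omega> \<omega>') \<partial>PP)" .
      qed measurable
      also have "\<dots> = 2 * (\<integral>\<omega>. indicator (?Y (Suc N) B) \<omega> \<partial>PP)"
        using integral_split[of "indicator (?Y (Suc N) B)" 1 1] Y[of "Suc N" B] by (simp add: indicator_def)
      also have "\<dots> = 2 * P.prob (?Y (Suc N) B)" using Y[of "Suc N" B] by simp
      finally show ?thesis .
    qed
qed

text \<open>
  The maximal inequality bounds the probability of cancellation at any time by twice that of cancellation at
  one late time, which is small by \<open>no_cancellation\<close>.
\<close>

theorem no_cancellation_ever:
  assumes "\<epsilon> > 0"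
  shows "\<exists>\<eta>>0. \<forall>v. v \<noteq> 0 \<longrightarrow>
    P.prob {\<omega>\<in>space PP. \<exists>n. norm (left_product \<omega> n *v v) \<le> \<eta> * norm (left_product \<omega> n) * norm v} \<le> \<epsilon>"
proof -
  obtain \<eta>1 where \<eta>1: "\<eta>1 > 0" "\<And>n w. w \<noteq> 0 \<Longrightarrow> cancel_prob n w \<eta>1 < 1/2"
    using no_cancellation[of "1/2"] by auto
  obtain \<eta>2 where \<eta>2: "\<eta>2 > 0" "\<And>n w. w \<noteq> 0 \<Longrightarrow> cancel_prob n w \<eta>2 < \<epsilon> / 2"
    using no_cancellation[of "\<epsilon> / 2"] assms by auto
  define \<eta> where "\<eta> = \<eta>2 * \<eta>1 / CARD('n)"
  have \<eta>: "\<eta> > 0" "\<eta> * CARD('n) / \<eta>1 = \<eta>2" using \<eta>1 \<eta>2 by (auto simp: \<eta>_def)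
  have "P.prob {\<omega>\<in>space PP. \<exists>n. norm (left_product \<omega> n *v v) \<le> \<eta> * norm (left_product \<omega> n) * norm v} \<le> \<epsilon>" if v: "v \<noteq> 0" for v
  proof -
    define X where "X N = {\<omega>\<in>space PP. \<exists>n\<le>N. norm (left_product \<omega> n *v v) \<le> \<eta> * norm (left_product \<omega> n) * norm v}" for N
    have bound: "P.prob (X N) \<le> \<epsilon>" for N
    proof -
      have "invertible (mat 1 :: real^'n^'n)" by (auto simp: invertible_def intro!: exI[of _ "mat 1"])
      then have "P.prob (X N) \<le> 2 * cancel_prob N v \<eta>2"
        using cancellation_maximal_inequality[of \<eta>1 \<eta> v "mat 1" N] \<eta>1 \<eta> v
        by (simp add: X_def cancel_prob_def less_imp_le)
      then show ?thesis using \<eta>2(2)[OF v, of N] by simp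
    qed
    have "(\<lambda>N. P.prob (X N)) \<longlonglongrightarrow> P.prob (\<Union>N. X N)"
    proof (rule P.finite_Lim_measure_incseq)
      show "range X \<subseteq> sets PP" unfolding X_def by (auto intro!: measurable_sets) measurable
      show "incseq X" by (auto simp: incseq_def X_def intro: order_trans)
    qed
    then have "P.prob (\<Union>N. X N) \<le> \<epsilon>" by (rule LIMSEQ_le_const2) (use bound in auto)
    moreover have "(\<Union>N. X N) = {\<omega>\<in>space PP. \<exists>n. norm (left_product \<omega> n *v v) \<le> \<eta> * norm (left_product \<omega> n) * norm v}"
      by (auto simp: X_def)
    ultimately show ?thesis by simp
  qed
  then show ?thesis using \<eta>(1) by blast
qed

end

section \<open>Functions invariant under homotheties\<close>

text \<open>
  These are the continuous functions on the quotient, seen on the vector space. The value 0 at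
  the origin is a convention.
\<close>

definition homothety_invariant :: "real \<Rightarrow> (real^'n \<Rightarrow> real) \<Rightarrow> bool" where
  "homothety_invariant c F \<longleftrightarrow> continuous_on (- {0}) F \<and> F 0 = 0 \<and>
     (\<forall>v. F (c *\<^sub>R v) = F v \<and> F (- v) = F v)"

lemma homothety_invariant_power_int:
  assumes "homothety_invariant c F" "c > 1"
  shows "F ((c powi k) *\<^sub>R v) = F v"
proof -
  have nat: "F (c ^ n *\<^sub>R v) = F v" for n v
  proof (induction n)
    case (Suc n)
    have "F (c ^ Suc n *\<^sub>R v) = F (c *\<^sub>R (c ^ n *\<^sub>R v))" by simp
    also have "\<dots> = F (c ^ n *\<^sub>R v)" using assms(1) unfolding homothety_invariant_def by blast
    finally show ?case using Suc by simp
  qed simp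
  show ?thesis
  proof (cases "k \<ge> 0")
    case True
    then show ?thesis using nat by (simp add: power_int_def)
  next
    case False
    have "F (c ^ nat (- k) *\<^sub>R ((c powi k) *\<^sub>R v)) = F ((c powi k) *\<^sub>R v)" by (rule nat)
    moreover have "c ^ nat (- k) * (c powi k) = 1" using False assms(2) by (simp add: power_int_def field_simps)
    ultimately show ?thesis by simp
  qed
qed

text \<open>
  The annulus \<open>1 \<le> norm v < c\<close> is a fundamental domain for the homotheties with positive ratio.
\<close>

lemma annulus_representative:
  fixes v :: "real^'n"
  assumes "c > 1" "v \<noteq> 0"
  shows "\<exists>k::int. 1 \<le> norm ((c powi k) *\<^sub>R v) \<and> norm ((c powi k) *\<^sub>R v) < c"
proof -
  define k where "k = \<lfloor>log c (norm v)\<rfloor>"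
  have "c powr k \<le> norm v \<and> norm v < c powr (k + 1)"
    using floor_log_eq_powr_iff[of "norm v" c k] assms by (simp add: k_def)
  then have *: "c powi k \<le> norm v" "norm v < c powi k * c"
    using assms by (auto simp: powr_real_of_int' power_int_add powr_add)
  have "c powi k > 0" using assms by simp
  then have "1 \<le> norm ((c powi (-k)) *\<^sub>R v) \<and> norm ((c powi (-k)) *\<^sub>R v) < c"
    using * by (simp add: power_int_minus field_simps)
  then show ?thesis by blast
qed

text \<open>
  After rescaling, \<open>v\<close> lies in the annulus from 1 to \<open>c\<close> and \<open>w\<close> in the larger compact annulus from 1/2 to
  \<open>2 * c\<close>, where continuity is uniform. Closeness is therefore measured relative to the norm of \<open>v\<close>.
\<close>

lemma homothety_invariant_uniformly_continuous:
  fixes F :: "real^'n \<Rightarrow> real"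
  assumes F: "homothety_invariant c F" and c: "c > 1" and "\<epsilon> > 0"
  shows "\<exists>\<delta>>0. \<forall>v w. v \<noteq> 0 \<longrightarrow> norm (v - w) \<le> \<delta> * norm v \<longrightarrow> w \<noteq> 0 \<and> \<bar>F v - F w\<bar> < \<epsilon>"
proof -
  let ?K = "cball 0 (2 * c) - ball 0 (1/2) :: (real^'n) set"
  have "continuous_on ?K F"
    using F unfolding homothety_invariant_def by (auto elim!: continuous_on_subset)
  then have "uniformly_continuous_on ?K F"
    by (intro compact_uniformly_continuous compact_diff) auto
  then obtain \<delta>0 where \<delta>0: "\<delta>0 > 0" "\<And>x y. x \<in> ?K \<Longrightarrow> y \<in> ?K \<Longrightarrow> dist y x < \<delta>0 \<Longrightarrow> dist (F y) (F x) < \<epsilon>"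
    unfolding uniformly_continuous_on_def using \<open>\<epsilon> > 0\<close> by metis
  define \<delta> where "\<delta> = min (1/2) (\<delta>0 / (2 * c))"
  have \<delta>: "\<delta> > 0" "\<delta> \<le> 1/2" "\<delta> * c < \<delta>0" using \<delta>0(1) c by (auto simp: \<delta>_def min_def field_simps)
  show ?thesis
  proof (intro exI[of _ \<delta>] conjI allI impI \<delta>(1))
    fix v w :: "real^'n" assume v: "v \<noteq> 0" and close: "norm (v - w) \<le> \<delta> * norm v"
    show "w \<noteq> 0"
    proof
      assume "w = 0"
      then have "norm v \<le> \<delta> * norm v" using close by simp
      also have "\<dots> \<le> 1/2 * norm v" using \<delta>(2) by (rule mult_right_mono) simp
      finally have "norm v \<le> 1/2 * norm v" .
      then show False using v by simp
    qed
    obtain k :: int where k: "1 \<le> norm ((c powi k) *\<^sub>R v)" "norm ((c powi k) *\<^sub>R v) < c"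
      using annulus_representative[OF c v] by blast
    define t where "t = c powi k"
    have t: "t > 0" using c by (simp add: t_def)
    have tv: "1 \<le> norm (t *\<^sub>R v)" "norm (t *\<^sub>R v) < c" unfolding t_def by (rule k)+
    have "norm (t *\<^sub>R v - t *\<^sub>R w) = t * norm (v - w)" using t by (simp flip: scaleR_diff_right)
    also have "\<dots> \<le> \<delta> * norm (t *\<^sub>R v)" using close t by (simp add: mult.left_commute)
    finally have d: "norm (t *\<^sub>R v - t *\<^sub>R w) \<le> \<delta> * norm (t *\<^sub>R v)" .
    have d2: "\<delta> * norm (t *\<^sub>R v) \<le> 1/2 * norm (t *\<^sub>R v)" using \<delta> by (intro mult_right_mono) auto
    have "norm (t *\<^sub>R v) \<le> norm (t *\<^sub>R w) + norm (t *\<^sub>R v - t *\<^sub>R w)"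
      using norm_triangle_sub[of "t *\<^sub>R v" "t *\<^sub>R w"] by simp
    moreover have "norm (t *\<^sub>R w) \<le> norm (t *\<^sub>R v) + norm (t *\<^sub>R v - t *\<^sub>R w)"
      using norm_triangle_sub[of "t *\<^sub>R w" "t *\<^sub>R v"] by (simp add: norm_minus_commute)
    ultimately have tw: "1/2 \<le> norm (t *\<^sub>R w)" "norm (t *\<^sub>R w) \<le> 2 * c"
      using tv d d2 c by linarith+
    have "\<delta> * norm (t *\<^sub>R v) \<le> \<delta> * c" using tv \<delta> by (intro mult_left_mono) auto
    then have "dist (t *\<^sub>R v) (t *\<^sub>R w) < \<delta>0" using d \<delta>(3) by (simp add: dist_norm)
    moreover have "t *\<^sub>R v \<in> ?K" using tv c unfolding mem_ball mem_cball Diff_iff dist_0_norm by linarith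
    moreover have "t *\<^sub>R w \<in> ?K" using tw c unfolding mem_ball mem_cball Diff_iff dist_0_norm by linarith
    ultimately have "dist (F (t *\<^sub>R v)) (F (t *\<^sub>R w)) < \<epsilon>" using \<delta>0(2) by blast
    then show "\<bar>F v - F w\<bar> < \<epsilon>"
      unfolding t_def homothety_invariant_power_int[OF F c] by (simp add: dist_real_def)
  qed
qed

lemma homothety_invariant_bounded:
  fixes F :: "real^'n \<Rightarrow> real"
  assumes F: "homothety_invariant c F" and c: "c > 1"
  shows "\<exists>B>0. \<forall>v. \<bar>F v\<bar> \<le> B"
proof -
  let ?K = "cball 0 c - ball 0 1 :: (real^'n) set"
  have "continuous_on ?K F"
    using F unfolding homothety_invariant_def by (auto elim!: continuous_on_subset)
  then have "compact (F ` ?K)" by (intro compact_continuous_image compact_diff) auto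
  then obtain B where B: "B > 0" "\<And>x. x \<in> ?K \<Longrightarrow> \<bar>F x\<bar> \<le> B"
    using compact_imp_bounded bounded_pos[of "F ` ?K"] by auto
  have "\<bar>F v\<bar> \<le> B" for v
  proof (cases "v = 0")
    case True then show ?thesis using F B(1) by (simp add: homothety_invariant_def)
  next
    case False
    obtain k :: int where k: "1 \<le> norm ((c powi k) *\<^sub>R v)" "norm ((c powi k) *\<^sub>R v) < c"
      using annulus_representative[OF c False] by blast
    then have "(c powi k) *\<^sub>R v \<in> ?K" unfolding mem_ball mem_cball Diff_iff dist_0_norm by linarith
    then show ?thesis using B(2) homothety_invariant_power_int[OF F c] by metis
  qed
  then show ?thesis using B(1) by blast
qed

lemma homothety_invariant_measurable:
  assumes "homothety_invariant c F"
  shows "F \<in> borel_measurable borel"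
proof -
  have "(\<lambda>x. indicator (- {0}) x *\<^sub>R F x) \<in> borel_measurable borel"
    using assms by (intro borel_measurable_continuous_on_indicator) (auto simp: homothety_invariant_def)
  moreover have "(\<lambda>x. indicator (- {0}) x *\<^sub>R F x) = F"
    using assms by (auto simp: homothety_invariant_def indicator_def)
  ultimately show ?thesis by simp
qed

lemma homothety_invariant_uminus: "homothety_invariant c F \<Longrightarrow> homothety_invariant c (\<lambda>v. - F v)"
  by (auto simp: homothety_invariant_def intro!: continuous_intros)

text \<open>
  For a set \<open>S\<close> invariant under homotheties this quotient is invariant as well. It plays the role of the distance
  from a closed subset of the quotient space.
\<close>

definition cone_dist :: "(real^'n) set \<Rightarrow> real^'n \<Rightarrow> real" where
  "cone_dist S v = infdist v S / norm v"

lemma infdist_scale: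
  fixes S :: "'a::real_normed_vector set"
  assumes "t \<noteq> 0" "\<And>s. s \<in> S \<Longrightarrow> t *\<^sub>R s \<in> S" "\<And>s. s \<in> S \<Longrightarrow> (1 / t) *\<^sub>R s \<in> S"
  shows "infdist (t *\<^sub>R v) S = \<bar>t\<bar> * infdist v S"
proof (cases "S = {}")
  case False
  have le: "infdist (t *\<^sub>R v) S \<le> \<bar>t\<bar> * infdist v S"
    if t: "t \<noteq> 0" "\<And>s. s \<in> S \<Longrightarrow> t *\<^sub>R s \<in> S" for t v
  proof -
    have "infdist (t *\<^sub>R v) S / \<bar>t\<bar> \<le> infdist v S"
      unfolding infdist_notempty[OF False, of v]
    proof (rule cINF_greatest[OF False])
      fix s assume "s \<in> S"
      then have "infdist (t *\<^sub>R v) S \<le> dist (t *\<^sub>R v) (t *\<^sub>R s)" by (intro infdist_le t)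
      also have "\<dots> = \<bar>t\<bar> * dist v s" by (simp add: dist_norm flip: scaleR_diff_right)
      finally show "infdist (t *\<^sub>R v) S / \<bar>t\<bar> \<le> dist v s" using t by (simp add: field_simps)
    qed
    then show ?thesis using t by (simp add: field_simps)
  qed
  have "infdist v S \<le> \<bar>1 / t\<bar> * infdist (t *\<^sub>R v) S"
    using le[of "1 / t" "t *\<^sub>R v"] assms by simp
  then have "\<bar>t\<bar> * infdist v S \<le> infdist (t *\<^sub>R v) S" using assms(1) by (simp add: field_simps)
  then show ?thesis using le[of t v] assms by simp
qed (simp add: infdist_def)

lemma cone_dist_invariant:
  fixes S :: "(real^'n) set"
  assumes c: "c > 1" and S: "\<And>s. s \<in> S \<Longrightarrow> c *\<^sub>R s \<in> S" "\<And>s. s \<in> S \<Longrightarrow> (1 / c) *\<^sub>R s \<in> S" "\<And>s. s \<in> S \<Longrightarrow> - s \<in> S"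
  shows "homothety_invariant c (cone_dist S)"
  unfolding homothety_invariant_def
proof (intro conjI allI)
  show "continuous_on (- {0}) (cone_dist S)"
    unfolding cone_dist_def by (intro continuous_intros) auto
  show "cone_dist S 0 = 0" by (simp add: cone_dist_def)
  fix v
  show "cone_dist S (c *\<^sub>R v) = cone_dist S v"
    using infdist_scale[of c S v] c S by (simp add: cone_dist_def)
  show "cone_dist S (- v) = cone_dist S v"
    using infdist_scale[of "-1" S v] S by (simp add: cone_dist_def)
qed

lemma cone_dist_less_witness:
  assumes "cone_dist S v < \<delta>" "v \<noteq> 0" "S \<noteq> {}"
  shows "\<exists>s\<in>S. norm (v - s) < \<delta> * norm v"
proof -
  have "infdist v S < \<delta> * norm v" using assms by (simp add: cone_dist_def field_simps)
  then show ?thesis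
    unfolding infdist_notempty[OF assms(3)] using assms(3)
    by (subst (asm) cINF_less_iff) (auto simp: dist_norm intro: bdd_belowI2[of _ 0])
qed

lemma cone_dist_le: "s \<in> S \<Longrightarrow> norm (v - s) \<le> \<delta> * norm v \<Longrightarrow> v \<noteq> 0 \<Longrightarrow> cone_dist S v \<le> \<delta>"
  using infdist_le[of s S v] by (simp add: cone_dist_def dist_norm field_simps)

lemma cone_dist_nonneg: "0 \<le> cone_dist S v"
  by (simp add: cone_dist_def infdist_nonneg)

section \<open>Convergence of the averages\<close>

context irreducible_walk
begin

text \<open>
  The \<open>n\<close>-th iterate of the Markov operator applied to the function \<open>F\<close>.
\<close>

definition average :: "nat \<Rightarrow> (real^'n \<Rightarrow> real) \<Rightarrow> real^'n \<Rightarrow> real" where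
  "average n F v = (\<integral>\<omega>. F (left_product \<omega> n *v v) \<partial>PP)"

lemma measurable_average_integrand:
  assumes "homothety_invariant c F"
  shows "(\<lambda>\<omega>. F (left_product \<omega> n *v v)) \<in> borel_measurable PP"
  by (rule measurable_compose[OF _ homothety_invariant_measurable[OF assms]]) measurable

lemma integrable_average:
  assumes "homothety_invariant c F" "c > 1"
  shows "integrable PP (\<lambda>\<omega>. F (left_product \<omega> n *v v))"
proof -
  obtain B where "\<And>v. \<bar>F v\<bar> \<le> B" using homothety_invariant_bounded[OF assms] by blast
  then show ?thesis
    using measurable_average_integrand[OF assms(1)] by (intro P.integrable_const_bound[of _ B]) simp_all
qed

lemma average_add:
  assumes "homothety_invariant c F" "c > 1"
  shows "average (n + k) F v = (\<integral>\<omega>. average n F (left_product \<omega> k *v v) \<partial>PP)"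
    and "(\<lambda>\<omega>. average n F (left_product \<omega> k *v v)) \<in> borel_measurable PP"
proof -
  obtain B where B: "\<And>v. \<bar>F v\<bar> \<le> B" using homothety_invariant_bounded[OF assms] by blast
  show "average (n + k) F v = (\<integral>\<omega>. average n F (left_product \<omega> k *v v) \<partial>PP)"
    unfolding average_def
    by (subst integral_split[OF measurable_average_integrand[OF assms(1)] B, where k=k])
       (simp add: left_product_comb matrix_vector_mul_assoc)
  show "(\<lambda>\<omega>. average n F (left_product \<omega> k *v v)) \<in> borel_measurable PP"
    using measurable_split_integral[OF measurable_average_integrand[OF assms(1), of "n + k" v], of k]
    by (simp add: average_def left_product_comb matrix_vector_mul_assoc)
qed

text \<open>
  Outside the event of cancellation at \<open>v\<close>, a product expands relative distances from \<open>v\<close> at most by the factor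
  \<open>1 / \<eta>\<close>, uniformly in the time \<open>n\<close>; on this event \<open>F\<close> is merely bounded, but the event is unlikely.
\<close>

lemma average_equicontinuous:
  assumes F: "homothety_invariant c F" and c: "c > 1" and "\<epsilon> > 0"
  shows "\<exists>\<delta>>0. \<forall>n v w. v \<noteq> 0 \<longrightarrow> norm (v - w) \<le> \<delta> * norm v \<longrightarrow> w \<noteq> 0 \<and> \<bar>average n F v - average n F w\<bar> \<le> \<epsilon>"
proof -
  obtain B where B: "B > 0" "\<And>v. \<bar>F v\<bar> \<le> B" using homothety_invariant_bounded[OF F c] by blast
  obtain \<delta>1 where \<delta>1: "\<delta>1 > 0" "\<And>v w. v \<noteq> 0 \<Longrightarrow> norm (v - w) \<le> \<delta>1 * norm v \<Longrightarrow> \<bar>F v - F w\<bar> < \<epsilon> / 2"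
    using homothety_invariant_uniformly_continuous[OF F c, of "\<epsilon> / 2"] \<open>\<epsilon> > 0\<close> by auto
  obtain \<eta> where \<eta>: "\<eta> > 0" "\<And>n v. v \<noteq> 0 \<Longrightarrow> cancel_prob n v \<eta> < \<epsilon> / (4 * B)"
    using no_cancellation[of "\<epsilon> / (4 * B)"] \<open>\<epsilon> > 0\<close> B(1) by auto
  define \<delta> where "\<delta> = min (1/2) (\<delta>1 * \<eta>)"
  have \<delta>: "\<delta> > 0" "\<delta> \<le> 1/2" "\<delta> \<le> \<delta>1 * \<eta>" using \<delta>1 \<eta> by (auto simp: \<delta>_def)
  show ?thesis
  proof (intro exI[of _ \<delta>] conjI allI impI \<delta>(1))
    fix n and v w :: "real^'n" assume v: "v \<noteq> 0" and close: "norm (v - w) \<le> \<delta> * norm v"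
    show "w \<noteq> 0"
    proof
      assume "w = 0"
      then have "norm v \<le> \<delta> * norm v" using close by simp
      also have "\<dots> \<le> 1/2 * norm v" using \<delta>(2) by (rule mult_right_mono) simp
      finally have "norm v \<le> 1/2 * norm v" .
      then show False using v by simp
    qed
    let ?Q = "{\<omega>\<in>space PP. norm (left_product \<omega> n *v v) \<le> \<eta> * norm (left_product \<omega> n) * norm v}"
    have pointwise: "\<bar>F (left_product \<omega> n *v v) - F (left_product \<omega> n *v w)\<bar> \<le> \<epsilon> / 2 + 2 * B * indicator ?Q \<omega>"
      if \<omega>: "\<omega> \<in> space PP" for \<omega>
    proof (cases "\<omega> \<in> ?Q")
      case True
      then show ?thesis using B(2)[of "left_product \<omega> n *v v"] B(2)[of "left_product \<omega> n *v w"] \<open>\<epsilon> > 0\<close> by simp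
    next
      case False
      let ?L = "left_product \<omega> n"
      have "norm (?L *v v - ?L *v w) = norm (?L *v (v - w))" by (simp add: matrix_vector_mult_diff_distrib)
      also have "\<dots> \<le> norm ?L * norm (v - w)" by (rule norm_matrix_vector_mult_le)
      also have "\<dots> \<le> norm ?L * ((\<delta>1 * \<eta>) * norm v)"
        using close mult_right_mono[OF \<delta>(3), of "norm v"] by (intro mult_left_mono) auto
      also have "\<dots> = \<delta>1 * (\<eta> * norm ?L * norm v)" by simp
      also have "\<dots> \<le> \<delta>1 * norm (?L *v v)" using False \<omega> \<delta>1(1) by (intro mult_left_mono) auto
      finally have "\<bar>F (?L *v v) - F (?L *v w)\<bar> < \<epsilon> / 2"
        using invertible_left_product[OF \<omega>] v by (intro \<delta>1(2)) auto
      then show ?thesis using False by simp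
    qed
    note int = integrable_average[OF F c]
    have "\<bar>average n F v - average n F w\<bar> = \<bar>\<integral>\<omega>. F (left_product \<omega> n *v v) - F (left_product \<omega> n *v w) \<partial>PP\<bar>"
      by (simp add: average_def int)
    also have "\<dots> \<le> (\<integral>\<omega>. \<bar>F (left_product \<omega> n *v v) - F (left_product \<omega> n *v w)\<bar> \<partial>PP)"
      by (rule integral_abs_bound)
    also have "\<dots> \<le> (\<integral>\<omega>. \<epsilon> / 2 + 2 * B * indicator ?Q \<omega> \<partial>PP)"
    proof (rule integral_mono)
      show "integrable PP (\<lambda>\<omega>. \<bar>F (left_product \<omega> n *v v) - F (left_product \<omega> n *v w)\<bar>)"
        by (intro integrable_abs Bochner_Integration.integrable_diff int)
      show "integrable PP (\<lambda>\<omega>. \<epsilon> / 2 + 2 * B * indicator ?Q \<omega>)"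
        by (intro P.integrable_const_bound[of _ "\<epsilon> / 2 + 2 * B"]) (use B(1) \<open>\<epsilon> > 0\<close> in \<open>auto simp: indicator_def\<close>)
    qed (use pointwise in auto)
    also have "\<dots> = \<epsilon> / 2 + 2 * B * cancel_prob n v \<eta>"
    proof -
      have "integrable PP (\<lambda>\<omega>. 2 * B * indicator ?Q \<omega>)"
        by (intro P.integrable_const_bound[of _ "2 * B"]) (use B(1) in \<open>auto simp: indicator_def\<close>)
      then show ?thesis by (simp add: P.prob_space cancel_prob_def)
    qed
    also have "\<dots> \<le> \<epsilon> / 2 + 2 * B * (\<epsilon> / (4 * B))"
      using \<eta>(2)[OF v, of n] B(1) by (intro add_left_mono mult_left_mono) auto
    also have "\<dots> = \<epsilon>" using B(1) by simp
    finally show "\<bar>average n F v - average n F w\<bar> \<le> \<epsilon>" .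
  qed
qed

lemma average_invariant:
  assumes F: "homothety_invariant c F" and c: "c > 1"
  shows "homothety_invariant c (average n F)"
  unfolding homothety_invariant_def
proof (intro conjI allI)
  show "continuous_on (- {0}) (average n F)"
    unfolding continuous_on_iff
  proof (intro ballI allI impI)
    fix x :: "real^'n" and e :: real assume x: "x \<in> - {0}" and "e > 0"
    then obtain \<delta> where \<delta>: "\<delta> > 0" "\<And>w. norm (x - w) \<le> \<delta> * norm x \<Longrightarrow> \<bar>average n F x - average n F w\<bar> \<le> e / 2"
      using average_equicontinuous[OF F c, of "e / 2"] by auto
    show "\<exists>d>0. \<forall>x'\<in>- {0}. dist x' x < d \<longrightarrow> dist (average n F x') (average n F x) < e"
    proof (intro exI[of _ "\<delta> * norm x"] conjI ballI impI)
      fix x' assume "dist x' x < \<delta> * norm x"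
      then have "\<bar>average n F x - average n F x'\<bar> \<le> e / 2" by (intro \<delta>(2)) (simp add: dist_norm norm_minus_commute)
      then show "dist (average n F x') (average n F x) < e" using \<open>e > 0\<close> unfolding dist_real_def by linarith
    qed (use \<delta> x in auto)
  qed
  have F': "F 0 = 0" "\<And>v. F (c *\<^sub>R v) = F v" "\<And>v. F (- v) = F v" using F by (auto simp: homothety_invariant_def)
  show "average n F 0 = 0" by (simp add: average_def F')
  fix v
  show "average n F (c *\<^sub>R v) = average n F v" by (simp add: average_def matrix_vector_mult_scaleR F')
  have "left_product \<omega> n *v (- v) = - (left_product \<omega> n *v v)" for \<omega>
    using matrix_vector_mult_scaleR[of "left_product \<omega> n" "-1" v] by simp
  then show "average n F (- v) = average n F v" by (simp add: average_def F')
qed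

text \<open>
  A maximum principle. The value at \<open>X i\<close> is a mean over the first \<open>k\<close> steps of values at time \<open>r i - k\<close>, none of
  which exceeds \<open>M\<close> by much. Since the mean almost reaches \<open>M\<close>, so do the values on every event of fixed
  positive probability; the event of following \<open>g\<close> closely is one, and equicontinuity moves the conclusion to
  the point \<open>g x\<close> itself.
\<close>

lemma near_maximum_propagates:
  assumes F: "homothety_invariant c F" and c: "c > 1" and "\<epsilon> > 0"
    and U: "\<And>n v. v \<noteq> 0 \<Longrightarrow> average n F v \<le> U n" "U \<longlonglongrightarrow> M"
    and X: "X \<longlonglongrightarrow> x" "x \<noteq> 0" "\<And>i. X i \<noteq> 0"
    and r: "strict_mono r" "\<And>i. average (r i) F (X i) \<ge> M - 1 / Suc i"
    and g: "g \<in> set_power T k" "g *v x \<noteq> 0"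
  shows "\<forall>\<^sub>F i in sequentially. average (r i - k) F (g *v x) \<ge> M - 2 * \<epsilon>"
proof -
  obtain \<delta> where \<delta>: "\<delta> > 0" "\<And>n v w. v \<noteq> 0 \<Longrightarrow> norm (v - w) \<le> \<delta> * norm v \<Longrightarrow> \<bar>average n F v - average n F w\<bar> \<le> \<epsilon>"
    using average_equicontinuous[OF F c \<open>\<epsilon> > 0\<close>] by blast
  define R where "R = \<delta> * norm (g *v x) / 2"
  have R: "R > 0" using \<delta> g(2) by (simp add: R_def)
  \<comment> \<open>With this radius, the error of the word and the error of the starting point contribute \<open>R\<close> each, and \<open>2 * R\<close>
    is the modulus of equicontinuity at \<open>g x\<close>.\<close>
  define \<rho> where "\<rho> = R / (norm x + 1)"
  have \<rho>: "\<rho> > 0" "\<rho> * (norm x + 1) = R"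
  proof -
    have "norm x + 1 > 0" by (simp add: add_nonneg_pos)
    then show "\<rho> > 0" "\<rho> * (norm x + 1) = R" using R by (simp_all add: \<rho>_def)
  qed
  define E where "E = {\<omega>\<in>space PP. dist (left_product \<omega> k) g < \<rho>}"
  have E: "E \<in> sets PP" unfolding E_def by measurable
  define p where "p = P.prob E"
  have p: "p > 0" "p \<le> 1" unfolding p_def E_def using words_are_charged[OF g(1) \<rho>(1)] by auto
  have "\<forall>\<^sub>F i in sequentially. k \<le> r i"
    using filterlim_subseq[OF r(1)] by (auto simp: filterlim_at_top)
  moreover have "\<forall>\<^sub>F i in sequentially. U (r i - k) < M + p * \<epsilon> / 2"
  proof -
    have "filterlim (\<lambda>i. r i - k) at_top sequentially"
      using filterlim_compose[OF filterlim_minus_const_nat_at_top filterlim_subseq[OF r(1)]] by simp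
    then have "(\<lambda>i. U (r i - k)) \<longlonglongrightarrow> M" by (rule filterlim_compose[OF U(2)])
    then show ?thesis using p \<open>\<epsilon> > 0\<close> by (intro order_tendstoD) auto
  qed
  moreover have "\<forall>\<^sub>F i in sequentially. 1 / Suc i < p * \<epsilon> / 2"
    using p \<open>\<epsilon> > 0\<close> by (intro order_tendstoD(2)[OF LIMSEQ_Suc[OF lim_1_over_n]]) auto
  moreover have "\<forall>\<^sub>F i in sequentially. dist (X i) x < min 1 (R / (norm g + 1))"
    using X(1) R by (intro tendstoD) (auto simp: add_nonneg_pos)
  ultimately show ?thesis
  proof eventually_elim
    case (elim i)
    define n where "n = r i - k"
    \<comment> \<open>Otherwise the part of the mean carried by \<open>E\<close> would lower it by about \<open>p * \<epsilon>\<close>.\<close>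
    have "\<exists>\<omega>\<in>E. average n F (left_product \<omega> k *v X i) \<ge> M - \<epsilon>"
    proof (rule ccontr)
      assume neg: "\<not> ?thesis"
      let ?u = "\<lambda>\<omega>. U n - (U n - (M - \<epsilon>)) * indicator E \<omega>"
      have "average (r i) F (X i) = average (n + k) F (X i)" using elim(1) by (simp add: n_def)
      also have "\<dots> = (\<integral>\<omega>. average n F (left_product \<omega> k *v X i) \<partial>PP)" by (rule average_add(1)[OF F c])
      also have "\<dots> \<le> (\<integral>\<omega>. ?u \<omega> \<partial>PP)"
      proof (rule integral_mono)
        obtain B where "\<And>v. \<bar>average n F v\<bar> \<le> B" using homothety_invariant_bounded[OF average_invariant[OF F c] c] by blast
        then show "integrable PP (\<lambda>\<omega>. average n F (left_product \<omega> k *v X i))"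
          using average_add(2)[OF F c] by (intro P.integrable_const_bound[of _ B]) auto
        show "integrable PP ?u"
          using E by (intro P.integrable_const_bound[of _ "\<bar>U n\<bar> + \<bar>M - \<epsilon>\<bar>"]) (auto simp: indicator_def)
        fix \<omega> assume \<omega>: "\<omega> \<in> space PP"
        have "left_product \<omega> k *v X i \<noteq> 0" using invertible_left_product[OF \<omega>] X(3) by simp
        then show "average n F (left_product \<omega> k *v X i) \<le> ?u \<omega>"
          using U(1)[of _ n] neg by (auto simp: indicator_def not_le less_imp_le)
      qed
      also have "\<dots> = U n - (U n - (M - \<epsilon>)) * p"
      proof -
        have "integrable PP (\<lambda>\<omega>. (U n - (M - \<epsilon>)) * indicator E \<omega>)"
          using E by (intro P.integrable_const_bound[of _ "\<bar>U n - (M - \<epsilon>)\<bar>"]) (auto simp: indicator_def)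
        then show ?thesis using E by (simp add: P.prob_space p_def)
      qed
      also have "\<dots> = (1 - p) * U n + p * (M - \<epsilon>)" by (simp add: algebra_simps)
      also have "\<dots> \<le> (1 - p) * (M + p * \<epsilon> / 2) + p * (M - \<epsilon>)"
        using elim(2) p by (intro add_right_mono mult_left_mono) (auto simp: n_def)
      also have "\<dots> = M - p * \<epsilon> / 2 - p * (p * \<epsilon> / 2)" by (simp add: field_simps)
      also have "\<dots> \<le> M - p * \<epsilon> / 2" using p \<open>\<epsilon> > 0\<close> by simp
      finally show False using r(2)[of i] elim(3) by linarith
    qed
    then obtain \<omega> where \<omega>: "\<omega> \<in> E" "average n F (left_product \<omega> k *v X i) \<ge> M - \<epsilon>" by blast
    let ?A = "left_product \<omega> k"
    have "g *v x - ?A *v X i = (g - ?A) *v X i + g *v (x - X i)"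
      by (simp add: matrix_vector_mult_diff_rdistrib matrix_vector_mult_diff_distrib)
    then have "norm (g *v x - ?A *v X i) \<le> norm ((g - ?A) *v X i) + norm (g *v (x - X i))"
      by (simp add: norm_triangle_ineq)
    also have "\<dots> \<le> norm (g - ?A) * norm (X i) + norm g * norm (x - X i)"
      by (intro add_mono norm_matrix_vector_mult_le)
    also have "\<dots> \<le> \<rho> * (norm x + 1) + (norm g + 1) * (R / (norm g + 1))"
    proof (intro add_mono mult_mono)
      show "norm (g - ?A) \<le> \<rho>" using \<omega>(1) by (simp add: E_def dist_norm norm_minus_commute)
      show "norm (X i) \<le> norm x + 1" using elim(4) norm_triangle_sub[of "X i" x] by (simp add: dist_norm)
      show "norm (x - X i) \<le> R / (norm g + 1)" using elim(4) by (simp add: dist_norm norm_minus_commute)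
    qed (use \<rho> R in auto)
    also have "\<dots> = \<delta> * norm (g *v x)"
    proof -
      have "norm g + 1 \<noteq> 0" using norm_ge_zero[of g] by linarith
      then have eq: "(norm g + 1) * (R / (norm g + 1)) = R" by simp
      show ?thesis unfolding \<rho>(2) eq by (simp add: R_def)
    qed
    finally have "\<bar>average n F (g *v x) - average n F (?A *v X i)\<bar> \<le> \<epsilon>" by (rule \<delta>(2)[OF g(2)])
    then show ?case using \<omega>(2) by (simp add: n_def)
  qed
qed

text \<open>
  The suprema of the averages decrease to some \<open>M\<close> and the infima increase to some \<open>m\<close>; the claim is \<open>M = m\<close>.
  Points at which supremum and infimum are almost attained accumulate along a common subsequence of times at \<open>x\<close>
  and \<open>y\<close>, say. Two words of equal length bring \<open>x\<close> and \<open>y\<close> close to each other up to sign. By the maximum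
  principle the average at the same earlier time is almost \<open>M\<close> at the first image and almost \<open>m\<close> at the second,
  so equicontinuity forces \<open>M\<close> and \<open>m\<close> to coincide.
\<close>

theorem average_converges:
  assumes F: "homothety_invariant c F" and c: "c > 1"
  shows "\<exists>l. \<forall>v. v \<noteq> 0 \<longrightarrow> (\<lambda>n. average n F v) \<longlonglongrightarrow> l"
proof -
  obtain B where B: "\<And>v. \<bar>F v\<bar> \<le> B" using homothety_invariant_bounded[OF F c] by blast
  have avgB: "\<bar>average n F v\<bar> \<le> B" for n v
  proof -
    have "\<bar>average n F v\<bar> \<le> (\<integral>\<omega>. \<bar>F (left_product \<omega> n *v v)\<bar> \<partial>PP)" unfolding average_def by (rule integral_abs_bound)
    also have "\<dots> \<le> (\<integral>\<omega>. B \<partial>PP)"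
      by (rule integral_mono) (use B integrable_average[OF F c] in auto)
    finally show ?thesis by (simp add: P.prob_space)
  qed
  let ?V = "{v :: real^'n. v \<noteq> 0}"
  have ne: "?V \<noteq> {}" using v_nz by auto
  define up where "up n = (SUP v\<in>?V. average n F v)" for n
  define lo where "lo n = (INF v\<in>?V. average n F v)" for n
  have ba: "bdd_above (average n F ` ?V)" "bdd_below (average n F ` ?V)" for n
    using avgB[of n] by (auto intro!: bdd_aboveI[of _ B] bdd_belowI[of _ "- B"] simp: abs_le_iff) (metis minus_le_iff)
  have up: "average n F v \<le> up n" if "v \<noteq> 0" for n v unfolding up_def using that by (intro cSUP_upper ba) auto
  have lo: "lo n \<le> average n F v" if "v \<noteq> 0" for n v unfolding lo_def using that by (intro cINF_lower ba) auto
  have int: "integrable PP (\<lambda>\<omega>. average n F (left_product \<omega> 1 *v v))" for n v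
    using average_add(2)[OF F c, of n 1 v] avgB[of n] by (intro P.integrable_const_bound[of _ B]) auto
  have step: "lo n \<le> average (Suc n) F v \<and> average (Suc n) F v \<le> up n" if v: "v \<noteq> 0" for n v
  proof -
    have "average (Suc n) F v = (\<integral>\<omega>. average n F (left_product \<omega> 1 *v v) \<partial>PP)"
      using average_add(1)[OF F c, of n 1 v] by simp
    moreover have nz: "left_product \<omega> 1 *v v \<noteq> 0" if "\<omega> \<in> space PP" for \<omega>
      using invertible_left_product[OF that, of 1] v by simp
    moreover have "(\<integral>\<omega>. average n F (left_product \<omega> 1 *v v) \<partial>PP) \<le> (\<integral>\<omega>. up n \<partial>PP)"
      by (rule integral_mono[OF int _ up[OF nz]]) simp
    moreover have "(\<integral>\<omega>. lo n \<partial>PP) \<le> (\<integral>\<omega>. average n F (left_product \<omega> 1 *v v) \<partial>PP)"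
      by (rule integral_mono[OF _ int lo[OF nz]]) simp
    ultimately show ?thesis by (simp add: P.prob_space)
  qed
  have "decseq up" unfolding decseq_Suc_iff up_def[of "Suc _"] using step by (intro allI cSUP_least ne) auto
  moreover have upB: "- B \<le> up n" for n using avgB[of n v0] up[OF v_nz, of n] by linarith
  ultimately obtain M where M: "up \<longlonglongrightarrow> M" "\<And>n. M \<le> up n" using decseq_convergent by metis
  have "incseq lo" unfolding incseq_Suc_iff lo_def[of "Suc _"] using step by (intro allI cINF_greatest ne) auto
  moreover have loB: "lo n \<le> B" for n using avgB[of n v0] lo[OF v_nz, of n] by linarith
  ultimately obtain m where m: "lo \<longlonglongrightarrow> m" "\<And>n. lo n \<le> m" using incseq_convergent by metis
  \<comment> \<open>Extremal points can be taken in a compact annulus, where they accumulate.\<close>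
  have normalise: "\<exists>w. 1 \<le> norm w \<and> norm w \<le> c \<and> average n F w = average n F v" if v: "v \<noteq> 0" for n v
  proof -
    obtain k :: int where k: "1 \<le> norm ((c powi k) *\<^sub>R v)" "norm ((c powi k) *\<^sub>R v) < c"
      using annulus_representative[OF c v] by blast
    have "average n F ((c powi k) *\<^sub>R v) = average n F v"
      by (rule homothety_invariant_power_int[OF average_invariant[OF F c] c])
    with k show ?thesis by (meson less_imp_le)
  qed
  have "\<exists>w. 1 \<le> norm w \<and> norm w \<le> c \<and> average n F w > M - 1 / Suc n" for n
  proof -
    have "M - 1 / Suc n < up n" using M(2)[of n] by (simp add: less_le_trans[rotated])
    then obtain v where "v \<noteq> 0" "average n F v > M - 1 / Suc n"
      unfolding up_def using less_cSUP_iff[OF ne ba(1)] by auto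
    then show ?thesis using normalise[of v n] by metis
  qed
  then obtain x where x: "\<And>n. 1 \<le> norm (x n)" "\<And>n. norm (x n) \<le> c" "\<And>n. average n F (x n) > M - 1 / Suc n" by metis
  have "\<exists>w. 1 \<le> norm w \<and> norm w \<le> c \<and> average n F w < m + 1 / Suc n" for n
  proof -
    have "lo n < m + 1 / Suc n" using m(2)[of n] by (simp add: le_less_trans)
    then obtain v where "v \<noteq> 0" "average n F v < m + 1 / Suc n"
      unfolding lo_def using cINF_less_iff[OF ne ba(2)] by auto
    then show ?thesis using normalise[of v n] by metis
  qed
  then obtain y where y: "\<And>n. 1 \<le> norm (y n)" "\<And>n. norm (y n) \<le> c" "\<And>n. average n F (y n) < m + 1 / Suc n" by metis
  let ?K = "cball 0 c - ball 0 1 :: (real^'n) set"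
  have "compact (?K \<times> ?K)" by (intro compact_Times compact_diff) auto
  then have K: "seq_compact (?K \<times> ?K)" by (rule compact_imp_seq_compact)
  have xy: "\<forall>n. (x n, y n) \<in> ?K \<times> ?K" using x y by (auto simp: not_less)
  obtain z r where z: "z \<in> ?K \<times> ?K" "strict_mono (r :: nat \<Rightarrow> nat)" "((\<lambda>n. (x n, y n)) \<circ> r) \<longlonglongrightarrow> z"
    by (rule seq_compactE[OF K xy])
  have X: "(\<lambda>i. x (r i)) \<longlonglongrightarrow> fst z" and Y: "(\<lambda>i. y (r i)) \<longlonglongrightarrow> snd z"
    using tendsto_fst[OF z(3)] tendsto_snd[OF z(3)] by (simp_all add: comp_def)
  have nz: "fst z \<noteq> 0" "snd z \<noteq> 0" using z(1) by (auto simp: mem_Times_iff)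
  have xn: "x i \<noteq> 0" and yn: "y i \<noteq> 0" for i using x(1)[of i] y(1)[of i] by auto
  have "M \<le> m"
  proof (rule ccontr)
    assume "\<not> M \<le> m"
    define \<epsilon> where "\<epsilon> = (M - m) / 8"
    have \<epsilon>: "\<epsilon> > 0" "8 * \<epsilon> = M - m" using \<open>\<not> M \<le> m\<close> by (simp_all add: \<epsilon>_def)
    obtain \<delta> where \<delta>: "\<delta> > 0" "\<And>n v w. v \<noteq> 0 \<Longrightarrow> norm (v - w) \<le> \<delta> * norm v \<Longrightarrow> w \<noteq> 0 \<and> \<bar>average n F v - average n F w\<bar> \<le> \<epsilon>"
      using average_equicontinuous[OF F c \<epsilon>(1)] by blast
    obtain k g g' \<sigma> where g: "g \<in> set_power T k" "g' \<in> set_power T k" "\<sigma> = 1 \<or> \<sigma> = -1"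
      "norm (g *v fst z - \<sigma> *\<^sub>R (g' *v snd z)) < \<delta> * norm (g *v fst z)"
      using synchronous_approach[OF nz \<delta>(1)] by blast
    have gx: "g *v fst z \<noteq> 0"
    proof
      assume z: "g *v fst z = 0"
      show False using g(4) unfolding z norm_zero mult_zero_right by (simp only: norm_not_less_zero)
    qed
    have gy: "\<sigma> *\<^sub>R (g' *v snd z) \<noteq> 0" and close: "\<bar>average n F (g *v fst z) - average n F (\<sigma> *\<^sub>R (g' *v snd z))\<bar> \<le> \<epsilon>" for n
      using \<delta>(2)[OF gx less_imp_le[OF g(4)]] by auto
    have even: "average n F (\<sigma> *\<^sub>R v) = average n F v" for n v
      using average_invariant[OF F c, of n] g(3) by (auto simp: homothety_invariant_def)
    have sub: "1 / Suc (r i) \<le> 1 / Suc i" for i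
      using seq_suble[OF z(2), of i] by (intro divide_left_mono) auto
    have 1: "\<forall>\<^sub>F i in sequentially. average (r i - k) F (g *v fst z) \<ge> M - 2 * \<epsilon>"
    proof (rule near_maximum_propagates[OF F c \<epsilon>(1) up M(1) X nz(1) xn z(2) _ g(1) gx])
      show "M - 1 / Suc i \<le> average (r i) F (x (r i))" for i using x(3)[of "r i"] sub[of i] by linarith
    qed
    have neg: "average n (\<lambda>v. - F v) v = - average n F v" for n v by (simp add: average_def)
    have 2: "\<forall>\<^sub>F i in sequentially. average (r i - k) (\<lambda>v. - F v) (g' *v snd z) \<ge> - m - 2 * \<epsilon>"
    proof (rule near_maximum_propagates[OF homothety_invariant_uminus[OF F] c \<epsilon>(1) _ _ Y nz(2) yn z(2) _ g(2)])
      show "average n (\<lambda>v. - F v) v \<le> - lo n" if "v \<noteq> 0" for n v using lo[OF that, of n] by (simp add: neg)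
      show "(\<lambda>n. - lo n) \<longlonglongrightarrow> - m" by (intro tendsto_intros m)
      show "- m - 1 / Suc i \<le> average (r i) (\<lambda>v. - F v) (y (r i))" for i
        using y(3)[of "r i"] sub[of i] unfolding neg by linarith
      show "g' *v snd z \<noteq> 0" using gy by auto
    qed
    obtain i where "average (r i - k) F (g *v fst z) \<ge> M - 2 * \<epsilon>" "- average (r i - k) F (g' *v snd z) \<ge> - m - 2 * \<epsilon>"
      using eventually_happens[OF eventually_conj[OF 1 2]] by (auto simp: neg)
    then show False using close[of "r i - k"] \<epsilon> unfolding even by linarith
  qed
  have "m \<le> M" by (rule LIMSEQ_le[OF m(1) M(1)]) (use order_trans[OF lo[OF v_nz] up[OF v_nz]] in auto)
  with \<open>M \<le> m\<close> have "m = M" by simp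
  have "(\<lambda>n. average n F v) \<longlonglongrightarrow> M" if "v \<noteq> 0" for v
    by (rule tendsto_sandwich[OF _ _ m(1)[unfolded \<open>m = M\<close>] M(1)]) (use lo up that in auto)
  then show ?thesis by blast
qed

text \<open>
  The averages of the distance from \<open>S\<close> being small at \<open>v\<close>, at some time \<open>k\<close> the walk is close to a point \<open>s\<close> of
  \<open>S\<close> with high probability. From then on it stays close to the trajectory of \<open>s\<close>, which never leaves \<open>S\<close>,
  unless cancellation occurs at some later time; that is unlikely. So the walk returns to a given distance from
  \<open>S\<close> infinitely often only with probability 0.
\<close>

theorem trajectories_approach_cone:
  fixes S :: "(real^'n) set"
  assumes c: "c > 1" and cone: "\<And>s. s \<in> S \<Longrightarrow> c *\<^sub>R s \<in> S" "\<And>s. s \<in> S \<Longrightarrow> (1 / c) *\<^sub>R s \<in> S" "\<And>s. s \<in> S \<Longrightarrow> - s \<in> S"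
    and ne: "S \<noteq> {}"
    and inv: "\<And>g s. g \<in> space \<mu> \<Longrightarrow> s \<in> S \<Longrightarrow> g *v s \<in> S"
    and v: "v \<noteq> 0" and lim: "(\<lambda>n. average n (cone_dist S) v) \<longlonglongrightarrow> 0"
  shows "AE \<omega> in PP. (\<lambda>n. cone_dist S (left_product \<omega> n *v v)) \<longlonglongrightarrow> 0"
proof -
  let ?u = "cone_dist S"
  have F: "homothety_invariant c ?u" by (rule cone_dist_invariant[OF c cone])
  have uL: "(\<lambda>\<omega>. ?u (left_product \<omega> n *v w)) \<in> borel_measurable PP" for n w
    by (rule measurable_average_integrand[OF F])
  have invL: "left_product \<omega> n *v s \<in> S" if "\<omega> \<in> space PP" "s \<in> S" for \<omega> n s
    using that
  proof (induction n)
    case (Suc n)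
    then show ?case using inv[OF step_in_space[OF Suc.prems(1)]] by (simp flip: matrix_vector_mul_assoc)
  qed simp
  have recur: "P.prob {\<omega>\<in>space PP. \<forall>N. \<exists>n\<ge>N. ?u (left_product \<omega> n *v v) > \<epsilon>} = 0" if "\<epsilon> > 0" for \<epsilon>
  proof -
    define W where "W = {\<omega>\<in>space PP. \<forall>N. \<exists>n\<ge>N. ?u (left_product \<omega> n *v v) > \<epsilon>}"
    have "P.prob W \<le> \<epsilon>'" if "\<epsilon>' > 0" for \<epsilon>'
    proof -
      obtain \<eta> where \<eta>: "\<eta> > 0" "\<And>w. w \<noteq> 0 \<Longrightarrow>
         P.prob {\<omega>\<in>space PP. \<exists>n. norm (left_product \<omega> n *v w) \<le> \<eta> * norm (left_product \<omega> n) * norm w} \<le> \<epsilon>' / 2"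
        using no_cancellation_ever[of "\<epsilon>' / 2"] \<open>\<epsilon>' > 0\<close> by auto
      define \<delta> where "\<delta> = \<epsilon> * \<eta>"
      have \<delta>: "\<delta> > 0" using \<open>\<epsilon> > 0\<close> \<eta> by (simp add: \<delta>_def)
      have "\<forall>\<^sub>F k in sequentially. average k ?u v < \<delta> * (\<epsilon>' / 2)"
        using lim \<delta> \<open>\<epsilon>' > 0\<close> by (intro order_tendstoD) auto
      then obtain k where k: "average k ?u v < \<delta> * (\<epsilon>' / 2)" using eventually_happens by force
      let ?Far = "{\<omega>\<in>space PP. ?u (left_product \<omega> k *v v) \<ge> \<delta>}"
      have Far: "?Far \<in> sets PP" using uL[of k v] by measurable
      have "\<delta> * P.prob ?Far = (\<integral>\<omega>. \<delta> * indicator ?Far \<omega> \<partial>PP)" using Far by simp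
      also have "\<dots> \<le> average k ?u v"
        unfolding average_def
      proof (rule integral_mono)
        show "integrable PP (\<lambda>\<omega>. \<delta> * indicator ?Far \<omega>)"
          using Far \<delta> by (intro P.integrable_const_bound[of _ \<delta>]) (auto simp: indicator_def)
      qed (use integrable_average[OF F c] cone_dist_nonneg in \<open>auto simp: indicator_def\<close>)
      finally have "\<delta> * P.prob ?Far \<le> \<delta> * (\<epsilon>' / 2)" using k by simp
      then have far: "P.prob ?Far \<le> \<epsilon>' / 2" using \<delta> by simp
      define Z where "Z = {\<omega>\<in>space PP. \<exists>n. ?u (left_product \<omega> (n + k) *v v) > \<epsilon>}"
      have Z: "Z \<in> sets PP" unfolding Z_def using uL by measurable
      have "W \<subseteq> Z"
      proof
        fix \<omega> assume "\<omega> \<in> W"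
        then obtain n where "\<omega> \<in> space PP" "n \<ge> k" "?u (left_product \<omega> n *v v) > \<epsilon>" by (auto simp: W_def)
        then show "\<omega> \<in> Z" by (auto simp: Z_def intro!: exI[of _ "n - k"])
      qed
      then have "P.prob W \<le> P.prob Z" using Z by (intro P.finite_measure_mono)
      also have "\<dots> \<le> (\<integral>\<omega>. \<epsilon>' / 2 + indicator ?Far \<omega> \<partial>PP)"
      proof (rule prob_split_le[OF Z, where k=k and B="\<epsilon>' / 2 + 1"])
        show "(\<lambda>\<omega>. \<epsilon>' / 2 + indicator ?Far \<omega>) \<in> borel_measurable PP" using Far by measurable
        show "\<bar>\<epsilon>' / 2 + indicator ?Far \<omega>\<bar> \<le> \<epsilon>' / 2 + 1" for \<omega> using \<open>\<epsilon>' > 0\<close> by (auto simp: indicator_def)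
        fix \<omega> assume \<omega>: "\<omega> \<in> space PP"
        let ?w = "left_product \<omega> k *v v"
        have w: "?w \<noteq> 0" using invertible_left_product[OF \<omega>] v by simp
        let ?E = "{\<omega>'\<in>space PP. comb_seq k \<omega> \<omega>' \<in> Z}"
        show "P.prob ?E \<le> \<epsilon>' / 2 + indicator ?Far \<omega>"
        proof (cases "\<omega> \<in> ?Far")
          case True
          then have "indicator ?Far \<omega> = (1 :: real)" by (rule indicator_simps)
          moreover have "P.prob ?E \<le> 1" by (rule P.prob_le_1)
          ultimately show ?thesis using \<open>\<epsilon>' > 0\<close> by linarith
        next
          case False
          then have "?u ?w < \<delta>" using \<omega> by simp
          then obtain s where s: "s \<in> S" "norm (?w - s) < \<delta> * norm ?w" using cone_dist_less_witness[OF _ w ne] by blast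
          have "?E \<subseteq> {\<omega>'\<in>space PP. \<exists>n. norm (left_product \<omega>' n *v ?w) \<le> \<eta> * norm (left_product \<omega>' n) * norm ?w}"
          proof safe
            fix \<omega>' assume \<omega>': "\<omega>' \<in> space PP" and "comb_seq k \<omega> \<omega>' \<in> Z"
            then obtain n where n: "?u (left_product \<omega>' n *v ?w) > \<epsilon>"
              by (auto simp: Z_def left_product_comb matrix_vector_mul_assoc)
            let ?L = "left_product \<omega>' n"
            show "\<exists>n. norm (left_product \<omega>' n *v ?w) \<le> \<eta> * norm (left_product \<omega>' n) * norm ?w"
            proof (rule ccontr)
              assume "\<not> ?thesis"
              then have gt: "norm (?L *v ?w) > \<eta> * norm ?L * norm ?w" by (auto simp: not_le)
              have "norm (?L *v ?w - ?L *v s) = norm (?L *v (?w - s))" by (simp add: matrix_vector_mult_diff_distrib)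
              also have "\<dots> \<le> norm ?L * norm (?w - s)" by (rule norm_matrix_vector_mult_le)
              also have "\<dots> \<le> norm ?L * (\<delta> * norm ?w)" using s(2) by (intro mult_left_mono) auto
              also have "\<dots> = \<epsilon> * (\<eta> * norm ?L * norm ?w)" by (simp add: \<delta>_def)
              also have "\<dots> \<le> \<epsilon> * norm (?L *v ?w)" using gt \<open>\<epsilon> > 0\<close> by (intro mult_left_mono) auto
              finally have "?u (?L *v ?w) \<le> \<epsilon>"
                using invL[OF \<omega>' s(1)] invertible_left_product[OF \<omega>'] w by (intro cone_dist_le[of "?L *v s"]) auto
              then show False using n by simp
            qed
          qed
          then have "P.prob ?E \<le> P.prob {\<omega>'\<in>space PP. \<exists>n. norm (left_product \<omega>' n *v ?w) \<le> \<eta> * norm (left_product \<omega>' n) * norm ?w}"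
            by (rule P.finite_measure_mono) measurable
          also have "\<dots> \<le> \<epsilon>' / 2" by (rule \<eta>(2)[OF w])
          finally show ?thesis using False by simp
        qed
      qed
      also have "\<dots> = \<epsilon>' / 2 + P.prob ?Far"
      proof -
        have "integrable PP (\<lambda>\<omega>. indicator ?Far \<omega> :: real)"
          using Far by (intro P.integrable_const_bound[of _ 1]) (auto simp: indicator_def)
        then show ?thesis using Far by (simp add: P.prob_space)
      qed
      finally show ?thesis using far by simp
    qed
    then have "P.prob W \<le> 0" by (rule field_le_epsilon[of _ 0, simplified])
    then show ?thesis by (simp add: W_def measure_le_0_iff)
  qed
  have "AE \<omega> in PP. \<exists>N. \<forall>n\<ge>N. ?u (left_product \<omega> n *v v) \<le> 1 / Suc j" for j
  proof (rule AE_I)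
    let ?W = "{\<omega>\<in>space PP. \<forall>N. \<exists>n\<ge>N. ?u (left_product \<omega> n *v v) > 1 / Suc j}"
    show "{\<omega>\<in>space PP. \<not> (\<exists>N. \<forall>n\<ge>N. ?u (left_product \<omega> n *v v) \<le> 1 / Suc j)} \<subseteq> ?W" by (auto simp: not_le)
    show "emeasure PP ?W = 0" using recur[of "1 / Suc j"] by (simp add: P.emeasure_eq_measure)
    show "?W \<in> sets PP" using uL by measurable
  qed
  then have "AE \<omega> in PP. \<forall>j. \<exists>N. \<forall>n\<ge>N. ?u (left_product \<omega> n *v v) \<le> 1 / Suc j" by (simp add: AE_all_countable)
  then show ?thesis
  proof (rule AE_mp, intro AE_I2 impI)
    fix \<omega> assume *: "\<forall>j. \<exists>N. \<forall>n\<ge>N. ?u (left_product \<omega> n *v v) \<le> 1 / Suc j"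
    show "(\<lambda>n. ?u (left_product \<omega> n *v v)) \<longlonglongrightarrow> 0"
    proof (rule LIMSEQ_I)
      fix r :: real assume "r > 0"
      then obtain j where "1 / Suc j < r" using nat_approx_posE by (metis of_nat_Suc)
      moreover obtain N where "\<And>n. n \<ge> N \<Longrightarrow> ?u (left_product \<omega> n *v v) \<le> 1 / Suc j" using * by blast
      ultimately show "\<exists>no. \<forall>n\<ge>no. norm (?u (left_product \<omega> n *v v) - 0) < r"
        using cone_dist_nonneg[of S] by (intro exI[of _ N]) (force simp: abs_of_nonneg)
    qed
  qed
qed

end

section \<open>Borel structure of the quotient\<close>

text \<open>
  The projection with an arbitrary value at the origin, so that it is a measurable map on the whole space.
\<close>

definition orbit_map :: "real \<Rightarrow> real^'n \<Rightarrow> (real^'n) set" where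
  "orbit_map c v = Pc_proj c (if v = 0 then 1 else v)"

lemma orbit_map_eq: "v \<noteq> 0 \<Longrightarrow> orbit_map c v = Pc_proj c v"
  by (simp add: orbit_map_def)

lemma Pc_proj_in: "v \<noteq> 0 \<Longrightarrow> Pc_proj c v \<in> Pc c"
  by (auto simp: Pc_eq)

lemma one_vec_nonzero [simp]: "(1 :: real^'n) \<noteq> 0"
  by (simp add: vec_eq_iff)

lemma orbit_map_in: "orbit_map c v \<in> Pc c"
  by (simp add: orbit_map_def Pc_proj_in)

lemma PcE:
  assumes "x \<in> Pc c" obtains v where "v \<noteq> 0" "x = Pc_proj c v"
  using assms by (auto simp: Pc_eq)

lemma Pc_proj_scale:
  assumes "c > 1" "v \<noteq> 0"
  shows "Pc_proj c ((c powi k) *\<^sub>R v) = Pc_proj c v" "Pc_proj c (- v) = Pc_proj c v"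
proof -
  have "(v, (c powi k) *\<^sub>R v) \<in> homothety_rel c" using assms by (auto simp: homothety_rel_def)
  then show "Pc_proj c ((c powi k) *\<^sub>R v) = Pc_proj c v" using Pc_proj_eq_iff[OF assms(1), of v "(c powi k) *\<^sub>R v"] assms by auto
  have "(v, - v) \<in> homothety_rel c" using assms by (auto simp: homothety_rel_def intro!: exI[of _ 0])
  then show "Pc_proj c (- v) = Pc_proj c v" using Pc_proj_eq_iff[OF assms(1), of v "- v"] assms by auto
qed

lemma space_Pc_borel: "space (Pc_borel c) = (Pc c :: (real^'n) set set)"
  and sets_Pc_borel: "sets (Pc_borel c) = sigma_sets (Pc c) {U :: (real^'n) set set. openin (Pc_top c) U}"
proof -
  have "{U :: (real^'n) set set. openin (Pc_top c) U} \<subseteq> Pow (Pc c)" by (auto simp: openin_Pc_top)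
  then show "space (Pc_borel c) = (Pc c :: (real^'n) set set)"
    "sets (Pc_borel c) = sigma_sets (Pc c) {U :: (real^'n) set set. openin (Pc_top c) U}"
    by (simp_all add: Pc_borel_def borel_sigma_def topspace_Pc_top)
qed

lemma open_in_Pc_borel: "openin (Pc_top c) U \<Longrightarrow> U \<in> sets (Pc_borel c)"
  by (simp add: sets_Pc_borel sigma_sets.Basic)

lemma measurable_orbit_map: "orbit_map c \<in> measurable borel (Pc_borel c)"
  unfolding Pc_borel_def borel_sigma_def
proof (rule measurable_measure_of)
  show "{U. openin (Pc_top c) U} \<subseteq> Pow (topspace (Pc_top c))" by (auto dest: openin_subset)
  show "orbit_map c \<in> space borel \<rightarrow> topspace (Pc_top c)" by (simp add: topspace_Pc_top orbit_map_in)
  fix U :: "(real^'n) set set" assume "U \<in> {U. openin (Pc_top c) U}"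
  then have "open {v. v \<noteq> 0 \<and> Pc_proj c v \<in> U}" by (simp add: openin_Pc_top)
  moreover have "orbit_map c -` U \<inter> space borel = {v. v \<noteq> 0 \<and> Pc_proj c v \<in> U} \<union> (if orbit_map c 0 \<in> U then {0} else {})"
  proof (rule set_eqI)
    fix v :: "real^'n"
    show "v \<in> orbit_map c -` U \<inter> space borel \<longleftrightarrow>
      v \<in> {v. v \<noteq> 0 \<and> Pc_proj c v \<in> U} \<union> (if orbit_map c 0 \<in> U then {0} else {})"
      by (cases "v = 0") (simp_all add: orbit_map_def)
  qed
  ultimately show "orbit_map c -` U \<inter> space borel \<in> sets borel" by simp
qed

text \<open>
  The saturation of \<open>W\<close> is the union of its images under the homotheties.
\<close>

lemma openin_orbit_image:
  fixes W :: "(real^'n) set"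
  assumes c: "c > 1" and "open W" "0 \<notin> W"
  shows "openin (Pc_top c) (Pc_proj c ` W)"
  unfolding openin_Pc_top
proof
  show "Pc_proj c ` W \<subseteq> Pc c"
  proof safe
    fix v assume "v \<in> W"
    then have "v \<noteq> 0" using assms(3) by auto
    then show "Pc_proj c v \<in> Pc c" by (rule Pc_proj_in)
  qed
  have "{v. v \<noteq> 0 \<and> Pc_proj c v \<in> Pc_proj c ` W} = (\<Union>k::int. (*\<^sub>R) (c powi k) ` W \<union> (*\<^sub>R) (- (c powi k)) ` W)"
  proof safe
    fix v w assume v: "v \<noteq> 0" "Pc_proj c v = Pc_proj c w" "w \<in> W"
    then have "w \<noteq> 0" using assms(3) by auto
    then have "(w, v) \<in> homothety_rel c" using Pc_proj_eq_iff[OF c, of w v] v by auto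
    then obtain k :: int where "v = (c powi k) *\<^sub>R w \<or> v = (- (c powi k)) *\<^sub>R w" by (auto simp: homothety_rel_def)
    then show "v \<in> (\<Union>k::int. (*\<^sub>R) (c powi k) ` W \<union> (*\<^sub>R) (- (c powi k)) ` W)" using v(3) by blast
  next
    fix k :: int and w assume w: "w \<in> W"
    then have w0: "w \<noteq> 0" using assms(3) by auto
    show "Pc_proj c ((c powi k) *\<^sub>R w) \<in> Pc_proj c ` W" using Pc_proj_scale(1)[OF c w0] w by simp
    have "Pc_proj c (- ((c powi k) *\<^sub>R w)) = Pc_proj c w"
      using Pc_proj_scale(2)[OF c, of "(c powi k) *\<^sub>R w"] Pc_proj_scale(1)[OF c w0] w0 c by simp
    then show "Pc_proj c ((- (c powi k)) *\<^sub>R w) \<in> Pc_proj c ` W" using w by simp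
  qed (use assms in auto)
  also have "open \<dots>"
    using c assms(2) by (intro open_UN ballI open_Un open_scaling) auto
  finally show "open {v. v \<noteq> 0 \<and> Pc_proj c v \<in> Pc_proj c ` W}" .
qed

text \<open>
  The radius is chosen such that norms within the ball differ by a factor smaller than \<open>c\<close> and that the ball
  contains no two opposite vectors. No homothety other than the identity then maps a point of the ball into the
  ball.
\<close>

lemma injective_ball:
  fixes q :: "real^'n"
  assumes c: "c > 1" and "q \<noteq> 0"
  defines "e \<equiv> min (1/2) ((c - 1) / (c + 1))"
  shows "inj_on (Pc_proj c) (ball q (e * norm q))" "0 \<notin> ball q (e * norm q)" "e > 0"
proof -
  have "e \<le> (c - 1) / (c + 1)" by (simp add: e_def)
  then have "e * (c + 1) \<le> c - 1" using c by (simp add: pos_le_divide_eq)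
  moreover have "e > 0" using c by (simp add: e_def)
  moreover have "e \<le> 1/2" unfolding e_def by (rule min.cobounded1)
  ultimately have e: "e > 0" "e \<le> 1/2" "e * (c + 1) \<le> c - 1" by auto
  then show "e > 0" by simp
  have bounds: "(1 - e) * norm q < norm v \<and> norm v < (1 + e) * norm q" if "v \<in> ball q (e * norm q)" for v
  proof -
    have "norm (q - v) < e * norm q" using that by (simp add: dist_norm)
    then show ?thesis using norm_triangle_sub[of q v] norm_triangle_sub[of v q]
      by (simp add: norm_minus_commute algebra_simps)
  qed
  have q: "norm q > 0" using assms(2) by simp
  show "0 \<notin> ball q (e * norm q)"
    using q e(2) mult_right_mono[OF e(2), of "norm q"] by (auto simp: dist_norm)
  have ratio: "norm w < c * norm v" if "v \<in> ball q (e * norm q)" "w \<in> ball q (e * norm q)" for v w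
  proof -
    have "norm w < (1 + e) * norm q" using bounds[OF that(2)] by simp
    also have "\<dots> \<le> (c * (1 - e)) * norm q" using e q by (intro mult_right_mono) (auto simp: algebra_simps)
    also have "\<dots> = c * ((1 - e) * norm q)" by simp
    also have "\<dots> < c * norm v" using bounds[OF that(1)] c by simp
    finally show ?thesis .
  qed
  show "inj_on (Pc_proj c) (ball q (e * norm q))"
  proof (rule inj_onI)
    fix v w assume v: "v \<in> ball q (e * norm q)" and w: "w \<in> ball q (e * norm q)" and eq: "Pc_proj c v = Pc_proj c w"
    have nz: "v \<noteq> 0" "w \<noteq> 0" using v w \<open>0 \<notin> ball q (e * norm q)\<close> by auto
    then have "(v, w) \<in> homothety_rel c" using eq Pc_proj_eq_iff[OF c] by blast
    then obtain k :: int where k: "w = (c powi k) *\<^sub>R v \<or> w = (- (c powi k)) *\<^sub>R v" by (auto simp: homothety_rel_def)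
    have cp: "c powi k > 0" using c by simp
    have nw: "norm w = c powi k * norm v" using k cp by auto
    have "k = 0"
    proof (rule ccontr)
      assume "k \<noteq> 0"
      then consider "k \<ge> 1" | "k \<le> -1" by linarith
      then show False
      proof cases
        case 1
        then have "c powi 1 \<le> c powi k" using c by (intro power_int_increasing) auto
        then have "c * norm v \<le> norm w" unfolding nw by (intro mult_right_mono) auto
        then show False using ratio[OF v w] by simp
      next
        case 2
        then have "c powi k \<le> c powi (-1)" using c by (intro power_int_increasing) auto
        then have "norm w \<le> (c powi (-1)) * norm v" unfolding nw by (intro mult_right_mono) auto
        then have "c * norm w \<le> norm v" using c by (simp add: power_int_minus field_simps)
        then show False using ratio[OF w v] by simp
      qed
    qed
    then have "w = v \<or> w = - v" using k by auto
    moreover have "w \<noteq> - v"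
    proof
      assume "w = - v"
      then have "2 * norm v = norm (v - w)" by (simp flip: scaleR_2)
      also have "\<dots> \<le> norm (v - q) + norm (q - w)" using norm_triangle_ineq[of "v - q" "q - w"] by simp
      also have "\<dots> < 2 * (e * norm q)" using v w by (simp add: dist_norm norm_minus_commute)
      finally have "norm v < e * norm q" by simp
      moreover have "e * norm q \<le> (1 - e) * norm q" using e by (intro mult_right_mono) auto
      ultimately show False using bounds[OF v] by linarith
    qed
    ultimately show "v = w" by simp
  qed
qed

lemma injective_open_cover:
  assumes c: "c > 1"
  shows "\<exists>W :: nat \<Rightarrow> (real^'n) set. (\<forall>i. open (W i) \<and> inj_on (Pc_proj c) (W i) \<and> 0 \<notin> W i) \<and> (\<Union>i. W i) = - {0}"
proof -
  define e where "e = min (1/2) ((c - 1) / (c + 1))"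
  define \<F> where "\<F> = (\<lambda>q :: real^'n. ball q (e * norm q)) ` (- {0})"
  note ball = injective_ball[OF c, folded e_def]
  have "\<Union>\<F> = - {0}"
  proof (intro equalityI subsetI)
    fix x assume "x \<in> \<Union>\<F>"
    then obtain q where "q \<noteq> 0" "x \<in> ball q (e * norm q)" unfolding \<F>_def by blast
    then show "x \<in> - {0}" using ball(2)[of q] by auto
  next
    fix x :: "real^'n" assume "x \<in> - {0}"
    then have "x \<noteq> 0" by simp
    then have "x \<in> ball x (e * norm x)" using ball(3)[of x] by simp
    then show "x \<in> \<Union>\<F>" unfolding \<F>_def using \<open>x \<in> - {0}\<close> by blast
  qed
  moreover obtain \<G> where G: "\<G> \<subseteq> \<F>" "countable \<G>" "\<Union>\<G> = \<Union>\<F>"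
    using Lindelof[of \<F>] unfolding \<F>_def by (metis (no_types, lifting) imageE open_ball)
  ultimately have U: "\<Union>\<G> = - {0}" by simp
  have "(1 :: real^'n) \<in> \<Union>\<G>" unfolding U by simp
  then have "\<G> \<noteq> {}" by blast
  have good: "open S \<and> inj_on (Pc_proj c) S \<and> 0 \<notin> S" if S: "S \<in> \<G>" for S
  proof -
    obtain q where q: "q \<noteq> 0" "S = ball q (e * norm q)" using G(1) S unfolding \<F>_def by blast
    then show ?thesis using ball(1,2)[OF q(1)] by simp
  qed
  show ?thesis
  proof (intro exI[of _ "from_nat_into \<G>"] conjI allI)
    show "(\<Union>i. from_nat_into \<G> i) = - {0}" using range_from_nat_into[OF \<open>\<G> \<noteq> {}\<close> G(2)] U by simp
    show "open (from_nat_into \<G> i)" "inj_on (Pc_proj c) (from_nat_into \<G> i)" "0 \<notin> from_nat_into \<G> i" for i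
      using good[OF from_nat_into[OF \<open>\<G> \<noteq> {}\<close>]] by simp_all
  qed
qed

text \<open>
  On a set where the projection is injective it commutes with complements, so that the images of Borel sets can be
  found by induction on the generation of the Borel sets from the open ones.
\<close>

lemma borel_injective_image:
  fixes W :: "(real^'n) set"
  assumes c: "c > 1" and W: "open W" "inj_on (Pc_proj c) W" "0 \<notin> W" and B: "B \<in> sets borel"
  shows "Pc_proj c ` (B \<inter> W) \<in> sets (Pc_borel c)"
proof -
  have "B \<in> sigma_sets UNIV {S. open S}" using B by (simp add: borel_def)
  then show ?thesis
  proof induction
    case (Basic S)
    then show ?case using W by (intro open_in_Pc_borel openin_orbit_image c) auto
  next
    case (Compl S)
    have "Pc_proj c ` ((UNIV - S) \<inter> W) = Pc_proj c ` W - Pc_proj c ` (S \<inter> W)"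
      using W(2) by (auto simp: inj_on_def)
    moreover have "Pc_proj c ` W \<in> sets (Pc_borel c)" by (intro open_in_Pc_borel openin_orbit_image c W)
    ultimately show ?case using Compl.IH by (simp only: sets.Diff)
  next
    case (Union S)
    have "Pc_proj c ` (\<Union> (range S) \<inter> W) = (\<Union>i. Pc_proj c ` (S i \<inter> W))" by auto
    then show ?case using Union by auto
  qed simp
qed

text \<open>
  Each point is lifted by the first of countably many local inverses of the projection that is defined there.
  The section transfers questions of measurability on the quotient to the vector space.
\<close>

lemma measurable_representative:
  assumes c: "c > 1"
  shows "\<exists>R :: (real^'n) set \<Rightarrow> real^'n. R \<in> measurable (Pc_borel c) borel \<and> (\<forall>x\<in>Pc c. R x \<noteq> 0 \<and> Pc_proj c (R x) = x)"
proof -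
  obtain W :: "nat \<Rightarrow> (real^'n) set" where W: "\<And>i. open (W i)" "\<And>i. inj_on (Pc_proj c) (W i)" "\<And>i. 0 \<notin> W i" "(\<Union>i. W i) = - {0}"
    using injective_open_cover[OF c] by blast
  define ind where "ind x = (LEAST i. x \<in> Pc_proj c ` W i)" for x
  define R where "R x = the_inv_into (W (ind x)) (Pc_proj c) x" for x
  have ind: "x \<in> Pc_proj c ` W (ind x)" if "x \<in> Pc c" for x
  proof -
    obtain v where "v \<noteq> 0" "x = Pc_proj c v" using \<open>x \<in> Pc c\<close> by (rule PcE)
    then have "\<exists>i. x \<in> Pc_proj c ` W i" using W(4) by blast
    then show ?thesis unfolding ind_def by (rule LeastI_ex)
  qed
  have R: "R x \<in> W (ind x)" "Pc_proj c (R x) = x" if "x \<in> Pc c" for x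
    using the_inv_into_into[OF W(2) ind[OF that] subset_refl] f_the_inv_into_f[OF W(2) ind[OF that]] by (simp_all add: R_def)
  have "R \<in> measurable (Pc_borel c) borel"
  proof (rule measurableI)
    fix B :: "(real^'n) set" assume B: "B \<in> sets borel"
    have "R -` B \<inter> space (Pc_borel c) = (\<Union>i. Pc_proj c ` (B \<inter> W i) - (\<Union>j<i. Pc_proj c ` W j))"
      unfolding space_Pc_borel
    proof (intro equalityI subsetI)
      fix x assume "x \<in> R -` B \<inter> Pc c"
      then have x: "x \<in> Pc c" "R x \<in> B" by auto
      have "Pc_proj c (R x) \<in> Pc_proj c ` (B \<inter> W (ind x))" using R(1)[OF x(1)] x(2) by blast
      then have "x \<in> Pc_proj c ` (B \<inter> W (ind x))" using R(2)[OF x(1)] by simp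
      moreover have "x \<notin> Pc_proj c ` W j" if "j < ind x" for j using not_less_Least[of j] that unfolding ind_def by blast
      ultimately show "x \<in> (\<Union>i. Pc_proj c ` (B \<inter> W i) - (\<Union>j<i. Pc_proj c ` W j))" by blast
    next
      fix x assume "x \<in> (\<Union>i. Pc_proj c ` (B \<inter> W i) - (\<Union>j<i. Pc_proj c ` W j))"
      then obtain i v where v: "v \<in> B" "v \<in> W i" "x = Pc_proj c v" and first: "\<And>j. j < i \<Longrightarrow> x \<notin> Pc_proj c ` W j" by blast
      have "v \<noteq> 0" using v(2) W(3)[of i] by metis
      then have inP: "x \<in> Pc c" unfolding v(3) by (rule Pc_proj_in)
      have "ind x = i"
        unfolding ind_def
      proof (rule Least_equality)
        show "x \<in> Pc_proj c ` W i" using v by blast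
        show "i \<le> j" if "x \<in> Pc_proj c ` W j" for j using first[of j] that by (metis not_le)
      qed
      then have "R x = v" unfolding R_def using the_inv_into_f_f[OF W(2) v(2)] v(3) by simp
      then show "x \<in> R -` B \<inter> Pc c" using v inP by simp
    qed
    moreover have "Pc_proj c ` W j \<in> sets (Pc_borel c)" for j
      by (intro open_in_Pc_borel openin_orbit_image c W)
    ultimately show "R -` B \<inter> space (Pc_borel c) \<in> sets (Pc_borel c)"
      using borel_injective_image[OF c W(1-3) B] by auto
  qed auto
  moreover have "\<forall>x\<in>Pc c. R x \<noteq> 0 \<and> Pc_proj c (R x) = x" using R W(3) by metis
  ultimately show ?thesis by blast
qed

text \<open>
  Pulling back and descending are mutually inverse bijections between the continuous functions on the quotient and the
  homothety-invariant functions; the value at the origin is a convention.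
\<close>

definition pullback :: "real \<Rightarrow> ((real^'n) set \<Rightarrow> real) \<Rightarrow> real^'n \<Rightarrow> real" where
  "pullback c f v = (if v = 0 then 0 else f (Pc_proj c v))"

text \<open>
  The chosen representative is irrelevant for homothety-invariant \<open>F\<close>, the case in which this is used.
\<close>

definition descend :: "(real^'n \<Rightarrow> real) \<Rightarrow> (real^'n) set \<Rightarrow> real" where
  "descend F x = F (SOME v. v \<in> x)"

lemma pullback_invariant:
  fixes f :: "(real^'n) set \<Rightarrow> real"
  assumes c: "c > 1" and f: "continuous_map (Pc_top c) euclideanreal f"
  shows "homothety_invariant c (pullback c f)"
  unfolding homothety_invariant_def
proof (intro conjI allI)
  have "continuous_map (top_of_set (UNIV - {0})) euclideanreal (f \<circ> Pc_proj c)"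
    by (rule continuous_map_compose[OF quotient_imp_continuous_map[OF quotient_map_Pc_proj] f])
  then have "continuous_on (- {0}) (f \<circ> Pc_proj c)" by (simp add: Compl_eq_Diff_UNIV)
  then show "continuous_on (- {0}) (pullback c f)"
    by (rule continuous_on_eq) (auto simp: pullback_def)
  show "pullback c f 0 = 0" by (simp add: pullback_def)
  fix v
  show "pullback c f (c *\<^sub>R v) = pullback c f v" using Pc_proj_scale(1)[OF c, of v 1] c by (simp add: pullback_def)
  show "pullback c f (- v) = pullback c f v" using Pc_proj_scale(2)[OF c, of v] by (simp add: pullback_def)
qed

lemma descend_eq:
  assumes c: "c > 1" and F: "homothety_invariant c F" and v: "v \<noteq> 0"
  shows "descend F (Pc_proj c v) = F v"
proof -
  have "F w = F v" if "w \<in> Pc_proj c v" for w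
  proof -
    from that obtain k :: int where k: "w = (c powi k) *\<^sub>R v \<or> w = (- (c powi k)) *\<^sub>R v"
      by (auto simp: Pc_proj_def homothety_rel_def)
    have "F (- ((c powi k) *\<^sub>R v)) = F ((c powi k) *\<^sub>R v)" using F by (simp add: homothety_invariant_def)
    then show ?thesis using k homothety_invariant_power_int[OF F c, of k v] by auto
  qed
  moreover have "v \<in> Pc_proj c v" using v by (auto simp: Pc_proj_def homothety_rel_def intro!: exI[of _ 0])
  ultimately show ?thesis unfolding descend_def by (metis someI)
qed

lemma descend_continuous:
  fixes F :: "real^'n \<Rightarrow> real"
  assumes c: "c > 1" and F: "homothety_invariant c F"
  shows "continuous_map (Pc_top c) euclideanreal (descend F)"
proof (rule continuous_compose_quotient_map[OF quotient_map_Pc_proj])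
  have "continuous_on (- {0}) F" using F by (simp add: homothety_invariant_def)
  then have "continuous_on (- {0}) (descend F \<circ> Pc_proj c)"
    by (rule continuous_on_eq) (simp add: descend_eq[OF c F])
  then show "continuous_map (top_of_set (UNIV - {0})) euclideanreal (descend F \<circ> Pc_proj c)"
    by (simp add: Compl_eq_Diff_UNIV)
qed

lemma pullback_descend:
  assumes "c > 1" "homothety_invariant c F"
  shows "pullback c (descend F) = F"
  using assms by (auto simp: pullback_def descend_eq homothety_invariant_def fun_eq_iff)

lemma continuous_Pc_measurable:
  assumes "continuous_map (Pc_top c) euclideanreal f"
  shows "f \<in> borel_measurable (Pc_borel c)"
proof (rule borel_measurableI)
  fix S :: "real set" assume "open S"
  then have "openin (Pc_top c) {x \<in> topspace (Pc_top c). f x \<in> S}"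
    using assms by (auto simp: continuous_map)
  moreover have "f -` S \<inter> space (Pc_borel c) = {x \<in> topspace (Pc_top c). f x \<in> S}"
    by (auto simp: space_Pc_borel topspace_Pc_top)
  ultimately show "f -` S \<inter> space (Pc_borel c) \<in> sets (Pc_borel c)" by (simp add: open_in_Pc_borel)
qed

lemma continuous_Pc_bounded:
  fixes f :: "(real^'n) set \<Rightarrow> real"
  assumes c: "c > 1" and f: "continuous_map (Pc_top c) euclideanreal f"
  shows "\<exists>B>0. \<forall>x\<in>Pc c. \<bar>f x\<bar> \<le> B"
proof -
  obtain B where B: "B > 0" "\<And>v. \<bar>pullback c f v\<bar> \<le> B"
    using homothety_invariant_bounded[OF pullback_invariant[OF c f] c] by blast
  have "\<bar>f x\<bar> \<le> B" if "x \<in> Pc c" for x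
    using that B(2) by (metis PcE pullback_def)
  then show ?thesis using B(1) by blast
qed

lemma continuous_Pc_integrable:
  fixes f :: "(real^'n) set \<Rightarrow> real"
  assumes c: "c > 1" and f: "continuous_map (Pc_top c) euclideanreal f"
    and \<rho>: "prob_space \<rho>" "sets \<rho> = sets (Pc_borel c)"
  shows "integrable \<rho> f"
proof -
  interpret prob_space \<rho> by fact
  obtain B where B: "\<And>x. x \<in> Pc c \<Longrightarrow> \<bar>f x\<bar> \<le> B" using continuous_Pc_bounded[OF c f] by blast
  have "space \<rho> = Pc c" using sets_eq_imp_space_eq[OF \<rho>(2)] by (simp add: space_Pc_borel)
  then show ?thesis
    using B continuous_Pc_measurable[OF f] measurable_cong_sets[OF \<rho>(2) refl]
    by (intro integrable_const_bound[of _ B]) auto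
qed

definition cone_over :: "real \<Rightarrow> (real^'n) set set \<Rightarrow> (real^'n) set" where
  "cone_over c M = {v. v \<noteq> 0 \<and> Pc_proj c v \<in> M}"

lemma cone_over_scale:
  assumes "c > 1" "v \<in> cone_over c M"
  shows "c *\<^sub>R v \<in> cone_over c M" "(1 / c) *\<^sub>R v \<in> cone_over c M" "- v \<in> cone_over c M"
  using assms Pc_proj_scale(1)[OF assms(1), of v 1] Pc_proj_scale(1)[OF assms(1), of v "-1"] Pc_proj_scale(2)[OF assms(1), of v]
  by (auto simp: cone_over_def power_int_minus inverse_eq_divide)

lemma cone_over_dist_invariant: "c > 1 \<Longrightarrow> homothety_invariant c (cone_dist (cone_over c M))"
  by (intro cone_dist_invariant cone_over_scale)

lemma cone_over_nonempty: "M \<subseteq> Pc c \<Longrightarrow> M \<noteq> {} \<Longrightarrow> cone_over c M \<noteq> {}"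
  by (auto simp: cone_over_def elim!: PcE)

text \<open>
  For closed \<open>M\<close> the cone becomes closed when the origin is added, and \<open>v\<close> is not the origin.
\<close>

lemma cone_dist_eq_0_iff:
  fixes M :: "(real^'n) set set"
  assumes c: "c > 1" and M: "closedin (Pc_top c) M" "M \<noteq> {}" and v: "v \<noteq> 0"
  shows "cone_dist (cone_over c M) v = 0 \<longleftrightarrow> Pc_proj c v \<in> M"
proof -
  have MP: "M \<subseteq> Pc c" using closedin_subset[OF M(1)] by (simp add: topspace_Pc_top)
  have "openin (Pc_top c) (Pc c - M)" using M(1) by (simp add: closedin_def topspace_Pc_top)
  then have "open {v. v \<noteq> 0 \<and> Pc_proj c v \<in> Pc c - M}" by (simp add: openin_Pc_top)
  then have "closed (- {v. v \<noteq> 0 \<and> Pc_proj c v \<in> Pc c - M})" by (rule closed_Compl)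
  moreover have "- {v. v \<noteq> 0 \<and> Pc_proj c v \<in> Pc c - M} = insert 0 (cone_over c M)"
  proof (rule set_eqI)
    fix w :: "real^'n"
    show "w \<in> - {v. v \<noteq> 0 \<and> Pc_proj c v \<in> Pc c - M} \<longleftrightarrow> w \<in> insert 0 (cone_over c M)"
      by (cases "w = 0") (simp_all add: cone_over_def Pc_proj_in)
  qed
  ultimately have "closed (insert 0 (cone_over c M))" by (simp only:)
  then have cl: "closure (cone_over c M) \<subseteq> insert 0 (cone_over c M)" by (intro closure_minimal) auto
  have "cone_dist (cone_over c M) v = 0 \<longleftrightarrow> infdist v (cone_over c M) = 0" using v by (simp add: cone_dist_def)
  also have "\<dots> \<longleftrightarrow> v \<in> closure (cone_over c M)"
    using in_closure_iff_infdist_zero[OF cone_over_nonempty[OF MP M(2)]] by simp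
  also have "\<dots> \<longleftrightarrow> v \<in> cone_over c M" using cl v closure_subset[of "cone_over c M"] by auto
  also have "\<dots> \<longleftrightarrow> Pc_proj c v \<in> M" using v by (simp add: cone_over_def)
  finally show ?thesis .
qed

text \<open>
  Every closed set is the zero set of a continuous function, which makes continuous functions strong enough to
  determine measures and supports.
\<close>

lemma closed_zero_set:
  fixes M :: "(real^'n) set set"
  assumes c: "c > 1" and M: "closedin (Pc_top c) M" "M \<noteq> {}"
  defines "u \<equiv> descend (cone_dist (cone_over c M))"
  shows "continuous_map (Pc_top c) euclideanreal u" "\<And>x. x \<in> Pc c \<Longrightarrow> 0 \<le> u x"
    "\<And>x. x \<in> Pc c \<Longrightarrow> u x = 0 \<longleftrightarrow> x \<in> M"
proof -
  note F = cone_over_dist_invariant[OF c, of M]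
  show "continuous_map (Pc_top c) euclideanreal u" unfolding u_def by (rule descend_continuous[OF c F])
  show "0 \<le> u x" if "x \<in> Pc c" for x
    using that unfolding u_def by (elim PcE) (simp add: descend_eq[OF c F] cone_dist_nonneg)
  show "u x = 0 \<longleftrightarrow> x \<in> M" if "x \<in> Pc c" for x
    using that unfolding u_def by (elim PcE) (simp add: descend_eq[OF c F] cone_dist_eq_0_iff[OF c M])
qed

text \<open>
  The indicator of an open set is the increasing limit of the continuous functions \<open>min 1 (n * u)\<close>, where \<open>u\<close>
  vanishes exactly on the complement; and the open sets form a generator closed under intersection.
\<close>

lemma measure_eqI_continuous:
  fixes \<rho>1 \<rho>2 :: "(real^'n) set measure"
  assumes c: "c > 1" and 1: "prob_space \<rho>1" "sets \<rho>1 = sets (Pc_borel c)" and 2: "prob_space \<rho>2" "sets \<rho>2 = sets (Pc_borel c)"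
    and eq: "\<And>f. continuous_map (Pc_top c) euclideanreal f \<Longrightarrow> (\<integral>x. f x \<partial>\<rho>1) = (\<integral>x. f x \<partial>\<rho>2)"
  shows "\<rho>1 = \<rho>2"
proof (rule measure_eqI_generator_eq)
  show "Int_stable {U :: (real^'n) set set. openin (Pc_top c) U}" by (auto simp: Int_stable_def)
  show "{U :: (real^'n) set set. openin (Pc_top c) U} \<subseteq> Pow (Pc c)" by (auto simp: openin_Pc_top)
  show "sets \<rho>1 = sigma_sets (Pc c) {U. openin (Pc_top c) U}" "sets \<rho>2 = sigma_sets (Pc c) {U. openin (Pc_top c) U}"
    using 1 2 by (simp_all add: sets_Pc_borel)
  show "range (\<lambda>_::nat. Pc c) \<subseteq> {U. openin (Pc_top c) U}"
    using openin_topspace[of "Pc_top c"] by (auto simp: topspace_Pc_top)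
  show "(\<Union>i::nat. Pc c) = Pc c" by simp
  show "emeasure \<rho>1 (Pc c) \<noteq> \<infinity>" using finite_measure.emeasure_finite[OF prob_space.finite_measure[OF 1(1)]] by simp
  fix U :: "(real^'n) set set" assume "U \<in> {U. openin (Pc_top c) U}"
  then have U: "openin (Pc_top c) U" by simp
  have UP: "U \<subseteq> Pc c" using U by (simp add: openin_Pc_top)
  have mU: "measure \<rho> U = lim (\<lambda>n. \<integral>x. min 1 (real n * descend (cone_dist (cone_over c (Pc c - U))) x) \<partial>\<rho>)"
    if \<rho>: "prob_space \<rho>" "sets \<rho> = sets (Pc_borel c)" and ne: "Pc c - U \<noteq> {}" for \<rho>
  proof -
    interpret prob_space \<rho> by fact
    have sp: "space \<rho> = Pc c" using sets_eq_imp_space_eq[OF \<rho>(2)] by (simp add: space_Pc_borel)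
    have C: "closedin (Pc_top c) (Pc c - U)" using U UP by (auto simp: closedin_def topspace_Pc_top double_diff)
    let ?u = "descend (cone_dist (cone_over c (Pc c - U)))"
    note u = closed_zero_set[OF c C ne]
    have meas: "?u \<in> borel_measurable \<rho>"
      using continuous_Pc_measurable[OF u(1)] measurable_cong_sets[OF \<rho>(2) refl] by blast
    have "(\<lambda>n. \<integral>x. min 1 (real n * ?u x) \<partial>\<rho>) \<longlonglongrightarrow> (\<integral>x. indicator U x \<partial>\<rho>)"
    proof (rule integral_dominated_convergence[where w="\<lambda>_. 1"])
      show "AE x in \<rho>. (\<lambda>n. min 1 (real n * ?u x)) \<longlonglongrightarrow> indicator U x"
      proof (rule AE_I2)
        fix x assume "x \<in> space \<rho>"
        then have x: "x \<in> Pc c" by (simp add: sp)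
        show "(\<lambda>n. min 1 (real n * ?u x)) \<longlonglongrightarrow> indicator U x"
        proof (cases "x \<in> U")
          case True
          then have "?u x > 0" using u(2)[OF x] u(3)[OF x] by auto
          then obtain n0 :: nat where "1 < real n0 * ?u x" using reals_Archimedean3 by blast
          then have "\<forall>n\<ge>n0. min 1 (real n * ?u x) = 1"
            using \<open>?u x > 0\<close> by (intro allI impI min_absorb1) (meson less_imp_le mult_right_mono of_nat_mono order_trans)
          then have "\<forall>\<^sub>F n in sequentially. min 1 (real n * ?u x) = 1" by (auto simp: eventually_sequentially)
          then show ?thesis using True by (simp add: tendsto_eventually)
        next
          case False
          then show ?thesis using u(3)[OF x] x by simp
        qed
      qed
      show "AE x in \<rho>. norm (min 1 (real n * ?u x)) \<le> 1" for n
        using u(2) by (intro AE_I2) (auto simp: sp min_def)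
      show "(\<lambda>x. min 1 (real n * ?u x)) \<in> borel_measurable \<rho>" for n using meas by measurable
      show "(indicator U :: _ \<Rightarrow> real) \<in> borel_measurable \<rho>"
        using open_in_Pc_borel[OF U] \<rho>(2) by simp
    qed simp
    moreover have "(\<integral>x. indicator U x \<partial>\<rho>) = measure \<rho> U" using open_in_Pc_borel[OF U] \<rho>(2) by simp
    ultimately show ?thesis by (simp add: limI)
  qed
  show "emeasure \<rho>1 U = emeasure \<rho>2 U"
  proof (cases "Pc c - U = {}")
    case True
    then have "U = Pc c" using UP by blast
    then have "U = space \<rho>1" "U = space \<rho>2"
      using sets_eq_imp_space_eq[OF 1(2)] sets_eq_imp_space_eq[OF 2(2)] by (simp_all add: space_Pc_borel)
    then show ?thesis using prob_space.emeasure_space_1[OF 1(1)] prob_space.emeasure_space_1[OF 2(1)] by metis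
  next
    case False
    have C: "closedin (Pc_top c) (Pc c - U)" using U UP by (auto simp: closedin_def topspace_Pc_top double_diff)
    note u = closed_zero_set[OF c C False]
    have "continuous_map (Pc_top c) euclideanreal (\<lambda>x. min 1 (real n * descend (cone_dist (cone_over c (Pc c - U))) x))" for n
      by (intro continuous_intros u(1))
    then have "measure \<rho>1 U = measure \<rho>2 U" using mU[OF 1 False] mU[OF 2 False] eq by simp
    then show ?thesis
      using finite_measure.emeasure_eq_measure[OF prob_space.finite_measure] 1(1) 2(1) by metis
  qed
qed

section \<open>Weak compactness of uniformly bounded measures\<close>

text \<open>
  A continuous even function of period 2 that vanishes on \<open>[0, 1/3]\<close> and is equal to 1 on \<open>[2/3, 1]\<close>. The cosine yields
  evenness, periodicity and continuity without a distinction of cases.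
\<close>

definition bump :: "real \<Rightarrow> real" where
  "bump t = max 0 (min 1 (1/2 - cos (pi * t)))"

lemma bump_range: "0 \<le> bump t" "bump t \<le> 1"
  by (auto simp: bump_def)

lemma bump_shift: "bump (2 * of_int m + t) = bump t"
proof -
  have "cos (pi * (2 * of_int m + t)) = cos (pi * t + 2 * pi * of_int m)" by (simp add: algebra_simps)
  also have "\<dots> = cos (pi * t)" by (simp only: cos_add cos_int_2pin sin_int_2pin mult_1_right mult_zero_right diff_zero)
  finally show ?thesis by (simp add: bump_def)
qed

lemma bump_left: "0 \<le> t \<Longrightarrow> t \<le> 1/3 \<Longrightarrow> bump t = 0"
proof -
  assume t: "0 \<le> t" "t \<le> 1/3"
  have "cos (pi / 3) \<le> cos (pi * t)" using t by (intro cos_monotone_0_pi_le) auto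
  then have "1/2 - cos (pi * t) \<le> 0" unfolding cos_60 by linarith
  then show "bump t = 0" by (simp add: bump_def)
qed

lemma bump_right: "2/3 \<le> t \<Longrightarrow> t \<le> 1 \<Longrightarrow> bump t = 1"
proof -
  assume t: "2/3 \<le> t" "t \<le> 1"
  have "cos (pi * t) \<le> cos (2 * pi / 3)" using t by (intro cos_monotone_0_pi_le) auto
  then have "1 \<le> 1/2 - cos (pi * t)" unfolding cos_120 by linarith
  then have "min 1 (1/2 - cos (pi * t)) = 1" by (rule min_absorb1)
  then show "bump t = 1" by (simp add: bump_def)
qed

text \<open>
  Schoenberg's space-filling curve. For \<open>t\<close> in the Cantor set, the number \<open>bump (3 ^ k * t)\<close> is half of the ternary
  digit of \<open>t\<close> with index \<open>k\<close>. These digits are distributed over the coordinates, where they serve as binary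
  digits.
\<close>

definition schoenberg_curve :: "real \<Rightarrow> real^'n" where
  "schoenberg_curve t = (\<chi> j. \<Sum>i. bump (3 ^ prod_encode (i, to_nat j) * t) / 2 ^ Suc i)"

lemma summable_half_powers: "summable (\<lambda>i. 1 / 2 ^ Suc i :: real)"
proof -
  have "summable (\<lambda>i. (1/2) * (1/2 :: real) ^ i)" by (intro summable_mult summable_geometric) simp
  then show ?thesis by (simp add: power_one_over mult.commute)
qed

lemma continuous_schoenberg_curve: "continuous_on UNIV (schoenberg_curve :: real \<Rightarrow> real^'n)"
  unfolding schoenberg_curve_def
proof (intro continuous_on_vec_lambda)
  fix j :: 'n
  let ?f = "\<lambda>i t. bump (3 ^ prod_encode (i, to_nat j) * t) / 2 ^ Suc i"
  have "uniform_limit UNIV (\<lambda>n t. \<Sum>i<n. ?f i t) (\<lambda>t. \<Sum>i. ?f i t) sequentially"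
  proof (rule Weierstrass_m_test[OF _ summable_half_powers])
    show "norm (?f i t) \<le> 1 / 2 ^ Suc i" for i t using bump_range[of "3 ^ prod_encode (i, to_nat j) * t"] by (simp add: divide_right_mono)
  qed
  moreover have "continuous_on UNIV (\<lambda>t. \<Sum>i<n. ?f i t)" for n
    unfolding bump_def by (intro continuous_intros) auto
  ultimately show "continuous_on UNIV (\<lambda>t. \<Sum>i. ?f i t)"
    by (intro uniform_limit_theorem[of _ "\<lambda>n t. \<Sum>i<n. ?f i t"]) auto
qed

text \<open>
  Multiplication by \<open>3 ^ k\<close> shifts the expansion: \<open>3 ^ k * t\<close> differs by an even integer from a number \<open>T k\<close> whose
  first digit is the one with index \<open>k\<close>, and \<open>bump\<close> has period 2.
\<close>

lemma ternary_expansion_bump: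
  fixes \<beta> :: "nat \<Rightarrow> nat"
  assumes \<beta>: "\<And>k. \<beta> k \<le> 1"
  defines "t \<equiv> \<Sum>k. 2 * real (\<beta> k) / 3 ^ Suc k"
  shows "0 \<le> t" "t \<le> 1" "bump (3 ^ k * t) = \<beta> k"
proof -
  define T where "T k = (\<Sum>l. 2 * real (\<beta> (l + k)) / 3 ^ Suc l)" for k
  have geo: "(\<lambda>l. 2 / 3 ^ Suc l :: real) sums 1"
    using sums_mult[OF geometric_sums[of "1/3 :: real"], of "2/3"] by (simp add: power_divide)
  have le: "2 * real (\<beta> k) / 3 ^ Suc l \<le> 2 / 3 ^ Suc l" for k l
    using \<beta>[of k] by (intro divide_right_mono) auto
  have sm: "summable (\<lambda>l. 2 * real (\<beta> (l + k)) / 3 ^ Suc l)" for k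
    by (rule summable_comparison_test'[OF sums_summable[OF geo]]) (use le in auto)
  have T01: "0 \<le> T k" "T k \<le> 1" for k
  proof -
    show "0 \<le> T k" unfolding T_def by (rule suminf_nonneg[OF sm]) auto
    have "T k \<le> (\<Sum>l. 2 / 3 ^ Suc l)" unfolding T_def by (rule suminf_le[OF le sm sums_summable[OF geo]])
    then show "T k \<le> 1" using sums_unique[OF geo] by simp
  qed
  have rec: "3 * T k = 2 * real (\<beta> k) + T (Suc k)" for k
  proof -
    have "T k = (\<Sum>l. 2 * real (\<beta> (Suc l + k)) / 3 ^ Suc (Suc l)) + 2 * real (\<beta> (0 + k)) / 3 ^ Suc 0"
      using suminf_split_head[OF sm[of k]] unfolding T_def by linarith
    also have "(\<Sum>l. 2 * real (\<beta> (Suc l + k)) / 3 ^ Suc (Suc l)) = (\<Sum>l. (2 * real (\<beta> (l + Suc k)) / 3 ^ Suc l) / 3)"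
      by (simp add: mult.commute)
    also have "\<dots> = T (Suc k) / 3" unfolding T_def by (rule suminf_divide[OF sm])
    finally show ?thesis by simp
  qed
  have T0: "t = T 0" by (simp add: t_def T_def)
  show "0 \<le> t" "t \<le> 1" unfolding T0 by (rule T01)+
  have shift: "\<exists>m::int. 3 ^ k * t = 2 * of_int m + T k" for k
  proof (induction k)
    case 0 then show ?case by (intro exI[of _ 0]) (simp add: T0)
  next
    case (Suc k)
    then obtain m :: int where "3 ^ k * t = 2 * of_int m + T k" by blast
    then have "3 ^ Suc k * t = 2 * of_int (3 * m + int (\<beta> k)) + T (Suc k)" using rec[of k] by (simp add: algebra_simps)
    then show ?case by blast
  qed
  obtain m :: int where "3 ^ k * t = 2 * of_int m + T k" using shift by blast
  then have "bump (3 ^ k * t) = bump (T k)" by (simp add: bump_shift)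
  also have "\<dots> = \<beta> k"
  proof (cases "\<beta> k = 0")
    case True
    then show ?thesis using rec[of k] T01[of "Suc k"] T01[of k] by (simp add: bump_left)
  next
    case False
    then have "\<beta> k = 1" using \<beta>[of k] by simp
    then show ?thesis using rec[of k] T01[of "Suc k"] T01[of k] by (simp add: bump_right)
  qed
  finally show "bump (3 ^ k * t) = \<beta> k" .
qed

lemma binary_expansion:
  assumes "0 \<le> x" "x < (1::real)"
  shows "\<exists>b :: nat \<Rightarrow> nat. (\<forall>i. b i \<le> 1) \<and> (\<lambda>i. real (b i) / 2 ^ Suc i) sums x"
proof -
  define b where "b i = nat (\<lfloor>2 ^ Suc i * x\<rfloor> mod 2)" for i
  have b01: "b i \<le> 1" for i unfolding b_def by (simp add: nat_le_iff)
  have half: "\<lfloor>2 * y\<rfloor> = 2 * \<lfloor>y\<rfloor> + \<lfloor>2 * y\<rfloor> mod 2" for y :: real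
  proof -
    have "\<lfloor>2 * y\<rfloor> div 2 = \<lfloor>y\<rfloor>" by linarith
    then show ?thesis by presburger
  qed
  have partial: "(\<Sum>i<n. real (b i) / 2 ^ Suc i) = of_int \<lfloor>2 ^ n * x\<rfloor> / 2 ^ n" for n
  proof (induction n)
    case 0 then show ?case using assms by (simp add: floor_eq_iff)
  next
    case (Suc n)
    have "\<lfloor>2 ^ Suc n * x\<rfloor> = 2 * \<lfloor>2 ^ n * x\<rfloor> + \<lfloor>2 ^ Suc n * x\<rfloor> mod 2" using half[of "2 ^ n * x"] by (simp add: mult.assoc)
    then have "real_of_int \<lfloor>2 ^ Suc n * x\<rfloor> = 2 * of_int \<lfloor>2 ^ n * x\<rfloor> + real (b n)"
      by (simp add: b_def)
    then show ?case using Suc by (simp add: field_simps)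
  qed
  have "(\<lambda>n. of_int \<lfloor>2 ^ n * x\<rfloor> / 2 ^ n) \<longlonglongrightarrow> x"
  proof (rule tendsto_sandwich[of "\<lambda>n. x - 1 / 2 ^ n" _ _ "\<lambda>_. x"])
    have "(\<lambda>n. x - (1 / 2) ^ n) \<longlonglongrightarrow> x - 0" by (intro tendsto_intros LIMSEQ_realpow_zero) auto
    then show "(\<lambda>n. x - 1 / 2 ^ n) \<longlonglongrightarrow> x" by (simp add: power_divide)
    have "x - 1 / 2 ^ n \<le> of_int \<lfloor>2 ^ n * x\<rfloor> / 2 ^ n \<and> of_int \<lfloor>2 ^ n * x\<rfloor> / 2 ^ n \<le> x" for n
    proof -
      have "2 ^ n * x - 1 \<le> of_int \<lfloor>2 ^ n * x\<rfloor>" "of_int \<lfloor>2 ^ n * x\<rfloor> \<le> 2 ^ n * x" by linarith+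
      then have "(2 ^ n * x - 1) / 2 ^ n \<le> of_int \<lfloor>2 ^ n * x\<rfloor> / 2 ^ n"
        "of_int \<lfloor>2 ^ n * x\<rfloor> / 2 ^ n \<le> (2 ^ n * x) / 2 ^ n"
        by (intro divide_right_mono; simp)+
      then show ?thesis by (simp add: diff_divide_distrib)
    qed
    then show "\<forall>\<^sub>F n in sequentially. x - 1 / 2 ^ n \<le> of_int \<lfloor>2 ^ n * x\<rfloor> / 2 ^ n"
      "\<forall>\<^sub>F n in sequentially. of_int \<lfloor>2 ^ n * x\<rfloor> / 2 ^ n \<le> x" by auto
  qed auto
  then have "(\<lambda>i. real (b i) / 2 ^ Suc i) sums x" unfolding sums_def partial .
  then show ?thesis using b01 by blast
qed

lemma schoenberg_curve_onto:
  fixes x :: "real^'n"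
  assumes "\<And>j. 0 \<le> x $ j \<and> x $ j < 1"
  shows "\<exists>t. 0 \<le> t \<and> t \<le> 1 \<and> schoenberg_curve t = x"
proof -
  have "\<exists>b. \<forall>j. (\<forall>i. b j i \<le> (1::nat)) \<and> (\<lambda>i. real (b j i) / 2 ^ Suc i) sums (x $ j)"
    using binary_expansion assms by (intro choice) blast
  then obtain b where b: "\<And>j i. b j i \<le> (1::nat)" "\<And>j. (\<lambda>i. real (b j i) / 2 ^ Suc i) sums (x $ j)" by blast
  define \<beta> where "\<beta> k = (case prod_decode k of (i, m) \<Rightarrow> b (from_nat m) i)" for k
  have \<beta>1: "\<beta> k \<le> 1" for k using b(1) by (cases "prod_decode k") (simp add: \<beta>_def)
  define t where "t = (\<Sum>k. 2 * real (\<beta> k) / 3 ^ Suc k)"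
  have t: "0 \<le> t" "t \<le> 1" and bump_t: "\<And>k. bump (3 ^ k * t) = \<beta> k"
    unfolding t_def by (rule ternary_expansion_bump[OF \<beta>1])+
  have "schoenberg_curve t $ j = x $ j" for j
  proof -
    have "schoenberg_curve t $ j = (\<Sum>i. real (b j i) / 2 ^ Suc i)"
      by (simp add: schoenberg_curve_def bump_t \<beta>_def)
    then show ?thesis using sums_unique[OF b(2)] by simp
  qed
  then show ?thesis using t by (intro exI[of _ t]) (simp add: vec_eq_iff)
qed

lemma space_filling_map:
  assumes "K > 0"
  shows "\<exists>\<gamma> :: real \<Rightarrow> real^'n. continuous_on UNIV \<gamma> \<and> (\<forall>x. norm x < K \<longrightarrow> (\<exists>t. 0 \<le> t \<and> t \<le> 1 \<and> \<gamma> t = x))"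
proof (intro exI[of _ "\<lambda>t. (\<chi> j. 2 * K * (schoenberg_curve t $ j) - K)"] conjI allI impI)
  show "continuous_on UNIV (\<lambda>t. (\<chi> j. 2 * K * (schoenberg_curve t $ j) - K) :: real^'n)"
    by (intro continuous_on_vec_lambda continuous_intros continuous_schoenberg_curve)
  fix x :: "real^'n" assume x: "norm x < K"
  have "0 \<le> (\<chi> j. (x $ j + K) / (2 * K)) $ j \<and> (\<chi> j. (x $ j + K) / (2 * K)) $ j < 1" for j :: 'n
    using component_le_norm_cart[of x j] x assms by (auto simp: field_simps abs_le_iff)
  then obtain t where t: "0 \<le> t" "t \<le> 1" "schoenberg_curve t = (\<chi> j. (x $ j + K) / (2 * K))"
    using schoenberg_curve_onto by blast
  then show "\<exists>t. 0 \<le> t \<and> t \<le> 1 \<and> (\<chi> j. 2 * K * (schoenberg_curve t $ j) - K) = x"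
    using assms by (intro exI[of _ t]) (simp add: vec_eq_iff)
qed

text \<open>
  The section picks the least preimage in the unit interval. Within the ball, its sublevel sets are images of compact
  intervals.
\<close>

lemma measurable_section:
  fixes \<gamma> :: "real \<Rightarrow> real^'n"
  assumes \<gamma>: "continuous_on UNIV \<gamma>" and onto: "\<And>x. norm x < K \<Longrightarrow> \<exists>t. 0 \<le> t \<and> t \<le> 1 \<and> \<gamma> t = x"
  shows "\<exists>\<sigma>\<in>borel_measurable borel. (\<forall>x. norm x < K \<longrightarrow> \<gamma> (\<sigma> x) = x) \<and> (\<forall>x. 0 \<le> \<sigma> x \<and> \<sigma> x \<le> 1)"
proof -
  define \<sigma> where "\<sigma> x = (if norm x < K then Inf {t \<in> {0..1}. \<gamma> t = x} else 0)" for x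
  have closed: "closed {t \<in> {0..1}. \<gamma> t = x}" for x
  proof -
    have "closed ({0..1} \<inter> {t. \<gamma> t = x})" by (intro closed_Int closed_Collect_eq \<gamma> continuous_intros closed_atLeastAtMost)
    then show ?thesis by (simp add: Int_def)
  qed
  have bdd: "bdd_below {t \<in> {0..1}. \<gamma> t = x}" for x by (rule bdd_belowI[of _ 0]) auto
  have in_fibre: "\<sigma> x \<in> {t \<in> {0..1}. \<gamma> t = x}" if "norm x < K" for x
    using closed_contains_Inf[OF _ bdd closed, of x] onto[OF that] that by (force simp: \<sigma>_def)
  have "\<sigma> \<in> borel_measurable borel"
    unfolding borel_measurable_iff_le
  proof
    fix s
    have "{x. \<sigma> x \<le> s} = ({x. norm x < K} \<inter> \<gamma> ` ({0..1} \<inter> {..s})) \<union> ({x. \<not> norm x < K} \<inter> {x. 0 \<le> s})"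
    proof (rule set_eqI)
      fix x
      show "x \<in> {x. \<sigma> x \<le> s} \<longleftrightarrow> x \<in> ({x. norm x < K} \<inter> \<gamma> ` ({0..1} \<inter> {..s})) \<union> ({x. \<not> norm x < K} \<inter> {x. 0 \<le> s})"
      proof (cases "norm x < K")
        case True
        have "\<sigma> x \<le> s \<longleftrightarrow> x \<in> \<gamma> ` ({0..1} \<inter> {..s})"
        proof
          assume "\<sigma> x \<le> s"
          then show "x \<in> \<gamma> ` ({0..1} \<inter> {..s})" using in_fibre[OF True] by (intro image_eqI[of _ _ "\<sigma> x"]) auto
        next
          assume "x \<in> \<gamma> ` ({0..1} \<inter> {..s})"
          then obtain t where t: "x = \<gamma> t" "t \<in> {0..1}" "t \<le> s" by auto
          then have "Inf {t \<in> {0..1}. \<gamma> t = x} \<le> t" by (intro cInf_lower bdd) auto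
          then show "\<sigma> x \<le> s" using t True by (simp add: \<sigma>_def)
        qed
        then show ?thesis using True by simp
      next
        case False
        then show ?thesis by (simp add: \<sigma>_def)
      qed
    qed
    moreover have "compact (\<gamma> ` ({0..1} \<inter> {..s}))"
      by (intro compact_continuous_image continuous_on_subset[OF \<gamma>] compact_Int_closed) auto
    then have "\<gamma> ` ({0..1} \<inter> {..s}) \<in> sets borel" by (intro borel_closed compact_imp_closed)
    ultimately show "{x \<in> space borel. \<sigma> x \<le> s} \<in> sets borel" by simp
  qed
  moreover have "0 \<le> \<sigma> x \<and> \<sigma> x \<le> 1" for x
    using in_fibre[of x] by (cases "norm x < K") (auto simp: \<sigma>_def)
  ultimately show ?thesis using in_fibre by blast
qed

text \<open>
  A continuous map \<open>\<gamma>\<close> whose values on the unit interval cover the ball, together with a measurable section \<open>\<sigma>\<close>, reduces the claim to the real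
  line: Helly's selection theorem applies to the images under \<open>\<sigma>\<close>, and the limit is carried back by \<open>\<gamma>\<close>.
\<close>

theorem bounded_measures_weakly_compact:
  fixes M :: "nat \<Rightarrow> (real^'n) measure"
  assumes M: "\<And>n. prob_space (M n)" "\<And>n. sets (M n) = sets borel"
    and supp: "\<And>n. AE x in M n. norm x < K"
  shows "\<exists>(r :: nat \<Rightarrow> nat) N. strict_mono r \<and> prob_space N \<and> sets N = sets borel \<and>
    (\<forall>f :: real^'n \<Rightarrow> real. continuous_on UNIV f \<longrightarrow> bounded (range f) \<longrightarrow>
      (\<lambda>n. \<integral>x. f x \<partial>M (r n)) \<longlonglongrightarrow> (\<integral>x. f x \<partial>N))"
proof -
  have "K > 0"
  proof (rule ccontr)
    assume "\<not> K > 0"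
    have "AE x in M 0. False" using supp[of 0]
    proof eventually_elim
      case (elim x)
      then show False using \<open>\<not> K > 0\<close> norm_ge_zero[of x] by linarith
    qed
    then show False using prob_space.AE_False[OF M(1)] by blast
  qed
  then obtain \<gamma> :: "real \<Rightarrow> real^'n" where \<gamma>: "continuous_on UNIV \<gamma>" "\<And>x. norm x < K \<Longrightarrow> \<exists>t. 0 \<le> t \<and> t \<le> 1 \<and> \<gamma> t = x"
    using space_filling_map by blast
  obtain \<sigma> where \<sigma>: "\<sigma> \<in> borel_measurable borel" "\<And>x. norm x < K \<Longrightarrow> \<gamma> (\<sigma> x) = x" "\<And>x. 0 \<le> \<sigma> x \<and> \<sigma> x \<le> 1"
    using measurable_section[OF \<gamma>] by blast
  have \<sigma>M: "\<sigma> \<in> borel_measurable (M n)" for n using \<sigma>(1) measurable_cong_sets[OF M(2) refl] by blast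
  define m where "m n = distr (M n) borel \<sigma>" for n
  have rd: "real_distribution (m n)" for n
    unfolding m_def by (rule prob_space.real_distribution_distr[OF M(1) \<sigma>M])
  have "tight m"
    unfolding tight_def
  proof (intro conjI allI impI rd)
    fix \<epsilon> :: real assume "\<epsilon> > 0"
    have "measure (m n) {-1<..1} = 1" for n
    proof -
      have "measure (m n) {-1<..1} = measure (M n) (\<sigma> -` {-1<..1} \<inter> space (M n))"
        unfolding m_def by (rule measure_distr[OF \<sigma>M]) simp
      also have "\<sigma> -` {-1<..1} \<inter> space (M n) = space (M n)" using \<sigma>(3) by (force intro: less_le_trans[of _ 0])
      finally show ?thesis using prob_space.prob_space[OF M(1)] by simp
    qed
    then show "\<exists>a b. a < b \<and> (\<forall>n. 1 - \<epsilon> < measure (m n) {a<..b})" using \<open>\<epsilon> > 0\<close> by (intro exI[of _ "-1"] exI[of _ 1]) simp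
  qed
  then obtain r N where r: "strict_mono (r :: nat \<Rightarrow> nat)" "real_distribution N" "weak_conv_m (m \<circ> id \<circ> r) N"
    using tight_imp_convergent_subsubsequence[of m id] by (auto simp: strict_mono_def)
  interpret N: real_distribution N by fact
  have \<gamma>N: "\<gamma> \<in> borel_measurable N"
    using borel_measurable_continuous_onI[OF \<gamma>(1)] measurable_cong_sets[OF N.events_eq_borel refl] by blast
  show ?thesis
  proof (intro exI[of _ r] exI[of _ "distr N borel \<gamma>"] conjI allI impI)
    show "prob_space (distr N borel \<gamma>)" by (rule N.prob_space_distr[OF \<gamma>N])
    fix f :: "real^'n \<Rightarrow> real" assume f: "continuous_on UNIV f" "bounded (range f)"
    then obtain C where C: "\<And>x. norm (f x) \<le> C" unfolding bounded_iff by auto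
    have cont: "continuous_on UNIV (\<lambda>t. f (\<gamma> t))"
      by (rule continuous_on_compose2[OF f(1) \<gamma>(1)]) auto
    have "(\<lambda>n. integral\<^sup>L ((m \<circ> id \<circ> r) n) (\<lambda>t. f (\<gamma> t))) \<longlonglongrightarrow> integral\<^sup>L N (\<lambda>t. f (\<gamma> t))"
      using cont C
      by (intro weak_conv_imp_integral_bdd_continuous_conv[OF _ _ r(3)] rd r(2))
         (auto simp: continuous_on_eq_continuous_at rd)
    moreover have "integral\<^sup>L ((m \<circ> id \<circ> r) n) (\<lambda>t. f (\<gamma> t)) = (\<integral>x. f x \<partial>M (r n))" for n
    proof -
      have "integral\<^sup>L ((m \<circ> id \<circ> r) n) (\<lambda>t. f (\<gamma> t)) = (\<integral>x. f (\<gamma> (\<sigma> x)) \<partial>M (r n))"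
        unfolding m_def comp_def id_def by (rule integral_distr[OF \<sigma>M borel_measurable_continuous_onI[OF cont]])
      also have "\<dots> = (\<integral>x. f x \<partial>M (r n))"
      proof (rule integral_cong_AE)
        show "(\<lambda>x. f (\<gamma> (\<sigma> x))) \<in> borel_measurable (M (r n))"
          by (rule measurable_compose[OF \<sigma>M borel_measurable_continuous_onI[OF cont]])
        show "f \<in> borel_measurable (M (r n))"
          using borel_measurable_continuous_onI[OF f(1)] measurable_cong_sets[OF M(2) refl] by blast
        show "AE x in M (r n). f (\<gamma> (\<sigma> x)) = f x" using supp[of "r n"] by eventually_elim (simp add: \<sigma>(2))
      qed
      finally show ?thesis .
    qed
    moreover have "integral\<^sup>L N (\<lambda>t. f (\<gamma> t)) = (\<integral>x. f x \<partial>distr N borel \<gamma>)"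
      by (rule integral_distr[OF \<gamma>N borel_measurable_continuous_onI[OF f(1)], symmetric])
    ultimately show "(\<lambda>n. \<integral>x. f x \<partial>M (r n)) \<longlonglongrightarrow> (\<integral>x. f x \<partial>distr N borel \<gamma>)" by simp
  qed (use r in auto)
qed

section \<open>The Markov operator on the quotient\<close>

text \<open>
  Adding the bound to the function makes it non-negative and reduces the formula to that for the Lebesgue
  integral of non-negative functions.
\<close>

lemma integral_bind_bounded:
  fixes f :: "'b \<Rightarrow> real"
  assumes M: "prob_space M" and K: "K \<in> measurable M (subprob_algebra N)" "\<And>x. x \<in> space M \<Longrightarrow> prob_space (K x)"
    and f: "f \<in> borel_measurable N" "\<And>y. y \<in> space N \<Longrightarrow> \<bar>f y\<bar> \<le> B"
  shows "(\<integral>y. f y \<partial>(M \<bind> K)) = (\<integral>x. \<integral>y. f y \<partial>K x \<partial>M)"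
proof -
  interpret M: prob_space M by fact
  have sK: "sets (K x) = sets N" if "x \<in> space M" for x using sets_kernel[OF K(1) that] .
  have spK: "space (K x) = space N" if "x \<in> space M" for x using sets_eq_imp_space_eq[OF sK[OF that]] .
  have sB: "sets (M \<bind> K) = sets N" by (rule sets_bind[OF sK M.not_empty])
  have spB: "space (M \<bind> K) = space N" by (rule sets_eq_imp_space_eq[OF sB])
  interpret B: prob_space "M \<bind> K" by (rule M.prob_space_bind[OF AE_I2 K(1)]) (rule K(2))
  have fB: "f \<in> borel_measurable (M \<bind> K)" using f(1) measurable_cong_sets[OF sB refl] by blast
  have fK: "f \<in> borel_measurable (K x)" if "x \<in> space M" for x
    using f(1) measurable_cong_sets[OF sK[OF that] refl] by blast
  have iB: "integrable (M \<bind> K) f" by (rule B.integrable_const_bound[of _ B]) (use f(2) fB spB in auto)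
  have iK: "integrable (K x) f" if "x \<in> space M" for x
    using prob_space.finite_measure[OF K(2)[OF that]] f(2) fK[OF that] spK[OF that]
    by (intro finite_measure.integrable_const_bound[of _ _ B]) auto
  have inner: "(\<lambda>x. \<integral>y. f y \<partial>K x) \<in> borel_measurable M"
    by (rule measurable_compose[OF K(1) integral_measurable_subprob_algebra[OF f(1)]])
  have innerB: "\<bar>\<integral>y. f y \<partial>K x\<bar> \<le> B" if x: "x \<in> space M" for x
  proof -
    interpret Kx: prob_space "K x" by (rule K(2)[OF x])
    have "\<bar>\<integral>y. f y \<partial>K x\<bar> \<le> (\<integral>y. \<bar>f y\<bar> \<partial>K x)" by (rule integral_abs_bound)
    also have "\<dots> \<le> (\<integral>y. B \<partial>K x)" by (rule integral_mono) (use iK[OF x] f(2) spK[OF x] in auto)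
    finally show ?thesis by (simp add: Kx.prob_space)
  qed
  have iM: "integrable M (\<lambda>x. \<integral>y. f y \<partial>K x)"
    by (rule M.integrable_const_bound[of _ B]) (use innerB inner in auto)
  have "ennreal ((\<integral>y. f y \<partial>(M \<bind> K)) + B) = ennreal (\<integral>y. f y + B \<partial>(M \<bind> K))"
    using iB by (simp add: B.prob_space)
  also have "\<dots> = (\<integral>\<^sup>+y. ennreal (f y + B) \<partial>(M \<bind> K))"
    by (rule nn_integral_eq_integral[symmetric]) (use iB f(2) spB in \<open>force simp: abs_le_iff\<close>)+
  also have "\<dots> = (\<integral>\<^sup>+x. \<integral>\<^sup>+y. ennreal (f y + B) \<partial>K x \<partial>M)"
    by (rule nn_integral_bind[OF _ K(1)]) (use f(1) in measurable)
  also have "\<dots> = (\<integral>\<^sup>+x. ennreal ((\<integral>y. f y \<partial>K x) + B) \<partial>M)"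
  proof (rule nn_integral_cong)
    fix x assume x: "x \<in> space M"
    interpret Kx: prob_space "K x" by (rule K(2)[OF x])
    have "(\<integral>\<^sup>+y. ennreal (f y + B) \<partial>K x) = ennreal (\<integral>y. f y + B \<partial>K x)"
      by (rule nn_integral_eq_integral) (use iK[OF x] f(2) spK[OF x] in \<open>force simp: abs_le_iff\<close>)+
    then show "(\<integral>\<^sup>+y. ennreal (f y + B) \<partial>K x) = ennreal ((\<integral>y. f y \<partial>K x) + B)"
      using iK[OF x] by (simp add: Kx.prob_space)
  qed
  also have "\<dots> = ennreal (\<integral>x. (\<integral>y. f y \<partial>K x) + B \<partial>M)"
    by (rule nn_integral_eq_integral) (use iM innerB in \<open>force simp: abs_le_iff\<close>)+
  also have "\<dots> = ennreal ((\<integral>x. \<integral>y. f y \<partial>K x \<partial>M) + B)"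
    using iM by (simp add: M.prob_space)
  finally have eq: "ennreal ((\<integral>y. f y \<partial>(M \<bind> K)) + B) = ennreal ((\<integral>x. \<integral>y. f y \<partial>K x \<partial>M) + B)" .
  have "\<bar>\<integral>y. f y \<partial>(M \<bind> K)\<bar> \<le> (\<integral>y. \<bar>f y\<bar> \<partial>(M \<bind> K))" by (rule integral_abs_bound)
  also have "\<dots> \<le> (\<integral>y. B \<partial>(M \<bind> K))" by (rule integral_mono) (use iB f(2) spB in auto)
  finally have 1: "(\<integral>y. f y \<partial>(M \<bind> K)) + B \<ge> 0" by (simp add: B.prob_space abs_le_iff)
  have "\<bar>\<integral>x. \<integral>y. f y \<partial>K x \<partial>M\<bar> \<le> (\<integral>x. \<bar>\<integral>y. f y \<partial>K x\<bar> \<partial>M)" by (rule integral_abs_bound)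
  also have "\<dots> \<le> (\<integral>x. B \<partial>M)" by (rule integral_mono) (use iM innerB in auto)
  finally have 2: "(\<integral>x. \<integral>y. f y \<partial>K x \<partial>M) + B \<ge> 0" by (simp add: M.prob_space abs_le_iff)
  show ?thesis using eq unfolding ennreal_inj[OF 1 2] by simp
qed

text \<open>
  The words in \<open>T\<close> lie in the space of \<open>\<mu>\<close> and are dense in it; it is on these words that strong irreducibility and the
  limit of rank one are assumed.
\<close>

locale projective_walk = irreducible_walk \<mu> G T h a v0 \<phi>
  for \<mu> :: "(real^'n^'n) measure" and G T :: "(real^'n^'n) set" and h :: "nat \<Rightarrow> real^'n^'n"
    and a :: "nat \<Rightarrow> real" and v0 \<phi> :: "real^'n" +
  fixes c :: real
  assumes c: "c > 1" and G_sub: "G \<subseteq> space \<mu>" and G_dense: "space \<mu> \<subseteq> closure G" and T_sub: "T \<subseteq> G"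
begin

abbreviation "N \<equiv> Pc_borel c :: (real^'n) set measure"

lemma act_proj: "g \<in> space \<mu> \<Longrightarrow> v \<noteq> 0 \<Longrightarrow> act g (Pc_proj c v) = Pc_proj c (g *v v)"
  by (rule act_Pc_proj[OF c invertible_mu])

lemma act_in: "g \<in> space \<mu> \<Longrightarrow> x \<in> Pc c \<Longrightarrow> act g x \<in> Pc c"
  using invertible_mu by (elim PcE) (simp add: act_proj Pc_proj_in)

text \<open>
  The action is computed on the measurable representative.
\<close>

lemma measurable_action: "(\<lambda>(x, g). act g x) \<in> measurable (N \<Otimes>\<^sub>M \<mu>) N"
proof -
  obtain R :: "(real^'n) set \<Rightarrow> real^'n" where R: "R \<in> measurable N borel" "\<And>x. x \<in> Pc c \<Longrightarrow> R x \<noteq> 0" "\<And>x. x \<in> Pc c \<Longrightarrow> Pc_proj c (R x) = x"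
    using measurable_representative[OF c] by blast
  have meas: "(\<lambda>z. R (fst z)) \<in> borel_measurable (N \<Otimes>\<^sub>M \<mu>)" "(\<lambda>z. snd z) \<in> borel_measurable (N \<Otimes>\<^sub>M \<mu>)"
    using measurable_compose[OF measurable_fst R(1)] measurable_compose[OF measurable_snd measurable_subspace] by auto
  have "(\<lambda>z. orbit_map c (snd z *v R (fst z))) \<in> measurable (N \<Otimes>\<^sub>M \<mu>) N"
    by (rule measurable_compose[OF measurable_matrix_vector[OF meas(2,1)] measurable_orbit_map])
  then show ?thesis
  proof (rule measurable_cong[THEN iffD1, rotated])
    fix z assume "z \<in> space (N \<Otimes>\<^sub>M \<mu>)"
    then have z: "fst z \<in> Pc c" "snd z \<in> space \<mu>" by (auto simp: space_pair_measure space_Pc_borel)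
    have "snd z *v R (fst z) \<noteq> 0" using R(2)[OF z(1)] invertible_mu[OF z(2)] by simp
    then have "orbit_map c (snd z *v R (fst z)) = act (snd z) (Pc_proj c (R (fst z)))"
      using act_proj[OF z(2) R(2)[OF z(1)]] by (simp add: orbit_map_eq)
    then show "orbit_map c (snd z *v R (fst z)) = (case z of (x, g) \<Rightarrow> act g x)"
      using R(3)[OF z(1)] by (simp add: case_prod_unfold)
  qed
qed

lemma measurable_action_left: "x \<in> Pc c \<Longrightarrow> (\<lambda>g. act g x) \<in> measurable \<mu> N"
  using measurable_compose[OF measurable_Pair1' measurable_action, of x] by (simp add: space_Pc_borel)

lemma measurable_action_right: "g \<in> space \<mu> \<Longrightarrow> act g \<in> measurable N N"
  using measurable_compose[OF measurable_Pair2' measurable_action, of g] by simp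

lemma mu_in_algebra: "\<mu> \<in> space (subprob_algebra \<mu>)"
  using prob_mu by (simp add: space_subprob_algebra prob_space_imp_subprob_space)

lemma measurable_markov_kernel: "markov_kernel c \<mu> \<in> measurable N (subprob_algebra N)"
proof -
  have "(\<lambda>z. return N (act (snd z) (fst z))) \<in> measurable (N \<Otimes>\<^sub>M \<mu>) (subprob_algebra N)"
    using measurable_compose[OF measurable_action return_measurable] by (simp add: case_prod_unfold)
  then show ?thesis
    unfolding markov_kernel_def[abs_def]
    by (intro measurable_bind[where N=\<mu>] measurable_const mu_in_algebra)
qed

lemma measurable_markov_iter: "markov_iter c \<mu> n \<in> measurable N (subprob_algebra N)"
proof (induction n)
  case 0
  have "markov_iter c \<mu> 0 = return N" by (simp add: fun_eq_iff)
  then show ?case by (simp only: return_measurable)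
next
  case (Suc n)
  have "markov_iter c \<mu> (Suc n) = (\<lambda>x. markov_kernel c \<mu> x \<bind> markov_iter c \<mu> n)" by (simp add: fun_eq_iff)
  then show ?case using measurable_bind2[OF measurable_markov_kernel Suc] by simp
qed

lemma measurable_return_action: "x \<in> Pc c \<Longrightarrow> (\<lambda>g. return N (act g x)) \<in> measurable \<mu> (subprob_algebra N)"
  by (rule measurable_compose[OF measurable_action_left return_measurable])

lemma prob_space_markov_kernel: "x \<in> Pc c \<Longrightarrow> prob_space (markov_kernel c \<mu> x)"
  unfolding markov_kernel_def
  by (rule prob_space.prob_space_bind[OF prob_mu AE_I2 measurable_return_action])
     (auto intro!: prob_space_return simp: space_Pc_borel act_in)

lemma sets_markov_kernel: "x \<in> Pc c \<Longrightarrow> sets (markov_kernel c \<mu> x) = sets N"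
  by (rule sets_kernel[OF measurable_markov_kernel]) (simp add: space_Pc_borel)

lemma prob_space_markov_iter: "x \<in> Pc c \<Longrightarrow> prob_space (markov_iter c \<mu> n x)"
proof (induction n arbitrary: x)
  case 0 then show ?case by (simp add: prob_space_return space_Pc_borel)
next
  case (Suc n)
  have sp: "space (markov_kernel c \<mu> x) = Pc c"
    using sets_eq_imp_space_eq[OF sets_markov_kernel[OF Suc.prems]] by (simp add: space_Pc_borel)
  have m: "markov_iter c \<mu> n \<in> measurable (markov_kernel c \<mu> x) (subprob_algebra N)"
    using measurable_markov_iter measurable_cong_sets[OF sets_markov_kernel[OF Suc.prems] refl] by blast
  show ?case
    using prob_space.prob_space_bind[OF prob_space_markov_kernel[OF Suc.prems] AE_I2 m] Suc.IH sp by simp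
qed

lemma integral_first_step:
  fixes F :: "real^'n^'n \<Rightarrow> real"
  assumes "F \<in> borel_measurable borel"
  shows "(\<integral>\<omega>. F (left_product \<omega> 1) \<partial>PP) = (\<integral>g. F g \<partial>\<mu>)"
proof -
  interpret sequence_space \<mu> by (rule sequence_space_mu)
  have F\<mu>: "F \<in> borel_measurable \<mu>" using measurable_compose[OF measurable_subspace assms] by simp
  have "(\<integral>g. F g \<partial>\<mu>) = (\<integral>g. F g \<partial>distr PP \<mu> (\<lambda>\<omega>. \<omega> 0))" using PiM_component[of 0] by simp
  also have "\<dots> = (\<integral>\<omega>. F (\<omega> 0) \<partial>PP)" by (rule integral_distr[OF _ F\<mu>]) simp
  finally show ?thesis by simp
qed

lemma average_one:
  assumes "homothety_invariant c F"
  shows "average 1 F v = (\<integral>g. F (g *v v) \<partial>\<mu>)"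
  unfolding average_def
proof (rule integral_first_step)
  show "(\<lambda>g. F (g *v v)) \<in> borel_measurable borel"
    by (rule measurable_compose[OF _ homothety_invariant_measurable[OF assms]]) measurable
qed

lemma average_compose:
  assumes "homothety_invariant c F"
  shows "average (n + k) F = average k (average n F)"
  using average_add(1)[OF assms c] by (simp add: average_def[of k] fun_eq_iff)

lemma integral_markov_kernel:
  assumes f: "continuous_map (Pc_top c) euclideanreal f" and x: "x \<in> Pc c"
  shows "(\<integral>y. f y \<partial>markov_kernel c \<mu> x) = (\<integral>g. f (act g x) \<partial>\<mu>)"
proof -
  obtain B where B: "\<And>x. x \<in> Pc c \<Longrightarrow> \<bar>f x\<bar> \<le> B" using continuous_Pc_bounded[OF c f] by blast
  note fm = continuous_Pc_measurable[OF f]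
  have "(\<integral>y. f y \<partial>markov_kernel c \<mu> x) = (\<integral>g. \<integral>y. f y \<partial>return N (act g x) \<partial>\<mu>)"
    unfolding markov_kernel_def
    by (rule integral_bind_bounded[OF prob_mu measurable_return_action[OF x] _ fm, of B])
       (use B act_in[OF _ x] in \<open>auto intro!: prob_space_return simp: space_Pc_borel\<close>)
  also have "\<dots> = (\<integral>g. f (act g x) \<partial>\<mu>)"
    by (rule Bochner_Integration.integral_cong[OF refl]) (rule integral_return[OF _ fm], use act_in[OF _ x] in \<open>simp add: space_Pc_borel\<close>)
  finally show ?thesis .
qed

lemma integral_act:
  assumes F: "homothety_invariant c F" and v: "v \<noteq> 0"
  shows "(\<integral>g. descend F (act g (Pc_proj c v)) \<partial>\<mu>) = average 1 F v"
  unfolding average_one[OF F]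
proof (rule Bochner_Integration.integral_cong[OF refl])
  fix g assume g: "g \<in> space \<mu>"
  have "g *v v \<noteq> 0" using invertible_mu[OF g] v by simp
  then show "descend F (act g (Pc_proj c v)) = F (g *v v)" by (simp add: act_proj[OF g v] descend_eq[OF c F])
qed

text \<open>
  This identifies the iterated kernels with the averages over the random walk on the vector space.
\<close>

lemma integral_markov_iter:
  assumes f: "continuous_map (Pc_top c) euclideanreal f" and v: "v \<noteq> 0"
  shows "(\<integral>y. f y \<partial>markov_iter c \<mu> n (Pc_proj c v)) = average n (pullback c f) v"
  using v
proof (induction n arbitrary: v)
  case 0
  have "(\<integral>y. f y \<partial>return N (Pc_proj c v)) = f (Pc_proj c v)"
    by (rule integral_return[OF _ continuous_Pc_measurable[OF f]]) (simp add: space_Pc_borel Pc_proj_in 0)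
  then show ?case using 0 by (simp add: average_def pullback_def P.prob_space)
next
  case (Suc n)
  let ?F = "pullback c f" and ?x = "Pc_proj c v"
  note F = pullback_invariant[OF c f]
  have x: "?x \<in> Pc c" by (rule Pc_proj_in[OF Suc.prems])
  obtain B where B: "\<And>x. x \<in> Pc c \<Longrightarrow> \<bar>f x\<bar> \<le> B" using continuous_Pc_bounded[OF c f] by blast
  note sk = sets_markov_kernel[OF x]
  have sp: "space (markov_kernel c \<mu> ?x) = Pc c" using sets_eq_imp_space_eq[OF sk] by (simp add: space_Pc_borel)
  have m: "markov_iter c \<mu> n \<in> measurable (markov_kernel c \<mu> ?x) (subprob_algebra N)"
    using measurable_markov_iter measurable_cong_sets[OF sk refl] by blast
  have "(\<integral>y. f y \<partial>markov_iter c \<mu> (Suc n) ?x) = (\<integral>y. \<integral>z. f z \<partial>markov_iter c \<mu> n y \<partial>markov_kernel c \<mu> ?x)"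
    unfolding markov_iter.simps
    by (rule integral_bind_bounded[OF prob_space_markov_kernel[OF x] m _ continuous_Pc_measurable[OF f], of B])
       (use B sp prob_space_markov_iter in \<open>auto simp: space_Pc_borel\<close>)
  also have "\<dots> = (\<integral>y. descend (average n ?F) y \<partial>markov_kernel c \<mu> ?x)"
  proof (rule Bochner_Integration.integral_cong[OF refl])
    fix y assume "y \<in> space (markov_kernel c \<mu> ?x)"
    then obtain w where w: "w \<noteq> 0" "y = Pc_proj c w" unfolding sp by (rule PcE)
    then show "(\<integral>z. f z \<partial>markov_iter c \<mu> n y) = descend (average n ?F) y"
      using Suc.IH[OF w(1)] by (simp add: descend_eq[OF c average_invariant[OF F c]])
  qed
  also have "\<dots> = (\<integral>g. descend (average n ?F) (act g ?x) \<partial>\<mu>)"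
    by (rule integral_markov_kernel[OF descend_continuous[OF c average_invariant[OF F c]] x])
  also have "\<dots> = average 1 (average n ?F) v"
    by (rule integral_act[OF average_invariant[OF F c] Suc.prems])
  also have "\<dots> = average (Suc n) ?F v" using average_compose[OF F, of n 1] by simp
  finally show ?case .
qed

text \<open>
  A measurable choice of a representative in the annulus \<open>1 \<le> norm w < c\<close>.
\<close>

definition normalise :: "real^'n \<Rightarrow> real^'n" where
  "normalise w = (c powr (- real_of_int \<lfloor>log c (norm w)\<rfloor>)) *\<^sub>R w"

lemma normalise_measurable: "normalise \<in> borel_measurable borel"
  unfolding normalise_def[abs_def] by measurable

lemma normalise:
  assumes "w \<noteq> 0"
  shows "1 \<le> norm (normalise w)" "norm (normalise w) < c" "homothety_invariant c F \<Longrightarrow> F (normalise w) = F w"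
proof -
  define k where "k = \<lfloor>log c (norm w)\<rfloor>"
  have k: "c powr k \<le> norm w" "norm w < c powr (k + 1)"
    using floor_log_eq_powr_iff[of "norm w" c k] assms c by (auto simp: k_def)
  have n: "norm (normalise w) = norm w / c powr k"
    by (simp add: normalise_def k_def powr_minus divide_inverse mult.commute)
  show "1 \<le> norm (normalise w)" unfolding n using k c by (simp add: pos_le_divide_eq)
  show "norm (normalise w) < c" unfolding n using k c by (simp add: pos_divide_less_eq powr_add mult.commute)
  assume F: "homothety_invariant c F"
  have "normalise w = (c powi (- k)) *\<^sub>R w"
    using c by (simp add: normalise_def k_def powr_real_of_int' flip: of_int_minus)
  then show "F (normalise w) = F w" by (simp add: homothety_invariant_power_int[OF F c])
qed

text \<open>
  The laws of the walk started at \<open>v0\<close>, normalised into the annulus, have a weakly convergent subsequence. Its limit,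
  projected to the quotient, integrates \<open>f\<close> to the limit of the averages along this subsequence; but the averages
  of \<open>f\<close> converge along all times and from all starting points to the same constant.
\<close>

theorem limit_measure_exists:
  "\<exists>\<rho>. prob_space \<rho> \<and> sets \<rho> = sets N \<and>
    (\<forall>f v. continuous_map (Pc_top c) euclideanreal f \<longrightarrow> v \<noteq> 0 \<longrightarrow>
       (\<lambda>n. average n (pullback c f) v) \<longlonglongrightarrow> (\<integral>x. f x \<partial>\<rho>))"
proof -
  define X where "X n \<omega> = normalise (left_product \<omega> n *v v0)" for n \<omega>
  have Xm: "X n \<in> borel_measurable PP" for n
    unfolding X_def by (rule measurable_compose[OF _ normalise_measurable]) measurable
  have Lnz: "left_product \<omega> n *v v0 \<noteq> 0" if "\<omega> \<in> space PP" for \<omega> n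
    using invertible_left_product[OF that] v_nz by simp
  define M where "M n = distr PP borel (X n)" for n
  have M: "prob_space (M n)" "sets (M n) = sets borel" for n
    unfolding M_def using P.prob_space_distr[OF Xm] by simp_all
  have supp: "AE x in M n. norm x < c" for n
    unfolding M_def using Xm normalise(2)[OF Lnz] by (subst AE_distr_iff) (auto simp: X_def)
  obtain r Q where r: "strict_mono (r :: nat \<Rightarrow> nat)" and Q: "prob_space Q" "sets Q = sets borel"
    and lim: "\<And>f :: real^'n \<Rightarrow> real. continuous_on UNIV f \<Longrightarrow> bounded (range f) \<Longrightarrow>
      (\<lambda>n. \<integral>x. f x \<partial>M (r n)) \<longlonglongrightarrow> (\<integral>x. f x \<partial>Q)"
    using bounded_measures_weakly_compact[of M c, OF M supp] by blast
  interpret Q: prob_space Q by fact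
  have int_M: "(\<integral>x. f x \<partial>M n) = (\<integral>\<omega>. f (X n \<omega>) \<partial>PP)" if "continuous_on UNIV f" for f :: "real^'n \<Rightarrow> real" and n
    unfolding M_def by (rule integral_distr[OF Xm borel_measurable_continuous_onI[OF that]])
  \<comment> \<open>The limit law gives no mass to the open unit ball, in particular none to the origin.\<close>
  have outside: "AE w in Q. 1 \<le> norm w"
  proof -
    let ?b = "\<lambda>w :: real^'n. max 0 (1 - norm w)"
    have cont: "continuous_on UNIV ?b" by (intro continuous_intros)
    have bnd: "\<bar>?b w\<bar> \<le> 1" for w by auto
    have "(\<integral>x. ?b x \<partial>M n) = 0" for n
    proof -
      have "(\<integral>\<omega>. ?b (X n \<omega>) \<partial>PP) = (\<integral>\<omega>. 0 \<partial>PP)"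
        by (rule Bochner_Integration.integral_cong[OF refl]) (use normalise(1)[OF Lnz] in \<open>simp add: X_def\<close>)
      then show ?thesis unfolding int_M[OF cont] by simp
    qed
    moreover have "bounded (range ?b)" unfolding bounded_iff by (intro exI[of _ 1]) auto
    ultimately have "(\<lambda>n. 0 :: real) \<longlonglongrightarrow> (\<integral>x. ?b x \<partial>Q)" using lim[OF cont] by simp
    then have 0: "(\<integral>x. ?b x \<partial>Q) = 0" using LIMSEQ_const_iff by metis
    have bm: "?b \<in> borel_measurable Q" using borel_measurable_continuous_onI[OF cont] measurable_cong_sets[OF Q(2) refl] by blast
    have "integrable Q ?b" by (rule Q.integrable_const_bound[of _ 1]) (use bnd bm in auto)
    then have "AE x in Q. ?b x = 0" using 0 by (subst (asm) integral_nonneg_eq_0_iff_AE) auto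
    then show ?thesis by eventually_elim (auto simp: max_def split: if_splits)
  qed
  have om: "orbit_map c \<in> measurable Q N" using measurable_orbit_map measurable_cong_sets[OF Q(2) refl] by blast
  define \<rho> where "\<rho> = distr Q N (orbit_map c)"
  have \<rho>: "prob_space \<rho>" "sets \<rho> = sets N" unfolding \<rho>_def using Q.prob_space_distr[OF om] by simp_all
  have "(\<lambda>n. average n (pullback c f) v) \<longlonglongrightarrow> (\<integral>x. f x \<partial>\<rho>)"
    if f: "continuous_map (Pc_top c) euclideanreal f" and v: "v \<noteq> 0" for f v
  proof -
    let ?F = "pullback c f"
    note F = pullback_invariant[OF c f]
    obtain B where B: "B > 0" "\<And>v. \<bar>?F v\<bar> \<le> B" using homothety_invariant_bounded[OF F c] by blast
    obtain l where l: "\<And>v. v \<noteq> 0 \<Longrightarrow> (\<lambda>n. average n ?F v) \<longlonglongrightarrow> l" using average_converges[OF F c] by blast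
    \<comment> \<open>Damping the pullback near the origin makes it continuous everywhere without changing it on the annulus.\<close>
    let ?D = "\<lambda>w. ?F w * min 1 (norm w)"
    have contD: "continuous_on UNIV ?D"
      unfolding continuous_on_eq_continuous_at[OF open_UNIV]
    proof
      fix w :: "real^'n"
      show "isCont ?D w"
      proof (cases "w = 0")
        case False
        have "isCont ?F w"
          using F False by (auto simp: homothety_invariant_def continuous_on_eq_continuous_at open_Compl)
        then show ?thesis by (intro continuous_intros)
      next
        case True
        have "?D \<midarrow>0\<rightarrow> 0"
        proof (rule Lim_null_comparison[of _ "\<lambda>w. B * norm w"])
          have "norm (?D w) \<le> B * norm w" for w
            using mult_mono[OF B(2), of "min 1 (norm w)" "norm w" w] B(1) by (simp add: abs_mult)
          then show "\<forall>\<^sub>F w in at 0. norm (?D w) \<le> B * norm w" by simp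
          show "((\<lambda>w :: real^'n. B * norm w) \<longlongrightarrow> 0) (at 0)" by (auto intro!: tendsto_eq_intros)
        qed
        then show ?thesis using True by (simp add: isCont_def)
      qed
    qed
    have bD: "\<bar>?D w\<bar> \<le> B" for w
      using mult_mono[OF B(2), of "min 1 (norm w)" 1 w] B(1) by (simp add: abs_mult)
    have "(\<integral>x. ?D x \<partial>M n) = average n ?F v0" for n
      unfolding int_M[OF contD] average_def
      by (rule Bochner_Integration.integral_cong[OF refl])
        (use normalise(1)[OF Lnz] normalise(3)[OF Lnz F] in \<open>simp add: X_def\<close>)
    moreover have "bounded (range ?D)" unfolding bounded_iff by (intro exI[of _ B]) (use bD in auto)
    ultimately have "(\<lambda>n. average (r n) ?F v0) \<longlonglongrightarrow> (\<integral>x. ?D x \<partial>Q)" using lim[OF contD] by simp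
    moreover have "(\<lambda>n. average (r n) ?F v0) \<longlonglongrightarrow> l"
      using LIMSEQ_subseq_LIMSEQ[OF l[OF v_nz] r] by (simp add: comp_def)
    ultimately have "l = (\<integral>x. ?D x \<partial>Q)" by (rule LIMSEQ_unique[symmetric])
    also have "\<dots> = (\<integral>x. f (orbit_map c x) \<partial>Q)"
    proof (rule integral_cong_AE)
      show "?D \<in> borel_measurable Q"
        using borel_measurable_continuous_onI[OF contD] measurable_cong_sets[OF Q(2) refl] by blast
      show "(\<lambda>x. f (orbit_map c x)) \<in> borel_measurable Q"
        by (rule measurable_compose[OF om continuous_Pc_measurable[OF f]])
      show "AE x in Q. ?D x = f (orbit_map c x)"
        using outside by eventually_elim (auto simp: pullback_def orbit_map_def)
    qed
    also have "\<dots> = (\<integral>x. f x \<partial>\<rho>)"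
      unfolding \<rho>_def by (rule integral_distr[OF om continuous_Pc_measurable[OF f], symmetric])
    finally show ?thesis using l[OF v] by simp
  qed
  then show ?thesis using \<rho> by blast
qed

lemma measurable_push:
  assumes "prob_space \<rho>" "sets \<rho> = sets N"
  shows "(\<lambda>g. distr \<rho> N (act g)) \<in> measurable \<mu> (subprob_algebra N)"
proof (rule measurable_distr2)
  have "(\<lambda>(g, x). act g x) \<in> measurable (\<mu> \<Otimes>\<^sub>M N) N"
    using measurable_compose[OF measurable_pair_swap' measurable_action] by (simp add: case_prod_unfold comp_def)
  then show "case_prod act \<in> measurable (\<mu> \<Otimes>\<^sub>M \<rho>) N"
    using measurable_cong_sets[OF sets_pair_measure_cong[OF refl assms(2)] refl] by blast
  show "(\<lambda>g. \<rho>) \<in> measurable \<mu> (subprob_algebra \<rho>)"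
    using assms by (intro measurable_const) (simp add: space_subprob_algebra prob_space_imp_subprob_space)
qed

lemma act_measurable_from:
  "sets \<rho> = sets N \<Longrightarrow> g \<in> space \<mu> \<Longrightarrow> act g \<in> measurable \<rho> N"
  using measurable_action_right measurable_cong_sets[of \<rho> N N N] by blast

lemma push_prob_space:
  assumes "prob_space \<rho>" "sets \<rho> = sets N"
  shows "prob_space (\<mu> \<bind> (\<lambda>g. distr \<rho> N (act g)))" "sets (\<mu> \<bind> (\<lambda>g. distr \<rho> N (act g))) = sets N"
proof -
  show "prob_space (\<mu> \<bind> (\<lambda>g. distr \<rho> N (act g)))"
    by (rule prob_space.prob_space_bind[OF prob_mu AE_I2 measurable_push[OF assms]])
      (intro prob_space.prob_space_distr assms act_measurable_from)
  show "sets (\<mu> \<bind> (\<lambda>g. distr \<rho> N (act g))) = sets N"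
    by (rule sets_bind) (use prob_space.not_empty[OF prob_mu] in simp_all)
qed

text \<open>
  By Fubini's theorem the push-forward under the action is dual to one step of the Markov operator.
\<close>

lemma integral_push:
  assumes \<rho>: "prob_space \<rho>" "sets \<rho> = sets N" and f: "continuous_map (Pc_top c) euclideanreal f"
  shows "(\<integral>y. f y \<partial>(\<mu> \<bind> (\<lambda>g. distr \<rho> N (act g)))) = (\<integral>x. descend (average 1 (pullback c f)) x \<partial>\<rho>)"
proof -
  note F = pullback_invariant[OF c f]
  interpret R: prob_space \<rho> by fact
  interpret mu: prob_space \<mu> by (rule prob_mu)
  interpret pr: pair_prob_space \<mu> \<rho> by unfold_locales
  obtain B where B: "\<And>x. x \<in> Pc c \<Longrightarrow> \<bar>f x\<bar> \<le> B" using continuous_Pc_bounded[OF c f] by blast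
  note fm = continuous_Pc_measurable[OF f]
  have sp: "space \<rho> = Pc c" using sets_eq_imp_space_eq[OF \<rho>(2)] by (simp add: space_Pc_borel)
  have "(\<integral>y. f y \<partial>(\<mu> \<bind> (\<lambda>g. distr \<rho> N (act g)))) = (\<integral>g. \<integral>y. f y \<partial>distr \<rho> N (act g) \<partial>\<mu>)"
    by (rule integral_bind_bounded[OF prob_mu measurable_push[OF \<rho>] _ fm, of B])
      (use B in \<open>auto simp: space_Pc_borel intro!: R.prob_space_distr act_measurable_from \<rho>\<close>)
  also have "\<dots> = (\<integral>g. \<integral>x. f (act g x) \<partial>\<rho> \<partial>\<mu>)"
    by (rule Bochner_Integration.integral_cong[OF refl]) (rule integral_distr[OF act_measurable_from[OF \<rho>(2)] fm])
  also have "\<dots> = (\<integral>x. \<integral>g. f (act g x) \<partial>\<mu> \<partial>\<rho>)"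
  proof (rule pr.Fubini_integral[symmetric])
    have "case_prod act \<in> measurable (\<mu> \<Otimes>\<^sub>M N) N"
      using measurable_compose[OF measurable_pair_swap' measurable_action] by (simp add: case_prod_unfold comp_def)
    then have "case_prod act \<in> measurable (\<mu> \<Otimes>\<^sub>M \<rho>) N"
      using measurable_cong_sets[OF sets_pair_measure_cong[OF refl \<rho>(2)] refl] by blast
    then have "(\<lambda>z. f (case_prod act z)) \<in> borel_measurable (\<mu> \<Otimes>\<^sub>M \<rho>)" by (rule measurable_compose[OF _ fm])
    then show "integrable (\<mu> \<Otimes>\<^sub>M \<rho>) (case_prod (\<lambda>g x. f (act g x)))"
      using B act_in by (intro pr.P.integrable_const_bound[of _ B]) (auto simp: space_pair_measure sp case_prod_unfold)
  qed
  also have "\<dots> = (\<integral>x. descend (average 1 (pullback c f)) x \<partial>\<rho>)"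
  proof (rule Bochner_Integration.integral_cong[OF refl])
    fix x assume "x \<in> space \<rho>"
    then obtain v where v: "v \<noteq> 0" "x = Pc_proj c v" unfolding sp by (rule PcE)
    have "(\<integral>g. f (act g x) \<partial>\<mu>) = (\<integral>g. descend (pullback c f) (act g x) \<partial>\<mu>)"
    proof (rule Bochner_Integration.integral_cong[OF refl])
      fix g assume g: "g \<in> space \<mu>"
      have "g *v v \<noteq> 0" using invertible_mu[OF g] v by simp
      then show "f (act g x) = descend (pullback c f) (act g x)"
        unfolding v(2) act_proj[OF g v(1)] by (simp add: descend_eq[OF c F] pullback_def)
    qed
    also have "\<dots> = average 1 (pullback c f) v" unfolding v(2) by (rule integral_act[OF F v(1)])
    finally show "(\<integral>g. f (act g x) \<partial>\<mu>) = descend (average 1 (pullback c f)) x"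
      using v by (simp add: descend_eq[OF c average_invariant[OF F c]])
  qed
  finally show ?thesis .
qed

end

section \<open>Stationary measure, its support, and the trajectories\<close>

context projective_walk
begin

text \<open>
  Stationarity of \<open>\<rho>\<close> expresses that the limit of the averages of \<open>f\<close> is unchanged by one more step. Conversely, the integral of
  \<open>f\<close> against a stationary measure is unchanged if \<open>f\<close> is replaced by its averages, which converge boundedly to the
  constant given by \<open>\<rho>\<close>.
\<close>

theorem stationary_iff:
  assumes \<rho>: "prob_space \<rho>" "sets \<rho> = sets N"
    and lim: "\<And>f v. continuous_map (Pc_top c) euclideanreal f \<Longrightarrow> v \<noteq> 0 \<Longrightarrow>
       (\<lambda>n. average n (pullback c f) v) \<longlonglongrightarrow> (\<integral>x. f x \<partial>\<rho>)"
  shows "stationary_probability c \<mu> \<rho>' \<longleftrightarrow> \<rho>' = \<rho>"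
proof
  assume "\<rho>' = \<rho>"
  have "\<mu> \<bind> (\<lambda>g. distr \<rho> N (act g)) = \<rho>"
  proof (rule measure_eqI_continuous[OF c push_prob_space[OF \<rho>] \<rho>])
    fix f :: "(real^'n) set \<Rightarrow> real" assume f: "continuous_map (Pc_top c) euclideanreal f"
    let ?F = "pullback c f"
    note F = pullback_invariant[OF c f]
    note F1 = average_invariant[OF F c, of 1]
    have "(\<lambda>n. average n (average 1 ?F) v0) \<longlonglongrightarrow> (\<integral>x. descend (average 1 ?F) x \<partial>\<rho>)"
      using lim[OF descend_continuous[OF c F1] v_nz] unfolding pullback_descend[OF c F1] .
    moreover have "average n (average 1 ?F) v0 = average (Suc n) ?F v0" for n
      using average_compose[OF F, of 1 n] by simp
    ultimately have "(\<lambda>n. average (Suc n) ?F v0) \<longlonglongrightarrow> (\<integral>x. descend (average 1 ?F) x \<partial>\<rho>)" by simp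
    moreover have "(\<lambda>n. average (Suc n) ?F v0) \<longlonglongrightarrow> (\<integral>x. f x \<partial>\<rho>)" by (rule LIMSEQ_Suc[OF lim[OF f v_nz]])
    ultimately have "(\<integral>x. descend (average 1 ?F) x \<partial>\<rho>) = (\<integral>x. f x \<partial>\<rho>)" by (rule LIMSEQ_unique)
    then show "(\<integral>y. f y \<partial>(\<mu> \<bind> (\<lambda>g. distr \<rho> N (act g)))) = (\<integral>x. f x \<partial>\<rho>)"
      using integral_push[OF \<rho> f] by simp
  qed
  then show "stationary_probability c \<mu> \<rho>'" unfolding stationary_probability_def using \<rho> \<open>\<rho>' = \<rho>\<close> by simp
next
  assume "stationary_probability c \<mu> \<rho>'"
  then have \<rho>': "prob_space \<rho>'" "sets \<rho>' = sets N" and fixed: "\<mu> \<bind> (\<lambda>g. distr \<rho>' N (act g)) = \<rho>'"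
    unfolding stationary_probability_def by auto
  interpret R': prob_space \<rho>' by fact
  have sp': "space \<rho>' = Pc c" using sets_eq_imp_space_eq[OF \<rho>'(2)] by (simp add: space_Pc_borel)
  show "\<rho>' = \<rho>"
  proof (rule measure_eqI_continuous[OF c \<rho>' \<rho>])
    fix f :: "(real^'n) set \<Rightarrow> real" assume f: "continuous_map (Pc_top c) euclideanreal f"
    let ?F = "pullback c f"
    note F = pullback_invariant[OF c f]
    note Fn = average_invariant[OF F c]
    have const: "(\<integral>x. descend (average n ?F) x \<partial>\<rho>') = (\<integral>x. f x \<partial>\<rho>')" for n
    proof (induction n)
      case 0
      show ?case
      proof (rule Bochner_Integration.integral_cong[OF refl])
        fix x assume "x \<in> space \<rho>'"
        then obtain v where v: "v \<noteq> 0" "x = Pc_proj c v" unfolding sp' by (rule PcE)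
        show "descend (average 0 ?F) x = f x"
          unfolding v(2) descend_eq[OF c Fn v(1)] using v(1) by (simp add: average_def P.prob_space pullback_def)
      qed
    next
      case (Suc n)
      have "(\<integral>x. descend (average n ?F) x \<partial>\<rho>') = (\<integral>x. descend (average 1 (pullback c (descend (average n ?F)))) x \<partial>\<rho>')"
        using integral_push[OF \<rho>' descend_continuous[OF c Fn]] unfolding fixed .
      also have "average 1 (pullback c (descend (average n ?F))) = average (Suc n) ?F"
        unfolding pullback_descend[OF c Fn] using average_compose[OF F, of n 1] by simp
      finally show ?case using Suc by simp
    qed
    obtain B where B: "B > 0" "\<And>v. \<bar>?F v\<bar> \<le> B" using homothety_invariant_bounded[OF F c] by blast
    have "(\<lambda>n. \<integral>x. descend (average n ?F) x \<partial>\<rho>') \<longlonglongrightarrow> (\<integral>x. (\<integral>y. f y \<partial>\<rho>) \<partial>\<rho>')"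
    proof (rule integral_dominated_convergence[where w="\<lambda>_. B"])
      show "(\<lambda>x. descend (average n ?F) x) \<in> borel_measurable \<rho>'" for n
        using continuous_Pc_measurable[OF descend_continuous[OF c Fn]] measurable_cong_sets[OF \<rho>'(2) refl] by blast
      show "AE x in \<rho>'. (\<lambda>n. descend (average n ?F) x) \<longlonglongrightarrow> (\<integral>y. f y \<partial>\<rho>)"
      proof (rule AE_I2)
        fix x assume "x \<in> space \<rho>'"
        then obtain v where v: "v \<noteq> 0" "x = Pc_proj c v" unfolding sp' by (rule PcE)
        show "(\<lambda>n. descend (average n ?F) x) \<longlonglongrightarrow> (\<integral>y. f y \<partial>\<rho>)"
          using lim[OF f v(1)] unfolding v(2) descend_eq[OF c Fn v(1)] .
      qed
      show "AE x in \<rho>'. norm (descend (average n ?F) x) \<le> B" for n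
      proof (rule AE_I2)
        fix x assume "x \<in> space \<rho>'"
        then obtain v where v: "v \<noteq> 0" "x = Pc_proj c v" unfolding sp' by (rule PcE)
        have "\<bar>average n ?F v\<bar> \<le> (\<integral>\<omega>. \<bar>?F (left_product \<omega> n *v v)\<bar> \<partial>PP)" unfolding average_def by (rule integral_abs_bound)
        also have "\<dots> \<le> (\<integral>\<omega>. B \<partial>PP)"
          by (rule integral_mono) (use B integrable_average[OF F c] in auto)
        finally show "norm (descend (average n ?F) x) \<le> B"
          unfolding v(2) descend_eq[OF c Fn v(1)] by (simp add: P.prob_space)
      qed
    qed simp_all
    then have "(\<lambda>n. \<integral>x. f x \<partial>\<rho>') \<longlonglongrightarrow> (\<integral>y. f y \<partial>\<rho>)" unfolding const by (simp add: R'.prob_space)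
    then show "(\<integral>x. f x \<partial>\<rho>') = (\<integral>x. f x \<partial>\<rho>)" using LIMSEQ_const_iff by blast
  qed
qed

lemma image_cone_over: "U \<subseteq> Pc c \<Longrightarrow> Pc_proj c ` cone_over c U = U"
proof (intro equalityI subsetI)
  fix x assume "U \<subseteq> Pc c" "x \<in> U"
  then have "x \<in> Pc c" by blast
  then obtain v where "v \<noteq> 0" "x = Pc_proj c v" by (rule PcE)
  then show "x \<in> Pc_proj c ` cone_over c U" using \<open>x \<in> U\<close> by (auto simp: cone_over_def)
qed (auto simp: cone_over_def)

lemma complement_support:
  fixes \<rho> :: "(real^'n) set measure"
  shows "Pc c - measure_support (Pc_top c) \<rho> = \<Union>{U. openin (Pc_top c) U \<and> emeasure \<rho> U = 0}"
proof (intro equalityI subsetI)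
  fix x assume "x \<in> Pc c - measure_support (Pc_top c) \<rho>"
  then obtain U where "openin (Pc_top c) U" "x \<in> U" "emeasure \<rho> U = 0"
    by (auto simp: measure_support_def topspace_Pc_top zero_less_iff_neq_zero)
  then show "x \<in> \<Union>{U. openin (Pc_top c) U \<and> emeasure \<rho> U = 0}" by blast
next
  fix x assume "x \<in> \<Union>{U. openin (Pc_top c) U \<and> emeasure \<rho> U = 0}"
  then obtain U where U: "openin (Pc_top c) U" "x \<in> U" "emeasure \<rho> U = 0" by blast
  have "x \<in> Pc c" using openin_subset[OF U(1)] U(2) unfolding topspace_Pc_top by blast
  moreover have "x \<notin> measure_support (Pc_top c) \<rho>" using U by (auto simp: measure_support_def)
  ultimately show "x \<in> Pc c - measure_support (Pc_top c) \<rho>" by blast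
qed

lemma support_closed:
  fixes \<rho> :: "(real^'n) set measure"
  shows "closedin (Pc_top c) (measure_support (Pc_top c) \<rho>)"
proof -
  let ?S = "measure_support (Pc_top c) \<rho>"
  note complement_support[of \<rho>]
  moreover have "openin (Pc_top c) (\<Union>{U. openin (Pc_top c) U \<and> emeasure \<rho> U = 0})" by (rule openin_Union) simp
  ultimately have "openin (Pc_top c) (topspace (Pc_top c) - ?S)" by (simp add: topspace_Pc_top)
  moreover have "?S \<subseteq> topspace (Pc_top c)" by (auto simp: measure_support_def)
  ultimately show ?thesis by (simp add: closedin_def)
qed

lemma support_sub:
  fixes \<rho> :: "(real^'n) set measure"
  shows "measure_support (Pc_top c) \<rho> \<subseteq> Pc c"
  by (auto simp: measure_support_def topspace_Pc_top)

text \<open>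
  The complement of the support is a union of open null sets, and by the Lindelof property of the vector space countably
  many of them suffice.
\<close>

lemma null_outside_support:
  assumes "sets \<rho> = sets N"
  shows "Pc c - measure_support (Pc_top c) \<rho> \<in> null_sets \<rho>"
proof -
  define \<U> where "\<U> = {U. openin (Pc_top c) U \<and> emeasure \<rho> U = 0}"
  define \<F> where "\<F> = cone_over c ` \<U>"
  have open_F: "open V" if "V \<in> \<F>" for V
    using that by (auto simp: \<F>_def \<U>_def cone_over_def openin_Pc_top)
  obtain \<G> where G: "\<G> \<subseteq> \<F>" "countable \<G>" "\<Union>\<G> = \<Union>\<F>" using Lindelof[OF open_F] by blast
  have null: "Pc_proj c ` V \<in> null_sets \<rho>" if V: "V \<in> \<G>" for V
  proof -
    obtain U where U: "U \<in> \<U>" "V = cone_over c U" using V G(1) by (auto simp: \<F>_def)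
    have "U \<subseteq> Pc c" using U(1) by (simp add: \<U>_def openin_Pc_top)
    then have "Pc_proj c ` V = U" unfolding U(2) by (rule image_cone_over)
    moreover have "U \<in> sets \<rho>" unfolding assms using U(1) by (auto simp: \<U>_def intro: open_in_Pc_borel)
    ultimately show ?thesis using U(1) by (simp add: \<U>_def null_sets_def)
  qed
  have "(\<Union>V\<in>\<G>. Pc_proj c ` V) \<in> null_sets \<rho>" by (rule null_sets_UN'[OF G(2) null])
  moreover have "Pc c - measure_support (Pc_top c) \<rho> = (\<Union>V\<in>\<G>. Pc_proj c ` V)"
  proof -
    have "Pc c - measure_support (Pc_top c) \<rho> = \<Union>\<U>"
      unfolding complement_support \<U>_def ..
    also have "\<dots> = (\<Union>U\<in>\<U>. Pc_proj c ` cone_over c U)"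
    proof -
      have "Pc_proj c ` cone_over c U = U" if "U \<in> \<U>" for U
        by (rule image_cone_over) (use that in \<open>simp add: \<U>_def openin_Pc_top\<close>)
      then show ?thesis by simp
    qed
    also have "\<dots> = Pc_proj c ` \<Union>\<F>" by (auto simp: \<F>_def)
    also have "\<dots> = Pc_proj c ` \<Union>\<G>" using G(3) by simp
    also have "\<dots> = (\<Union>V\<in>\<G>. Pc_proj c ` V)" by blast
    finally show ?thesis .
  qed
  ultimately show ?thesis by simp
qed

lemma support_nonempty:
  assumes "prob_space \<rho>" "sets \<rho> = sets N"
  shows "measure_support (Pc_top c) \<rho> \<noteq> {}"
proof
  assume "measure_support (Pc_top c) \<rho> = {}"
  then have "emeasure \<rho> (Pc c) = 0" using null_outside_support[OF assms(2)] by auto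
  moreover have "space \<rho> = Pc c" using sets_eq_imp_space_eq[OF assms(2)] by (simp add: space_Pc_borel)
  ultimately show False using prob_space.emeasure_space_1[OF assms(1)] by simp
qed

text \<open>
  A matrix close to \<open>t\<close> maps a neighbourhood \<open>V'\<close> of \<open>v\<close> into a given neighbourhood of \<open>t v\<close>. Both the matrices close to \<open>t\<close>
  and the points in \<open>V'\<close> are charged, hence so is the neighbourhood of \<open>t v\<close>, by stationarity.
\<close>

text \<open>
  Invariance passes from \<open>T\<close> to words and, the support being closed, to limits of words.
\<close>

lemma support_invariant_step:
  assumes \<rho>: "prob_space \<rho>" "sets \<rho> = sets N" and fixed: "\<mu> \<bind> (\<lambda>g. distr \<rho> N (act g)) = \<rho>"
    and t: "t \<in> T" and v: "v \<in> cone_over c (measure_support (Pc_top c) \<rho>)"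
  shows "t *v v \<in> cone_over c (measure_support (Pc_top c) \<rho>)"
proof -
  have v0: "v \<noteq> 0" and vS: "Pc_proj c v \<in> measure_support (Pc_top c) \<rho>" using v by (auto simp: cone_over_def)
  have tm: "t \<in> space \<mu>" using t T_sub G_sub by blast
  have tv: "t *v v \<noteq> 0" using invertible_mu[OF tm] v0 by simp
  have "0 < emeasure \<rho> U" if U: "openin (Pc_top c) U" "Pc_proj c (t *v v) \<in> U" for U
  proof -
    have op: "open (cone_over c U)" using U(1) by (simp add: cone_over_def openin_Pc_top)
    have "continuous_on UNIV (\<lambda>z :: (real^'n^'n) \<times> (real^'n). fst z *v snd z)" by (intro continuous_intros)
    then have "open ((\<lambda>z :: (real^'n^'n) \<times> (real^'n). fst z *v snd z) -` cone_over c U)" using op by (rule open_vimage[rotated])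
    moreover have "(t, v) \<in> (\<lambda>z :: (real^'n^'n) \<times> (real^'n). fst z *v snd z) -` cone_over c U"
      using U(2) tv by (simp add: cone_over_def)
    ultimately obtain A V where AV: "open A" "open V" "(t, v) \<in> A \<times> V" "A \<times> V \<subseteq> (\<lambda>z. fst z *v snd z) -` cone_over c U"
      by (rule open_prod_elim)
    obtain r where r: "r > 0" "ball t r \<subseteq> A" using AV openE by blast
    define V' where "V' = V - {0}"
    have V': "open V'" "0 \<notin> V'" "v \<in> V'" using AV v0 by (auto simp: V'_def open_delete)
    have op': "openin (Pc_top c) (Pc_proj c ` V')" by (rule openin_orbit_image[OF c V'(1,2)])
    then have pos: "0 < emeasure \<rho> (Pc_proj c ` V')" using vS V'(3) by (auto simp: measure_support_def)
    let ?E = "{g \<in> space \<mu>. dist g t < r}"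
    have E: "?E \<in> sets \<mu>" by measurable
    have inner: "emeasure \<rho> (Pc_proj c ` V') * indicator ?E g \<le> emeasure (distr \<rho> N (act g)) U" if g: "g \<in> space \<mu>" for g
    proof (cases "g \<in> ?E")
      case True
      have sp: "space \<rho> = Pc c" using sets_eq_imp_space_eq[OF \<rho>(2)] by (simp add: space_Pc_borel)
      have meas: "act g \<in> measurable \<rho> N" by (rule act_measurable_from[OF \<rho>(2) g])
      have "Pc_proj c ` V' \<subseteq> act g -` U \<inter> space \<rho>"
      proof
        fix y assume "y \<in> Pc_proj c ` V'"
        then obtain w where w: "w \<in> V'" and y: "y = Pc_proj c w" by blast
        have w0: "w \<noteq> 0" using w V'(2) by metis
        have "g \<in> A" using True r(2) by (auto simp: dist_commute)
        then have "g *v w \<in> cone_over c U" using AV(4) w by (auto simp: V'_def)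
        then show "y \<in> act g -` U \<inter> space \<rho>"
          unfolding y sp by (simp add: act_proj[OF g w0] cone_over_def Pc_proj_in[OF w0])
      qed
      then have "emeasure \<rho> (Pc_proj c ` V') \<le> emeasure \<rho> (act g -` U \<inter> space \<rho>)"
        by (rule emeasure_mono) (rule measurable_sets[OF meas open_in_Pc_borel[OF U(1)]])
      also have "\<dots> = emeasure (distr \<rho> N (act g)) U"
        by (rule emeasure_distr[OF meas open_in_Pc_borel[OF U(1)], symmetric])
      finally show ?thesis using True by simp
    qed simp
    have "0 < emeasure \<rho> (Pc_proj c ` V') * emeasure \<mu> ?E"
    proof -
      have "0 < measure \<mu> ?E" by (rule support[OF t r(1)])
      then have "0 < emeasure \<mu> ?E"
        using finite_measure.emeasure_eq_measure[OF prob_space.finite_measure[OF prob_mu]] by simp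
      then show ?thesis using pos by (simp add: ennreal_zero_less_mult_iff)
    qed
    also have "\<dots> = (\<integral>\<^sup>+g. emeasure \<rho> (Pc_proj c ` V') * indicator ?E g \<partial>\<mu>)"
      using E by (simp add: nn_integral_cmult_indicator)
    also have "\<dots> \<le> (\<integral>\<^sup>+g. emeasure (distr \<rho> N (act g)) U \<partial>\<mu>)" by (rule nn_integral_mono) (rule inner)
    also have "\<dots> = emeasure (\<mu> \<bind> (\<lambda>g. distr \<rho> N (act g))) U"
      by (rule emeasure_bind[OF prob_space.not_empty[OF prob_mu] measurable_push[OF \<rho>] open_in_Pc_borel[OF U(1)], symmetric])
    finally show ?thesis unfolding fixed .
  qed
  then show ?thesis using tv by (auto simp: cone_over_def measure_support_def topspace_Pc_top Pc_proj_in)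
qed

lemma support_invariant:
  assumes \<rho>: "prob_space \<rho>" "sets \<rho> = sets N" and fixed: "\<mu> \<bind> (\<lambda>g. distr \<rho> N (act g)) = \<rho>"
    and g: "g \<in> space \<mu>" and v: "v \<in> cone_over c (measure_support (Pc_top c) \<rho>)"
  shows "g *v v \<in> cone_over c (measure_support (Pc_top c) \<rho>)"
proof -
  let ?S = "measure_support (Pc_top c) \<rho>"
  let ?u = "cone_dist (cone_over c ?S)"
  have v0: "v \<noteq> 0" using v by (simp add: cone_over_def)
  have words: "s \<in> set_power T k \<Longrightarrow> w \<in> cone_over c ?S \<Longrightarrow> s *v w \<in> cone_over c ?S" for s k w
  proof (induction k arbitrary: s w)
    case (Suc k)
    then obtain p t where "s = p ** t" "p \<in> set_power T k" "t \<in> T" by auto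
    then show ?case using Suc support_invariant_step[OF \<rho> fixed] by (simp flip: matrix_vector_mul_assoc)
  qed simp
  have inS: "s *v v \<in> cone_over c ?S" if "s \<in> G" for s using words word[OF that] v by blast
  obtain s where s: "\<And>n. s n \<in> G" "s \<longlonglongrightarrow> g" using g G_dense closure_sequential by blast
  have gv: "g *v v \<noteq> 0" using invertible_mu[OF g] v0 by simp
  have "(\<lambda>n. s n *v v) \<longlonglongrightarrow> g *v v" by (intro tendsto_intros s)
  moreover have "isCont ?u (g *v v)"
    using cone_over_dist_invariant[OF c, of ?S] gv
    by (auto simp: homothety_invariant_def continuous_on_eq_continuous_at open_Compl)
  ultimately have "(\<lambda>n. ?u (s n *v v)) \<longlonglongrightarrow> ?u (g *v v)" by (rule isCont_tendsto_compose[rotated])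
  moreover have "?u (s n *v v) = 0" for n
  proof -
    have "s n *v v \<noteq> 0" "Pc_proj c (s n *v v) \<in> ?S" using inS[OF s(1), of n] by (auto simp: cone_over_def)
    then show ?thesis using cone_dist_eq_0_iff[OF c support_closed support_nonempty[OF \<rho>]] by blast
  qed
  ultimately have "?u (g *v v) = 0" by (simp add: LIMSEQ_const_iff)
  then show ?thesis
    using cone_dist_eq_0_iff[OF c support_closed support_nonempty[OF \<rho>] gv] gv by (simp add: cone_over_def)
qed

text \<open>
  Starting in a closed invariant set \<open>M\<close> the walk never leaves it. Therefore the distance from \<open>M\<close> has zero averages and
  zero integral against \<open>\<rho>\<close>, and \<open>M\<close> contains the support: the support is the least non-empty closed invariant set.
\<close>

theorem support_unique_minimal:
  assumes \<rho>: "prob_space \<rho>" "sets \<rho> = sets N" and fixed: "\<mu> \<bind> (\<lambda>g. distr \<rho> N (act g)) = \<rho>"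
    and lim: "\<And>f v. continuous_map (Pc_top c) euclideanreal f \<Longrightarrow> v \<noteq> 0 \<Longrightarrow>
       (\<lambda>n. average n (pullback c f) v) \<longlonglongrightarrow> (\<integral>x. f x \<partial>\<rho>)"
  shows "minimal_invariant c (space \<mu>) M \<longleftrightarrow> M = measure_support (Pc_top c) \<rho>"
proof -
  let ?S = "measure_support (Pc_top c) \<rho>"
  interpret R: prob_space \<rho> by fact
  have S_inv: "closed_invariant c (space \<mu>) ?S"
    unfolding closed_invariant_def
  proof (intro conjI support_closed ballI subsetI)
    fix g y assume g: "g \<in> space \<mu>" and "y \<in> act g ` ?S"
    then obtain x where x: "x \<in> ?S" "y = act g x" by blast
    then have "x \<in> Pc c" using support_sub by blast
    then obtain v where v: "v \<noteq> 0" "x = Pc_proj c v" by (rule PcE)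
    then have "g *v v \<in> cone_over c ?S" using support_invariant[OF \<rho> fixed g, of v] x(1) by (simp add: cone_over_def)
    then show "y \<in> ?S" unfolding x(2) v(2) act_proj[OF g v(1)] by (simp add: cone_over_def)
  qed
  have least: "?S \<subseteq> M" if M: "closed_invariant c (space \<mu>) M" "M \<noteq> {}" for M
  proof -
    have cl: "closedin (Pc_top c) M" and inv: "\<And>g. g \<in> space \<mu> \<Longrightarrow> act g ` M \<subseteq> M"
      using M(1) by (auto simp: closed_invariant_def)
    have MP: "M \<subseteq> Pc c" using closedin_subset[OF cl] by (simp add: topspace_Pc_top)
    let ?F = "cone_dist (cone_over c M)"
    note F = cone_over_dist_invariant[OF c, of M]
    note u = closed_zero_set[OF c cl M(2)]
    obtain v where v: "v \<in> cone_over c M" using cone_over_nonempty[OF MP M(2)] by blast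
    then have v0: "v \<noteq> 0" by (simp add: cone_over_def)
    have stay: "left_product \<omega> n *v v \<in> cone_over c M" if \<omega>: "\<omega> \<in> space PP" for \<omega> n
    proof (induction n)
      case 0 then show ?case using v by simp
    next
      case (Suc n)
      let ?w = "left_product \<omega> n *v v"
      have w: "?w \<noteq> 0" "Pc_proj c ?w \<in> M" using Suc by (auto simp: cone_over_def)
      have g: "\<omega> n \<in> space \<mu>" by (rule step_in_space[OF \<omega>])
      have "act (\<omega> n) (Pc_proj c ?w) \<in> M" using inv[OF g] w(2) by blast
      then have "Pc_proj c (\<omega> n *v ?w) \<in> M" by (simp only: act_proj[OF g w(1)])
      then show ?case using invertible_mu[OF g] w(1)
        by (simp add: cone_over_def flip: matrix_vector_mul_assoc)
    qed
    have "average n ?F v = 0" for n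
    proof -
      have "average n ?F v = (\<integral>\<omega>. 0 \<partial>PP)"
        unfolding average_def
      proof (rule Bochner_Integration.integral_cong[OF refl])
        fix \<omega> assume "\<omega> \<in> space PP"
        from stay[OF this, of n] show "?F (left_product \<omega> n *v v) = 0"
          using cone_dist_eq_0_iff[OF c cl M(2)] by (simp add: cone_over_def)
      qed
      then show ?thesis by simp
    qed
    then have "(\<lambda>n. 0 :: real) \<longlonglongrightarrow> (\<integral>x. descend ?F x \<partial>\<rho>)"
      using lim[OF u(1) v0] by (simp add: pullback_descend[OF c F])
    then have 0: "(\<integral>x. descend ?F x \<partial>\<rho>) = 0" using LIMSEQ_const_iff by metis
    have sp: "space \<rho> = Pc c" using sets_eq_imp_space_eq[OF \<rho>(2)] by (simp add: space_Pc_borel)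
    have nonneg: "AE x in \<rho>. 0 \<le> descend ?F x" by (rule AE_I2) (use u(2) in \<open>simp add: sp\<close>)
    have "AE x in \<rho>. descend ?F x = 0"
      using 0 integral_nonneg_eq_0_iff_AE[OF continuous_Pc_integrable[OF c u(1) \<rho>] nonneg] by simp
    then have AE_M: "AE x in \<rho>. x \<in> M"
    proof (rule AE_mp, intro AE_I2 impI)
      fix x assume "x \<in> space \<rho>" "descend ?F x = 0"
      then show "x \<in> M" using u(3)[of x] by (simp add: sp)
    qed
    have op: "openin (Pc_top c) (Pc c - M)" using cl by (simp add: closedin_def topspace_Pc_top)
    have "emeasure \<rho> (Pc c - M) = 0"
    proof -
      have "Pc c - M \<in> sets \<rho>" using open_in_Pc_borel[OF op] \<rho>(2) by simp
      moreover have "{x \<in> space \<rho>. \<not> x \<in> M} = Pc c - M" by (auto simp: sp)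
      ultimately show ?thesis using AE_M by (subst (asm) AE_iff_measurable[of "Pc c - M"]) auto
    qed
    then show "?S \<subseteq> M" using op support_sub by (fastforce simp: measure_support_def)
  qed
  show ?thesis
  proof
    assume M: "minimal_invariant c (space \<mu>) M"
    then have "closed_invariant c (space \<mu>) M" "M \<noteq> {}" and min: "\<not> (\<exists>N. closed_invariant c (space \<mu>) N \<and> N \<noteq> {} \<and> N \<subset> M)"
      by (auto simp: minimal_invariant_def)
    then have "?S \<subseteq> M" by (intro least)
    moreover have "\<not> ?S \<subset> M" using min S_inv support_nonempty[OF \<rho>] by blast
    ultimately show "M = ?S" by blast
  next
    assume "M = ?S"
    moreover have "\<not> (\<exists>N. closed_invariant c (space \<mu>) N \<and> N \<noteq> {} \<and> N \<subset> ?S)" using least by blast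
    ultimately show "minimal_invariant c (space \<mu>) M"
      unfolding minimal_invariant_def using S_inv support_nonempty[OF \<rho>] by simp
  qed
qed

theorem weak_convergence:
  assumes lim: "\<And>f v. continuous_map (Pc_top c) euclideanreal f \<Longrightarrow> v \<noteq> 0 \<Longrightarrow>
       (\<lambda>n. average n (pullback c f) v) \<longlonglongrightarrow> (\<integral>x. f x \<partial>\<rho>)" and x: "x \<in> Pc c"
  shows "weakly_converges (Pc_top c) (\<lambda>n. markov_iter c \<mu> n x) \<rho>"
proof -
  obtain v where v: "v \<noteq> 0" "x = Pc_proj c v" using x by (rule PcE)
  show ?thesis
    unfolding weakly_converges_def v(2) using lim v(1) by (simp add: integral_markov_iter)
qed

text \<open>
  The distance from the support has integral 0 against \<open>\<rho>\<close>, so its averages tend to 0 and the walk approaches the cone over the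
  support. Under the given metric \<open>D\<close> the distance from the support is a continuous function that vanishes on the
  support; by uniform continuity it is small wherever the relative distance from the cone is small.
\<close>

theorem trajectories_approach_support:
  fixes \<Omega> :: "'w measure"
  assumes \<rho>: "prob_space \<rho>" "sets \<rho> = sets N" and fixed: "\<mu> \<bind> (\<lambda>g. distr \<rho> N (act g)) = \<rho>"
    and lim: "\<And>f v. continuous_map (Pc_top c) euclideanreal f \<Longrightarrow> v \<noteq> 0 \<Longrightarrow>
       (\<lambda>n. average n (pullback c f) v) \<longlonglongrightarrow> (\<integral>x. f x \<partial>\<rho>)"
    and D: "compatible_metric c D" and x: "x \<in> Pc c" and iid: "iid_with_law \<Omega> \<mu> g"
  shows "AE \<omega> in \<Omega>. (\<lambda>n. INF s\<in>measure_support (Pc_top c) \<rho>.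
             D (act (left_product (\<lambda>i. g i \<omega>) n) x) s) \<longlonglongrightarrow> 0"
proof -
  let ?S = "measure_support (Pc_top c) \<rho>"
  let ?C = "cone_over c ?S"
  obtain v where v: "v \<noteq> 0" "x = Pc_proj c v" using x by (rule PcE)
  have sp: "space \<rho> = Pc c" using sets_eq_imp_space_eq[OF \<rho>(2)] by (simp add: space_Pc_borel)
  note Sne = support_nonempty[OF \<rho>]
  note u = closed_zero_set[OF c support_closed Sne]
  note F = cone_over_dist_invariant[OF c, of ?S]
  have "(\<integral>x. descend (cone_dist ?C) x \<partial>\<rho>) = 0"
  proof (rule integral_eq_zero_AE)
    have "AE x in \<rho>. x \<notin> Pc c - ?S" by (rule AE_not_in[OF null_outside_support[OF \<rho>(2)]])
    then show "AE x in \<rho>. descend (cone_dist ?C) x = 0"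
    proof (rule AE_mp, intro AE_I2 impI)
      fix x assume "x \<in> space \<rho>" "x \<notin> Pc c - ?S"
      then show "descend (cone_dist ?C) x = 0" using u(3)[of x] by (simp add: sp)
    qed
  qed
  then have to0: "(\<lambda>n. average n (cone_dist ?C) v) \<longlonglongrightarrow> 0"
    using lim[OF u(1) v(1)] by (simp add: pullback_descend[OF c F])
  have AE_PP: "AE \<omega> in PP. (\<lambda>n. cone_dist ?C (left_product \<omega> n *v v)) \<longlonglongrightarrow> 0"
    by (rule trajectories_approach_cone[OF c _ _ _ _ _ v(1) to0])
       (use cone_over_scale[OF c] cone_over_nonempty[OF support_sub Sne] support_invariant[OF \<rho> fixed] in blast)+
  \<comment> \<open>The distance to the support is itself a continuous function on the space, hence controlled by the cone distance.\<close>
  define f where "f y = (INF s\<in>?S. D y s)" for y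
  have D': "Metric_space (Pc c) D" "Metric_space.mtopology (Pc c) D = Pc_top c"
    using D by (simp_all add: compatible_metric_def)
  interpret DM: Metric_space "Pc c" D by (rule D'(1))
  have bdd: "bdd_below (D y ` ?S)" for y by (rule bdd_belowI[of _ 0]) auto
  have f_le: "f y \<le> f z + D y z" if "y \<in> Pc c" "z \<in> Pc c" for y z
  proof -
    have "f y - D y z \<le> f z"
      unfolding f_def[of z]
    proof (rule cINF_greatest[OF Sne])
      fix s assume s: "s \<in> ?S"
      then have "f y \<le> D y s" unfolding f_def by (intro cINF_lower bdd)
      also have "\<dots> \<le> D y z + D z s" using that s support_sub by (intro DM.triangle) auto
      finally show "f y - D y z \<le> D z s" by simp
    qed
    then show ?thesis by simp
  qed
  have f_nonneg: "0 \<le> f y" for y unfolding f_def by (rule cINF_greatest[OF Sne]) simp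
  have f_zero: "f s = 0" if "s \<in> ?S" for s
  proof -
    have "f s \<le> D s s" unfolding f_def using that by (intro cINF_lower bdd)
    moreover have "s \<in> Pc c" using that support_sub by blast
    ultimately show ?thesis using f_nonneg[of s] DM.zero[of s s] by simp
  qed
  have f_cont: "continuous_map (Pc_top c) euclideanreal f"
  proof -
    have "continuous_map DM.mtopology (Met_TC.mtopology) f"
      unfolding DM.metric_continuous_map[OF Met_TC.Metric_space_axioms]
    proof (intro conjI ballI allI impI)
      fix y :: "(real^'n) set" and e :: real assume "y \<in> Pc c" "e > 0"
      show "\<exists>\<delta>>0. \<forall>z. z \<in> Pc c \<and> D y z < \<delta> \<longrightarrow> dist (f y) (f z) < e"
      proof (intro exI[of _ e] conjI allI impI \<open>e > 0\<close>; elim conjE)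
        fix z assume z: "z \<in> Pc c" "D y z < e"
        show "dist (f y) (f z) < e"
          using f_le[OF \<open>y \<in> Pc c\<close> z(1)] f_le[OF z(1) \<open>y \<in> Pc c\<close>] z(2) DM.commute[of y z]
          unfolding dist_real_def by linarith
      qed
    qed auto
    then show ?thesis unfolding D'(2) by simp
  qed
  note Ff = pullback_invariant[OF c f_cont]
  have conv: "(\<lambda>n. f (act (left_product \<omega> n) x)) \<longlonglongrightarrow> 0"
    if \<omega>: "\<omega> \<in> space PP" and to: "(\<lambda>n. cone_dist ?C (left_product \<omega> n *v v)) \<longlonglongrightarrow> 0" for \<omega>
  proof (rule LIMSEQ_I)
    fix e :: real assume "e > 0"
    obtain \<delta> where \<delta>: "\<delta> > 0" "\<And>w s. w \<noteq> 0 \<Longrightarrow> norm (w - s) \<le> \<delta> * norm w \<Longrightarrow> \<bar>pullback c f w - pullback c f s\<bar> < e"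
      using homothety_invariant_uniformly_continuous[OF Ff c \<open>e > 0\<close>] by blast
    have "\<forall>\<^sub>F n in sequentially. cone_dist ?C (left_product \<omega> n *v v) < \<delta>"
      using to \<delta>(1) by (rule order_tendstoD)
    then obtain n0 where n0: "\<And>n. n \<ge> n0 \<Longrightarrow> cone_dist ?C (left_product \<omega> n *v v) < \<delta>"
      unfolding eventually_sequentially by blast
    have "norm (f (act (left_product \<omega> n) x) - 0) < e" if n: "n \<ge> n0" for n
    proof -
      let ?w = "left_product \<omega> n *v v"
      have inv: "invertible (left_product \<omega> n)" by (rule invertible_left_product[OF \<omega>])
      have w: "?w \<noteq> 0" using inv v(1) by simp
      obtain s where s: "s \<in> ?C" "norm (?w - s) < \<delta> * norm ?w"
        using cone_dist_less_witness[OF n0[OF n] w cone_over_nonempty[OF support_sub Sne]] by blast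
      have "pullback c f s = 0" using s(1) f_zero by (simp add: cone_over_def pullback_def)
      moreover have "\<bar>pullback c f ?w - pullback c f s\<bar> < e" using s(2) by (intro \<delta>(2) w) simp
      moreover have "f (act (left_product \<omega> n) x) = pullback c f ?w"
        unfolding v(2) act_Pc_proj[OF c inv v(1)] using w by (simp add: pullback_def)
      ultimately show ?thesis by simp
    qed
    then show "\<exists>no. \<forall>n\<ge>no. norm (f (act (left_product \<omega> n) x) - 0) < e" by blast
  qed
  have AE_f: "AE \<omega> in PP. (\<lambda>n. f (act (left_product \<omega> n) x)) \<longlonglongrightarrow> 0"
    using AE_PP by (rule AE_mp) (intro AE_I2 impI conv)
  interpret W: prob_space \<Omega> using iid by (simp add: iid_with_law_def)
  have ind: "W.indep_vars (\<lambda>_. \<mu>) g UNIV" and law: "\<And>n. distr \<Omega> \<mu> (g n) = \<mu>"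
    using iid by (auto simp: iid_with_law_def)
  have rv: "\<And>n. g n \<in> measurable \<Omega> \<mu>" using ind by (auto simp: W.indep_vars_def)
  \<comment> \<open>An i.i.d. sequence on any probability space has the law of the path space.\<close>
  have "distr \<Omega> PP (\<lambda>\<omega>. \<lambda>i\<in>UNIV. g i \<omega>) = Pi\<^sub>M UNIV (\<lambda>i. distr \<Omega> \<mu> (g i))"
    using W.indep_vars_iff_distr_eq_PiM[where I = UNIV and M' = "\<lambda>_. \<mu>" and X = g, OF _ rv] ind by simp
  then have eq: "distr \<Omega> PP (\<lambda>\<omega> i. g i \<omega>) = PP" unfolding law by (simp add: restrict_UNIV)
  have meas: "(\<lambda>\<omega> i. g i \<omega>) \<in> measurable \<Omega> PP"
    by (rule measurable_PiM_single') (use rv measurable_space[OF rv] in \<open>auto simp: PiE_UNIV_domain\<close>)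
  have "AE \<omega> in \<Omega>. (\<lambda>n. f (act (left_product (\<lambda>i. g i \<omega>) n) x)) \<longlonglongrightarrow> 0"
    by (rule AE_distrD[OF meas]) (unfold eq, rule AE_f)
  then show ?thesis unfolding f_def .
qed

end

lemma closure_of_subset_closure: "top_of_set S closure_of A \<subseteq> closure A"
  by (metis closure_of_subtopology_subset euclidean_closure_of)

text \<open>
  A finite union of subspaces is closed. Hence invariance under \<open>G\<close> extends to the closure, and strong irreducibility
  is inherited by dense subsemigroups.
\<close>

lemma closed_union_of_subspaces_invariant:
  assumes "finite \<W>" "\<And>W. W \<in> \<W> \<Longrightarrow> subspace (W :: (real^'n) set)"
    and inv: "\<And>g. g \<in> G \<Longrightarrow> (*v) g ` \<Union>\<W> \<subseteq> \<Union>\<W>" and g: "g \<in> closure G"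
  shows "(*v) g ` \<Union>\<W> \<subseteq> \<Union>\<W>"
proof
  fix y assume "y \<in> (*v) g ` \<Union>\<W>"
  then obtain w where w: "w \<in> \<Union>\<W>" "y = g *v w" by blast
  obtain s where s: "\<And>n. s n \<in> G" "s \<longlonglongrightarrow> g" using g closure_sequential by blast
  have closed: "closed (\<Union>\<W>)" using assms(1,2) by (intro closed_Union) (auto intro: closed_subspace)
  have lim: "(\<lambda>n. s n *v w) \<longlonglongrightarrow> g *v w" by (intro tendsto_intros s)
  have "s n *v w \<in> \<Union>\<W>" for n using inv[OF s(1)[of n]] w(1) by (meson image_subset_iff)
  then have "g *v w \<in> \<Union>\<W>" using closed_sequentially[OF closed _ lim] by metis
  then show "y \<in> \<Union>\<W>" by (simp only: w(2))
qed

text \<open>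
  The words in the support of \<open>\<mu>\<close> form a dense subsemigroup. It need not contain a proximal element, but the powers of the given
  one can be approximated by words so closely that the rescaled words have the same limit of rank one.
\<close>

lemma projective_walk_exists:
  fixes \<Gamma> :: "(real^'n^'n) set" and \<mu> :: "(real^'n^'n) measure"
  assumes card: "CARD('n) > 1" and \<Gamma>: "subsemigroup_GL \<Gamma>" and si: "strongly_irreducible \<Gamma>"
    and prox: "\<exists>\<gamma>\<in>\<Gamma>. proximal \<gamma>" and c: "c > 1" and \<mu>: "probability_on \<Gamma> \<mu>"
    and gen: "support_generates \<Gamma> \<mu>"
  shows "space \<mu> = \<Gamma> \<and> (\<exists>G T h a v \<phi>. projective_walk \<mu> G T h a v \<phi> c)"
proof -
  define T where "T = measure_support (top_of_set \<Gamma>) \<mu>"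
  define G where "G = semigroup_generated T"
  have sp: "space \<mu> = \<Gamma>" and pm: "prob_space \<mu>" and sets: "sets \<mu> = sets (restrict_space borel \<Gamma>)"
    using \<mu> by (auto simp: probability_on_def)
  have inv: "\<And>g. g \<in> \<Gamma> \<Longrightarrow> invertible g" and mult: "\<And>g h. g \<in> \<Gamma> \<Longrightarrow> h \<in> \<Gamma> \<Longrightarrow> g ** h \<in> \<Gamma>" and ne: "\<Gamma> \<noteq> {}"
    using \<Gamma> by (auto simp: subsemigroup_GL_def)
  have T\<Gamma>: "T \<subseteq> \<Gamma>" by (auto simp: T_def measure_support_def)
  have G\<Gamma>: "G \<subseteq> \<Gamma>"
  proof
    fix g assume "g \<in> G"
    then show "g \<in> \<Gamma>" unfolding G_def by induction (use T\<Gamma> mult in auto)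
  qed
  have "top_of_set \<Gamma> closure_of G = \<Gamma>" using gen by (simp add: support_generates_def G_def T_def)
  then have dense: "\<Gamma> \<subseteq> closure G" using closure_of_subset_closure[of \<Gamma> G] by simp
  have G_ne: "G \<noteq> {}" using dense ne by auto
  have G_mult: "g ** h \<in> G" if "g \<in> G" "h \<in> G" for g h using that by (simp add: G_def semigroup_generated.mult)
  have G_irr: "strongly_irreducible G"
    unfolding strongly_irreducible_def
  proof
    assume "\<exists>\<W>. finite \<W> \<and> \<W> \<noteq> {} \<and> (\<forall>W\<in>\<W>. subspace W \<and> W \<noteq> {0} \<and> W \<noteq> UNIV) \<and> (\<forall>\<gamma>\<in>G. (*v) \<gamma> ` \<Union>\<W> \<subseteq> \<Union>\<W>)"
    then obtain \<W> where W: "finite \<W>" "\<W> \<noteq> {}" "\<And>W. W\<in>\<W> \<Longrightarrow> subspace W \<and> W \<noteq> {0} \<and> W \<noteq> UNIV"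
      "\<And>\<gamma>. \<gamma>\<in>G \<Longrightarrow> (*v) \<gamma> ` \<Union>\<W> \<subseteq> \<Union>\<W>" by metis
    have "(*v) \<gamma> ` \<Union>\<W> \<subseteq> \<Union>\<W>" if "\<gamma> \<in> \<Gamma>" for \<gamma>
      by (rule closed_union_of_subspaces_invariant[OF W(1) _ W(4)]) (use W(3) dense that in auto)
    then show False using si W(1-3) unfolding strongly_irreducible_def by metis
  qed
  obtain \<gamma> where \<gamma>: "\<gamma> \<in> \<Gamma>" "proximal \<gamma>" using prox by blast
  obtain a v \<phi> where lim: "\<And>n::nat. a n \<noteq> (0::real)" "v \<noteq> 0" "\<phi> \<noteq> 0"
     "(\<lambda>n. (1 / a n) *\<^sub>R matrix_pow \<gamma> n) \<longlonglongrightarrow> (\<chi> i j. v $ i * \<phi> $ j)"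
    using proximal_limit[OF \<gamma>(2)] by blast
  have pow: "matrix_pow \<gamma> (Suc n) \<in> \<Gamma>" for n by (induction n) (use \<gamma>(1) mult in auto)
  have "\<exists>g\<in>G. dist (matrix_pow \<gamma> (Suc n)) g < \<bar>a (Suc n)\<bar> / Suc n" for n
    using pow[of n] dense lim(1)[of "Suc n"] by (intro closure_approachableD) auto
  then obtain h where h: "\<And>n. h n \<in> G" "\<And>n. dist (matrix_pow \<gamma> (Suc n)) (h n) < \<bar>a (Suc n)\<bar> / Suc n" by metis
  have h_lim: "(\<lambda>n. (1 / a (Suc n)) *\<^sub>R h n) \<longlonglongrightarrow> outer v \<phi>"
  proof -
    have "(\<lambda>n. (1 / a (Suc n)) *\<^sub>R (h n - matrix_pow \<gamma> (Suc n))) \<longlonglongrightarrow> 0"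
    proof (rule Lim_null_comparison)
      show "(\<lambda>n. 1 / real (Suc n)) \<longlonglongrightarrow> 0" by (rule LIMSEQ_Suc[OF lim_1_over_n])
      have "norm ((1 / a (Suc n)) *\<^sub>R (h n - matrix_pow \<gamma> (Suc n))) \<le> 1 / real (Suc n)" for n
      proof -
        have "norm ((1 / a (Suc n)) *\<^sub>R (h n - matrix_pow \<gamma> (Suc n))) = dist (matrix_pow \<gamma> (Suc n)) (h n) / \<bar>a (Suc n)\<bar>"
          by (simp add: dist_norm norm_minus_commute)
        also have "\<dots> \<le> (\<bar>a (Suc n)\<bar> / Suc n) / \<bar>a (Suc n)\<bar>" using h(2)[of n] by (intro divide_right_mono) auto
        also have "\<dots> = 1 / real (Suc n)" using lim(1)[of "Suc n"] by simp
        finally show ?thesis .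
      qed
      then show "\<forall>\<^sub>F n in sequentially. norm ((1 / a (Suc n)) *\<^sub>R (h n - matrix_pow \<gamma> (Suc n))) \<le> 1 / real (Suc n)" by simp
    qed
    from tendsto_add[OF this LIMSEQ_Suc[OF lim(4)]] show ?thesis
      by (simp add: scaleR_diff_right outer_def)
  qed
  have supp: "0 < measure \<mu> {g\<in>space \<mu>. dist g t < r}" if "t \<in> T" "r > 0" for t r
  proof -
    have "openin (top_of_set \<Gamma>) (\<Gamma> \<inter> ball t r)" by (intro openin_open_Int) simp
    moreover have "t \<in> \<Gamma> \<inter> ball t r" using that T\<Gamma> by auto
    ultimately have "0 < emeasure \<mu> (\<Gamma> \<inter> ball t r)" using that(1) by (auto simp: T_def measure_support_def)
    moreover have "\<Gamma> \<inter> ball t r = {g\<in>space \<mu>. dist g t < r}" by (auto simp: sp dist_commute)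
    ultimately show ?thesis
      using finite_measure.emeasure_eq_measure[OF prob_space.finite_measure[OF pm]] by simp
  qed
  interpret mu: prob_space \<mu> by fact
  have "projective_walk \<mu> G T h (\<lambda>n. a (Suc n)) v \<phi> c"
  proof unfold_locales
    show "\<exists>k. g \<in> set_power T k" if "g \<in> G" for g using that semigroup_generated_set_power by (simp add: G_def)
    show "T \<subseteq> G" by (auto simp: G_def intro: semigroup_generated.gen)
    show "sets \<mu> = sets (restrict_space borel (space \<mu>))" using sets sp by simp
    show "g ** h \<in> G" if "g \<in> G" "h \<in> G" for g h by (rule G_mult[OF that])
    show "h n \<in> G" for n by (rule h)
    show "invertible g" if "g \<in> space \<mu>" for g using inv that sp by simp
    show "invertible g" if "g \<in> G" for g using inv that G\<Gamma> by blast
    show "G \<subseteq> space \<mu>" "space \<mu> \<subseteq> closure G" using G\<Gamma> dense sp by simp_all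
    show "0 < measure \<mu> {g\<in>space \<mu>. dist g t < r}" if "t \<in> T" "r > 0" for t r by (rule supp[OF that])
  qed (use pm G_ne G_irr lim h_lim card c in simp_all)
  then show ?thesis using sp by blast
qed

theorem theorem1p3:
  fixes \<Gamma> :: "(real ^ 'n ^ 'n) set" and \<mu> :: "(real ^ 'n ^ 'n) measure" and c :: real
  assumes "CARD('n) > 1"
    and "subsemigroup_GL \<Gamma>"
    and "strongly_irreducible \<Gamma>"
    and "\<exists>\<gamma>\<in>\<Gamma>. proximal \<gamma>"
    and "c > 1"
    and "probability_on \<Gamma> \<mu>"
    and "support_generates \<Gamma> \<mu>"
  shows "\<exists>\<rho> :: (real ^ 'n) set measure.
    (\<forall>\<rho>'. stationary_probability c \<mu> \<rho>' \<longleftrightarrow> \<rho>' = \<rho>) \<and>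
    (\<forall>M. minimal_invariant c \<Gamma> M \<longleftrightarrow> M = measure_support (Pc_top c) \<rho>) \<and>
    (\<forall>v\<in>Pc c. weakly_converges (Pc_top c) (\<lambda>n. markov_iter c \<mu> n v) \<rho>) \<and>
    (\<forall>D. compatible_metric c D \<longrightarrow>
      (\<forall>v\<in>Pc c. \<forall>(\<Omega> :: 'w measure) g. iid_with_law \<Omega> \<mu> g \<longrightarrow>
        (AE \<omega> in \<Omega>.
          (\<lambda>n. INF s\<in>measure_support (Pc_top c) \<rho>.
             D (act (left_product (\<lambda>i. g i \<omega>) n) v) s) \<longlonglongrightarrow> 0)))"
proof -
  obtain G T h a v \<phi> where sp: "space \<mu> = \<Gamma>" and walk: "projective_walk \<mu> G T h a v \<phi> c"
    using projective_walk_exists[OF assms] by blast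
  interpret projective_walk \<mu> G T h a v \<phi> c by (rule walk)
  obtain \<rho> where \<rho>: "prob_space \<rho>" "sets \<rho> = sets (Pc_borel c)"
    and lim: "\<And>f v. continuous_map (Pc_top c) euclideanreal f \<Longrightarrow> v \<noteq> 0 \<Longrightarrow>
       (\<lambda>n. average n (pullback c f) v) \<longlonglongrightarrow> (\<integral>x. f x \<partial>\<rho>)"
    using limit_measure_exists by blast
  note stat = stationary_iff[OF \<rho> lim]
  then have fixed: "\<mu> \<bind> (\<lambda>g. distr \<rho> (Pc_borel c) (act g)) = \<rho>"
    unfolding stationary_probability_def by blast
  show ?thesis
  proof (intro exI[of _ \<rho>] conjI allI ballI impI)
    show "stationary_probability c \<mu> \<rho>' \<longleftrightarrow> \<rho>' = \<rho>" for \<rho>' by (rule stat)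
    show "minimal_invariant c \<Gamma> M \<longleftrightarrow> M = measure_support (Pc_top c) \<rho>" for M
      by (rule support_unique_minimal[OF \<rho> fixed lim, unfolded sp])
    show "weakly_converges (Pc_top c) (\<lambda>n. markov_iter c \<mu> n v) \<rho>" if "v \<in> Pc c" for v
      by (rule weak_convergence[OF lim that])
  qed (rule trajectories_approach_support[OF \<rho> fixed lim])
qed

end
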